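(* Let $T>0$. Let $(V,d,\pi,\kappa)$ and $(\phi,\psi^*,\alpha)$ satisfy the standing assumptions listed in the context; assume moreover that $\phi$ is strictly convex and that $D_\phi:[0,\infty)^2\to[0,\infty]$ is convex. Let $(\rho,j)\in\mathcal{RCE}([0,T])$, $\rho_t=u_t\pi$, and for $t\in[0,T]$ set $\mathscr L_t(\rho,j):=\mathscr E(\rho_t)-\mathscr E(\rho_0)+\int_0^t\big(\mathscr R(\rho_r,j_r)+\mathscr D(\rho_r)\big)\,\mathrm dr$. Then the following are equivalent: (i) $\mathscr L_t(\rho,j)\le 0$ for all $t\in[0,T]$; (ii) $\mathscr L_t(\rho,j)=0$ for all $t\in[0,T]$; (iii) for a.e. $t\in(0,T)$, $F(u_t(x),u_t(y))$ is defined for $\vartheta_\kappa$-a.e. $(x,y)$ and $2j_t(\mathrm dx\,\mathrm dy)=-F(u_t(x),u_t(y))\,\vartheta_\kappa(\mathrm dx\,\mathrm dy)$.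
   Context: **Setting.** $(V,d)$ is a separable metric space, $\pi$ a finite positive Borel measure on $V$, $E:=V\times V$, $E':=E\setminus\{(x,x):x\in V\}$, $\mathcal M^+(V)$ is the set of finite positive Borel measures on $V$. The jump kernel $\kappa=(\kappa(x,\cdot))_{x\in V}$ is a family of positive $\sigma$-finite Borel measures on $V$ with $\kappa(x,\{x\})=0$, such that $x\mapsto\int_V f(y)(1\wedge d^2(x,y))\,\kappa(x,\mathrm dy)$ is Borel for every bounded Borel $f:V\to\mathbb R$, and $\sup_{x\in V}\int_V(1\wedge d^2(x,y))\,\kappa(x,\mathrm dy)<\infty$. The $\sigma$-finite measure $\vartheta_\kappa(\mathrm dx\,\mathrm dy):=\pi(\mathrm dx)\,\kappa(x,\mathrm dy)$ on $E$ is invariant under $(x,y)\mapsto(y,x)$ (detailed balance). Write $\overline\nabla\varphi(x,y):=\varphi(y)-\varphi(x)$. **Fluxes.** For a separable metric space $Y$, $\mathcal M_\sigma(Y)$ is the set of pairs $\mu=(\mu^+,\mu^-)$ of mutually singular $\sigma$-finite positive Borel measures on $Y$; $|\mu|:=\mu^++\mu^-$ and $\int f\,\mathrm d\mu:=\int f\,\mathrm d\mu^+-\int f\,\mathrm d\mu^-$ for $f\in L^1(|\mu|)$. A family $(j_t)_{t\in[0,T]}\subset\mathcal M_\sigma(E)$ is measurable if $t\mapsto j_t^\pm(B)$ is Borel for every Borel $B$. If $|\mu|\ll\gamma$ with $\gamma$ positive $\sigma$-finite, $\frac{\mathrm d\mu}{\mathrm d\gamma}:=\frac{\mathrm d\mu^+}{\mathrm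 d\gamma}-\frac{\mathrm d\mu^-}{\mathrm d\gamma}$. **Densities.** $\phi\in C([0,\infty))\cap C^1((0,\infty))$ is convex, $\min\phi=0$, $\lim_{r\to\infty}\phi(r)/r=\infty$. $\psi^*:\mathbb R\to[0,\infty)$ is convex, differentiable, even, $\psi^*(0)=0$, $\lim_{|\xi|\to\infty}\psi^*(\xi)/|\xi|=\infty$, $\lim_{\xi\to0}\psi^*(\xi)/|\xi|^2\in(0,\infty)$; $\psi$ is its convex conjugate. $\alpha:[0,\infty)^2\to[0,\infty)$ is not identically zero, continuous, concave, symmetric. **Functionals.** $\mathscr E(\rho):=\int_V\phi(\frac{\mathrm d\rho}{\mathrm d\pi})\,\mathrm d\pi$ if $\rho\ll\pi$, $+\infty$ otherwise. For $\rho=u\pi$ and $j\in\mathcal M_\sigma(E)$ let $\nu_\rho(\mathrm dx\,\mathrm dy):=\alpha(u(x),u(y))\,\vartheta_\kappa(\mathrm dx\,\mathrm dy)$ and $\mathscr R(\rho,j):=\frac12\iint\psi\big(\frac{\mathrm d(2j)}{\mathrm d\nu_\rho}\big)\,\mathrm d\nu_\rho$ if $|j|\ll\nu_\rho$, $+\infty$ otherwise. Set $\phi'(0):=\lim_{r\downarrow0}\phi'(r)\in[-\infty,\infty)$, $\Lambda_\phi(u,v):=\phi'(v)-\phi'(u)$ for $(u,v)\ne(0,0)$, $\Lambda_\phi(0,0):=0$. $D_\phi^+(u,v):=\psi^*(\Lambda_\phi(u,v))\alpha(u,v)$ if $\alpha(u,v)>0$ (with $\psi^*(\pm\infty)=+\infty$),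 $:=0$ if $u=v=0$, $:=+\infty$ if $\alpha(u,v)=0$ and $u\neq v$; $D_\phi:[0,\infty)^2\to[0,\infty]$ is the lower semicontinuous envelope of $D_\phi^+$. The Fisher information is $\mathscr D(\rho):=\frac12\iint_E D_\phi(u(x),u(y))\,\vartheta_\kappa(\mathrm dx\,\mathrm dy)$ for $\rho=u\pi$. **The map $F$.** $F(u,v):=(\psi^* )'(\Lambda_\phi(u,v))\,\alpha(u,v)$ if $\alpha(u,v)>0$ (with $(\psi^* )'(\pm\infty):=\pm\infty$), $F(0,0):=0$; $F(u,v)$ is not defined if $\alpha(u,v)=0$ and $(u,v)\ne(0,0)$. **Continuity equations.** $\mathrm{Lip}_b(V)$ is the space of bounded $d$-Lipschitz functions. $(\rho,j)\in\mathcal{CE}([0,T])$ means: $\rho=(\rho_t)_{t\in[0,T]}\subset\mathcal M^+(V)$; $j=(j_t)_{t\in[0,T]}\subset\mathcal M_\sigma(E)$ is a measurable family with $|j_t|(E\setminus E')=0$ and $\int_0^T\iint_E(1\wedge d(x,y))\,|j_t|(\mathrm dx\,\mathrm dy)\,\mathrm dt<\infty$; and for all $\varphi\in\mathrm{Lip}_b(V)$ and $[s,t]\subset[0,T]$: ( * ) $\int_V\varphi\,\mathrm d\rho_t-\int_V\varphi\,\mathrm d\rho_s=\int_s^t\iint_{E'}\overline\nabla\varphi(x,y)\,j_r(\mathrm dx\,\mathrm dy)\,\mathrm dr$. $\mathcal{ACE}([0,T])$: pairs in $\mathcal{CE}([0,T])$ with $\sup_{t\in[0,T]}\mathscr E(\rho_t)<\infty$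 and $\int_0^T(\mathscr R(\rho_t,j_t)+\mathscr D(\rho_t))\,\mathrm dt<\infty$. $\mathcal{RCE}([0,T])$ (reflecting continuity equation): pairs $(\rho,j)\in\mathcal{ACE}([0,T])$, $\rho_t=u_t\pi$, with $\operatorname{ess\,sup}_{t\in(0,T)}\|u_t\|_{L^\infty(V;\pi)}<\infty$, such that ( * ) holds for all $[s,t]\subset[0,T]$ and all $\varphi\in\mathcal X_2:=\{\varphi\in L^\infty(V;\pi):\iint_{E'}|\overline\nabla\varphi|^2\,\mathrm d\vartheta_\kappa<\infty\}$. *)

theory Defs
  imports "HOL-Analysis.Analysis"
begin

section \<open>Jump kernels\<close>

definition jump_kernel :: "('v::{metric_space,second_countable_topology} \<Rightarrow> 'v measure) \<Rightarrow> bool" where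
  "jump_kernel \<kappa> \<longleftrightarrow>
     (\<forall>x. sets (\<kappa> x) = sets borel \<and> sigma_finite_measure (\<kappa> x) \<and> emeasure (\<kappa> x) {x} = 0) \<and>
     (\<forall>f \<in> borel_measurable borel. bounded (range f) \<longrightarrow>
        (\<lambda>x. \<integral>y. f y * min 1 ((dist x y)\<^sup>2) \<partial>\<kappa> x) \<in> borel_measurable borel) \<and>
     (SUP x. \<integral>\<^sup>+y. ennreal (min 1 ((dist x y)\<^sup>2)) \<partial>\<kappa> x) < \<infinity>"

text \<open>The measure \<open>\<pi>(dx) \<kappa>(x,dy)\<close>. The kernel may have infinite mass, so the constructions for
  (sub)probability kernels do not apply. Since the space is second countable, the Borel sets of the
  product are the product Borel sets.\<close>

definition edge_measure ::
    "'v::{metric_space,second_countable_topology} measure \<Rightarrow> ('v \<Rightarrow> 'v measure) \<Rightarrow> ('v \<times> 'v) measure" where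
  "edge_measure \<pi> \<kappa> =
     measure_of UNIV (sets borel) (\<lambda>A. \<integral>\<^sup>+x. (\<integral>\<^sup>+y. indicator A (x, y) \<partial>\<kappa> x) \<partial>\<pi>)"

definition detailed_balance ::
    "'v::{metric_space,second_countable_topology} measure \<Rightarrow> ('v \<Rightarrow> 'v measure) \<Rightarrow> bool" where
  "detailed_balance \<pi> \<kappa> \<longleftrightarrow>
     distr (edge_measure \<pi> \<kappa>) borel prod.swap = edge_measure \<pi> \<kappa>"

definition finite_borel_measure :: "'v::topological_space measure \<Rightarrow> bool" where
  "finite_borel_measure \<mu> \<longleftrightarrow> sets \<mu> = sets borel \<and> finite_measure \<mu>"

definition offdiag :: "('v \<times> 'v) set" where
  "offdiag = {(x, y). x \<noteq> y}"

definition grad :: "('v \<Rightarrow> real) \<Rightarrow> 'v \<times> 'v \<Rightarrow> real" where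
  "grad f = (\<lambda>(x, y). f y - f x)"

section \<open>Sigma-finite signed measures as pairs\<close>

type_synonym 'a smeasure = "'a measure \<times> 'a measure"

definition signed_sigma_finite :: "'a::topological_space smeasure \<Rightarrow> bool" where
  "signed_sigma_finite \<mu> \<longleftrightarrow>
     sets (fst \<mu>) = sets borel \<and> sigma_finite_measure (fst \<mu>) \<and>
     sets (snd \<mu>) = sets borel \<and> sigma_finite_measure (snd \<mu>) \<and>
     (\<exists>A \<in> sets borel. emeasure (fst \<mu>) A = 0 \<and> emeasure (snd \<mu>) (- A) = 0)"

definition variation :: "'a::topological_space smeasure \<Rightarrow> 'a measure" where
  "variation \<mu> =
     measure_of UNIV (sets borel) (\<lambda>A. emeasure (fst \<mu>) A + emeasure (snd \<mu>) A)"

definition sm_integral :: "'a smeasure \<Rightarrow> 'a set \<Rightarrow> ('a \<Rightarrow> real) \<Rightarrow> real" where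
  "sm_integral \<mu> A f = (\<integral>z\<in>A. f z \<partial>fst \<mu>) - (\<integral>z\<in>A. f z \<partial>snd \<mu>)"

definition sm_scale :: "ennreal \<Rightarrow> 'a smeasure \<Rightarrow> 'a smeasure" where
  "sm_scale c \<mu> = (scale_measure c (fst \<mu>), scale_measure c (snd \<mu>))"

text \<open>For sigma-finite measures the Radon-Nikodym derivatives are finite almost everywhere, so that
  \<^const>\<open>enn2real\<close> changes them on a null set only.\<close>

definition sm_deriv :: "'a smeasure \<Rightarrow> 'a measure \<Rightarrow> 'a \<Rightarrow> real" where
  "sm_deriv \<mu> \<gamma> z = enn2real (RN_deriv \<gamma> (fst \<mu>) z) - enn2real (RN_deriv \<gamma> (snd \<mu>) z)"

text \<open>The signed measure \<open>f \<gamma>\<close>: \<^const>\<open>e2ennreal\<close> sends negative values to 0, so the two components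
  have densities \<open>f\<^sup>+\<close> and \<open>f\<^sup>-\<close>.\<close>

definition sm_density :: "'a measure \<Rightarrow> ('a \<Rightarrow> ereal) \<Rightarrow> 'a smeasure" where
  "sm_density \<gamma> f = (density \<gamma> (\<lambda>z. e2ennreal (f z)), density \<gamma> (\<lambda>z. e2ennreal (- f z)))"

definition measurable_family :: "real \<Rightarrow> (real \<Rightarrow> 'a::topological_space smeasure) \<Rightarrow> bool" where
  "measurable_family T j \<longleftrightarrow>
     (\<forall>B \<in> sets borel.
        (\<lambda>t. emeasure (fst (j t)) B) \<in> borel_measurable (restrict_space borel {0..T}) \<and>
        (\<lambda>t. emeasure (snd (j t)) B) \<in> borel_measurable (restrict_space borel {0..T}))"

section \<open>Densities\<close>

abbreviation quadrant :: "(real \<times> real) set" where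
  "quadrant \<equiv> {0..} \<times> {0..}"

definition admissible_phi :: "(real \<Rightarrow> real) \<Rightarrow> bool" where
  "admissible_phi \<phi> \<longleftrightarrow>
     continuous_on {0..} \<phi> \<and> (\<forall>r>0. \<phi> differentiable (at r)) \<and> continuous_on {0<..} (deriv \<phi>) \<and>
     convex_on {0..} \<phi> \<and> (\<forall>r\<ge>0. \<phi> r \<ge> 0) \<and> (\<exists>r\<ge>0. \<phi> r = 0) \<and>
     filterlim (\<lambda>r. \<phi> r / r) at_top at_top"

definition strictly_convex_on :: "'a::real_vector set \<Rightarrow> ('a \<Rightarrow> real) \<Rightarrow> bool" where
  "strictly_convex_on S f \<longleftrightarrow> convex S \<and>
     (\<forall>x\<in>S. \<forall>y\<in>S. \<forall>t. x \<noteq> y \<and> 0 < t \<and> t < 1 \<longrightarrow>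
        f ((1 - t) *\<^sub>R x + t *\<^sub>R y) < (1 - t) * f x + t * f y)"

definition admissible_psi_star :: "(real \<Rightarrow> real) \<Rightarrow> bool" where
  "admissible_psi_star \<psi>s \<longleftrightarrow>
     (\<forall>\<xi>. \<psi>s \<xi> \<ge> 0) \<and> convex_on UNIV \<psi>s \<and> (\<forall>\<xi>. \<psi>s differentiable (at \<xi>)) \<and>
     (\<forall>\<xi>. \<psi>s (- \<xi>) = \<psi>s \<xi>) \<and> \<psi>s 0 = 0 \<and>
     filterlim (\<lambda>\<xi>. \<psi>s \<xi> / \<bar>\<xi>\<bar>) at_top at_infinity \<and>
     (\<exists>c>0. ((\<lambda>\<xi>. \<psi>s \<xi> / \<bar>\<xi>\<bar>\<^sup>2) \<longlongrightarrow> c) (at 0))"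

text \<open>The supremum is finite when the function is superlinear and bounded below.\<close>

definition convex_conjugate :: "(real \<Rightarrow> real) \<Rightarrow> real \<Rightarrow> real" where
  "convex_conjugate g s = (SUP \<xi>. s * \<xi> - g \<xi>)"

definition admissible_alpha :: "(real \<times> real \<Rightarrow> real) \<Rightarrow> bool" where
  "admissible_alpha \<alpha> \<longleftrightarrow>
     (\<forall>p\<in>quadrant. \<alpha> p \<ge> 0) \<and> (\<exists>p\<in>quadrant. \<alpha> p \<noteq> 0) \<and>
     continuous_on quadrant \<alpha> \<and> concave_on quadrant \<alpha> \<and>
     (\<forall>u\<ge>0. \<forall>v\<ge>0. \<alpha> (u, v) = \<alpha> (v, u))"

definition phi' :: "(real \<Rightarrow> real) \<Rightarrow> real \<Rightarrow> ereal" where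
  "phi' \<phi> r =
     (if r = 0 then Lim (at_right 0) (\<lambda>s. ereal (deriv \<phi> s)) else ereal (deriv \<phi> r))"

definition Lambda :: "(real \<Rightarrow> real) \<Rightarrow> real \<Rightarrow> real \<Rightarrow> ereal" where
  "Lambda \<phi> u v = (if u = 0 \<and> v = 0 then 0 else phi' \<phi> v - phi' \<phi> u)"

definition psi_star_ext :: "(real \<Rightarrow> real) \<Rightarrow> ereal \<Rightarrow> ennreal" where
  "psi_star_ext \<psi>s \<xi> = (case \<xi> of ereal r \<Rightarrow> ennreal (\<psi>s r) | PInfty \<Rightarrow> \<infinity> | MInfty \<Rightarrow> \<infinity>)"

definition psi_star'_ext :: "(real \<Rightarrow> real) \<Rightarrow> ereal \<Rightarrow> ereal" where
  "psi_star'_ext \<psi>s \<xi> =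
     (case \<xi> of ereal r \<Rightarrow> ereal (deriv \<psi>s r) | PInfty \<Rightarrow> \<infinity> | MInfty \<Rightarrow> - \<infinity>)"

text \<open>A function \<open>\<alpha>\<close> as above is positive at all \<open>(u,u)\<close> with \<open>u > 0\<close>, so the last case below is
  exactly \<open>\<alpha> (u,v) = 0\<close>, \<open>u \<noteq> v\<close>.\<close>

definition D_plus ::
    "(real \<Rightarrow> real) \<Rightarrow> (real \<Rightarrow> real) \<Rightarrow> (real \<times> real \<Rightarrow> real) \<Rightarrow> real \<times> real \<Rightarrow> ennreal" where
  "D_plus \<phi> \<psi>s \<alpha> = (\<lambda>(u, v).
     if \<alpha> (u, v) > 0 then psi_star_ext \<psi>s (Lambda \<phi> u v) * ennreal (\<alpha> (u, v))
     else if u = 0 \<and> v = 0 then 0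
     else \<infinity>)"

definition lsc_on :: "'a::topological_space set \<Rightarrow> ('a \<Rightarrow> ennreal) \<Rightarrow> bool" where
  "lsc_on S g \<longleftrightarrow> (\<forall>p\<in>S. g p \<le> Liminf (at p within S) g)"

definition lsc_envelope_on :: "'a::topological_space set \<Rightarrow> ('a \<Rightarrow> ennreal) \<Rightarrow> 'a \<Rightarrow> ennreal" where
  "lsc_envelope_on S f p = (SUP g \<in> {g. lsc_on S g \<and> (\<forall>q\<in>S. g q \<le> f q)}. g p)"

definition D_phi ::
    "(real \<Rightarrow> real) \<Rightarrow> (real \<Rightarrow> real) \<Rightarrow> (real \<times> real \<Rightarrow> real) \<Rightarrow> real \<times> real \<Rightarrow> ennreal" where
  "D_phi \<phi> \<psi>s \<alpha> = lsc_envelope_on quadrant (D_plus \<phi> \<psi>s \<alpha>)"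

definition convex_on_ennreal :: "'a::real_vector set \<Rightarrow> ('a \<Rightarrow> ennreal) \<Rightarrow> bool" where
  "convex_on_ennreal S f \<longleftrightarrow> convex S \<and>
     (\<forall>x\<in>S. \<forall>y\<in>S. \<forall>t\<in>{0..1}.
        f ((1 - t) *\<^sub>R x + t *\<^sub>R y) \<le> ennreal (1 - t) * f x + ennreal t * f y)"

text \<open>\<open>F\<close> is a partial function: its value 0 outside \<open>F_defined\<close> carries no meaning.\<close>

definition F_defined :: "(real \<times> real \<Rightarrow> real) \<Rightarrow> real \<Rightarrow> real \<Rightarrow> bool" where
  "F_defined \<alpha> u v \<longleftrightarrow> \<alpha> (u, v) > 0 \<or> (u = 0 \<and> v = 0)"

definition F_map ::
    "(real \<Rightarrow> real) \<Rightarrow> (real \<Rightarrow> real) \<Rightarrow> (real \<times> real \<Rightarrow> real) \<Rightarrow> real \<Rightarrow> real \<Rightarrow> ereal" where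
  "F_map \<phi> \<psi>s \<alpha> u v =
     (if \<alpha> (u, v) > 0 then psi_star'_ext \<psi>s (Lambda \<phi> u v) * ereal (\<alpha> (u, v)) else 0)"

section \<open>Functionals\<close>

definition dens :: "'v measure \<Rightarrow> 'v measure \<Rightarrow> 'v \<Rightarrow> real" where
  "dens \<pi> \<rho> x = enn2real (RN_deriv \<pi> \<rho> x)"

definition energy :: "'v measure \<Rightarrow> (real \<Rightarrow> real) \<Rightarrow> 'v measure \<Rightarrow> ennreal" where
  "energy \<pi> \<phi> \<rho> =
     (if absolutely_continuous \<pi> \<rho> then \<integral>\<^sup>+x. ennreal (\<phi> (dens \<pi> \<rho> x)) \<partial>\<pi> else \<infinity>)"

text \<open>The next three functionals are meant for \<open>\<rho>\<close> absolutely continuous with respect to \<open>\<pi>\<close>.\<close>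

definition nu ::
    "'v::{metric_space,second_countable_topology} measure \<Rightarrow> ('v \<Rightarrow> 'v measure) \<Rightarrow>
     (real \<times> real \<Rightarrow> real) \<Rightarrow> 'v measure \<Rightarrow> ('v \<times> 'v) measure" where
  "nu \<pi> \<kappa> \<alpha> \<rho> =
     density (edge_measure \<pi> \<kappa>) (\<lambda>(x, y). ennreal (\<alpha> (dens \<pi> \<rho> x, dens \<pi> \<rho> y)))"

definition dissipation ::
    "'v::{metric_space,second_countable_topology} measure \<Rightarrow> ('v \<Rightarrow> 'v measure) \<Rightarrow>
     (real \<Rightarrow> real) \<Rightarrow> (real \<times> real \<Rightarrow> real) \<Rightarrow> 'v measure \<Rightarrow> ('v \<times> 'v) smeasure \<Rightarrow> ennreal" where
  "dissipation \<pi> \<kappa> \<psi>s \<alpha> \<rho> j =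
     (if absolutely_continuous (nu \<pi> \<kappa> \<alpha> \<rho>) (variation j)
      then (\<integral>\<^sup>+z. ennreal (convex_conjugate \<psi>s (sm_deriv (sm_scale 2 j) (nu \<pi> \<kappa> \<alpha> \<rho>) z))
              \<partial>nu \<pi> \<kappa> \<alpha> \<rho>) / 2
      else \<infinity>)"

definition fisher ::
    "'v::{metric_space,second_countable_topology} measure \<Rightarrow> ('v \<Rightarrow> 'v measure) \<Rightarrow>
     (real \<Rightarrow> real) \<Rightarrow> (real \<Rightarrow> real) \<Rightarrow> (real \<times> real \<Rightarrow> real) \<Rightarrow> 'v measure \<Rightarrow> ennreal" where
  "fisher \<pi> \<kappa> \<phi> \<psi>s \<alpha> \<rho> =
     (\<integral>\<^sup>+(x, y). D_phi \<phi> \<psi>s \<alpha> (dens \<pi> \<rho> x, dens \<pi> \<rho> y) \<partial>edge_measure \<pi> \<kappa>) / 2"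

section \<open>Continuity equations\<close>

text \<open>For the test functions and pairs \<open>(\<rho>, j)\<close> used below, all integrals in this identity are
  absolutely convergent, the inner one on the right for almost every \<open>r\<close>.\<close>

definition ce_identity ::
    "real \<Rightarrow> (real \<Rightarrow> 'v measure) \<Rightarrow> (real \<Rightarrow> ('v \<times> 'v) smeasure) \<Rightarrow> ('v \<Rightarrow> real) \<Rightarrow> bool" where
  "ce_identity T \<rho> j f \<longleftrightarrow>
     (\<forall>s t. 0 \<le> s \<and> s \<le> t \<and> t \<le> T \<longrightarrow>
        (\<integral>x. f x \<partial>\<rho> t) - (\<integral>x. f x \<partial>\<rho> s) =
        (\<integral>r\<in>{s..t}. sm_integral (j r) offdiag (grad f) \<partial>lborel))"

definition Lip_b :: "('v::metric_space \<Rightarrow> real) set" where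
  "Lip_b = {f. bounded (range f) \<and> (\<exists>L. L-lipschitz_on UNIV f)}"

definition CE ::
    "real \<Rightarrow> ((real \<Rightarrow> 'v::{metric_space,second_countable_topology} measure) \<times>
              (real \<Rightarrow> ('v \<times> 'v) smeasure)) set" where
  "CE T = {(\<rho>, j).
     (\<forall>t\<in>{0..T}. finite_borel_measure (\<rho> t)) \<and>
     (\<forall>t\<in>{0..T}. signed_sigma_finite (j t)) \<and>
     measurable_family T j \<and>
     (\<forall>t\<in>{0..T}. emeasure (variation (j t)) (- offdiag) = 0) \<and>
     (\<integral>\<^sup>+t\<in>{0..T}. (\<integral>\<^sup>+(x, y). ennreal (min 1 (dist x y)) \<partial>variation (j t)) \<partial>lborel) < \<infinity> \<and>
     (\<forall>f\<in>Lip_b. ce_identity T \<rho> j f)}"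

definition ACE ::
    "'v::{metric_space,second_countable_topology} measure \<Rightarrow> ('v \<Rightarrow> 'v measure) \<Rightarrow>
     (real \<Rightarrow> real) \<Rightarrow> (real \<Rightarrow> real) \<Rightarrow> (real \<times> real \<Rightarrow> real) \<Rightarrow> real \<Rightarrow>
     ((real \<Rightarrow> 'v measure) \<times> (real \<Rightarrow> ('v \<times> 'v) smeasure)) set" where
  "ACE \<pi> \<kappa> \<phi> \<psi>s \<alpha> T = {(\<rho>, j) \<in> CE T.
     (SUP t\<in>{0..T}. energy \<pi> \<phi> (\<rho> t)) < \<infinity> \<and>
     (\<integral>\<^sup>+t\<in>{0..T}. (dissipation \<pi> \<kappa> \<psi>s \<alpha> (\<rho> t) (j t) + fisher \<pi> \<kappa> \<phi> \<psi>s \<alpha> (\<rho> t)) \<partial>lborel) < \<infinity>}"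

text \<open>Classes in \<open>L\<^sup>\<infinity>(\<pi>)\<close> are given by all their Borel representatives.\<close>

definition X2 ::
    "'v::{metric_space,second_countable_topology} measure \<Rightarrow> ('v \<Rightarrow> 'v measure) \<Rightarrow> ('v \<Rightarrow> real) set" where
  "X2 \<pi> \<kappa> = {f \<in> borel_measurable borel.
     (\<exists>C. AE x in \<pi>. \<bar>f x\<bar> \<le> C) \<and>
     (\<integral>\<^sup>+z\<in>offdiag. ennreal (\<bar>grad f z\<bar>\<^sup>2) \<partial>edge_measure \<pi> \<kappa>) < \<infinity>}"

definition RCE ::
    "'v::{metric_space,second_countable_topology} measure \<Rightarrow> ('v \<Rightarrow> 'v measure) \<Rightarrow>
     (real \<Rightarrow> real) \<Rightarrow> (real \<Rightarrow> real) \<Rightarrow> (real \<times> real \<Rightarrow> real) \<Rightarrow> real \<Rightarrow>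
     ((real \<Rightarrow> 'v measure) \<times> (real \<Rightarrow> ('v \<times> 'v) smeasure)) set" where
  "RCE \<pi> \<kappa> \<phi> \<psi>s \<alpha> T = {(\<rho>, j) \<in> ACE \<pi> \<kappa> \<phi> \<psi>s \<alpha> T.
     (\<exists>C. AE t in lborel. t \<in> {0<..<T} \<longrightarrow> (AE x in \<pi>. \<bar>dens \<pi> (\<rho> t) x\<bar> \<le> C)) \<and>
     (\<forall>f \<in> X2 \<pi> \<kappa>. ce_identity T \<rho> j f)}"

definition EDF ::
    "'v::{metric_space,second_countable_topology} measure \<Rightarrow> ('v \<Rightarrow> 'v measure) \<Rightarrow>
     (real \<Rightarrow> real) \<Rightarrow> (real \<Rightarrow> real) \<Rightarrow> (real \<times> real \<Rightarrow> real) \<Rightarrow>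
     (real \<Rightarrow> 'v measure) \<Rightarrow> (real \<Rightarrow> ('v \<times> 'v) smeasure) \<Rightarrow> real \<Rightarrow> ereal" where
  "EDF \<pi> \<kappa> \<phi> \<psi>s \<alpha> \<rho> j t =
     enn2ereal (energy \<pi> \<phi> (\<rho> t)) - enn2ereal (energy \<pi> \<phi> (\<rho> 0)) +
     enn2ereal (\<integral>\<^sup>+r\<in>{0..t}. (dissipation \<pi> \<kappa> \<psi>s \<alpha> (\<rho> r) (j r) + fisher \<pi> \<kappa> \<phi> \<psi>s \<alpha> (\<rho> r)) \<partial>lborel)"

end

theory Submission
  imports Defs "HOL-Probability.Giry_Monad"
begin

text \<open>
  Write \<open>2 j\<^sub>t = w\<^sub>t \<nu>\<^sub>t\<close> and \<open>L = \<Lambda>\<^sub>\<phi>(u\<^sub>t(x), u\<^sub>t(y))\<close>. If the chain rule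
  \<open>\<E>(\<rho>\<^sub>b) - \<E>(\<rho>\<^sub>0) = \<integral>\<^sub>0\<^sup>b \<integral>\<integral> L dj\<^sub>t dt\<close> holds, then \<open>\<L>\<^sub>b\<close> is the space-time
  integral of half of \<open>\<psi>(w) \<alpha> + D\<^sub>\<phi> + w L \<alpha>\<close>. By the Young inequality this integrand is nonnegative,
  and it vanishes exactly when \<open>w = - (\<psi>\<^sup>*)'(L)\<close>; where \<open>\<alpha> = 0\<close> it vanishes exactly when
  \<open>D\<^sub>\<phi> = 0\<close>, that is, on the diagonal.

  For the chain rule, \<open>\<phi>\<close> is linearised below \<open>\<epsilon>\<close>. Convexity of \<open>D\<^sub>\<phi>\<close> and strict convexity of
  \<open>\<phi>\<close> make \<open>D\<^sub>\<phi>\<close> positive off the diagonal, so that on bounded sets it dominates the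
  squared gradient of the truncated \<open>\<phi>\<^sub>\<epsilon>'(u)\<close>; hence \<open>\<phi>\<^sub>\<epsilon>'(u\<^sub>t)\<close> is an admissible test function at
  almost every \<open>t\<close>. Convexity of \<open>\<phi>\<^sub>\<epsilon>\<close> bounds \<open>\<E>\<^sub>\<epsilon>(\<rho>\<^bsub>t+s\<^esub>) - \<E>\<^sub>\<epsilon>(\<rho>\<^sub>t)\<close> from below, for both
  signs of \<open>s\<close>, by the flux between \<open>t\<close> and \<open>t + s\<close> tested with \<open>\<phi>\<^sub>\<epsilon>'(u\<^sub>t)\<close>. Averaging over \<open>t\<close>,
  dividing by \<open>s\<close> and letting \<open>s \<rightarrow> 0\<close> turns these inequalities into the chain rule for \<open>\<phi>\<^sub>\<epsilon>\<close>;
  dominated convergence gives \<open>\<epsilon> \<rightarrow> 0\<close>.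

  Since \<open>nn_integral\<close> of a nonmeasurable function is only a lower integral, all densities are first
  replaced by jointly measurable versions in \<open>(t, x, y)\<close>.
\<close>

section \<open>Bounded Lipschitz functions and translation continuity\<close>

text \<open>Both the gradient of \<open>\<phi>\<^sub>\<epsilon>'(u\<^sub>t)\<close> and the flux are
  merely measurable in \<open>t\<close>, and the energy is only lower semicontinuous, so nothing can
  be differentiated directly. The basic object is therefore the product of the gradient at time
  \<open>t\<close> with the flux at another time \<open>r\<close>. Young's inequality splits it into
  a term at \<open>t\<close>, controlled by the Fisher information, and a term at \<open>r\<close>,
  controlled by the dissipation; the mobility is taken at \<open>r\<close> and is bounded because
  the densities are. Continuity in the shift \<open>r - t\<close> comes from translation continuity
  in \<open>L\<^sup>1\<close> of the flux for fixed \<open>(x, y)\<close>. The bound on the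
  densities is first extended from almost every time to every time, since the increments of the
  energy compare a generic time with every other one. The constant of the mixed-time bound depends
  on \<open>\<epsilon>\<close>; in the limit \<open>\<epsilon> \<rightarrow> 0\<close> both factors
  stand at the same time, and Young's inequality against \<open>\<Lambda>\<^sub>\<phi>\<close>
  itself gives a uniform bound. One inequality of the chain rule is proved directly, the other by
  reversing time.\<close>

lemma Lip_bI: "bounded (range f) \<Longrightarrow> L-lipschitz_on UNIV f \<Longrightarrow> f \<in> Lip_b"
  unfolding Lip_b_def by auto

lemma Lip_b_const: "(\<lambda>x. c) \<in> Lip_b"
  by (rule Lip_bI[of _ 0]) (auto intro: lipschitz_on_constant)

lemma Lip_b_add:
  assumes "f \<in> Lip_b" "g \<in> Lip_b"
  shows "(\<lambda>x. f x + g x) \<in> Lip_b"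
proof -
  obtain L M where "L-lipschitz_on UNIV f" "M-lipschitz_on UNIV g" "bounded (range f)" "bounded (range g)"
    using assms unfolding Lip_b_def by auto
  then show ?thesis
    by (intro Lip_bI[of _ "L + M"] lipschitz_on_add) (auto intro: bounded_plus_comp)
qed

lemma Lip_b_cmult:
  assumes "f \<in> Lip_b"
  shows "(\<lambda>x. c * f x) \<in> Lip_b"
proof -
  obtain L where "L-lipschitz_on UNIV f" "bounded (range f)"
    using assms unfolding Lip_b_def by auto
  then show ?thesis
    using bounded_linear_image[OF _ bounded_linear_mult_right[of c], of "range f"]
    by (intro Lip_bI[of _ "\<bar>c\<bar> * L"] lipschitz_on_cmult_real) (auto simp: image_image)
qed

lemma Lip_b_diff: "f \<in> Lip_b \<Longrightarrow> g \<in> Lip_b \<Longrightarrow> (\<lambda>x. f x - g x) \<in> Lip_b"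
  using Lip_b_add[of f "\<lambda>x. (-1) * g x"] Lip_b_cmult[of g "-1"] by simp

lemma Lip_b_sum: "finite I \<Longrightarrow> (\<And>i. i \<in> I \<Longrightarrow> f i \<in> Lip_b) \<Longrightarrow> (\<lambda>x. \<Sum>i\<in>I. f i x) \<in> Lip_b"
  by (induction I rule: finite_induct) (auto intro: Lip_b_const Lip_b_add)

lemma Lip_b_max_0:
  assumes "f \<in> Lip_b"
  shows "(\<lambda>x. max 0 (f x)) \<in> Lip_b"
proof -
  obtain L B where f: "L-lipschitz_on UNIV f" and B: "\<And>x. \<bar>f x\<bar> \<le> B"
    using assms unfolding Lip_b_def by (auto simp: bounded_iff)
  show ?thesis
  proof (rule Lip_bI[of _ L])
    show "bounded (range (\<lambda>x. max 0 (f x)))"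
      unfolding bounded_iff using order_trans[OF abs_ge_zero B] B
      by (intro exI[of _ B]) (auto simp: abs_le_iff max_def)
    show "L-lipschitz_on UNIV (\<lambda>x. max 0 (f x))"
    proof (rule lipschitz_onI)
      fix x y show "dist (max 0 (f x)) (max 0 (f y)) \<le> L * dist x y"
        using lipschitz_onD[OF f, of x y] by (auto simp: dist_real_def max_def split: if_splits)
    qed (rule lipschitz_on_nonneg[OF f])
  qed
qed

lemma Lip_b_measurable: "f \<in> Lip_b \<Longrightarrow> f \<in> borel_measurable borel"
  unfolding Lip_b_def
  by (auto intro!: borel_measurable_continuous_onI elim: lipschitz_on_continuous_on)

lemma Lip_b_bounded: "f \<in> Lip_b \<Longrightarrow> \<exists>B. \<forall>x. \<bar>f x\<bar> \<le> B"
  unfolding Lip_b_def by (auto simp: bounded_iff)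

lemma Lip_b_integrable:
  assumes "finite_measure \<mu>" "sets \<mu> = sets borel" "f \<in> Lip_b"
  shows "integrable \<mu> f"
proof -
  interpret finite_measure \<mu> by fact
  have "f \<in> borel_measurable \<mu>"
    using Lip_b_measurable[OF assms(3)] assms(2) by (simp cong: measurable_cong_sets)
  moreover obtain B where "\<forall>x. \<bar>f x\<bar> \<le> B" using Lip_b_bounded[OF assms(3)] by blast
  ultimately show ?thesis
    by (intro integrable_const_bound[of _ B]) auto
qed

text \<open>For nonempty closed \<open>A\<close> these cut-offs decrease to the indicator of
  \<open>A\<close> as \<open>n\<close> grows, which starts the density argument.\<close>

lemma Lip_b_infdist: "(\<lambda>x. max 0 (1 - real n * infdist x A)) \<in> Lip_b"
proof (rule Lip_bI[of _ "real n"])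
  have "0 \<le> real n * infdist x A" for x
    by (simp add: infdist_nonneg)
  then show "bounded (range (\<lambda>x. max 0 (1 - real n * infdist x A)))"
    unfolding bounded_iff by (intro exI[of _ 1]) (auto simp: max_def)
  show "(real n)-lipschitz_on UNIV (\<lambda>x. max 0 (1 - real n * infdist x A))"
  proof (rule lipschitz_onI)
    fix x y
    have "\<bar>real n * infdist x A - real n * infdist y A\<bar> \<le> real n * dist x y"
      using infdist_triangle_abs[of x A y]
      by (metis abs_mult abs_of_nat mult_left_mono of_nat_0_le_iff right_diff_distrib)
    then show "dist (max 0 (1 - real n * infdist x A)) (max 0 (1 - real n * infdist y A)) \<le> real n * dist x y"
      by (auto simp: dist_real_def max_def split: if_splits)
  qed simp
qed

lemma Lip_b_dense_closed:
  fixes \<mu> :: "'v::metric_space measure"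
  assumes "finite_measure \<mu>" and sets: "sets \<mu> = sets borel" and "closed F" "e > 0"
  shows "\<exists>f\<in>Lip_b. (\<integral>x. \<bar>indicator F x - f x\<bar> \<partial>\<mu>) < e"
\<comment> \<open>\<open>infdist x {}\<close> is 0, so the cut-offs of the empty set would be
  constantly 1; the zero function serves instead.\<close>
proof (cases "F = {}")
  case True
  then show ?thesis using \<open>e > 0\<close> by (intro bexI[of _ "\<lambda>x. 0"] Lip_b_const) simp
next
  case False
  interpret finite_measure \<mu> by fact
  let ?f = "\<lambda>n x. max 0 (1 - real n * infdist x F)"
  have [measurable]: "?f n \<in> borel_measurable \<mu>" for n
    using Lip_b_measurable[OF Lip_b_infdist[of n F]] sets by (simp cong: measurable_cong_sets)
  have [measurable]: "F \<in> sets \<mu>" using \<open>closed F\<close> sets by simp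
  have lim: "(\<lambda>n. ?f n x) \<longlonglongrightarrow> indicator F x" for x
  proof (cases "x \<in> F")
    case False
    then have pos: "infdist x F > 0"
      using in_closed_iff_infdist_zero[OF \<open>closed F\<close> \<open>F \<noteq> {}\<close>, of x] infdist_nonneg[of x F] by linarith
    obtain N where N: "real N * infdist x F > 1"
      using reals_Archimedean3[OF pos] by blast
    have "?f n x = 0" if "n \<ge> N" for n
    proof -
      have "real N * infdist x F \<le> real n * infdist x F"
        using that pos by (intro mult_right_mono) auto
      with N show ?thesis by simp
    qed
    then have "eventually (\<lambda>n. ?f n x = 0) sequentially"
      by (auto simp: eventually_sequentially)
    then show ?thesis using False by (simp add: tendsto_eventually)
  qed simp
  have "(\<lambda>n. \<integral>x. \<bar>indicator F x - ?f n x\<bar> \<partial>\<mu>) \<longlonglongrightarrow> (\<integral>x. 0 \<partial>\<mu>)"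
  proof (rule integral_dominated_convergence[where w = "\<lambda>x. 1"])
    show "AE x in \<mu>. (\<lambda>n. \<bar>indicator F x - ?f n x\<bar>) \<longlonglongrightarrow> 0"
    proof (rule AE_I2)
      fix x
      show "(\<lambda>n. \<bar>indicator F x - ?f n x\<bar>) \<longlonglongrightarrow> 0"
        using tendsto_rabs[OF tendsto_diff[OF tendsto_const lim[of x], of "indicator F x"]] by simp
    qed
    show "AE x in \<mu>. norm \<bar>indicator F x - ?f n x\<bar> \<le> 1" for n
      by (auto simp: indicator_def max_def infdist_nonneg)
  qed auto
  then have "eventually (\<lambda>n. (\<integral>x. \<bar>indicator F x - ?f n x\<bar> \<partial>\<mu>) < e) sequentially"
    using \<open>e > 0\<close> by (auto intro: order_tendstoD)
  then obtain n where "(\<integral>x. \<bar>indicator F x - ?f n x\<bar> \<partial>\<mu>) < e"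
    by (auto dest: eventually_happens)
  then show ?thesis by (intro bexI[of _ "?f n"] Lip_b_infdist)
qed

text \<open>The sets whose indicators are \<open>L\<^sup>1\<close>-limits of bounded Lipschitz
  functions form a Dynkin system, and it contains the closed sets, an intersection-stable generator
  of the Borel sets.\<close>

lemma Lip_b_dense_indicator:
  fixes \<mu> :: "'v::metric_space measure"
  assumes fin: "finite_measure \<mu>" and sets: "sets \<mu> = sets borel" and "A \<in> sets borel"
  shows "\<forall>e>0. \<exists>f\<in>Lip_b. (\<integral>x. \<bar>indicator A x - f x\<bar> \<partial>\<mu>) < e"
proof -
  interpret finite_measure \<mu> by fact
  have meas[measurable]: "f \<in> borel_measurable \<mu>" if "f \<in> Lip_b" for f
    using Lip_b_measurable[OF that] sets by (simp cong: measurable_cong_sets)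
  note int = Lip_b_integrable[OF fin sets]
  have stable: "Int_stable (Collect closed :: 'v set set)"
    by (auto simp: Int_stable_def)
  have "A \<in> sigma_sets UNIV (Collect closed)"
    using \<open>A \<in> sets borel\<close> by (simp add: borel_eq_closed)
  then show ?thesis
  proof (induction rule: sigma_sets_induct_disjoint[OF stable Pow_UNIV[THEN equalityD2, THEN order_trans[OF subset_UNIV]], consumes 1, case_names basic empty compl union])
    case (basic A)
    then show ?case using Lip_b_dense_closed[OF fin sets, of A] by auto
  next
    case empty
    then show ?case using Lip_b_dense_closed[OF fin sets, of "{}"] by auto
  next
    case (compl A)
    show ?case
    proof (intro allI impI)
      fix e :: real assume "e > 0"
      with compl obtain f where f: "f \<in> Lip_b" "(\<integral>x. \<bar>indicator A x - f x\<bar> \<partial>\<mu>) < e" by blast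
      have "\<bar>indicator (UNIV - A) x - (1 - f x)\<bar> = \<bar>indicator A x - f x\<bar>" for x
        by (auto simp: indicator_def)
      with f show "\<exists>f\<in>Lip_b. (\<integral>x. \<bar>indicator (UNIV - A) x - f x\<bar> \<partial>\<mu>) < e"
        by (intro bexI[of _ "\<lambda>x. 1 - f x"]) (auto intro: Lip_b_diff Lip_b_const)
    qed
  next
    case (union A)
    have A[measurable]: "A i \<in> sets \<mu>" for i
      using union(2) sets by (auto simp: borel_eq_closed)
    show ?case
    proof (intro allI impI)
      fix e :: real assume e: "e > 0"
      \<comment> \<open>The number \<open>n\<close> of sets is fixed first, with tail mass below
        \<open>e/2\<close>; the tolerance of each approximant may then depend on \<open>n\<close>.
        The \<open>+ 1\<close> in it covers \<open>n = 0\<close>.\<close>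
      have "(\<lambda>n. measure \<mu> (\<Union>i<n. A i)) \<longlonglongrightarrow> measure \<mu> (\<Union>n. \<Union>i<n. A i)"
        by (intro finite_Lim_measure_incseq) (auto simp: incseq_def, force)
      moreover have "(\<Union>n. \<Union>i<n. A i) = (\<Union>i. A i)" by auto
      ultimately have "(\<lambda>n. measure \<mu> (\<Union>i<n. A i)) \<longlonglongrightarrow> measure \<mu> (\<Union>i. A i)" by simp
      then have "eventually (\<lambda>n. measure \<mu> (\<Union>i<n. A i) > measure \<mu> (\<Union>i. A i) - e/2) sequentially"
        using e by (intro order_tendstoD) auto
      then obtain n where n: "measure \<mu> (\<Union>i<n. A i) > measure \<mu> (\<Union>i. A i) - e/2"
        by (auto dest: eventually_happens)
      have "\<forall>i. \<exists>f\<in>Lip_b. (\<integral>x. \<bar>indicator (A i) x - f x\<bar> \<partial>\<mu>) < e / 2 / (real n + 1)"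
        using union(3) e by auto
      then obtain f where f: "\<And>i. f i \<in> Lip_b"
        and fi: "\<And>i. (\<integral>x. \<bar>indicator (A i) x - f i x\<bar> \<partial>\<mu>) < e / 2 / (real n + 1)" by metis
      let ?U = "\<Union>i. A i" and ?Un = "\<Union>i<n. A i"
      have ind: "indicator ?Un x = (\<Sum>i<n. indicator (A i) x :: real)" for x
        using union(1) by (intro indicator_UN_disjoint) (auto simp: disjoint_family_on_def)
      have le: "\<bar>indicator ?U x - (\<Sum>i<n. f i x)\<bar> \<le> indicator (?U - ?Un) x + (\<Sum>i<n. \<bar>indicator (A i) x - f i x\<bar>)" for x
      proof -
        have "indicator ?U x - (\<Sum>i<n. f i x) = indicator (?U - ?Un) x + (\<Sum>i<n. indicator (A i) x - f i x)"
        proof -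
          have "indicator ?U x = (indicator (?U - ?Un) x + indicator ?Un x :: real)"
            by (auto simp: indicator_def)
          then show ?thesis unfolding ind by (simp add: sum_subtractf)
        qed
        also have "\<bar>\<dots>\<bar> \<le> \<bar>indicator (?U - ?Un) x\<bar> + (\<Sum>i<n. \<bar>indicator (A i) x - f i x\<bar>)"
          by (rule order_trans[OF abs_triangle_ineq]) (intro add_left_mono sum_abs)
        finally show ?thesis by simp
      qed
      have i1: "integrable \<mu> (\<lambda>x. \<bar>indicator (A i) x - f i x\<bar>)" for i
        using int[OF f] by (intro integrable_abs Bochner_Integration.integrable_diff) (auto simp: integrable_indicator_iff less_top[symmetric])
      have "(\<integral>x. \<bar>indicator ?U x - (\<Sum>i<n. f i x)\<bar> \<partial>\<mu>) \<le> (\<integral>x. indicator (?U - ?Un) x + (\<Sum>i<n. \<bar>indicator (A i) x - f i x\<bar>) \<partial>\<mu>)"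
        using le i1 int[OF f] 
        by (intro integral_mono integrable_abs Bochner_Integration.integrable_diff Bochner_Integration.integrable_add Bochner_Integration.integrable_sum) (auto simp: integrable_indicator_iff less_top[symmetric])
      also have "\<dots> = measure \<mu> (?U - ?Un) + (\<Sum>i<n. \<integral>x. \<bar>indicator (A i) x - f i x\<bar> \<partial>\<mu>)"
        using i1 by (subst Bochner_Integration.integral_add) (auto simp: integrable_indicator_iff less_top[symmetric])
      also have "measure \<mu> (?U - ?Un) = measure \<mu> ?U - measure \<mu> ?Un"
        by (intro finite_measure_Diff) auto
      also have "(\<Sum>i<n. \<integral>x. \<bar>indicator (A i) x - f i x\<bar> \<partial>\<mu>) \<le> (\<Sum>i<n. e / 2 / (real n + 1))"
        by (intro sum_mono less_imp_le fi)
      also have "\<dots> \<le> e / 2" using e by (simp add: field_simps)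
      finally have "(\<integral>x. \<bar>indicator ?U x - (\<Sum>i<n. f i x)\<bar> \<partial>\<mu>) < e"
        using n by linarith
      then show "\<exists>f\<in>Lip_b. (\<integral>x. \<bar>indicator ?U x - f x\<bar> \<partial>\<mu>) < e"
        using f by (intro bexI[of _ "\<lambda>x. \<Sum>i<n. f i x"] Lip_b_sum) auto
    qed
  qed
qed

text \<open>Carries time continuity from Lipschitz to bounded Borel test functions, and reduces
  translation continuity on the line to the Lipschitz case.\<close>

lemma Lip_b_dense:
  fixes \<mu> :: "'v::metric_space measure"
  assumes fin: "finite_measure \<mu>" and sets: "sets \<mu> = sets borel" and "integrable \<mu> g"
  shows "\<forall>e>0. \<exists>f\<in>Lip_b. (\<integral>x. \<bar>g x - f x\<bar> \<partial>\<mu>) < e"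
  using assms(3)
proof (induction rule: integrable_induct)
  case (base A c)
  show ?case
  proof (intro allI impI)
    fix e :: real assume e: "e > 0"
    obtain f where f: "f \<in> Lip_b" "(\<integral>x. \<bar>indicator A x - f x\<bar> \<partial>\<mu>) < e / (\<bar>c\<bar> + 1)"
      using Lip_b_dense_indicator[OF fin sets, of A] base(1) sets e
      by (metis abs_ge_zero add_nonneg_pos divide_pos_pos zero_less_one)
    have "\<bar>indicator A x *\<^sub>R c - c * f x\<bar> = \<bar>c\<bar> * \<bar>indicator A x - f x\<bar>" for x
      by (simp add: abs_mult[symmetric] algebra_simps)
    then have "(\<integral>x. \<bar>indicator A x *\<^sub>R c - c * f x\<bar> \<partial>\<mu>) = \<bar>c\<bar> * (\<integral>x. \<bar>indicator A x - f x\<bar> \<partial>\<mu>)" by simp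
    also have "\<dots> \<le> \<bar>c\<bar> * (e / (\<bar>c\<bar> + 1))" using f(2) by (intro mult_left_mono) auto
    also have "\<dots> < e" using e by (simp add: field_simps)
    finally show "\<exists>f\<in>Lip_b. (\<integral>x. \<bar>indicator A x *\<^sub>R c - f x\<bar> \<partial>\<mu>) < e"
      by (intro bexI[of _ "\<lambda>x. c * f x"] Lip_b_cmult f(1))
  qed
next
  case (add g h)
  show ?case
  proof (intro allI impI)
    fix e :: real assume e: "e > 0"
    obtain f where f: "f \<in> Lip_b" "(\<integral>x. \<bar>g x - f x\<bar> \<partial>\<mu>) < e/2" 
      using add.IH(1)[rule_format, of "e/2"] e by auto
    obtain k where k: "k \<in> Lip_b" "(\<integral>x. \<bar>h x - k x\<bar> \<partial>\<mu>) < e/2" 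
      using add.IH(2)[rule_format, of "e/2"] e by auto
    note ints = add.hyps Lip_b_integrable[OF fin sets f(1)] Lip_b_integrable[OF fin sets k(1)]
    have "(\<integral>x. \<bar>g x + h x - (f x + k x)\<bar> \<partial>\<mu>) \<le> (\<integral>x. \<bar>g x - f x\<bar> + \<bar>h x - k x\<bar> \<partial>\<mu>)"
      using ints by (intro integral_mono) auto
    also have "\<dots> < e" using ints f k by (subst Bochner_Integration.integral_add) auto
    finally show "\<exists>f\<in>Lip_b. (\<integral>x. \<bar>g x + h x - f x\<bar> \<partial>\<mu>) < e"
      by (intro bexI[of _ "\<lambda>x. f x + k x"] Lip_b_add f(1) k(1))
  qed
next
  case (lim g s)
  show ?case
  proof (intro allI impI)
    fix e :: real assume e: "e > 0"
    have [measurable]: "g \<in> borel_measurable \<mu>" "\<And>i. s i \<in> borel_measurable \<mu>"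
      using lim by auto
    have "(\<lambda>n. \<integral>x. \<bar>g x - s n x\<bar> \<partial>\<mu>) \<longlonglongrightarrow> (\<integral>x. 0 \<partial>\<mu>)"
    \<comment> \<open>The induction rule supplies approximants bounded by
      \<open>2 * \<bar>g x\<bar>\<close>, whence the factor 3.\<close>
    proof (rule integral_dominated_convergence[where w = "\<lambda>x. 3 * \<bar>g x\<bar>"])
      show "AE x in \<mu>. (\<lambda>n. \<bar>g x - s n x\<bar>) \<longlonglongrightarrow> 0"
      proof (rule AE_I2)
        fix x assume "x \<in> space \<mu>"
        from tendsto_rabs[OF tendsto_diff[OF tendsto_const lim.hyps(2)[OF this], of "g x"]]
        show "(\<lambda>n. \<bar>g x - s n x\<bar>) \<longlonglongrightarrow> 0" by simp
      qed
      show "AE x in \<mu>. norm \<bar>g x - s n x\<bar> \<le> 3 * \<bar>g x\<bar>" for n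
        using lim.hyps(3)[of _ n] by (intro AE_I2) (force simp: abs_le_iff)
    qed (use lim.hyps(4) in auto)
    then have "eventually (\<lambda>n. (\<integral>x. \<bar>g x - s n x\<bar> \<partial>\<mu>) < e/2) sequentially"
      using e by (intro order_tendstoD(2)[where y = 0]) auto
    then obtain n where n: "(\<integral>x. \<bar>g x - s n x\<bar> \<partial>\<mu>) < e/2"
      by (auto dest: eventually_happens)
    obtain f where f: "f \<in> Lip_b" "(\<integral>x. \<bar>s n x - f x\<bar> \<partial>\<mu>) < e/2" 
      using lim.IH[rule_format, of "e/2"] e by auto
    note ints = lim.hyps(1)[of n] lim.hyps(4) Lip_b_integrable[OF fin sets f(1)]
    have "(\<integral>x. \<bar>g x - f x\<bar> \<partial>\<mu>) \<le> (\<integral>x. \<bar>g x - s n x\<bar> + \<bar>s n x - f x\<bar> \<partial>\<mu>)"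
      using ints by (intro integral_mono) auto
    also have "\<dots> < e" using ints f n by (subst Bochner_Integration.integral_add) auto
    finally show "\<exists>f\<in>Lip_b. (\<integral>x. \<bar>g x - f x\<bar> \<partial>\<mu>) < e"
      using f(1) by blast
  qed
qed

text \<open>Outside a large interval the mass of \<open>g\<close> is small; inside, \<open>g\<close>
  is close in \<open>L\<^sup>1\<close> to a Lipschitz function, whose translates are uniformly close
  on a bounded window.\<close>

lemma L1_translation_continuous:
  fixes g :: "real \<Rightarrow> real"
  assumes g: "integrable lborel g"
  shows "((\<lambda>s. \<integral>t. \<bar>g (t + s) - g t\<bar> \<partial>lborel) \<longlongrightarrow> 0) (at 0)"
proof -
  have [measurable]: "g \<in> borel_measurable borel" using g by auto
  have shift: "integrable lborel (\<lambda>t. h (t + s))" "(\<integral>t. h (t + s) \<partial>lborel) = integral\<^sup>L lborel h"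
    if "integrable lborel h" for h :: "real \<Rightarrow> real" and s
    using lborel_integrable_real_affine[OF that, of 1 s] lborel_integral_real_affine[of 1 h s]
    by (auto simp: add.commute)
  have "\<exists>d>0. \<forall>s. \<bar>s\<bar> < d \<longrightarrow> (\<integral>t. \<bar>g (t + s) - g t\<bar> \<partial>lborel) < e" if e: "e > 0" for e
  proof -
    have "(\<lambda>n. \<integral>t. indicator (- {-real n..real n}) t * \<bar>g t\<bar> \<partial>lborel) \<longlonglongrightarrow> (\<integral>t. 0 \<partial>(lborel::real measure))"
    proof (rule integral_dominated_convergence[where w = "\<lambda>x. \<bar>g x\<bar>"])
      show "AE x in lborel. (\<lambda>n. indicator (- {-real n..real n}) x * \<bar>g x\<bar>) \<longlonglongrightarrow> 0"
      proof (rule AE_I2)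
        fix x :: real
        obtain N where "\<bar>x\<bar> \<le> real N" using real_arch_simple by blast
        then have "eventually (\<lambda>n. indicator (- {-real n..real n}) x * \<bar>g x\<bar> = 0) sequentially"
          unfolding eventually_sequentially by (intro exI[of _ N]) (auto simp: indicator_def)
        then show "(\<lambda>n. indicator (- {-real n..real n}) x * \<bar>g x\<bar>) \<longlonglongrightarrow> 0" by (simp add: tendsto_eventually)
      qed
    qed (use g in \<open>auto simp: indicator_def\<close>)
    then have "eventually (\<lambda>n. (\<integral>t. indicator (- {-real n..real n}) t * \<bar>g t\<bar> \<partial>lborel) < e/8) sequentially"
      using e by (intro order_tendstoD(2)[where y = 0]) auto
    then obtain n where n: "(\<integral>t. indicator (- {-real n..real n}) t * \<bar>g t\<bar> \<partial>lborel) < e/8"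
      by (auto dest: eventually_happens)
    \<comment> \<open>The margin 2 leaves room for shifts of size at most 1: if
      \<open>\<bar>t\<bar> \<le> n + 1\<close>, then \<open>t\<close> and \<open>t + s\<close> both
      lie in \<open>J\<close>; otherwise both lie outside the interval from \<open>-n\<close> to
      \<open>n\<close>.\<close>
    define J where "J = {-real n - 2..real n + 2}"
    have [measurable]: "J \<in> sets borel" by (simp add: J_def)
    define \<mu> where "\<mu> = density lborel (\<lambda>t. indicator J t)"
    have fin: "finite_measure \<mu>" and sets: "sets \<mu> = sets borel"
      unfolding \<mu>_def by (auto intro!: finite_measureI simp: emeasure_density J_def)
    have toJ: "(\<integral>x. h x \<partial>\<mu>) = (\<integral>x. indicator J x * h x \<partial>lborel)"
         "integrable \<mu> h \<longleftrightarrow> integrable lborel (\<lambda>x. indicator J x * h x)"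
      if "h \<in> borel_measurable borel" for h :: "real \<Rightarrow> real"
    proof -
      have "\<mu> = density lborel (\<lambda>t. ennreal (indicator J t))" unfolding \<mu>_def by (simp add: ennreal_indicator)
      then show "(\<integral>x. h x \<partial>\<mu>) = (\<integral>x. indicator J x * h x \<partial>lborel)" "integrable \<mu> h \<longleftrightarrow> integrable lborel (\<lambda>x. indicator J x * h x)"
        using that by (simp_all add: integral_density integrable_density)
    qed
    have "integrable \<mu> g"
      using toJ(2)[of g] integrable_real_mult_indicator[of J lborel g] g by (auto simp: mult.commute)
    then obtain f where f: "f \<in> Lip_b" and fe: "(\<integral>x. \<bar>g x - f x\<bar> \<partial>\<mu>) < e/8"
      using Lip_b_dense[OF fin sets] e by (metis divide_pos_pos zero_less_numeral)
    have [measurable]: "f \<in> borel_measurable borel" using Lip_b_measurable[OF f] .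
    obtain L where L: "L-lipschitz_on UNIV f" using f unfolding Lip_b_def by auto
    have L0: "L \<ge> 0" using lipschitz_on_nonneg[OF L] .
    define a where "a = (\<lambda>t. indicator J t * \<bar>g t - f t\<bar>)"
    define b where "b = (\<lambda>t. indicator (- {-real n..real n}) t * \<bar>g t\<bar>)"
    have ia: "integrable lborel a" unfolding a_def
      using \<open>integrable \<mu> g\<close> Lip_b_integrable[OF fin sets f] by (subst toJ(2)[symmetric]) auto
    have ib: "integrable lborel b" unfolding b_def
      using integrable_real_mult_indicator[of "- {-real n..real n}" lborel "\<lambda>t. \<bar>g t\<bar>"] g by (auto simp: mult.commute)
    have aI: "integral\<^sup>L lborel a < e/8" using fe toJ(1)[of "\<lambda>x. \<bar>g x - f x\<bar>"] by (simp add: a_def)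
    \<comment> \<open>Chosen so that the Lipschitz part integrates to at most \<open>e/8\<close>
      over \<open>J\<close>, whose length is \<open>2 * real n + 4\<close>; the other four terms
      cost less than \<open>e/8\<close> each.\<close>
    define d where "d = min 1 (e / (8 * (L + 1) * (2 * real n + 4)))"
    have d: "d > 0" "d \<le> 1" using e L0 by (auto simp: d_def intro!: divide_pos_pos mult_pos_pos)
    show ?thesis
    proof (intro exI[of _ d] conjI allI impI)
      fix s :: real assume s: "\<bar>s\<bar> < d"
      have key: "\<bar>g (t + s) - g t\<bar> \<le> a (t + s) + a t + b (t + s) + b t + L * d * indicator J t" for t
      proof (cases "t \<in> {-real n - 1..real n + 1}")
        case True
        with s d have "t \<in> J" "t + s \<in> J" by (auto simp: J_def)
        moreover have "\<bar>f (t + s) - f t\<bar> \<le> L * d"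
        proof -
          have "\<bar>f (t + s) - f t\<bar> \<le> L * \<bar>s\<bar>" using lipschitz_onD[OF L, of "t+s" t] by (simp add: dist_real_def)
          also have "\<dots> \<le> L * d" using s L0 by (intro mult_left_mono) auto
          finally show ?thesis .
        qed
        moreover have "b (t + s) \<ge> 0" "b t \<ge> 0" unfolding b_def by auto
        ultimately show ?thesis unfolding a_def by simp
      next
        case False
        with s d have "t \<notin> {-real n..real n}" "t + s \<notin> {-real n..real n}" by auto
        then have "b (t + s) = \<bar>g (t + s)\<bar>" "b t = \<bar>g t\<bar>" by (auto simp: b_def)
        moreover have "a (t + s) \<ge> 0" "a t \<ge> 0" "L * d * indicator J t \<ge> 0" using L0 d unfolding a_def by auto
        ultimately show ?thesis by linarith
      qed
      have iJ: "integrable lborel (\<lambda>t. L * d * indicator J t)" unfolding J_def by simp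
      have "(\<integral>t. \<bar>g (t + s) - g t\<bar> \<partial>lborel) \<le> (\<integral>t. a (t + s) + a t + b (t + s) + b t + L * d * indicator J t \<partial>lborel)"
        using key ia ib iJ shift(1)[OF g] g
        by (intro integral_mono integrable_abs Bochner_Integration.integrable_diff Bochner_Integration.integrable_add shift(1)) auto
      also have "\<dots> = 2 * integral\<^sup>L lborel a + 2 * integral\<^sup>L lborel b + L * d * (2 * real n + 4)"
        using ia ib iJ shift[OF ia] shift[OF ib] by (simp add: J_def)
      also have "\<dots> < e"
      proof -
        have "L * d \<le> (L + 1) * (e / (8 * (L + 1) * (2 * real n + 4)))"
          using L0 d unfolding d_def by (intro mult_mono) auto
        then have "L * d * (2 * real n + 4) \<le> (L + 1) * (e / (8 * (L + 1) * (2 * real n + 4))) * (2 * real n + 4)"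
          by (intro mult_right_mono) auto
        also have "\<dots> = e / 8"
        proof -
          have "x * (e / (8 * x * y)) * y = e / 8" if "x > 0" "y > 0" for x y :: real
            using that by (simp add: field_simps)
          from this[of "L + 1" "2 * real n + 4"] show ?thesis using L0 by linarith
        qed
        finally show ?thesis using aI n e unfolding b_def by linarith
      qed
      finally show "(\<integral>t. \<bar>g (t + s) - g t\<bar> \<partial>lborel) < e" .
    qed (rule d)
  qed
  then show ?thesis
    unfolding LIM_def by (fastforce simp: dist_real_def)
qed

section \<open>Weighted kernels and disintegration\<close>

lemma ennreal_mult_divide_cancel: "a \<noteq> 0 \<Longrightarrow> a \<noteq> \<infinity> \<Longrightarrow> a * (b / a) = (b :: ennreal)"
  by (simp add: ennreal_times_divide mult.commute[of a] ennreal_mult_divide_eq)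

text \<open>The integrand does not depend on \<open>x\<close>, so a monotone class argument in
  \<open>f\<close> alone suffices; joint integrands are the subject of the weighted version
  below.\<close>

lemma nn_integral_kernel_measurable:
  assumes sets: "\<And>x. x \<in> space M \<Longrightarrow> sets (K x) = sets N"
    and meas: "\<And>B. B \<in> sets N \<Longrightarrow> (\<lambda>x. emeasure (K x) B) \<in> borel_measurable M"
    and f: "f \<in> borel_measurable N"
  shows "(\<lambda>x. \<integral>\<^sup>+y. f y \<partial>K x) \<in> borel_measurable M"
  using f
proof (induction rule: borel_measurable_induct)
  case (cong f g)
  have "space (K x) = space N" if "x \<in> space M" for x
    using sets[OF that] by (rule sets_eq_imp_space_eq)
  with cong have eq: "(\<integral>\<^sup>+y. f y \<partial>K x) = (\<integral>\<^sup>+y. g y \<partial>K x)" if "x \<in> space M" for x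
    using that by (intro nn_integral_cong) auto
  show ?case
    by (subst measurable_cong[OF eq]) (assumption, rule cong.IH)
next
  case (set A)
  then show ?case
    using meas[OF set] by (subst measurable_cong[where g = "\<lambda>x. emeasure (K x) A"]) (auto simp: sets)
next
  case (mult u c)
  then show ?case
    by (subst measurable_cong[where g = "\<lambda>x. c * \<integral>\<^sup>+y. u y \<partial>K x"])
       (auto simp: sets intro!: nn_integral_cmult cong: measurable_cong_sets)
next
  case (add u v)
  then show ?case
    by (subst measurable_cong[where g = "\<lambda>x. (\<integral>\<^sup>+y. v y \<partial>K x) + (\<integral>\<^sup>+y. u y \<partial>K x)"])
       (auto simp: sets intro!: nn_integral_add cong: measurable_cong_sets)
next
  case (seq U)
  have eq: "(\<integral>\<^sup>+y. (SUP i. U i) y \<partial>K x) = (SUP i. (\<integral>\<^sup>+y. U i y \<partial>K x))" if "x \<in> space M" for x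
    unfolding SUP_apply using seq that
    by (intro nn_integral_monotone_convergence_SUP) (auto simp: sets cong: measurable_cong_sets)
  show ?case
    by (rule measurable_cong[THEN iffD2, OF eq]) (assumption, intro borel_measurable_SUP seq.IH countableI_type)
qed

text \<open>The kernel only has to become finite after multiplication with a positive weight.\<close>

lemma nn_integral_weighted_kernel_measurable:
  assumes sets: "\<And>x. x \<in> space M \<Longrightarrow> sets (K x) = sets N" and ne: "space N \<noteq> {}"
    and \<theta>: "\<theta> \<in> borel_measurable (M \<Otimes>\<^sub>M N)"
    and fin: "\<And>x. x \<in> space M \<Longrightarrow> (\<integral>\<^sup>+y. \<theta> (x, y) \<partial>K x) < \<infinity>"
    and pos: "\<And>x. x \<in> space M \<Longrightarrow> AE y in K x. \<theta> (x, y) \<noteq> 0"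
    and meas: "\<And>B. B \<in> sets N \<Longrightarrow> (\<lambda>x. \<integral>\<^sup>+y. \<theta> (x, y) * indicator B y \<partial>K x) \<in> borel_measurable M"
    and f: "f \<in> borel_measurable (M \<Otimes>\<^sub>M N)"
  shows "(\<lambda>x. \<integral>\<^sup>+y. f (x, y) \<partial>K x) \<in> borel_measurable M"
proof -
  define m where "m x = (\<integral>\<^sup>+y. \<theta> (x, y) \<partial>K x)" for x
  have sp: "space (K x) = space N" if "x \<in> space M" for x
    using sets[OF that] by (rule sets_eq_imp_space_eq)
  have m[measurable]: "m \<in> borel_measurable M"
    using meas[of "space N"] sp unfolding m_def
    by (subst measurable_cong[where g = "\<lambda>x. \<integral>\<^sup>+y. \<theta> (x, y) * indicator (space N) y \<partial>K x"])
       (auto intro!: nn_integral_cong)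
  have mfin: "m x < \<infinity>" if "x \<in> space M" for x using fin[OF that] by (simp add: m_def)
  \<comment> \<open>Normalised by its mass, the weighted kernel is a subprobability kernel, to which
    the measurability theorems of the Giry monad apply. Where the mass is 0, positivity of the
    weight makes every integral against \<open>K x\<close> vanish.\<close>
  define L where "L x = (if m x = 0 then null_measure N else density (K x) (\<lambda>y. \<theta> (x, y) / m x))" for x
  have \<theta>x: "(\<lambda>y. \<theta> (x, y)) \<in> borel_measurable (K x)" if "x \<in> space M" for x
    using measurable_Pair2[OF \<theta> that] sets[OF that] by (simp cong: measurable_cong_sets)
  have fx: "(\<lambda>y. f (x, y)) \<in> borel_measurable (K x)" if "x \<in> space M" for x
    using measurable_Pair2[OF f that] sets[OF that] by (simp cong: measurable_cong_sets)
  have setsL: "sets (L x) = sets N" if "x \<in> space M" for x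
    using sets[OF that] by (simp add: L_def)
  have emL: "emeasure (L x) B = (if m x = 0 then 0 else (\<integral>\<^sup>+y. \<theta> (x, y) * indicator B y \<partial>K x) / m x)"
    if "x \<in> space M" "B \<in> sets N" for x B
    using that \<theta>x[OF that(1)] sets[OF that(1)]
    by (auto simp: L_def emeasure_density nn_integral_divide[symmetric] ennreal_divide_times
        intro!: nn_integral_cong) (simp_all add: divide_ennreal_def mult_ac)
  have L: "L \<in> measurable M (subprob_algebra N)"
  proof (rule measurable_subprob_algebra)
    fix x assume x: "x \<in> space M"
    show "subprob_space (L x)"
    proof
      have "(\<integral>\<^sup>+y. \<theta> (x, y) * indicator (space N) y \<partial>K x) = m x"
        unfolding m_def using sp[OF x] by (auto intro!: nn_integral_cong)
      then show "emeasure (L x) (space (L x)) \<le> 1"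
        using emL[OF x, of "space N"] sets_eq_imp_space_eq[OF setsL[OF x]] mfin[OF x]
        by (auto simp: ennreal_divide_self)
      show "space (L x) \<noteq> {}" using ne sets_eq_imp_space_eq[OF setsL[OF x]] by simp
    qed
    show "sets (L x) = sets N" by (rule setsL[OF x])
  next
    fix B assume B: "B \<in> sets N"
    note [measurable] = meas[OF B]
    show "(\<lambda>x. emeasure (L x) B) \<in> borel_measurable M"
      by (subst measurable_cong[OF emL[OF _ B]]) auto
  qed
  have eq: "(\<integral>\<^sup>+y. f (x, y) \<partial>K x) = m x * (\<integral>\<^sup>+y. f (x, y) / \<theta> (x, y) \<partial>L x)" if x: "x \<in> space M" for x
  proof (cases "m x = 0")
    case True
    then have "AE y in K x. \<theta> (x, y) = 0"
      using nn_integral_0_iff_AE[OF \<theta>x[OF x]] by (simp add: m_def)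
    with pos[OF x] have "AE y in K x. f (x, y) = 0" by eventually_elim simp
    then have "(\<integral>\<^sup>+y. f (x, y) \<partial>K x) = (\<integral>\<^sup>+y. 0 \<partial>K x)" by (intro nn_integral_cong_AE) auto
    with True show ?thesis by simp
  next
    case False
    have "AE y in K x. \<theta> (x, y) \<noteq> \<infinity>"
      using fin[OF x] by (intro nn_integral_noteq_infinite[OF \<theta>x[OF x]]) auto
    with pos[OF x] have ae: "AE y in K x. f (x, y) = m x * (\<theta> (x, y) / m x * (f (x, y) / \<theta> (x, y)))"
    proof eventually_elim
      case (elim y)
      have "m x * (\<theta> (x, y) / m x) = \<theta> (x, y)"
        using False mfin[OF x] by (intro ennreal_mult_divide_cancel) auto
      moreover have "\<theta> (x, y) * (f (x, y) / \<theta> (x, y)) = f (x, y)"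
        using elim by (intro ennreal_mult_divide_cancel) auto
      ultimately show ?case by (metis mult.assoc)
    qed
    have L': "L x = density (K x) (\<lambda>y. \<theta> (x, y) / m x)" using False by (simp add: L_def)
    have "(\<integral>\<^sup>+y. f (x, y) \<partial>K x) = (\<integral>\<^sup>+y. m x * (\<theta> (x, y) / m x * (f (x, y) / \<theta> (x, y))) \<partial>K x)"
      using ae by (rule nn_integral_cong_AE)
    also have "\<dots> = m x * (\<integral>\<^sup>+y. f (x, y) / \<theta> (x, y) \<partial>L x)"
      unfolding L' using \<theta>x[OF x] fx[OF x]
      by (subst nn_integral_cmult) (auto simp: nn_integral_density)
    finally show ?thesis .
  qed
  have [measurable]: "(\<lambda>x. \<integral>\<^sup>+y. f (x, y) / \<theta> (x, y) \<partial>L x) \<in> borel_measurable M"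
    using f \<theta> by (intro nn_integral_measurable_subprob_algebra2[OF _ L]) (auto simp: case_prod_beta)
  show ?thesis
    by (subst measurable_cong[OF eq]) auto
qed

text \<open>The measure \<open>M(dx) K(x, dy)\<close> for kernels that need not have finite mass. It
  has the shape of \<open>edge_measure\<close> and also serves for the space-time measure
  \<open>dt K(t, dz)\<close>.\<close>

definition semidirect :: "'a measure \<Rightarrow> 'b measure \<Rightarrow> ('a \<Rightarrow> 'b measure) \<Rightarrow> ('a \<times> 'b) measure" where
  "semidirect M N K = measure_of (space M \<times> space N) (sets (M \<Otimes>\<^sub>M N))
     (\<lambda>A. \<integral>\<^sup>+x. (\<integral>\<^sup>+y. indicator A (x, y) \<partial>K x) \<partial>M)"

lemma sets_semidirect [measurable_cong]: "sets (semidirect M N K) = sets (M \<Otimes>\<^sub>M N)"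
  unfolding semidirect_def
  by (metis sets.sets_measure_of_eq space_pair_measure)

lemma emeasure_semidirect:
  assumes sets: "\<And>x. x \<in> space M \<Longrightarrow> sets (K x) = sets N"
    and meas: "\<And>f. f \<in> borel_measurable (M \<Otimes>\<^sub>M N) \<Longrightarrow> (\<lambda>x. \<integral>\<^sup>+y. f (x, y) \<partial>K x) \<in> borel_measurable M"
    and A: "A \<in> sets (M \<Otimes>\<^sub>M N)"
  shows "emeasure (semidirect M N K) A = (\<integral>\<^sup>+x. (\<integral>\<^sup>+y. indicator A (x, y) \<partial>K x) \<partial>M)"
  unfolding semidirect_def
proof (rule emeasure_measure_of_sigma[OF _ _ _ A])
  show "sigma_algebra (space M \<times> space N) (sets (M \<Otimes>\<^sub>M N))"
    by (metis sets.sigma_algebra_axioms space_pair_measure)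
  show "positive (sets (M \<Otimes>\<^sub>M N)) (\<lambda>A. \<integral>\<^sup>+x. (\<integral>\<^sup>+y. indicator A (x, y) \<partial>K x) \<partial>M)"
    by (simp add: positive_def)
  show "countably_additive (sets (M \<Otimes>\<^sub>M N)) (\<lambda>A. \<integral>\<^sup>+x. (\<integral>\<^sup>+y. indicator A (x, y) \<partial>K x) \<partial>M)"
  proof (rule countably_additiveI)
    fix F :: "nat \<Rightarrow> _" assume F: "range F \<subseteq> sets (M \<Otimes>\<^sub>M N)" "disjoint_family F"
    have m: "(\<lambda>y. indicator (F i) (x, y) :: ennreal) \<in> borel_measurable (K x)" if "x \<in> space M" for i x
    proof -
      have "indicator (F i) \<in> borel_measurable (M \<Otimes>\<^sub>M N)" using F by auto
      from measurable_Pair2[OF this that] show ?thesis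
        using sets[OF that] by (simp cong: measurable_cong_sets)
    qed
    have "(\<Sum>i. \<integral>\<^sup>+x. (\<integral>\<^sup>+y. indicator (F i) (x, y) \<partial>K x) \<partial>M) = (\<integral>\<^sup>+x. (\<Sum>i. \<integral>\<^sup>+y. indicator (F i) (x, y) \<partial>K x) \<partial>M)"
      using F by (intro nn_integral_suminf[symmetric] meas) auto
    also have "\<dots> = (\<integral>\<^sup>+x. (\<integral>\<^sup>+y. (\<Sum>i. indicator (F i) (x, y)) \<partial>K x) \<partial>M)"
      by (intro nn_integral_cong nn_integral_suminf[symmetric] m)
    also have "\<dots> = (\<integral>\<^sup>+x. (\<integral>\<^sup>+y. indicator (\<Union>i. F i) (x, y) \<partial>K x) \<partial>M)"
      by (simp add: suminf_indicator[OF F(2)])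
    finally show "(\<Sum>i. \<integral>\<^sup>+x. (\<integral>\<^sup>+y. indicator (F i) (x, y) \<partial>K x) \<partial>M) = (\<integral>\<^sup>+x. (\<integral>\<^sup>+y. indicator (\<Union>i. F i) (x, y) \<partial>K x) \<partial>M)" .
  qed
qed

lemma AE_semidirect:
  assumes sets: "\<And>x. x \<in> space M \<Longrightarrow> sets (K x) = sets N"
    and meas: "\<And>f. f \<in> borel_measurable (M \<Otimes>\<^sub>M N) \<Longrightarrow> (\<lambda>x. \<integral>\<^sup>+y. f (x, y) \<partial>K x) \<in> borel_measurable M"
    and P: "AE x in M. P x"
  shows "AE z in semidirect M N K. P (fst z)"
proof -
  from P obtain X where X: "{x\<in>space M. \<not> P x} \<subseteq> X" "emeasure M X = 0" "X \<in> sets M"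
    by (rule AE_E)
  have "emeasure (semidirect M N K) (X \<times> space N) = (\<integral>\<^sup>+x. (\<integral>\<^sup>+y. indicator (X \<times> space N) (x, y) \<partial>K x) \<partial>M)"
    using X by (intro emeasure_semidirect[OF sets meas]) auto
  also have "\<dots> = (\<integral>\<^sup>+x. 0 \<partial>M)"
  proof (intro nn_integral_cong_AE)
    have "AE x in M. x \<notin> X" using X by (intro AE_not_in) (auto simp: null_sets_def)
    then show "AE x in M. (\<integral>\<^sup>+y. indicator (X \<times> space N) (x, y) \<partial>K x) = 0"
      by eventually_elim (simp add: indicator_def)
  qed
  finally have "emeasure (semidirect M N K) (X \<times> space N) = 0" by simp
  moreover have "space (semidirect M N K) = space M \<times> space N"
    using sets_eq_imp_space_eq[OF sets_semidirect, of M N K] by (simp add: space_pair_measure)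
  ultimately show ?thesis
    using X by (intro AE_I[of _ _ "X \<times> space N"]) (auto simp: sets_semidirect)
qed

section \<open>Lebesgue decomposition and disintegration in time\<close>

lemma emeasure_variation:
  assumes "sets (fst \<mu>) = sets borel" "sets (snd \<mu>) = sets borel" "A \<in> sets borel"
  shows "emeasure (variation \<mu>) A = emeasure (fst \<mu>) A + emeasure (snd \<mu>) A"
  unfolding variation_def
proof (rule emeasure_measure_of_sigma[OF _ _ _ assms(3)])
  show "sigma_algebra UNIV (sets borel)"
    by (metis sets.sigma_algebra_axioms space_borel)
  show "countably_additive (sets borel) (\<lambda>A. emeasure (fst \<mu>) A + emeasure (snd \<mu>) A)"
    using assms by (auto simp: countably_additive_def suminf_add[symmetric] suminf_emeasure)
qed (simp add: positive_def)

lemma sets_variation [simp]: "sets (variation \<mu>) = sets borel"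
  unfolding variation_def by (metis sets.sets_measure_of_eq space_borel)

text \<open>\<open>Q\<close> is replaced by an equivalent finite measure \<open>Q'\<close>, and both
  measures are dominated by \<open>S = J + Q'\<close>. The singular part of \<open>J\<close> sits on
  the set \<open>N\<close> where \<open>dQ'/dS\<close> vanishes: \<open>Q\<close> does not charge
  \<open>N\<close>, and off \<open>N\<close> a \<open>Q\<close>-null set is \<open>S\<close>-null,
  hence \<open>J\<close>-null.\<close>

lemma Lebesgue_decomposition:
  fixes J Q :: "'a::topological_space measure"
  assumes "finite_measure J" "sigma_finite_measure Q" and sJ: "sets J = sets borel" and sQ: "sets Q = sets borel"
  obtains k N where "k \<in> borel_measurable borel" "N \<in> sets borel" "emeasure Q N = 0"
    "\<And>A. A \<in> sets borel \<Longrightarrow> emeasure J (A - N) = (\<integral>\<^sup>+x\<in>A. k x \<partial>Q)"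
proof -
  interpret J: finite_measure J by fact
  interpret Q: sigma_finite_measure Q by fact
  obtain h where h: "h \<in> borel_measurable Q" "integral\<^sup>N Q h \<noteq> \<infinity>" "\<And>x. x \<in> space Q \<Longrightarrow> 0 < h x"
    using Q.Ex_finite_integrable_function by blast
  define Q' where "Q' = density Q h"
  have Q'0: "emeasure Q A = 0 \<longleftrightarrow> emeasure Q' A = 0" if "A \<in> sets Q" for A
  proof -
    have "emeasure Q' A = 0 \<longleftrightarrow> (AE x in Q. h x * indicator A x = 0)"
      using that h by (simp add: Q'_def emeasure_density nn_integral_0_iff_AE)
    also have "\<dots> \<longleftrightarrow> (AE x in Q. x \<notin> A)"
      using h(3) by (intro AE_cong) (force simp: indicator_def)
    also have "\<dots> \<longleftrightarrow> emeasure Q A = 0"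
      using AE_iff_null_sets[OF that] that by (auto simp: null_sets_def)
    finally show ?thesis by simp
  qed
  have spQ: "space Q = UNIV" "space J = UNIV" using sQ sJ by (auto dest: sets_eq_imp_space_eq)
  define S where "S = variation (J, Q')"
  have sQ': "sets Q' = sets borel" using sQ by (simp add: Q'_def)
  have emS: "emeasure S A = emeasure J A + emeasure Q' A" if "A \<in> sets borel" for A
    using emeasure_variation[of "(J, Q')" A] that sJ sQ' by (simp add: S_def)
  have sS: "sets S = sets borel" by (simp add: S_def)
  have spS: "space S = UNIV" using sets_eq_imp_space_eq[OF sS] by simp
  have "emeasure Q' UNIV \<noteq> \<infinity>" using h spQ sQ by (simp add: Q'_def emeasure_density)
  moreover have "emeasure J UNIV \<noteq> \<infinity>" using J.emeasure_finite by simp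
  ultimately have "finite_measure S" by (intro finite_measureI) (simp add: emS spS)
  then interpret S: finite_measure S .
  have "absolutely_continuous S Q'"
    unfolding absolutely_continuous_def using emS sS sQ' by (auto simp: null_sets_def)
  from S.Radon_Nikodym[OF this] obtain f where f: "f \<in> borel_measurable S" "density S f = Q'"
    using sS sQ' by auto
  define N where "N = {x. f x = 0}"
  have N: "N \<in> sets borel"
    using measurable_sets[OF f(1), of "{0}"] sS spS by (simp add: N_def vimage_def)
  have "emeasure Q' N = (\<integral>\<^sup>+x. f x * indicator N x \<partial>S)"
    using f N sS by (simp add: emeasure_density[symmetric])
  also have "\<dots> = (\<integral>\<^sup>+x. 0 \<partial>S)" by (intro nn_integral_cong) (auto simp: N_def indicator_def)
  finally have QN: "emeasure Q N = 0" using Q'0 N sQ by simp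
  define J' where "J' = density J (indicator (- N))"
  have emJ': "emeasure J' A = emeasure J (A - N)" if "A \<in> sets borel" for A
  proof -
    have "emeasure J' A = (\<integral>\<^sup>+x. indicator (- N) x * indicator A x \<partial>J)"
      using that N sJ by (simp add: J'_def emeasure_density)
    also have "\<dots> = (\<integral>\<^sup>+x. indicator (A - N) x \<partial>J)"
      by (intro nn_integral_cong) (auto simp: indicator_def)
    finally show ?thesis using that N sJ by simp
  qed
  have "absolutely_continuous Q J'"
    unfolding absolutely_continuous_def
  proof
    fix A assume "A \<in> null_sets Q"
    then have A: "A \<in> sets borel" "emeasure Q' A = 0" using Q'0 sQ by (auto simp: null_sets_def)
    then have "emeasure (density S f) A = 0" by (simp add: f)
    then have "AE x in S. x \<in> A \<longrightarrow> f x = 0" using A f sS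
      by (auto simp: emeasure_density nn_integral_0_iff_AE indicator_def elim: eventually_mono)
    then have "emeasure S {x \<in> space S. \<not> (x \<in> A \<longrightarrow> f x = 0)} = 0"
      using A f sS by (subst (asm) AE_iff_measurable[OF _ refl]) auto
    also have "{x \<in> space S. \<not> (x \<in> A \<longrightarrow> f x = 0)} = A - N" by (auto simp: N_def spS)
    finally have "emeasure J (A - N) = 0" using emS[of "A - N"] A N by simp
    then show "A \<in> null_sets J'" using emJ'[OF A(1)] A sJ by (simp add: null_sets_def J'_def)
  qed
  from Q.Radon_Nikodym[OF this] obtain k where k: "k \<in> borel_measurable Q" "density Q k = J'"
    using sJ sQ by (auto simp: J'_def)
  show ?thesis
  proof (rule that[of k N])
    show "k \<in> borel_measurable borel" using k(1) sQ by (simp cong: measurable_cong_sets)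
    show "emeasure J (A - N) = (\<integral>\<^sup>+x\<in>A. k x \<partial>Q)" if "A \<in> sets borel" for A
      using emJ'[OF that] k that sQ by (simp add: emeasure_density[symmetric])
  qed (use N QN in auto)
qed

text \<open>Finite intersections of a countable basis. Countability matters: an identity that holds
  at almost every time for each generating set holds, outside a single null set of times, for all of
  them.\<close>

lemma countable_Int_stable_generator:
  obtains E :: "'z::second_countable_topology set set"
  where "countable E" "Int_stable E" "UNIV \<in> E" "sets borel = sigma_sets UNIV E" "E \<subseteq> sets borel"
proof -
  obtain B :: "'z set set" where B: "countable B" "topological_basis B"
    using ex_countable_basis by blast
  define E where "E = (\<lambda>F. \<Inter>F) ` {F. finite F \<and> F \<subseteq> B}"
  have "countable E" unfolding E_def using B(1) by (intro countable_image countable_Collect_finite_subset)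
  moreover have "Int_stable E"
    unfolding E_def Int_stable_def
  proof safe
    fix F G assume "finite F" "finite G" "F \<subseteq> B" "G \<subseteq> B"
    then show "\<Inter>F \<inter> \<Inter>G \<in> Inter ` {F. finite F \<and> F \<subseteq> B}"
      by (intro image_eqI[of _ _ "F \<union> G"]) auto
  qed
  moreover have "UNIV \<in> E" unfolding E_def by (intro image_eqI[of _ _ "{}"]) auto
  moreover have op: "open X" if "X \<in> E" for X
    using that topological_basis_open[OF B(2)] unfolding E_def by (auto intro: open_Inter)
  moreover have "sets borel = sigma_sets UNIV E"
  proof
    have "sets (borel :: 'z measure) = sigma_sets UNIV B"
      by (subst borel_eq_countable_basis[OF B]) (rule sets_measure_of, simp)
    also have "\<dots> \<subseteq> sigma_sets UNIV E"
    proof (rule sigma_sets_mono')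
      show "B \<subseteq> E" unfolding E_def
      proof
        fix b assume "b \<in> B" then show "b \<in> Inter ` {F. finite F \<and> F \<subseteq> B}"
          by (intro image_eqI[of _ _ "{b}"]) auto
      qed
    qed
    finally show "sets borel \<subseteq> sigma_sets UNIV E" .
    have "sigma_sets (space borel) E \<subseteq> sets borel"
      by (intro sets.sigma_sets_subset) (auto dest: op)
    then show "sigma_sets UNIV E \<subseteq> sets borel" by simp
  qed
  ultimately show ?thesis by (intro that[of E]) auto
qed

lemma sets_borel_prod:
  "sets (borel \<Otimes>\<^sub>M borel) =
    sets (borel :: ('a::second_countable_topology \<times> 'b::second_countable_topology) measure)"
  by (subst borel_prod) (rule refl)

lemma AE_emeasure_eq_imp_measure_eq:
  fixes m1 m2 :: "real \<Rightarrow> 'z::second_countable_topology measure"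
  assumes s: "\<And>t. sets (m1 t) = sets borel" "\<And>t. sets (m2 t) = sets borel"
    and fin: "AE t in lborel. emeasure (m1 t) UNIV \<noteq> \<infinity>"
    and eq: "\<And>C. C \<in> sets borel \<Longrightarrow> AE t in lborel. emeasure (m1 t) C = emeasure (m2 t) C"
  shows "AE t in lborel. m1 t = m2 t"
proof -
  obtain E :: "'z set set" where E: "countable E" "Int_stable E" "UNIV \<in> E" "sets borel = sigma_sets UNIV E" "E \<subseteq> sets borel"
    by (rule countable_Int_stable_generator)
  have "AE t in lborel. \<forall>C\<in>E. emeasure (m1 t) C = emeasure (m2 t) C"
    using E(1,5) eq by (subst AE_ball_countable) auto
  with fin show ?thesis
  proof eventually_elim
    case (elim t)
    show ?case
      using s E elim by (intro measure_eqI_generator_eq[OF E(2), where A = "\<lambda>_. UNIV" and \<Omega> = UNIV]) auto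
  qed
qed

text \<open>The set \<open>Bad\<close> of times at which absolute continuity fails is Borel because the family is
  disintegrated together with its singular part.\<close>

lemma disintegration:
  fixes \<mu> :: "real \<Rightarrow> 'z::second_countable_topology measure" and a :: "real \<times> 'z \<Rightarrow> real" and \<theta> :: "'z \<Rightarrow> real"
  assumes "sigma_finite_measure \<eta>" and s\<eta>[measurable_cong]: "sets \<eta> = sets borel"
    and s\<mu>: "\<And>t. sets (\<mu> t) = sets borel"
    and meas: "\<And>B. B \<in> sets borel \<Longrightarrow> (\<lambda>t. emeasure (\<mu> t) B) \<in> borel_measurable lborel"
    and \<theta>[measurable]: "\<theta> \<in> borel_measurable borel" and pos: "\<And>t. AE z in \<mu> t. \<theta> z > 0"
    and fin: "(\<integral>\<^sup>+t. (\<integral>\<^sup>+z. ennreal (\<theta> z) \<partial>\<mu> t) \<partial>lborel) < \<infinity>"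
    and a[measurable]: "a \<in> borel_measurable (borel \<Otimes>\<^sub>M borel)"
  obtains k :: "real \<times> 'z \<Rightarrow> ennreal" and Bad where
    "k \<in> borel_measurable (borel \<Otimes>\<^sub>M borel)" "Bad \<in> sets borel"
    "AE t in lborel. t \<in> Bad \<longleftrightarrow> \<not> absolutely_continuous (density \<eta> (\<lambda>z. ennreal (a (t, z)))) (\<mu> t)"
    "AE t in lborel. t \<notin> Bad \<longrightarrow> \<mu> t = density (density \<eta> (\<lambda>z. ennreal (a (t, z)))) (\<lambda>z. k (t, z))"
proof -
  interpret \<eta>: sigma_finite_measure \<eta> by fact
  interpret P: pair_sigma_finite lborel \<eta> ..
  have [measurable_cong]: "sets (lborel \<Otimes>\<^sub>M \<eta>) = sets (borel \<Otimes>\<^sub>M borel)"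
    by (intro sets_pair_measure_cong) (auto simp: s\<eta>)
  note s\<mu>[measurable_cong]
  define m where "m t = (\<integral>\<^sup>+z. ennreal (\<theta> z) \<partial>\<mu> t)" for t
  have intM: "(\<lambda>t. \<integral>\<^sup>+z. f z \<partial>\<mu> t) \<in> borel_measurable lborel" if "f \<in> borel_measurable borel" for f
    by (rule nn_integral_kernel_measurable[OF s\<mu> meas that])
  have m[measurable]: "m \<in> borel_measurable borel"
    using intM[of "\<lambda>z. ennreal (\<theta> z)"] unfolding m_def by simp
  have mfin: "AE t in lborel. m t < \<infinity>"
    using fin nn_integral_noteq_infinite[of m lborel] unfolding m_def[symmetric] by (auto simp: less_top)
  \<comment> \<open>The weight makes the mass finite at almost every time; putting the null measure
    at the exceptional times makes \<open>K\<close> a finite kernel throughout.\<close>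
  define K where "K t = (if m t < \<infinity> then density (\<mu> t) (\<lambda>z. ennreal (\<theta> z)) else null_measure borel)" for t
  have sK: "sets (K t) = sets borel" for t using s\<mu>[of t] by (simp add: K_def)
  have emK: "emeasure (K t) B = (if m t < \<infinity> then (\<integral>\<^sup>+z. ennreal (\<theta> z) * indicator B z \<partial>\<mu> t) else 0)" if "B \<in> sets borel" for t B
    using that s\<mu>[of t] by (auto simp: K_def emeasure_density)
  have Kfin: "emeasure (K t) UNIV < \<infinity>" for t
    by (simp add: emK m_def)
  have Kmeas: "(\<lambda>t. emeasure (K t) B) \<in> borel_measurable lborel" if [measurable]: "B \<in> sets borel" for B
    unfolding emK[OF that] using intM[of "\<lambda>z. ennreal (\<theta> z) * indicator B z"] by measurable
  have KM: "(\<lambda>t. \<integral>\<^sup>+z. f (t, z) \<partial>K t) \<in> borel_measurable lborel" if "f \<in> borel_measurable (lborel \<Otimes>\<^sub>M borel)" for f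
  proof (rule nn_integral_weighted_kernel_measurable[where \<theta> = "\<lambda>_. 1", OF sK _ _ _ _ _ that])
    show "(\<integral>\<^sup>+y. 1 \<partial>K t) < \<infinity>" for t using Kfin[of t] sets_eq_imp_space_eq[OF sK[of t]] by simp
    show "(\<lambda>t. \<integral>\<^sup>+y. 1 * indicator B y \<partial>K t) \<in> borel_measurable lborel" if "B \<in> sets borel" for B
      using Kmeas[OF that] that by (simp add: sK)
  qed auto
  define J where "J = semidirect lborel borel K"
  have sJ: "sets J = sets borel" unfolding J_def sets_semidirect borel_prod[symmetric]
    by (intro sets_pair_measure_cong) auto
  have emJ: "emeasure J A = (\<integral>\<^sup>+t. (\<integral>\<^sup>+z. indicator A (t, z) \<partial>K t) \<partial>lborel)" if "A \<in> sets borel" for A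
    unfolding J_def using that sJ by (intro emeasure_semidirect[OF sK KM]) (auto simp: J_def sets_semidirect)
  have spJ: "space J = UNIV" using sets_eq_imp_space_eq[OF sJ] by simp
  have finJ: "finite_measure J"
  proof
    have "emeasure J UNIV = (\<integral>\<^sup>+t. emeasure (K t) UNIV \<partial>lborel)"
      using sets_eq_imp_space_eq[OF sK] by (subst emJ) auto
    also have "\<dots> \<le> (\<integral>\<^sup>+t. m t \<partial>lborel)"
      by (intro nn_integral_mono) (simp add: emK m_def)
    also have "\<dots> < \<infinity>" using fin by (simp add: m_def)
    finally show "emeasure J (space J) \<noteq> \<infinity>" by (simp add: spJ)
  qed
  define Q where "Q = density (lborel \<Otimes>\<^sub>M \<eta>) (\<lambda>p. ennreal (a p))"
  have finQ: "sigma_finite_measure Q"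
    unfolding Q_def by (subst P.sigma_finite_iff_density_finite) auto
  have sQ: "sets Q = sets borel" unfolding Q_def sets_density borel_prod[symmetric]
    by (intro sets_pair_measure_cong) (auto simp: s\<eta>)
  obtain k N where k: "k \<in> borel_measurable borel" and N: "N \<in> sets borel" "emeasure Q N = 0"
    and JN: "\<And>A. A \<in> sets borel \<Longrightarrow> emeasure J (A - N) = (\<integral>\<^sup>+x\<in>A. k x \<partial>Q)"
    using Lebesgue_decomposition[OF finJ finQ sJ sQ] by blast
  have k': "k \<in> borel_measurable (borel \<Otimes>\<^sub>M borel)" and N': "N \<in> sets (borel \<Otimes>\<^sub>M borel)"
    using k N(1) by (simp_all only: sets_borel_prod borel_prod)
  note [measurable] = k' N'
  define Nt where "Nt t = {z. (t, z) \<in> N}" for t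
  have [measurable]: "Nt t \<in> sets borel" for t
  proof -
    have "Nt t = Pair t -` N" by (auto simp: Nt_def)
    also have "\<dots> \<in> sets borel" using sets_Pair1[OF N', of t] .
    finally show ?thesis .
  qed
  let ?nu = "\<lambda>t. density \<eta> (\<lambda>z. ennreal (a (t, z)))"
  have at: "(\<lambda>z. a (t, z)) \<in> borel_measurable borel" "(\<lambda>z. k (t, z)) \<in> borel_measurable borel" for t
    by measurable
  have nuN: "AE t in lborel. emeasure (?nu t) (Nt t) = 0"
  proof -
    have "0 = (\<integral>\<^sup>+p. ennreal (a p) * indicator N p \<partial>(lborel \<Otimes>\<^sub>M \<eta>))"
      using N(2) by (simp add: Q_def emeasure_density)
    also have "\<dots> = (\<integral>\<^sup>+t. (\<integral>\<^sup>+z. ennreal (a (t, z)) * indicator N (t, z) \<partial>\<eta>) \<partial>lborel)"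
      by (subst \<eta>.nn_integral_fst[symmetric]) auto
    finally have "AE t in lborel. (\<integral>\<^sup>+z. ennreal (a (t, z)) * indicator N (t, z) \<partial>\<eta>) = 0"
      by (subst (asm) eq_commute, subst (asm) nn_integral_0_iff_AE) auto
    then show ?thesis
    proof eventually_elim
      case (elim t)
      then show ?case by (simp add: emeasure_density Nt_def indicator_def)
    qed
  qed
  \<comment> \<open>The part of \<open>K t\<close> off the singular set. Its density is identified
    by testing the decomposition of \<open>J\<close> on rectangles \<open>B \<times> C\<close>:
    uniqueness of densities in \<open>t\<close> gives the identity for each fixed \<open>C\<close>,
    and the countable generator makes the null set of times independent of \<open>C\<close>.\<close>
  define M1 where "M1 t = density (K t) (indicator (- Nt t))" for t
  have emM1: "emeasure (M1 t) C = (\<integral>\<^sup>+z. indicator (UNIV \<times> C - N) (t, z) \<partial>K t)" if "C \<in> sets borel" for t C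
  proof -
    have "emeasure (M1 t) C = (\<integral>\<^sup>+z. indicator (- Nt t) z * indicator C z \<partial>K t)"
      using that unfolding M1_def by (subst emeasure_density) (auto simp: sK cong: measurable_cong_sets)
    also have "\<dots> = (\<integral>\<^sup>+z. indicator (UNIV \<times> C - N) (t, z) \<partial>K t)"
      by (intro nn_integral_cong) (auto simp: indicator_def Nt_def)
    finally show ?thesis .
  qed
  have AEeq: "AE t in lborel. M1 t = density (?nu t) (\<lambda>z. k (t, z))"
  proof (rule AE_emeasure_eq_imp_measure_eq)
    show "sets (M1 t) = sets borel" "sets (density (?nu t) (\<lambda>z. k (t, z))) = sets borel" for t
      using sK s\<eta> by (auto simp: M1_def)
    show "AE t in lborel. emeasure (M1 t) UNIV \<noteq> \<infinity>"
    proof (rule AE_I2)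
      fix t
      have "emeasure (M1 t) UNIV \<le> (\<integral>\<^sup>+z. 1 \<partial>K t)"
        by (subst emM1, simp) (intro nn_integral_mono, simp add: indicator_def)
      also have "\<dots> < \<infinity>" using Kfin[of t] sets_eq_imp_space_eq[OF sK[of t]] by simp
      finally show "emeasure (M1 t) UNIV \<noteq> \<infinity>" by simp
    qed
    fix C :: "'z set" assume C[measurable]: "C \<in> sets borel"
    let ?F = "\<lambda>t. \<integral>\<^sup>+z. indicator (UNIV \<times> C - N) (t, z) \<partial>K t"
    let ?G = "\<lambda>t. \<integral>\<^sup>+z. ennreal (a (t, z)) * (k (t, z) * indicator C z) \<partial>\<eta>"
    have F[measurable]: "?F \<in> borel_measurable lborel" by (rule KM) measurable
    have G[measurable]: "?G \<in> borel_measurable lborel" by measurable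
    have "density lborel ?F = density lborel ?G"
    proof (rule measure_eqI)
      fix B :: "real set" assume "B \<in> sets (density lborel ?F)"
      then have B[measurable]: "B \<in> sets borel" by simp
      have BC: "B \<times> C \<in> sets borel" unfolding borel_prod[symmetric] by measurable
      have "emeasure (density lborel ?F) B = (\<integral>\<^sup>+t. ?F t * indicator B t \<partial>lborel)"
        by (subst emeasure_density) auto
      also have "\<dots> = (\<integral>\<^sup>+t. (\<integral>\<^sup>+z. indicator (B \<times> C - N) (t, z) \<partial>K t) \<partial>lborel)"
        by (intro nn_integral_cong) (auto simp: indicator_def)
      also have "\<dots> = emeasure J (B \<times> C - N)" using BC N by (intro emJ[symmetric]) auto
      also have "\<dots> = (\<integral>\<^sup>+x\<in>B \<times> C. k x \<partial>Q)" by (rule JN[OF BC])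
      also have "\<dots> = (\<integral>\<^sup>+p. ennreal (a p) * (k p * indicator (B \<times> C) p) \<partial>(lborel \<Otimes>\<^sub>M \<eta>))"
        unfolding Q_def by (subst nn_integral_density) auto
      also have "\<dots> = (\<integral>\<^sup>+t. (\<integral>\<^sup>+z. ennreal (a (t, z)) * (k (t, z) * indicator (B \<times> C) (t, z)) \<partial>\<eta>) \<partial>lborel)"
        by (subst \<eta>.nn_integral_fst[symmetric]) auto
      also have "\<dots> = (\<integral>\<^sup>+t. ?G t * indicator B t \<partial>lborel)"
        by (intro nn_integral_cong) (auto simp: indicator_def)
      also have "\<dots> = emeasure (density lborel ?G) B" by (subst emeasure_density) auto
      finally show "emeasure (density lborel ?F) B = emeasure (density lborel ?G) B" .
    qed simp
    then have "AE t in lborel. ?F t = ?G t"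
      using sigma_finite_measure.density_unique_iff[OF sigma_finite_lborel F G] by simp
    then show "AE t in lborel. emeasure (M1 t) C = emeasure (density (?nu t) (\<lambda>z. k (t, z))) C"
    proof eventually_elim
      case (elim t)
      then show ?case using at[of t]
        by (simp add: emM1[OF C] density_density_eq emeasure_density mult_ac)
    qed
  qed
  define Bad where "Bad = {t. (\<integral>\<^sup>+z. indicator N (t, z) \<partial>K t) \<noteq> 0}"
  have KN: "(\<lambda>t. \<integral>\<^sup>+z. indicator N (t, z) \<partial>K t) \<in> borel_measurable lborel"
    by (rule KM) measurable
  have BadN: "t \<in> Bad \<longleftrightarrow> emeasure (K t) (Nt t) \<noteq> 0" for t
  proof -
    have "(\<integral>\<^sup>+z. indicator N (t, z) \<partial>K t) = (\<integral>\<^sup>+z. indicator (Nt t) z \<partial>K t)"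
      by (intro nn_integral_cong) (auto simp: Nt_def indicator_def)
    then show ?thesis by (simp add: Bad_def sK)
  qed
  have good: "\<mu> t = density (?nu t) (\<lambda>z. k (t, z) / ennreal (\<theta> z))"
    if "t \<notin> Bad" and mt: "m t < \<infinity>" and M1: "M1 t = density (?nu t) (\<lambda>z. k (t, z))" for t
  proof -
    have "AE z in K t. z \<notin> Nt t"
      using that(1) BadN[of t] by (intro AE_not_in) (auto simp: null_sets_def sK)
    then have "K t = M1 t" unfolding M1_def
      by (intro density_1[of "K t", symmetric, THEN trans] density_cong) (auto simp: sK indicator_def cong: measurable_cong_sets)
    moreover have "K t = density (\<mu> t) (\<lambda>z. ennreal (\<theta> z))" using mt by (simp add: K_def)
    ultimately have e: "density (\<mu> t) (\<lambda>z. ennreal (\<theta> z)) = density (?nu t) (\<lambda>z. k (t, z))" using M1 by simp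
    have "\<mu> t = density (\<mu> t) (\<lambda>z. ennreal (\<theta> z) * (1 / ennreal (\<theta> z)))"
      using pos[of t]
      by (intro density_1[of "\<mu> t", symmetric, THEN trans] density_cong)
         (auto elim!: eventually_mono simp: ennreal_times_divide ennreal_divide_self)
    also have "\<dots> = density (density (\<mu> t) (\<lambda>z. ennreal (\<theta> z))) (\<lambda>z. 1 / ennreal (\<theta> z))"
      by (subst density_density_eq) auto
    also have "\<dots> = density (density (?nu t) (\<lambda>z. k (t, z))) (\<lambda>z. 1 / ennreal (\<theta> z))" by (simp only: e)
    also have "\<dots> = density (?nu t) (\<lambda>z. k (t, z) * (1 / ennreal (\<theta> z)))"
      using at[of t] by (subst density_density_eq) auto
    finally show ?thesis by (simp add: ennreal_times_divide)
  qed
  show ?thesis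
  \<comment> \<open>Division by \<open>\<theta>\<close> undoes the weighting of
    \<open>K\<close>.\<close>
  proof (rule that[of "\<lambda>p. k p / ennreal (\<theta> (snd p))" Bad])
    show "Bad \<in> sets borel" unfolding Bad_def
      using measurable_sets[OF KN, of "- {0}"] by (auto simp: vimage_def)
    show "AE t in lborel. t \<notin> Bad \<longrightarrow> \<mu> t = density (?nu t) (\<lambda>z. k (t, z) / ennreal (\<theta> (snd (t, z))))"
      using mfin AEeq by eventually_elim (auto dest: good)
    show "AE t in lborel. (t \<in> Bad) = (\<not> absolutely_continuous (?nu t) (\<mu> t))"
      using mfin AEeq nuN
    proof eventually_elim
      case (elim t)
      show ?case
      proof
        assume "t \<in> Bad"
        then have "emeasure (K t) (Nt t) \<noteq> 0" by (simp add: BadN)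
        then have "emeasure (\<mu> t) (Nt t) \<noteq> 0"
        proof (rule contrapos_nn)
          assume "emeasure (\<mu> t) (Nt t) = 0"
          then have "AE z in \<mu> t. z \<notin> Nt t" by (intro AE_not_in) (auto simp: null_sets_def s\<mu>)
          then have "(\<integral>\<^sup>+z. ennreal (\<theta> z) * indicator (Nt t) z \<partial>\<mu> t) = (\<integral>\<^sup>+z. 0 \<partial>\<mu> t)"
            by (intro nn_integral_cong_AE) (auto elim!: eventually_mono)
          then show "emeasure (K t) (Nt t) = 0" by (simp add: emK)
        qed
        then have "Nt t \<notin> null_sets (\<mu> t)" by (simp add: null_sets_def)
        moreover have "Nt t \<in> null_sets (?nu t)" using elim by (simp add: null_sets_def s\<eta>)
        ultimately show "\<not> absolutely_continuous (?nu t) (\<mu> t)"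
          unfolding absolutely_continuous_def by blast
      next
        assume "\<not> absolutely_continuous (?nu t) (\<mu> t)"
        then show "t \<in> Bad"
        proof (rule contrapos_np)
          assume "t \<notin> Bad"
          then show "absolutely_continuous (?nu t) (\<mu> t)"
            by (subst good[OF _ elim(1,2)]) (assumption, rule absolutely_continuousI_density, measurable)
        qed
      qed
    qed
  qed measurable
qed

section \<open>The edge measure of a jump kernel\<close>

lemma edge_measure_semidirect:
  "sets \<pi> = sets borel \<Longrightarrow> edge_measure \<pi> \<kappa> = semidirect \<pi> borel \<kappa>"
  unfolding edge_measure_def semidirect_def
  using sets_pair_measure_cong[of \<pi> borel borel borel] sets_eq_imp_space_eq[of \<pi> borel]
  by (simp add: sets_borel_prod)

context
  fixes \<pi> :: "'v::{metric_space,second_countable_topology} measure" and \<kappa> :: "'v \<Rightarrow> 'v measure"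
  assumes \<pi>: "finite_borel_measure \<pi>" and \<kappa>: "jump_kernel \<kappa>"
begin

text \<open>The definition of a jump kernel provides measurability only for integrals against the
  weight \<open>min 1 ((dist x y)\<^sup>2)\<close>. These are finite, and the weight vanishes only
  at \<open>y = x\<close>, a null point of \<open>\<kappa> x\<close>, so the lemma on weighted
  kernels applies.\<close>

lemma jump_kernel_nn_integral_measurable:
  assumes "f \<in> borel_measurable (\<pi> \<Otimes>\<^sub>M borel)"
  shows "(\<lambda>x. \<integral>\<^sup>+y. f (x, y) \<partial>\<kappa> x) \<in> borel_measurable \<pi>"
proof -
  have s\<pi>[measurable_cong]: "sets \<pi> = sets borel" using \<pi> by (simp add: finite_borel_measure_def)
  have s\<kappa>[measurable_cong]: "sets (\<kappa> x) = sets borel" for x using \<kappa> by (simp add: jump_kernel_def)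
  let ?w = "\<lambda>x y. min 1 ((dist x y)\<^sup>2)"
  have fin: "(\<integral>\<^sup>+y. ennreal (?w x y) \<partial>\<kappa> x) < \<infinity>" for x
  proof -
    have "(\<integral>\<^sup>+y. ennreal (?w x y) \<partial>\<kappa> x) \<le> (SUP x. \<integral>\<^sup>+y. ennreal (?w x y) \<partial>\<kappa> x)"
      by (rule SUP_upper) simp
    also have "\<dots> < \<infinity>" using \<kappa> unfolding jump_kernel_def by blast
    finally show ?thesis .
  qed
  show ?thesis
  proof (rule nn_integral_weighted_kernel_measurable[where \<theta> = "\<lambda>(x, y). ennreal (?w x y)" and N = borel])
    show "(\<lambda>(x, y). ennreal (?w x y)) \<in> borel_measurable (\<pi> \<Otimes>\<^sub>M borel)"
      by measurable
    show "AE y in \<kappa> x. (case (x, y) of (x, y) \<Rightarrow> ennreal (?w x y)) \<noteq> 0" for x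
    proof -
      have "AE y in \<kappa> x. y \<notin> {x}"
        using \<kappa> by (intro AE_not_in) (auto simp: jump_kernel_def null_sets_def)
      then show ?thesis by (eventually_elim) (auto simp: min_def)
    qed
    fix B :: "'v set" assume B[measurable]: "B \<in> sets borel"
    have eq: "(\<integral>\<^sup>+y. (case (x, y) of (x, y) \<Rightarrow> ennreal (?w x y)) * indicator B y \<partial>\<kappa> x)
        = ennreal (\<integral>y. indicator B y * ?w x y \<partial>\<kappa> x)" for x
    proof -
      have "(\<integral>\<^sup>+y. ennreal (norm (indicator B y * ?w x y)) \<partial>\<kappa> x) \<le> (\<integral>\<^sup>+y. ennreal (?w x y) \<partial>\<kappa> x)"
        by (intro nn_integral_mono ennreal_leI) (auto simp: indicator_def)
      then have "(\<integral>\<^sup>+y. ennreal (norm (indicator B y * ?w x y)) \<partial>\<kappa> x) < \<infinity>"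
        using fin[of x] by (rule le_less_trans)
      then have "integrable (\<kappa> x) (\<lambda>y. indicator B y * ?w x y)"
        by (intro integrableI_bounded) measurable
      then have "ennreal (\<integral>y. indicator B y * ?w x y \<partial>\<kappa> x) = (\<integral>\<^sup>+y. ennreal (indicator B y * ?w x y) \<partial>\<kappa> x)"
        by (intro nn_integral_eq_integral[symmetric]) auto
      also have "\<dots> = (\<integral>\<^sup>+y. (case (x, y) of (x, y) \<Rightarrow> ennreal (?w x y)) * indicator B y \<partial>\<kappa> x)"
        by (intro nn_integral_cong) (auto simp: indicator_def)
      finally show ?thesis by simp
    qed
    have bd: "bounded (range (indicator B :: 'v \<Rightarrow> real))"
      by (rule boundedI[of _ 1]) (auto simp: indicator_def)
    have "\<forall>f \<in> borel_measurable borel. bounded (range f) \<longrightarrow>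
        (\<lambda>x. \<integral>y. f y * ?w x y \<partial>\<kappa> x) \<in> borel_measurable borel"
      using \<kappa> unfolding jump_kernel_def by blast
    from bspec[OF this, of "indicator B"] bd
    have "(\<lambda>x. \<integral>y. indicator B y * ?w x y \<partial>\<kappa> x) \<in> borel_measurable borel"
      by simp
    then show "(\<lambda>x. \<integral>\<^sup>+y. (case (x, y) of (x, y) \<Rightarrow> ennreal (?w x y)) * indicator B y \<partial>\<kappa> x) \<in> borel_measurable \<pi>"
      unfolding eq by measurable
  qed (use assms fin s\<kappa> in simp_all)
qed

lemma sets_edge_measure [simp]: "sets (edge_measure \<pi> \<kappa>) = sets borel"
  unfolding edge_measure_def by (rule sets.sets_measure_of_eq[of borel, unfolded space_borel])

lemma emeasure_edge_measure:
  assumes "A \<in> sets borel"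
  shows "emeasure (edge_measure \<pi> \<kappa>) A = (\<integral>\<^sup>+x. (\<integral>\<^sup>+y. indicator A (x, y) \<partial>\<kappa> x) \<partial>\<pi>)"
proof -
  have s: "sets \<pi> = sets borel" using \<pi> by (simp add: finite_borel_measure_def)
  show ?thesis unfolding edge_measure_semidirect[OF s]
    using assms jump_kernel_nn_integral_measurable \<kappa> sets_pair_measure_cong[OF s refl, of borel]
    by (intro emeasure_semidirect) (auto simp: jump_kernel_def sets_borel_prod)
qed

lemma AE_edge_measure_fst:
  assumes "AE x in \<pi>. P x"
  shows "AE z in edge_measure \<pi> \<kappa>. P (fst z)"
proof -
  have s: "sets \<pi> = sets borel" using \<pi> by (simp add: finite_borel_measure_def)
  show ?thesis unfolding edge_measure_semidirect[OF s]
    using assms jump_kernel_nn_integral_measurable \<kappa> 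
    by (intro AE_semidirect) (auto simp: jump_kernel_def)
qed

text \<open>A null set of \<open>\<pi>\<close> says nothing directly about the measures
  \<open>\<kappa> x\<close>; detailed balance turns the statement on the first coordinate into one
  on the second.\<close>

lemma AE_edge_measure_snd:
  assumes "detailed_balance \<pi> \<kappa>" "AE x in \<pi>. P x"
  shows "AE z in edge_measure \<pi> \<kappa>. P (snd z)"
proof -
  obtain X where X: "{x\<in>space \<pi>. \<not> P x} \<subseteq> X" "emeasure \<pi> X = 0" "X \<in> sets \<pi>"
    using assms(2) by (rule AE_E)
  have s: "sets \<pi> = sets borel" "space \<pi> = UNIV"
    using \<pi> sets_eq_imp_space_eq[of \<pi> borel] by (auto simp: finite_borel_measure_def)
  have m[measurable]: "prod.swap \<in> measurable (edge_measure \<pi> \<kappa>) (borel :: ('v \<times> 'v) measure)"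
    unfolding measurable_cong_sets[OF sets_edge_measure refl] prod.swap_def
    by (intro borel_measurable_continuous_onI continuous_intros)
  have [measurable]: "X \<in> sets borel" using X s by simp
  then have XB: "{z :: 'v \<times> 'v. fst z \<notin> X} \<in> sets borel" "{z :: 'v \<times> 'v. snd z \<notin> X} \<in> sets borel"
  proof -
    have "fst -` (- X) \<inter> space borel \<in> sets (borel :: ('v \<times> 'v) measure)"
      "snd -` (- X) \<inter> space borel \<in> sets (borel :: ('v \<times> 'v) measure)"
      by (rule measurable_sets[OF borel_measurable_continuous_onI]; simp add: continuous_on_fst continuous_on_snd)+
    then show "{z :: 'v \<times> 'v. fst z \<notin> X} \<in> sets borel" "{z :: 'v \<times> 'v. snd z \<notin> X} \<in> sets borel"
      by (simp_all add: vimage_def)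
  qed
  have "AE x in \<pi>. x \<notin> X" using X by (intro AE_not_in) (auto simp: null_sets_def)
  from AE_edge_measure_fst[OF this] have "AE z in edge_measure \<pi> \<kappa>. fst z \<notin> X" .
  then have "AE z in distr (edge_measure \<pi> \<kappa>) borel prod.swap. fst z \<notin> X"
    by (subst assms(1)[unfolded detailed_balance_def])
  then have "AE z in edge_measure \<pi> \<kappa>. fst (prod.swap z) \<notin> X"
    using XB by (subst (asm) AE_distr_iff[OF m]) auto
  then show ?thesis
    using X s by (auto elim!: eventually_mono)
qed

lemma AE_edge_measure_offdiag: "AE z in edge_measure \<pi> \<kappa>. z \<in> offdiag"
proof (rule AE_I')
  have D: "{z :: 'v \<times> 'v. fst z = snd z} \<in> sets borel"
    by (intro borel_closed closed_Collect_eq continuous_intros)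
  have "(\<integral>\<^sup>+y. indicator {z. fst z = snd z} (x, y) \<partial>\<kappa> x) = 0" for x
  proof -
    have "(\<integral>\<^sup>+y. indicator {z. fst z = snd z} (x, y) \<partial>\<kappa> x) = (\<integral>\<^sup>+y. indicator {x} y \<partial>\<kappa> x)"
      by (intro nn_integral_cong) (auto simp: indicator_def)
    also have "\<dots> = 0" using \<kappa> by (simp add: jump_kernel_def)
    finally show ?thesis .
  qed
  then have "emeasure (edge_measure \<pi> \<kappa>) {z. fst z = snd z} = 0"
    using emeasure_edge_measure[OF D] by simp
  then show "{z. fst z = snd z} \<in> null_sets (edge_measure \<pi> \<kappa>)"
    using D by (simp add: null_sets_def)
qed (auto simp: offdiag_def)

text \<open>On the set \<open>A n\<close>, where the weight is at least \<open>1 / Suc n\<close>,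
  the uniform weight bound of the kernel and the finiteness of \<open>\<pi>\<close> give finite
  mass. What these sets leave over is the diagonal, a null set.\<close>

lemma sigma_finite_edge_measure: "sigma_finite_measure (edge_measure \<pi> \<kappa>)"
proof -
  have s\<kappa>[measurable_cong]: "sets (\<kappa> x) = sets borel" for x using \<kappa> by (simp add: jump_kernel_def)
  interpret \<pi>: finite_measure \<pi> using \<pi> by (simp add: finite_borel_measure_def)
  let ?w = "\<lambda>x y. min 1 ((dist x y)\<^sup>2)"
  define S where "S = (SUP x. \<integral>\<^sup>+y. ennreal (?w x y) \<partial>\<kappa> x)"
  have S: "S < \<infinity>" using \<kappa> unfolding jump_kernel_def S_def by blast
  define A where "A n = {z :: 'v \<times> 'v. ?w (fst z) (snd z) \<ge> 1 / real (Suc n)}" for n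
  have Ab: "A n \<in> sets borel" for n
    unfolding A_def by (intro borel_closed closed_Collect_le continuous_intros)
  have Af: "emeasure (edge_measure \<pi> \<kappa>) (A n) < \<infinity>" for n
  proof -
    have "(\<integral>\<^sup>+y. indicator (A n) (x, y) \<partial>\<kappa> x) \<le> of_nat (Suc n) * S" for x
    proof -
      have "(\<integral>\<^sup>+y. indicator (A n) (x, y) \<partial>\<kappa> x) \<le> (\<integral>\<^sup>+y. of_nat (Suc n) * ennreal (?w x y) \<partial>\<kappa> x)"
      proof (intro nn_integral_mono)
        fix y
        have "(1::real) \<le> real (Suc n) * ?w x y" if "(x, y) \<in> A n"
          using that by (simp add: A_def pos_divide_le_eq mult.commute del: of_nat_Suc min_def min.bounded_iff)
        then show "indicator (A n) (x, y) \<le> of_nat (Suc n) * ennreal (?w x y)"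
          by (auto simp: indicator_def ennreal_of_nat_eq_real_of_nat ennreal_mult[symmetric] simp del: of_nat_Suc)
      qed
      also have "\<dots> = of_nat (Suc n) * (\<integral>\<^sup>+y. ennreal (?w x y) \<partial>\<kappa> x)"
        by (intro nn_integral_cmult) measurable
      also have "\<dots> \<le> of_nat (Suc n) * S"
        unfolding S_def by (intro mult_left_mono SUP_upper) auto
      finally show ?thesis .
    qed
    then have "emeasure (edge_measure \<pi> \<kappa>) (A n) \<le> (\<integral>\<^sup>+x. of_nat (Suc n) * S \<partial>\<pi>)"
      unfolding emeasure_edge_measure[OF Ab] by (intro nn_integral_mono)
    also have "\<dots> < \<infinity>"
      using S \<pi>.emeasure_finite[of "space \<pi>"]
      by (simp add: ennreal_mult_less_top ennreal_mult_eq_top_iff less_top[symmetric] ennreal_of_nat_eq_real_of_nat del: of_nat_Suc)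
    finally show ?thesis .
  qed
  let ?D = "{z :: 'v \<times> 'v. fst z = snd z}"
  have D: "?D \<in> sets borel" by (intro borel_closed closed_Collect_eq continuous_intros)
  have "AE z in edge_measure \<pi> \<kappa>. z \<notin> ?D"
    using AE_edge_measure_offdiag by (rule eventually_mono) (auto simp: offdiag_def)
  then have D0: "emeasure (edge_measure \<pi> \<kappa>) ?D = 0"
    using AE_iff_null_sets[of ?D "edge_measure \<pi> \<kappa>"] D by (auto simp: null_sets_def)
  have sp: "space (edge_measure \<pi> \<kappa>) = UNIV"
    using sets_eq_imp_space_eq[OF sets_edge_measure] by simp
  have "z \<in> ?D \<union> (\<Union>n. A n)" for z
  proof (cases "z \<in> ?D")
    case False
    then have "?w (fst z) (snd z) > 0" by (auto simp: min_def)
    then obtain n where "1 / real (Suc n) < ?w (fst z) (snd z)"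
      using reals_Archimedean by (metis inverse_eq_divide)
    then show ?thesis unfolding A_def by (auto intro!: exI[of _ n])
  qed auto
  then have un: "\<Union> (insert ?D (range A)) = UNIV" by blast
  show ?thesis
  proof (intro sigma_finite_measure.intro exI[of _ "insert ?D (range A)"] conjI ballI)
    show "\<Union> (insert ?D (range A)) = space (edge_measure \<pi> \<kappa>)" using un sp by simp
    fix a assume "a \<in> insert ?D (range A)"
    then show "emeasure (edge_measure \<pi> \<kappa>) a \<noteq> \<infinity>" using D0 Af by (auto simp: less_top)
  qed (use Ab D in auto)
qed

end

section \<open>Truncated densities and conjugate pairs\<close>

locale admissible_densities =
  fixes \<phi> \<psi>s :: "real \<Rightarrow> real" and \<alpha> :: "real \<times> real \<Rightarrow> real"
  assumes \<phi>: "admissible_phi \<phi>" and \<phi>_strict: "strictly_convex_on {0..} \<phi>"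
    and \<psi>s: "admissible_psi_star \<psi>s" and \<alpha>: "admissible_alpha \<alpha>"
begin

lemma phi_has_deriv: "r > 0 \<Longrightarrow> (\<phi> has_real_derivative deriv \<phi> r) (at r)"
  using \<phi> unfolding admissible_phi_def
  using DERIV_deriv_iff_real_differentiable by blast

lemma phi_nonneg: "r \<ge> 0 \<Longrightarrow> \<phi> r \<ge> 0"
  using \<phi> unfolding admissible_phi_def by blast

lemma phi_cont: "continuous_on {0..} \<phi>"
  using \<phi> unfolding admissible_phi_def by blast

lemma phi_tangent:
  assumes "r > 0" "s \<ge> 0"
  shows "\<phi> s \<ge> \<phi> r + deriv \<phi> r * (s - r)"
proof -
  have "convex_on {0..} \<phi>" using \<phi> unfolding admissible_phi_def by blast
  then have "\<phi> s - \<phi> r \<ge> deriv \<phi> r * (s - r)"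
    using assms by (intro convex_on_imp_above_tangent[where A = "{0..}"] has_field_derivative_at_within[OF phi_has_deriv])
      (auto simp: interior_real_atLeast is_interval_connected)
  then show ?thesis by simp
qed

text \<open>If the derivative did not grow, the tangent at \<open>r\<close> would bound
  \<open>\<phi>\<close> from above at \<open>s\<close> and from below at the midpoint, against
  strict convexity at the midpoint.\<close>

lemma deriv_phi_less:
  assumes "0 < r" "r < s"
  shows "deriv \<phi> r < deriv \<phi> s"
proof (rule ccontr)
  assume "\<not> ?thesis"
  then have le: "deriv \<phi> s \<le> deriv \<phi> r" by simp
  let ?m = "(r + s) / 2"
  have "\<phi> ((1 - 1/2) *\<^sub>R r + (1/2) *\<^sub>R s) < (1 - 1/2) * \<phi> r + (1/2) * \<phi> s"
    using \<phi>_strict assms unfolding strictly_convex_on_def by (intro \<phi>_strict[unfolded strictly_convex_on_def, THEN conjunct2, rule_format]) auto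
  then have mid: "\<phi> ?m < \<phi> r / 2 + \<phi> s / 2" by (simp add: field_simps)
  have 1: "\<phi> ?m \<ge> \<phi> r + deriv \<phi> r * ((s - r) / 2)"
    using phi_tangent[of r ?m] assms by (simp add: field_simps)
  have 2: "\<phi> r \<ge> \<phi> s - deriv \<phi> s * (s - r)"
    using phi_tangent[of s r] assms by (simp add: algebra_simps)
  have "deriv \<phi> s * (s - r) \<le> deriv \<phi> r * (s - r)" using le assms by (intro mult_right_mono) auto
  with 2 have "\<phi> s \<le> \<phi> r + deriv \<phi> r * (s - r)" by simp
  with 1 mid show False by (simp add: field_simps)
qed

lemma deriv_phi_mono: "0 < r \<Longrightarrow> r \<le> s \<Longrightarrow> deriv \<phi> r \<le> deriv \<phi> s"
  using deriv_phi_less[of r s] by (cases "r = s") auto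

text \<open>At 0 \<open>phi'\<close> is defined through \<open>Lim\<close>, which is meaningful only
  when the limit exists. By monotonicity it does: it is the infimum of the derivatives, possibly
  \<open>-\<infinity>\<close>.\<close>

lemma phi'_0_tendsto: "((\<lambda>s. ereal (deriv \<phi> s)) \<longlongrightarrow> phi' \<phi> 0) (at_right 0)"
  and phi'_0_le: "r > 0 \<Longrightarrow> phi' \<phi> 0 \<le> ereal (deriv \<phi> r)"
proof -
  define L where "L = (INF s\<in>{0<..}. ereal (deriv \<phi> s))"
  have lim: "((\<lambda>s. ereal (deriv \<phi> s)) \<longlongrightarrow> L) (at_right 0)"
  proof (rule order_tendstoI)
    fix a assume "a < L"
    then have "a < ereal (deriv \<phi> s)" if "s > 0" for s
      using that less_INF_D[OF \<open>a < L\<close>[unfolded L_def], of s] by simp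
    then show "eventually (\<lambda>s. a < ereal (deriv \<phi> s)) (at_right 0)"
      by (auto simp: eventually_at_right_field intro!: exI[of _ 1])
  next
    fix a assume "L < a"
    then obtain s0 where s0: "s0 > 0" "ereal (deriv \<phi> s0) < a"
      unfolding L_def by (auto simp: INF_less_iff)
    have "ereal (deriv \<phi> s) < a" if "0 < s" "s < s0" for s
    proof -
      have "ereal (deriv \<phi> s) \<le> ereal (deriv \<phi> s0)" using that deriv_phi_mono[of s s0] by simp
      then show ?thesis using s0(2) by (rule le_less_trans)
    qed
    with s0(1) show "eventually (\<lambda>s. ereal (deriv \<phi> s) < a) (at_right 0)"
      by (auto simp: eventually_at_right_field intro!: exI[of _ s0])
  qed
  then have L: "phi' \<phi> 0 = L" unfolding phi'_def by (simp add: tendsto_Lim)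
  show "((\<lambda>s. ereal (deriv \<phi> s)) \<longlongrightarrow> phi' \<phi> 0) (at_right 0)" using lim L by simp
  show "r > 0 \<Longrightarrow> phi' \<phi> 0 \<le> ereal (deriv \<phi> r)" unfolding L L_def by (rule INF_lower) simp
qed

lemma phi'_pos [simp]: "r > 0 \<Longrightarrow> phi' \<phi> r = ereal (deriv \<phi> r)"
  by (simp add: phi'_def)

lemma phi'_less: "0 \<le> r \<Longrightarrow> r < s \<Longrightarrow> phi' \<phi> r < phi' \<phi> s"
proof (cases "r = 0")
  case True
  assume "0 \<le> r" "r < s"
  have "phi' \<phi> 0 \<le> ereal (deriv \<phi> (s / 2))" using \<open>r < s\<close> True by (intro phi'_0_le) auto
  also have "\<dots> < ereal (deriv \<phi> s)" using \<open>r < s\<close> True deriv_phi_less[of "s/2" s] by simp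
  finally show ?thesis using True \<open>r < s\<close> by simp
qed (auto simp: deriv_phi_less)

lemma phi'_0_not_PInf: "phi' \<phi> 0 \<noteq> \<infinity>"
  using phi'_0_le[of 1] by auto

lemma phi'_not_PInf: "r \<ge> 0 \<Longrightarrow> phi' \<phi> r \<noteq> \<infinity>"
  using phi'_0_not_PInf by (cases "r = 0") auto

lemma deriv_phi_cont: "continuous_on {0<..} (deriv \<phi>)"
  using \<phi> unfolding admissible_phi_def by blast

lemma phi'_tendsto:
  assumes "r \<ge> 0"
  shows "(phi' \<phi> \<longlongrightarrow> phi' \<phi> r) (at r within {0..})"
proof (cases "r = 0")
  case True
  have "at (0::real) within {0..} = at_right 0"
    unfolding at_within_def by (rule arg_cong[where f = "\<lambda>A. inf (nhds 0) (principal A)"]) auto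
  moreover have "(phi' \<phi> \<longlongrightarrow> phi' \<phi> 0) (at_right 0)"
    by (rule Lim_transform_eventually[OF phi'_0_tendsto]) (auto simp: eventually_at_right_field intro!: exI[of _ 1])
  ultimately show ?thesis using True by simp
next
  case False
  then have r: "r > 0" using assms by simp
  then have "isCont (deriv \<phi>) r"
    using deriv_phi_cont continuous_on_eq_continuous_at[of "{0<..}" "deriv \<phi>"] by auto
  then have "((\<lambda>s. ereal (deriv \<phi> s)) \<longlongrightarrow> ereal (deriv \<phi> r)) (at r)"
    by (intro tendsto_ereal) (simp add: isCont_def)
  then have "(phi' \<phi> \<longlongrightarrow> ereal (deriv \<phi> r)) (at r)"
    by (rule Lim_transform_eventually)
       (use r in \<open>auto simp: eventually_at_filter intro!: eventually_mono[OF eventually_nhds_in_open[of "{0<..}" r]]\<close>)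
  then show ?thesis using r tendsto_within_subset[of "phi' \<phi>" _ r UNIV] by simp
qed

text \<open>Only at 0 can \<open>phi'\<close> be infinite, and then it is
  \<open>-\<infinity>\<close>. Away from the origin the difference in \<open>Lambda\<close> is thus
  never of the form infinity minus infinity, and limits pass through it.\<close>

lemma Lambda_finite:
  assumes "u \<ge> 0" "v \<ge> 0" "(u, v) \<noteq> (0, 0)"
  shows "\<not> (phi' \<phi> v = \<infinity> \<and> phi' \<phi> u = \<infinity> \<or> phi' \<phi> v = -\<infinity> \<and> phi' \<phi> u = -\<infinity>)"
  using assms phi'_not_PInf[of u] phi'_not_PInf[of v] by (cases "u = 0"; cases "v = 0") auto

lemma Lambda_neq_0:
  assumes "u \<ge> 0" "v \<ge> 0" "u \<noteq> v"
  shows "Lambda \<phi> u v \<noteq> 0"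
proof -
  have "u < v \<or> v < u" using assms by auto
  then have "phi' \<phi> u \<noteq> phi' \<phi> v"
    using assms phi'_less[of u v] phi'_less[of v u] by auto
  then show ?thesis
    using assms phi'_not_PInf[of u] phi'_not_PInf[of v]
    by (cases "phi' \<phi> u"; cases "phi' \<phi> v") (auto simp: Lambda_def)
qed

lemma Lambda_pos: "u > 0 \<Longrightarrow> v > 0 \<Longrightarrow> Lambda \<phi> u v = ereal (deriv \<phi> v - deriv \<phi> u)"
  by (simp add: Lambda_def)

text \<open>Below \<open>\<epsilon>\<close> the density \<open>\<phi>\<close> is replaced by its tangent at \<open>\<epsilon>\<close>, which makes the derivative bounded near 0.\<close>

definition phi_cut :: "real \<Rightarrow> real \<Rightarrow> real" where
  "phi_cut \<epsilon> u = \<phi> (max u \<epsilon>) + deriv \<phi> \<epsilon> * (min u \<epsilon> - \<epsilon>)"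

definition dphi_cut :: "real \<Rightarrow> real \<Rightarrow> real" where
  "dphi_cut \<epsilon> u = deriv \<phi> (max u \<epsilon>)"

lemma dphi_cut_mono: "\<epsilon> > 0 \<Longrightarrow> u \<le> v \<Longrightarrow> dphi_cut \<epsilon> u \<le> dphi_cut \<epsilon> v"
  unfolding dphi_cut_def by (intro deriv_phi_mono) auto

lemma dphi_cut_measurable: "\<epsilon> > 0 \<Longrightarrow> dphi_cut \<epsilon> \<in> borel_measurable borel"
  using dphi_cut_mono by (intro borel_measurable_mono monoI) auto

lemma dphi_cut_bound:
  assumes "\<epsilon> > 0" "0 \<le> u" "u \<le> C"
  shows "\<bar>dphi_cut \<epsilon> u\<bar> \<le> \<bar>dphi_cut \<epsilon> 0\<bar> + \<bar>dphi_cut \<epsilon> C\<bar>"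
  using dphi_cut_mono[of \<epsilon> 0 u] dphi_cut_mono[of \<epsilon> u C] assms by linarith

lemma phi_cut_measurable: "\<epsilon> > 0 \<Longrightarrow> phi_cut \<epsilon> \<in> borel_measurable borel"
  unfolding phi_cut_def
  by (intro borel_measurable_continuous_onI continuous_intros continuous_on_compose2[OF phi_cont]) auto

text \<open>Continuing \<open>\<phi>\<close> along its tangent keeps it convex, with
  \<open>dphi_cut\<close> as derivative. This inequality is what bounds the increments of the energy
  from below.\<close>

lemma phi_cut_tangent:
  assumes "\<epsilon> > 0" "r \<ge> 0" "s \<ge> 0"
  shows "phi_cut \<epsilon> s \<ge> phi_cut \<epsilon> r + dphi_cut \<epsilon> r * (s - r)"
proof (cases "r \<ge> \<epsilon>")
  case True
  show ?thesis
  proof (cases "s \<ge> \<epsilon>")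
    case False
    have "deriv \<phi> r * (\<epsilon> - s) \<ge> deriv \<phi> \<epsilon> * (\<epsilon> - s)"
      using False True assms by (intro mult_right_mono deriv_phi_mono) auto
    with phi_tangent[of r \<epsilon>] True False assms show ?thesis
      by (simp add: phi_cut_def dphi_cut_def max_def min_def algebra_simps)
  qed (use True assms phi_tangent[of r s] in \<open>simp add: phi_cut_def dphi_cut_def max_absorb1 min_absorb2\<close>)
next
  case False
  with assms phi_tangent[of \<epsilon> s] show ?thesis
    by (cases "s \<ge> \<epsilon>") (simp_all add: phi_cut_def dphi_cut_def max_def min_def algebra_simps)
qed

lemma phi_cut_le: "\<epsilon> > 0 \<Longrightarrow> u \<ge> 0 \<Longrightarrow> phi_cut \<epsilon> u \<le> \<phi> u"
  using phi_tangent[of \<epsilon> u] by (cases "u \<ge> \<epsilon>") (simp_all add: phi_cut_def max_def min_def)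

text \<open>A lower bound uniform in \<open>\<epsilon>\<close>, for dominated convergence. The slope
  at \<open>\<epsilon>\<close> may tend to \<open>-\<infinity>\<close>, but it is at most the slope
  at 1, and it multiplies a number between -1 and 0.\<close>

lemma phi_cut_ge:
  assumes "0 < \<epsilon>" "\<epsilon> \<le> 1" "u \<ge> 0"
  shows "phi_cut \<epsilon> u \<ge> - \<bar>deriv \<phi> 1\<bar>"
proof (cases "u \<ge> \<epsilon>")
  case True
  then have "phi_cut \<epsilon> u = \<phi> u" by (simp add: phi_cut_def max_absorb1 min_absorb2)
  with phi_nonneg[OF assms(3)] show ?thesis by linarith
next
  case False
  have "deriv \<phi> \<epsilon> * (\<epsilon> - u) \<le> \<bar>deriv \<phi> 1\<bar> * (\<epsilon> - u)"
    using deriv_phi_mono[of \<epsilon> 1] False assms by (intro mult_right_mono) auto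
  also have "\<dots> \<le> \<bar>deriv \<phi> 1\<bar> * 1" using False assms by (intro mult_left_mono) auto
  finally show ?thesis
    using False phi_nonneg[of \<epsilon>] assms by (simp add: phi_cut_def max_def min_def algebra_simps)
qed

text \<open>The delicate point is \<open>u = 0\<close>, where the truncation equals
  \<open>\<phi> \<epsilon> - \<epsilon> * deriv \<phi> \<epsilon>\<close> and the derivative may
  blow up. The tangent at \<open>\<epsilon>\<close>, evaluated at \<open>2 * \<epsilon>\<close>,
  bounds the product by \<open>\<phi> (2 * \<epsilon>) - \<phi> \<epsilon>\<close>, which tends to
  0; from above the truncation is bounded by \<open>\<phi> 0\<close>.\<close>

lemma phi_cut_tendsto:
  assumes "u \<ge> 0"
  shows "(\<lambda>n. phi_cut (1 / real (Suc n)) u) \<longlonglongrightarrow> \<phi> u"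
proof (cases "u = 0")
  case False
  then have "u > 0" using assms by simp
  have "eventually (\<lambda>n. 1 / real (Suc n) < u) sequentially"
    using order_tendstoD(2)[OF LIMSEQ_inverse_real_of_nat \<open>u > 0\<close>] by (simp add: inverse_eq_divide)
  then have "eventually (\<lambda>n. phi_cut (1 / real (Suc n)) u = \<phi> u) sequentially"
    by (rule eventually_mono) (simp add: phi_cut_def max_def min_def)
  then show ?thesis by (rule tendsto_eventually)
next
  case True
  let ?e = "\<lambda>n. 1 / real (Suc n)"
  have e0: "?e \<longlonglongrightarrow> 0" using LIMSEQ_inverse_real_of_nat by (simp add: inverse_eq_divide)
  have c: "(\<lambda>n. \<phi> (x n)) \<longlonglongrightarrow> \<phi> 0" if "x \<longlonglongrightarrow> 0" "\<And>n. x n \<ge> 0" for x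
    using phi_cont that by (intro continuous_on_tendsto_compose[where f = \<phi> and s = "{0..}"]) auto
  have "(\<lambda>n. \<phi> (?e n) - (\<phi> (2 * ?e n) - \<phi> (?e n))) \<longlonglongrightarrow> \<phi> 0 - (\<phi> 0 - \<phi> 0)"
    using tendsto_mult_left[OF e0, of 2] by (intro tendsto_diff c e0) auto
  then have l: "(\<lambda>n. \<phi> (?e n) - (\<phi> (2 * ?e n) - \<phi> (?e n))) \<longlonglongrightarrow> \<phi> 0" by simp
  have "(\<lambda>n. phi_cut (?e n) 0) \<longlonglongrightarrow> \<phi> 0"
  proof (rule tendsto_sandwich[OF _ _ l tendsto_const])
    show "eventually (\<lambda>n. \<phi> (?e n) - (\<phi> (2 * ?e n) - \<phi> (?e n)) \<le> phi_cut (?e n) 0) sequentially"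
    proof (intro always_eventually allI)
      fix n
      have "?e n > 0" by simp
      then show "\<phi> (?e n) - (\<phi> (2 * ?e n) - \<phi> (?e n)) \<le> phi_cut (?e n) 0"
        using phi_tangent[of "?e n" "2 * ?e n"] by (simp add: phi_cut_def max_def min_def algebra_simps)
    qed
    show "eventually (\<lambda>n. phi_cut (?e n) 0 \<le> \<phi> 0) sequentially"
      by (intro always_eventually allI phi_cut_le) auto
  qed
  then show ?thesis using True by simp
qed

text \<open>Monotonicity makes the gradient of the truncation a contraction of \<open>Lambda\<close>.\<close>

lemma dphi_cut_grad_le:
  assumes "\<epsilon> > 0" "u \<ge> 0" "v \<ge> 0"
  shows "ereal \<bar>dphi_cut \<epsilon> v - dphi_cut \<epsilon> u\<bar> \<le> \<bar>Lambda \<phi> u v\<bar>"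
proof -
  have *: "ereal (dphi_cut \<epsilon> v - dphi_cut \<epsilon> u) \<le> phi' \<phi> v - phi' \<phi> u" if "0 \<le> u" "u < v" for u v
  proof (cases "v \<le> \<epsilon>")
    case True
    then have "dphi_cut \<epsilon> v - dphi_cut \<epsilon> u = 0" using that by (simp add: dphi_cut_def max_def)
    then show ?thesis using phi'_less[OF that] phi'_not_PInf[of u] phi'_not_PInf[of v] that
      by (cases "phi' \<phi> u"; cases "phi' \<phi> v") auto
  next
    case False
    have "phi' \<phi> u \<le> ereal (dphi_cut \<epsilon> u)"
      using that assms deriv_phi_mono[of u "max u \<epsilon>"] phi'_0_le[of \<epsilon>] by (cases "u = 0") (auto simp: dphi_cut_def max_def)
    then show ?thesis using False that
      by (cases "phi' \<phi> u") (auto simp: dphi_cut_def max_def)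
  qed
  have ereal_le_abs: "x \<le> \<bar>x\<bar>" for x :: ereal by (cases x) auto
  consider "u = v" | "u < v" | "v < u" by linarith
  then show ?thesis
  proof cases
    case 2
    have "\<bar>dphi_cut \<epsilon> v - dphi_cut \<epsilon> u\<bar> = dphi_cut \<epsilon> v - dphi_cut \<epsilon> u"
      using 2 dphi_cut_mono[of \<epsilon> u v] assms by simp
    moreover have "Lambda \<phi> u v = phi' \<phi> v - phi' \<phi> u" using 2 assms by (auto simp: Lambda_def)
    ultimately show ?thesis using order_trans[OF *[OF assms(2) 2] ereal_le_abs] by simp
  next
    case 3
    have "\<bar>phi' \<phi> v - phi' \<phi> u\<bar> = \<bar>phi' \<phi> u - phi' \<phi> v\<bar>"
      by (cases "phi' \<phi> u"; cases "phi' \<phi> v") auto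
    moreover have "\<bar>dphi_cut \<epsilon> v - dphi_cut \<epsilon> u\<bar> = dphi_cut \<epsilon> u - dphi_cut \<epsilon> v"
      using 3 dphi_cut_mono[of \<epsilon> v u] assms by simp
    moreover have "Lambda \<phi> u v = phi' \<phi> v - phi' \<phi> u" using 3 assms by (auto simp: Lambda_def)
    ultimately show ?thesis using order_trans[OF *[OF assms(3) 3] ereal_le_abs] by simp
  next
    case 1
    have "0 \<le> \<bar>Lambda \<phi> u v\<bar>" by (cases "Lambda \<phi> u v") auto
    with 1 show ?thesis by (simp add: zero_ereal_def)
  qed
qed

lemma dphi_cut_tendsto:
  assumes "r \<ge> 0"
  shows "(\<lambda>n. ereal (dphi_cut (1 / real (Suc n)) r)) \<longlonglongrightarrow> phi' \<phi> r"
proof -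
  let ?e = "\<lambda>n. 1 / real (Suc n)"
  have e0: "?e \<longlonglongrightarrow> 0" using LIMSEQ_inverse_real_of_nat by (simp add: inverse_eq_divide)
  show ?thesis
  proof (cases "r = 0")
    case True
    have "filterlim ?e (at_right 0) sequentially"
      using e0 by (auto simp: filterlim_at intro!: always_eventually)
    from filterlim_compose[OF phi'_0_tendsto this] show ?thesis
      using True by (simp add: dphi_cut_def)
  next
    case False
    then have "eventually (\<lambda>n. ?e n < r) sequentially" using assms by (intro order_tendstoD(2)[OF e0]) auto
    then have "eventually (\<lambda>n. ereal (dphi_cut (?e n) r) = phi' \<phi> r) sequentially"
      by (rule eventually_mono) (use False assms in \<open>auto simp: dphi_cut_def max_def\<close>)
    then show ?thesis by (rule tendsto_eventually)
  qed
qed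

lemma dphi_cut_grad_tendsto:
  assumes "u \<ge> 0" "v \<ge> 0" "\<bar>Lambda \<phi> u v\<bar> \<noteq> \<infinity>"
  shows "(\<lambda>n. dphi_cut (1 / real (Suc n)) v - dphi_cut (1 / real (Suc n)) u) \<longlonglongrightarrow> real_of_ereal (Lambda \<phi> u v)"
proof -
  let ?e = "\<lambda>n. 1 / real (Suc n)"
  show ?thesis
  proof (cases "(u, v) = (0, 0)")
    case False
    have lim: "(\<lambda>n. ereal (dphi_cut (?e n) v) - ereal (dphi_cut (?e n) u)) \<longlonglongrightarrow> phi' \<phi> v - phi' \<phi> u"
      using Lambda_finite[OF assms(1,2) False] by (intro tendsto_diff_ereal_general dphi_cut_tendsto assms) auto
    have "Lambda \<phi> u v = phi' \<phi> v - phi' \<phi> u" using False by (auto simp: Lambda_def)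
    then have "phi' \<phi> v - phi' \<phi> u = ereal (real_of_ereal (Lambda \<phi> u v))"
      using assms(3) by (simp add: ereal_real')
    from lim[unfolded this ereal_minus] show ?thesis unfolding lim_ereal .
  qed (simp add: Lambda_def)
qed

section \<open>The conjugate pair of dissipation potentials\<close>

lemma psi_star_has_deriv: "(\<psi>s has_real_derivative deriv \<psi>s \<xi>) (at \<xi>)"
  using \<psi>s unfolding admissible_psi_star_def
  using DERIV_deriv_iff_real_differentiable by blast

lemma psi_star_nonneg: "\<psi>s \<xi> \<ge> 0" and psi_star_even: "\<psi>s (- \<xi>) = \<psi>s \<xi>" and psi_star_0: "\<psi>s 0 = 0"
  and psi_star_convex: "convex_on UNIV \<psi>s"
  using \<psi>s unfolding admissible_psi_star_def by auto

lemma psi_star_tangent: "\<psi>s \<eta> \<ge> \<psi>s \<xi> + deriv \<psi>s \<xi> * (\<eta> - \<xi>)"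
  using convex_on_imp_above_tangent[OF psi_star_convex, of \<xi> \<eta> "deriv \<psi>s \<xi>"] psi_star_has_deriv[of \<xi>] by simp

lemma psi_star_superlinear: "filterlim (\<lambda>\<xi>. \<psi>s \<xi> / \<bar>\<xi>\<bar>) at_top at_infinity"
  using \<psi>s unfolding admissible_psi_star_def by auto

lemma psi_star_superlinearD: "\<exists>B>0. \<forall>\<xi>. \<bar>\<xi>\<bar> \<ge> B \<longrightarrow> \<psi>s \<xi> \<ge> M * \<bar>\<xi>\<bar>"
proof -
  have "eventually (\<lambda>\<xi>. \<psi>s \<xi> / \<bar>\<xi>\<bar> \<ge> M) at_infinity"
    using psi_star_superlinear by (simp add: filterlim_at_top)
  then obtain b where b: "\<And>\<xi>. \<bar>\<xi>\<bar> \<ge> b \<Longrightarrow> \<psi>s \<xi> / \<bar>\<xi>\<bar> \<ge> M"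
    by (auto simp: eventually_at_infinity)
  show ?thesis
  proof (intro exI[of _ "max b 1"] conjI allI impI)
    fix \<xi> :: real assume "max b 1 \<le> \<bar>\<xi>\<bar>"
    with b[of \<xi>] show "M * \<bar>\<xi>\<bar> \<le> \<psi>s \<xi>" by (auto simp: pos_le_divide_eq)
  qed auto
qed

text \<open>The real \<open>SUP\<close> in \<open>convex_conjugate\<close> carries information only
  for bounded sets. Superlinearity makes the expression nonpositive for large
  \<open>\<xi>\<close>.\<close>

lemma conj_bdd: "bdd_above (range (\<lambda>\<xi>. s * \<xi> - \<psi>s \<xi>))"
proof -
  obtain B where B: "B > 0" "\<And>\<xi>. \<bar>\<xi>\<bar> \<ge> B \<Longrightarrow> \<psi>s \<xi> \<ge> \<bar>s\<bar> * \<bar>\<xi>\<bar>"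
    using psi_star_superlinearD[of "\<bar>s\<bar>"] by blast
  have "s * \<xi> - \<psi>s \<xi> \<le> \<bar>s\<bar> * B" for \<xi>
  proof (cases "\<bar>\<xi>\<bar> \<ge> B")
    case True
    have "s * \<xi> \<le> \<bar>s\<bar> * \<bar>\<xi>\<bar>" by (metis abs_ge_self abs_mult)
    with B(2)[OF True] have "s * \<xi> - \<psi>s \<xi> \<le> 0" by linarith
    also have "0 \<le> \<bar>s\<bar> * B" using B by simp
    finally show ?thesis .
  next
    case False
    have "s * \<xi> \<le> \<bar>s\<bar> * \<bar>\<xi>\<bar>" by (metis abs_ge_self abs_mult)
    also have "\<dots> \<le> \<bar>s\<bar> * B" using False by (intro mult_left_mono) auto
    finally show ?thesis using psi_star_nonneg[of \<xi>] by linarith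
  qed
  then show ?thesis by (auto intro!: bdd_aboveI2)
qed

abbreviation \<psi> :: "real \<Rightarrow> real" where "\<psi> \<equiv> convex_conjugate \<psi>s"

lemma Young: "s * \<xi> \<le> \<psi> s + \<psi>s \<xi>"
  using cSUP_upper[OF UNIV_I conj_bdd, of s \<xi>] unfolding convex_conjugate_def by simp

lemma psi_nonneg: "\<psi> s \<ge> 0"
  using Young[of s 0] psi_star_0 by simp

text \<open>Equality means that \<open>\<xi>\<close> maximises
  \<open>\<eta> \<mapsto> s * \<eta> - \<psi>s \<eta>\<close>; as \<open>\<psi>s\<close> is convex
  and differentiable, this is the vanishing of the derivative at \<open>\<xi>\<close>.\<close>

lemma Young_eq_iff: "\<psi> s + \<psi>s \<xi> = s * \<xi> \<longleftrightarrow> s = deriv \<psi>s \<xi>"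
proof
  assume eq: "\<psi> s + \<psi>s \<xi> = s * \<xi>"
  have "((\<lambda>\<eta>. s * \<eta> - \<psi>s \<eta>) has_real_derivative (s - deriv \<psi>s \<xi>)) (at \<xi>)"
    by (auto intro!: derivative_eq_intros psi_star_has_deriv)
  moreover have "s * \<eta> - \<psi>s \<eta> \<le> s * \<xi> - \<psi>s \<xi>" for \<eta>
    using Young[of s \<eta>] eq by linarith
  ultimately have "s - deriv \<psi>s \<xi> = 0"
    using DERIV_local_max[of "\<lambda>\<eta>. s * \<eta> - \<psi>s \<eta>" "s - deriv \<psi>s \<xi>" \<xi> 1] by auto
  then show "s = deriv \<psi>s \<xi>" by simp
next
  assume s: "s = deriv \<psi>s \<xi>"
  have "\<psi> s \<le> s * \<xi> - \<psi>s \<xi>" unfolding convex_conjugate_def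
    using psi_star_tangent[of \<xi>] by (intro cSUP_least) (auto simp: s algebra_simps)
  with Young[of s \<xi>] show "\<psi> s + \<psi>s \<xi> = s * \<xi>" by simp
qed

lemma deriv_psi_star_odd: "deriv \<psi>s (- \<xi>) = - deriv \<psi>s \<xi>"
proof -
  have "((\<lambda>x. \<psi>s (- x)) has_real_derivative deriv \<psi>s (- \<xi>) * (- 1)) (at \<xi>)"
    by (rule DERIV_chain2[OF psi_star_has_deriv]) (auto intro!: derivative_eq_intros)
  then have "(\<psi>s has_real_derivative - deriv \<psi>s (- \<xi>)) (at \<xi>)" by (simp add: psi_star_even)
  with psi_star_has_deriv[of \<xi>] show ?thesis using DERIV_unique by fastforce
qed

lemma Young_neg: "\<psi> s + \<psi>s \<xi> + s * \<xi> \<ge> 0"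
  using Young[of s "- \<xi>"] by (simp add: psi_star_even)

lemma Young_neg_eq_iff: "\<psi> s + \<psi>s \<xi> + s * \<xi> = 0 \<longleftrightarrow> s = - deriv \<psi>s \<xi>"
  using Young_eq_iff[of s "- \<xi>"] by (auto simp: psi_star_even deriv_psi_star_odd)

lemma deriv_psi_star_measurable: "deriv \<psi>s \<in> borel_measurable borel"
proof (intro borel_measurable_mono monoI)
  fix x y :: real assume "x \<le> y"
  show "deriv \<psi>s x \<le> deriv \<psi>s y"
  proof (cases "x = y")
    case False
    have "(deriv \<psi>s y - deriv \<psi>s x) * (y - x) \<ge> 0"
      using psi_star_tangent[of x y] psi_star_tangent[of y x] by (simp add: algebra_simps)
    with False \<open>x \<le> y\<close> show ?thesis by (simp add: zero_le_mult_iff)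
  qed simp
qed

text \<open>\<open>\<psi>\<close> is a supremum over uncountably many \<open>\<xi>\<close>;
  measurability comes from convexity, since a finite convex function on the line is
  continuous.\<close>

lemma psi_measurable: "\<psi> \<in> borel_measurable borel"
proof -
  have "convex_on UNIV \<psi>"
  proof (rule convex_onI)
    fix t x y :: real assume t: "0 < t" "t < 1"
    show "\<psi> ((1 - t) *\<^sub>R x + t *\<^sub>R y) \<le> (1 - t) * \<psi> x + t * \<psi> y"
      unfolding convex_conjugate_def[of _ "(1 - t) *\<^sub>R x + t *\<^sub>R y"]
    proof (rule cSUP_least)
      fix \<xi>
      have "(1 - t) * (x * \<xi> - \<psi>s \<xi>) \<le> (1 - t) * \<psi> x" "t * (y * \<xi> - \<psi>s \<xi>) \<le> t * \<psi> y"
        using t Young[of x \<xi>] Young[of y \<xi>] by (auto intro!: mult_left_mono)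
      then show "((1 - t) *\<^sub>R x + t *\<^sub>R y) * \<xi> - \<psi>s \<xi> \<le> (1 - t) * \<psi> x + t * \<psi> y"
        by (simp add: algebra_simps)
    qed simp
  qed simp
  then show ?thesis by (intro borel_measurable_continuous_onI convex_on_continuous) auto
qed

text \<open>The quotient \<open>\<psi>s \<xi> / \<xi>\<^sup>2\<close>, extended by its positive
  limit at 0, is continuous and positive, so it has positive bounds on compact intervals. A zero of
  \<open>\<psi>s\<close> away from 0 would by convexity give zeros on the whole segment to 0 and
  force the limit to be 0.\<close>

lemma psi_star_quadratic:
  "\<exists>k>0. \<exists>K>0. \<forall>\<xi>. \<bar>\<xi>\<bar> \<le> M \<longrightarrow> k * \<xi>\<^sup>2 \<le> \<psi>s \<xi> \<and> \<psi>s \<xi> \<le> K * \<xi>\<^sup>2"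
proof -
  obtain c where c: "c > 0" and lim: "((\<lambda>\<xi>. \<psi>s \<xi> / \<bar>\<xi>\<bar>\<^sup>2) \<longlongrightarrow> c) (at 0)"
    using \<psi>s unfolding admissible_psi_star_def by auto
  define h where "h \<xi> = (if \<xi> = 0 then c else \<psi>s \<xi> / \<xi>\<^sup>2)" for \<xi>
  have hc: "isCont h x" for x
  proof (cases "x = 0")
    case True
    have "(h \<longlongrightarrow> c) (at 0)"
      by (rule Lim_transform_eventually[OF lim]) (auto simp: h_def eventually_at_filter)
    then show ?thesis using True by (simp add: isCont_def h_def)
  next
    case False
    have "isCont (\<lambda>\<xi>. \<psi>s \<xi> / \<xi>\<^sup>2) x"
      using psi_star_has_deriv[of x, THEN DERIV_isCont] False by (intro continuous_intros) auto
    moreover have "eventually (\<lambda>\<xi>. h \<xi> = \<psi>s \<xi> / \<xi>\<^sup>2) (nhds x)"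
      by (rule eventually_mono[OF eventually_nhds_in_open[of "- {0}" x]]) (use False in \<open>auto simp: h_def\<close>)
    ultimately show ?thesis by (simp add: isCont_cong)
  qed
  have pos: "\<psi>s \<xi> > 0" if "\<xi> \<noteq> 0" for \<xi>
  proof (rule ccontr)
    assume "\<not> \<psi>s \<xi> > 0"
    then have z: "\<psi>s \<xi> = 0" using psi_star_nonneg[of \<xi>] by simp
    have "\<psi>s (t * \<xi>) = 0" if "0 < t" "t < 1" for t
      using convex_onD[OF psi_star_convex, of t 0 \<xi>] that z psi_star_0 psi_star_nonneg[of "t * \<xi>"] by simp
    then have ev: "eventually (\<lambda>t. \<psi>s (t * \<xi>) / \<bar>t * \<xi>\<bar>\<^sup>2 = 0) (at_right 0)"
      by (auto simp: eventually_at_right_field intro!: exI[of _ 1])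
    have "filterlim (\<lambda>t. t * \<xi>) (at 0) (at_right 0)"
      using \<open>\<xi> \<noteq> 0\<close> by (auto simp: filterlim_at eventually_at_right_field intro!: tendsto_eq_intros exI[of _ 1])
    from filterlim_compose[OF lim this] have "((\<lambda>t. \<psi>s (t * \<xi>) / \<bar>t * \<xi>\<bar>\<^sup>2) \<longlongrightarrow> c) (at_right 0)" .
    from Lim_transform_eventually[OF this ev]
    have "((\<lambda>t::real. 0) \<longlongrightarrow> c) (at_right 0)" .
    then have "0 = c" by (simp add: tendsto_const_iff)
    then show False using c by simp
  qed
  have hpos: "h x > 0" for x using pos[of x] c by (simp add: h_def)
  define M' where "M' = max M 0"
  have co: "compact {- M'..M'}" "{- M'..M'} \<noteq> {}" "continuous_on {- M'..M'} h"
    using hc by (auto simp: M'_def continuous_at_imp_continuous_on)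
  obtain x1 where x1: "\<And>y. y \<in> {- M'..M'} \<Longrightarrow> h x1 \<le> h y" using continuous_attains_inf[OF co] by blast
  obtain x2 where x2: "\<And>y. y \<in> {- M'..M'} \<Longrightarrow> h y \<le> h x2" using continuous_attains_sup[OF co] by blast
  have eq: "\<psi>s \<xi> = h \<xi> * \<xi>\<^sup>2" for \<xi> by (simp add: h_def psi_star_0)
  show ?thesis
  proof (rule exI[of _ "h x1"], rule conjI[OF hpos], rule exI[of _ "h x2"], rule conjI[OF hpos],
      intro allI impI conjI)
    fix \<xi> :: real assume "\<bar>\<xi>\<bar> \<le> M"
    then have "\<xi> \<in> {- M'..M'}" by (auto simp: M'_def)
    then have "h x1 \<le> h \<xi>" "h \<xi> \<le> h x2" using x1 x2 by blast+
    then show "h x1 * \<xi>\<^sup>2 \<le> \<psi>s \<xi>" "\<psi>s \<xi> \<le> h x2 * \<xi>\<^sup>2"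
      unfolding eq[of \<xi>] by (simp_all add: mult_right_mono)
  qed
qed

lemma psi_star_pos: "\<xi> \<noteq> 0 \<Longrightarrow> \<psi>s \<xi> > 0"
proof -
  assume "\<xi> \<noteq> 0"
  obtain k where "k > 0" "k * \<xi>\<^sup>2 \<le> \<psi>s \<xi>" using psi_star_quadratic[of "\<bar>\<xi>\<bar>"] by auto
  moreover have "k * \<xi>\<^sup>2 > 0" using \<open>k > 0\<close> \<open>\<xi> \<noteq> 0\<close> by simp
  ultimately show ?thesis by linarith
qed

section \<open>The mobility\<close>

lemma alpha_nonneg: "u \<ge> 0 \<Longrightarrow> v \<ge> 0 \<Longrightarrow> \<alpha> (u, v) \<ge> 0"
  using \<alpha> unfolding admissible_alpha_def by auto

lemma alpha_cont: "continuous_on quadrant \<alpha>"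
  using \<alpha> unfolding admissible_alpha_def by auto

lemma alpha_concave:
  assumes "p \<in> quadrant" "q \<in> quadrant" "0 \<le> t" "t \<le> 1"
  shows "\<alpha> ((1 - t) *\<^sub>R p + t *\<^sub>R q) \<ge> (1 - t) * \<alpha> p + t * \<alpha> q"
proof -
  have "concave_on quadrant \<alpha>" using \<alpha> unfolding admissible_alpha_def by auto
  then show ?thesis using assms by (intro concave_onD)
qed

text \<open>\<open>\<alpha>\<close> is positive at some point \<open>(a, b)\<close>. Any interior
  point is a convex combination of it, with small weight \<open>t\<close>, and another point of the
  quadrant; concavity and nonnegativity conclude. The bounds built into \<open>t\<close> keep that
  other point in the quadrant, and the \<open>+ 1\<close> in them avoids division by zero.\<close>

lemma alpha_pos:
  assumes "u > 0" "v > 0"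
  shows "\<alpha> (u, v) > 0"
proof -
  obtain a b where "a \<ge> 0" "b \<ge> 0" "\<alpha> (a, b) \<noteq> 0"
    using \<alpha> unfolding admissible_alpha_def by auto
  with alpha_nonneg[of a b] have ab: "a \<ge> 0" "b \<ge> 0" "\<alpha> (a, b) > 0" by auto
  define t where "t = min (1/2) (min (u / (a + 1)) (v / (b + 1)))"
  have t: "t > 0" "t < 1" using assms ab by (auto simp: t_def)
  have ta: "t * a \<le> u" "t * b \<le> v"
  proof -
    have "t \<le> u / (a + 1)" "t \<le> v / (b + 1)" by (auto simp: t_def)
    then have "t * a \<le> u / (a + 1) * a" "t * b \<le> v / (b + 1) * b"
      using ab by (auto intro: mult_right_mono simp del: times_divide_eq_left)
    moreover have "u / (a + 1) * a \<le> u" "v / (b + 1) * b \<le> v" using ab assms by (auto simp: field_simps)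
    ultimately show "t * a \<le> u" "t * b \<le> v" by linarith+
  qed
  let ?p = "((u - t * a) / (1 - t), (v - t * b) / (1 - t))"
  have p: "?p \<in> quadrant" using ta t by auto
  have "(1 - t) * \<alpha> ?p + t * \<alpha> (a, b) \<le> \<alpha> ((1 - t) *\<^sub>R ?p + t *\<^sub>R (a, b))"
    using ab t p by (intro alpha_concave) auto
  also have "(1 - t) *\<^sub>R ?p + t *\<^sub>R (a, b) = (u, v)" using t by simp
  finally have "(1 - t) * \<alpha> ?p + t * \<alpha> (a, b) \<le> \<alpha> (u, v)" .
  moreover have "(1 - t) * \<alpha> ?p \<ge> 0" using alpha_nonneg[of "fst ?p" "snd ?p"] p t by simp
  moreover have "t * \<alpha> (a, b) > 0" using t ab by simp
  ultimately show ?thesis by linarith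
qed

lemma alpha_bounded: "\<exists>A\<ge>0. \<forall>u v. 0 \<le> u \<and> u \<le> C \<and> 0 \<le> v \<and> v \<le> C \<longrightarrow> \<alpha> (u, v) \<le> A"
proof -
  have "compact ({0..C} \<times> {0..C})" "continuous_on ({0..C} \<times> {0..C}) \<alpha>"
    using alpha_cont by (auto intro: compact_Times continuous_on_subset)
  then have "bounded (\<alpha> ` ({0..C} \<times> {0..C}))" using compact_continuous_image compact_imp_bounded by blast
  then obtain B where "\<And>p. p \<in> {0..C} \<times> {0..C} \<Longrightarrow> \<bar>\<alpha> p\<bar> \<le> B" by (auto simp: bounded_iff)
  then show ?thesis by (intro exI[of _ "max B 0"]) force
qed

text \<open>Nothing is known of \<open>\<alpha>\<close> outside the quadrant, so the arguments are
  clamped to it.\<close>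

lemma alpha_max_measurable: "(\<lambda>(u, v). \<alpha> (max 0 u, max 0 v)) \<in> borel_measurable borel"
  by (intro borel_measurable_continuous_onI)
     (auto simp: case_prod_beta intro!: continuous_on_compose2[OF alpha_cont] continuous_intros)

end

section \<open>The Fisher integrand\<close>

lemma lsc_on_iff: "lsc_on S g \<longleftrightarrow> (\<forall>p\<in>S. \<forall>c<g p. eventually (\<lambda>q. c < g q) (at p within S))"
  unfolding lsc_on_def le_Liminf_iff by blast

lemma lsc_onD_open:
  assumes "lsc_on S g" "p \<in> S" "c < g p"
  shows "\<exists>U. open U \<and> p \<in> U \<and> (\<forall>q\<in>U \<inter> S. c < g q)"
proof -
  from assms have "eventually (\<lambda>q. c < g q) (at p within S)" unfolding lsc_on_iff by blast
  then obtain U where "open U" "p \<in> U" "\<forall>q\<in>U. q \<noteq> p \<longrightarrow> q \<in> S \<longrightarrow> c < g q"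
    unfolding eventually_at_topological by blast
  with assms(3) show ?thesis by (intro exI[of _ U]) auto
qed

lemma lsc_on_measurable:
  assumes "lsc_on S g" "S \<in> sets borel"
  shows "(\<lambda>p. if p \<in> S then g p else (0 :: ennreal)) \<in> borel_measurable borel"
proof (rule borel_measurableI_greater)
  fix c :: ennreal
  define W where "W = \<Union> {U. open U \<and> (\<forall>q\<in>U \<inter> S. c < g q)}"
  have "{p. c < (if p \<in> S then g p else 0)} = W \<inter> S"
  proof (intro set_eqI iffI)
    fix p assume "p \<in> {p. c < (if p \<in> S then g p else 0)}"
    then have p: "p \<in> S" "c < g p" by (auto split: if_splits)
    from lsc_onD_open[OF assms(1) p] p show "p \<in> W \<inter> S" unfolding W_def by blast
  qed (auto simp: W_def)
  moreover have "open W" unfolding W_def by auto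
  ultimately show "{p \<in> space borel. c < (if p \<in> S then g p else 0)} \<in> sets borel"
    using assms(2) by auto
qed

lemma lsc_envelope_lsc: "lsc_on S (lsc_envelope_on S f)"
  unfolding lsc_on_iff
proof safe
  fix p c assume "p \<in> S" "c < lsc_envelope_on S f p"
  then obtain g where g: "lsc_on S g" "\<forall>q\<in>S. g q \<le> f q" "c < g p"
    unfolding lsc_envelope_on_def by (auto simp: less_SUP_iff)
  then have "eventually (\<lambda>q. c < g q) (at p within S)" using \<open>p \<in> S\<close> unfolding lsc_on_iff by blast
  then show "eventually (\<lambda>q. c < lsc_envelope_on S f q) (at p within S)"
  proof (rule eventually_mono)
    fix q assume "c < g q"
    also have "g q \<le> lsc_envelope_on S f q" unfolding lsc_envelope_on_def using g by (intro SUP_upper) auto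
    finally show "c < lsc_envelope_on S f q" .
  qed
qed

lemma lsc_envelope_le: "p \<in> S \<Longrightarrow> lsc_envelope_on S f p \<le> f p"
  unfolding lsc_envelope_on_def by (rule SUP_least) auto

text \<open>The hypothesis is local at \<open>p\<close>: for \<open>c < f p\<close>, the step
  function with value \<open>c\<close> on a suitable neighbourhood and 0 elsewhere is a lower
  semicontinuous minorant of \<open>f\<close>.\<close>

lemma lsc_envelope_eq:
  fixes f :: "'a::t2_space \<Rightarrow> ennreal"
  assumes "p \<in> S" and lsc: "\<And>c. c < f p \<Longrightarrow> eventually (\<lambda>q. c < f q) (at p within S)"
  shows "lsc_envelope_on S f p = f p"
proof (rule antisym[OF lsc_envelope_le[OF assms(1)]])
  show "f p \<le> lsc_envelope_on S f p"
  proof (rule dense_le)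
    fix c assume c: "c < f p"
    then obtain U where U: "open U" "p \<in> U" "\<forall>q\<in>U. q \<noteq> p \<longrightarrow> q \<in> S \<longrightarrow> c < f q"
      using lsc[OF c] unfolding eventually_at_topological by blast
    define g where "g q = (if q \<in> U then c else 0)" for q
    have "lsc_on S g" unfolding lsc_on_iff
    proof safe
      fix r d assume "d < g r"
      then have "r \<in> U" "d < c" by (auto simp: g_def split: if_splits)
      have "eventually (\<lambda>q. q \<in> U) (at r within S)"
        using \<open>r \<in> U\<close> U(1) by (auto simp: eventually_at_topological)
      then show "eventually (\<lambda>q. d < g q) (at r within S)"
        by eventually_elim (use \<open>d < c\<close> in \<open>simp add: g_def\<close>)
    qed
    moreover have "g q \<le> f q" if "q \<in> S" for q
      using U c that by (cases "q = p") (auto simp: g_def)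
    ultimately have "g p \<le> lsc_envelope_on S f p"
      unfolding lsc_envelope_on_def by (intro SUP_upper) auto
    then show "c \<le> lsc_envelope_on S f p" using U by (simp add: g_def)
  qed
qed

locale convex_fisher = admissible_densities +
  assumes D_convex: "convex_on_ennreal quadrant (D_phi \<phi> \<psi>s \<alpha>)"
begin

abbreviation D :: "real \<times> real \<Rightarrow> ennreal" where "D \<equiv> D_phi \<phi> \<psi>s \<alpha>"

lemma psi_star_ext_0: "psi_star_ext \<psi>s 0 = 0"
  by (simp add: psi_star_ext_def zero_ereal_def psi_star_0)

text \<open>At the two infinite points, continuity of the extended function is the superlinear
  growth of \<open>\<psi>s\<close>.\<close>

lemma psi_star_ext_tendsto:
  assumes "(f \<longlongrightarrow> l) F"
  shows "((\<lambda>x. psi_star_ext \<psi>s (f x)) \<longlongrightarrow> psi_star_ext \<psi>s l) F"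
proof -
  have ext: "psi_star_ext \<psi>s y = (if \<bar>y\<bar> = \<infinity> then \<infinity> else ennreal (\<psi>s (real_of_ereal y)))" for y
    by (cases y) (auto simp: psi_star_ext_def)
  show ?thesis
  proof (cases "\<bar>l\<bar> = \<infinity>")
    case False
    then obtain r where r: "l = ereal r" by auto
    have "eventually (\<lambda>x. f x \<in> {ereal (r - 1)<..<ereal (r + 1)}) F"
      using assms r by (intro topological_tendstoD) auto
    then have ev: "eventually (\<lambda>x. ennreal (\<psi>s (real_of_ereal (f x))) = psi_star_ext \<psi>s (f x)) F"
      by eventually_elim (auto simp: ext)
    have "isCont \<psi>s r" using psi_star_has_deriv DERIV_isCont by blast
    then have "((\<lambda>x. \<psi>s (real_of_ereal (f x))) \<longlongrightarrow> \<psi>s r) F"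
      by (rule isCont_tendsto_compose) (use assms r in auto)
    then have "((\<lambda>x. ennreal (\<psi>s (real_of_ereal (f x)))) \<longlongrightarrow> ennreal (\<psi>s r)) F" by (rule tendsto_ennrealI)
    from Lim_transform_eventually[OF this ev] show ?thesis by (simp add: r ext)
  next
    case True
    have "eventually (\<lambda>x. ennreal B < psi_star_ext \<psi>s (f x)) F" if "B \<ge> 0" for B
    proof -
      obtain b where b: "b > 0" "\<And>\<xi>. \<bar>\<xi>\<bar> \<ge> b \<Longrightarrow> \<psi>s \<xi> \<ge> (B + 1) * \<bar>\<xi>\<bar>"
        using psi_star_superlinearD by blast
      have "eventually (\<lambda>x. ereal (max b 1) < \<bar>f x\<bar>) F"
      proof (cases "l = \<infinity>")
        case True
        then have "eventually (\<lambda>x. ereal (max b 1) < f x) F" using assms tendsto_PInfty by blast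
        then show ?thesis 
        proof eventually_elim
          case (elim x)
          then show ?case by (cases "f x") auto
        qed
      next
        case False
        then have "l = -\<infinity>" using True by auto
        then have "eventually (\<lambda>x. f x < ereal (- max b 1)) F" using assms tendsto_MInfty by blast
        then show ?thesis
        proof eventually_elim
          case (elim x)
          then show ?case by (cases "f x") (auto simp del: ereal_max simp: max_def)
        qed
      qed
      then show ?thesis
      proof eventually_elim
        case (elim x)
        show ?case
        proof (cases "f x")
          case (real r)
          then have r: "\<bar>r\<bar> \<ge> b" "\<bar>r\<bar> \<ge> 1" using elim by auto
          have "(B + 1) * 1 \<le> (B + 1) * \<bar>r\<bar>" using r that by (intro mult_left_mono) auto
          then have "B + 1 \<le> (B + 1) * \<bar>r\<bar>" by simp
          also have "\<dots> \<le> \<psi>s r" by (rule b(2)[OF r(1)])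
          finally have "B < \<psi>s r" by simp
          then show ?thesis using that by (simp add: real psi_star_ext_def ennreal_less_iff)
        qed (auto simp: psi_star_ext_def)
      qed
    qed
    then have "eventually (\<lambda>x. c < psi_star_ext \<psi>s (f x)) F" if "c < \<infinity>" for c
      using that by (cases c) auto
    then have "((\<lambda>x. psi_star_ext \<psi>s (f x)) \<longlongrightarrow> \<infinity>) F"
      by (intro order_tendstoI) auto
    with True show ?thesis by (simp add: ext)
  qed
qed

lemma D_le: "p \<in> quadrant \<Longrightarrow> D p \<le> D_plus \<phi> \<psi>s \<alpha> p"
  unfolding D_phi_def by (rule lsc_envelope_le)

lemma D_lsc: "lsc_on quadrant D"
  unfolding D_phi_def by (rule lsc_envelope_lsc)

text \<open>Where \<open>\<alpha>\<close> is positive and away from the origin,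
  \<open>D_plus\<close> is continuous, so the envelope changes nothing. At the origin
  \<open>Lambda\<close> is 0 by convention rather than by continuity, but no \<open>c\<close> lies
  below the value 0.\<close>

lemma D_eq:
  assumes "u \<ge> 0" "v \<ge> 0" "\<alpha> (u, v) > 0"
  shows "D (u, v) = psi_star_ext \<psi>s (Lambda \<phi> u v) * ennreal (\<alpha> (u, v))"
proof -
  let ?D = "D_plus \<phi> \<psi>s \<alpha>"
  have "D (u, v) = ?D (u, v)"
    unfolding D_phi_def
  proof (rule lsc_envelope_eq)
    show "(u, v) \<in> quadrant" using assms by simp
    fix c assume c: "c < ?D (u, v)"
    show "eventually (\<lambda>q. c < ?D q) (at (u, v) within quadrant)"
    proof (cases "(u, v) = (0, 0)")
      case True
      then show ?thesis using c by (auto simp: D_plus_def Lambda_def psi_star_ext_0 split: if_splits)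
    next
      case False
      let ?F = "at (u, v) within quadrant"
      have cfst: "((\<lambda>q. phi' \<phi> (fst q)) \<longlongrightarrow> phi' \<phi> u) ?F"
      proof (rule topological_tendstoI)
        fix S assume S: "open S" "phi' \<phi> u \<in> S"
        from topological_tendstoD[OF phi'_tendsto[OF assms(1)] S]
        obtain U where U: "open U" "u \<in> U" "\<forall>x\<in>U. x \<noteq> u \<longrightarrow> x \<in> {0..} \<longrightarrow> phi' \<phi> x \<in> S"
          unfolding eventually_at_topological by blast
        show "eventually (\<lambda>q. phi' \<phi> (fst q) \<in> S) ?F"
          unfolding eventually_at_topological using U S
          by (intro exI[of _ "U \<times> UNIV"]) (auto intro!: open_Times)
      qed
      have csnd: "((\<lambda>q. phi' \<phi> (snd q)) \<longlongrightarrow> phi' \<phi> v) ?F"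
      proof (rule topological_tendstoI)
        fix S assume S: "open S" "phi' \<phi> v \<in> S"
        from topological_tendstoD[OF phi'_tendsto[OF assms(2)] S]
        obtain U where U: "open U" "v \<in> U" "\<forall>x\<in>U. x \<noteq> v \<longrightarrow> x \<in> {0..} \<longrightarrow> phi' \<phi> x \<in> S"
          unfolding eventually_at_topological by blast
        show "eventually (\<lambda>q. phi' \<phi> (snd q) \<in> S) ?F"
          unfolding eventually_at_topological using U S
          by (intro exI[of _ "UNIV \<times> U"]) (auto intro!: open_Times)
      qed
      have L: "((\<lambda>q. phi' \<phi> (snd q) - phi' \<phi> (fst q)) \<longlongrightarrow> Lambda \<phi> u v) ?F"
        using tendsto_diff_ereal_general[OF csnd cfst] Lambda_finite[OF assms(1,2) False] False
        by (auto simp: Lambda_def)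
      have a: "(\<alpha> \<longlongrightarrow> \<alpha> (u, v)) ?F"
        using alpha_cont assms by (auto simp: continuous_on_def)
      have lim: "((\<lambda>q. psi_star_ext \<psi>s (phi' \<phi> (snd q) - phi' \<phi> (fst q)) * ennreal (\<alpha> q)) \<longlongrightarrow>
          psi_star_ext \<psi>s (Lambda \<phi> u v) * ennreal (\<alpha> (u, v))) ?F"
        using assms by (intro tendsto_mult_ennreal psi_star_ext_tendsto[OF L] tendsto_ennrealI a) auto
      have "eventually (\<lambda>q. q \<in> - {(0, 0)}) ?F"
        using False by (intro eventually_at_in_open[THEN filter_leD[OF at_le[OF subset_UNIV]]] topological_tendstoD[OF tendsto_ident_at]) auto
      with order_tendstoD(1)[OF a assms(3)]
      have ev: "eventually (\<lambda>q. psi_star_ext \<psi>s (phi' \<phi> (snd q) - phi' \<phi> (fst q)) * ennreal (\<alpha> q) = ?D q) ?F"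
      proof eventually_elim
        case (elim q)
        then have "\<not> (fst q = 0 \<and> snd q = 0)" "\<alpha> (fst q, snd q) > 0" by (auto simp: prod_eq_iff)
        then show ?case unfolding D_plus_def Lambda_def case_prod_beta by (simp only: if_True if_False prod.collapse)
      qed
      have "c < psi_star_ext \<psi>s (Lambda \<phi> u v) * ennreal (\<alpha> (u, v))" using c assms by (simp add: D_plus_def)
      from order_tendstoD(1)[OF lim this] ev show ?thesis by eventually_elim simp
    qed
  qed
  then show ?thesis using assms by (simp add: D_plus_def)
qed

lemma D_0: "D (0, 0) = 0"
proof -
  have "D_plus \<phi> \<psi>s \<alpha> (0, 0) = 0"
    by (simp add: D_plus_def Lambda_def psi_star_ext_0)
  with D_le[of "(0, 0)"] show ?thesis by simp
qed

lemma psi_star_ext_neq_0: "l \<noteq> 0 \<Longrightarrow> psi_star_ext \<psi>s l \<noteq> 0"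
  using psi_star_pos by (cases l) (auto simp: psi_star_ext_def zero_ereal_def ennreal_eq_0_iff not_le)

lemma D_pos_interior:
  assumes "u \<ge> 0" "v \<ge> 0" "u \<noteq> v" "\<alpha> (u, v) > 0"
  shows "D (u, v) \<noteq> 0"
  using psi_star_ext_neq_0[OF Lambda_neq_0[OF assms(1,2,3)]] assms(4)
  by (simp add: D_eq[OF assms(1,2,4)] ennreal_eq_0_iff not_le)

text \<open>At a boundary point where \<open>\<alpha>\<close> vanishes, convexity between this point and the diagonal
  transports a zero of \<open>D\<close> into the interior of the quadrant.\<close>

lemma D_eq_0_iff:
  assumes "u \<ge> 0" "v \<ge> 0"
  shows "D (u, v) = 0 \<longleftrightarrow> u = v"
proof
  assume "u = v"
  show "D (u, v) = 0"
  proof (cases "u = 0")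
    case False
    then have "\<alpha> (u, v) > 0" using alpha_pos assms \<open>u = v\<close> by simp
    with \<open>u = v\<close> assms False show ?thesis
      by (subst D_eq) (auto simp: Lambda_def psi_star_ext_0)
  qed (use \<open>u = v\<close> D_0 in simp)
next
  assume D: "D (u, v) = 0"
  show "u = v"
  proof (rule ccontr)
    assume "u \<noteq> v"
    define w where "w = max u v"
    have w: "w > 0" using assms \<open>u \<noteq> v\<close> unfolding w_def by linarith
    have "\<alpha> (w, w) > 0" by (rule alpha_pos[OF w w])
    then have "D (w, w) = 0"
      using w by (subst D_eq) (auto simp: Lambda_def psi_star_ext_0)
    let ?p = "(1 - 1/2) *\<^sub>R (u, v) + (1/2) *\<^sub>R (w, w)"
    have "D ?p \<le> ennreal (1 - 1/2) * D (u, v) + ennreal (1/2) * D (w, w)"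
      using D_convex assms w unfolding convex_on_ennreal_def by (intro D_convex[unfolded convex_on_ennreal_def, THEN conjunct2, rule_format]) auto
    then have "D ?p = 0" using D \<open>D (w, w) = 0\<close> by simp
    moreover have "?p = ((u + w) / 2, (v + w) / 2)" by (simp add: field_simps)
    ultimately have "D ((u + w) / 2, (v + w) / 2) = 0" by (simp only:)
    moreover have "D ((u + w) / 2, (v + w) / 2) \<noteq> 0"
      using w assms \<open>u \<noteq> v\<close> by (intro D_pos_interior alpha_pos) auto
    ultimately show False by (rule notE[rotated])
  qed
qed

text \<open>By contradiction and compactness. Pairs violating the bound with constant
  \<open>n\<close> accumulate at a zero of \<open>D\<close>, by lower semicontinuity and since the
  left side is bounded; hence at a diagonal point \<open>(a, a)\<close>. If
  \<open>a < \<epsilon>\<close>, the truncated derivative is constant nearby and the left side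
  vanishes. If \<open>a \<ge> \<epsilon>\<close>, then \<open>\<alpha>\<close> is bounded below
  nearby, and the quadratic lower bound of \<open>\<psi>s\<close> yields a fixed constant.\<close>

lemma dphi_cut_grad_sq_le:
  assumes e: "\<epsilon> > 0" and C: "C \<ge> 0"
  shows "\<exists>K\<ge>0. \<forall>u v. 0 \<le> u \<and> u \<le> C \<and> 0 \<le> v \<and> v \<le> C \<longrightarrow>
    ennreal ((dphi_cut \<epsilon> v - dphi_cut \<epsilon> u)\<^sup>2) \<le> ennreal K * D (u, v)"
proof (rule ccontr)
  let ?G = "\<lambda>p. (dphi_cut \<epsilon> (snd p) - dphi_cut \<epsilon> (fst p))\<^sup>2"
  let ?B = "{0..C} \<times> {0..C}"
  assume neg: "\<not> ?thesis"
  have "\<exists>p. p \<in> ?B \<and> ennreal (real n) * D p < ennreal (?G p)" for n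
    using neg[unfolded not_ex, rule_format, of "real n"] by (auto simp: not_le)
  then obtain p where pB: "\<And>n. p n \<in> ?B" and pG: "\<And>n. ennreal (real n) * D (p n) < ennreal (?G (p n))"
    by metis
  have "compact ?B" by (intro compact_Times) auto
  then obtain l r where l: "l \<in> ?B" and r: "strict_mono r" and lim: "(p \<circ> r) \<longlonglongrightarrow> l"
    using pB unfolding compact_def by metis
  define M where "M = \<bar>dphi_cut \<epsilon> 0\<bar> + \<bar>dphi_cut \<epsilon> C\<bar>"
  have GM: "?G q \<le> (2 * M)\<^sup>2" if "q \<in> ?B" for q
  proof -
    have "\<bar>dphi_cut \<epsilon> (snd q) - dphi_cut \<epsilon> (fst q)\<bar> \<le> \<bar>2 * M\<bar>"
      using dphi_cut_bound[OF e, of "snd q" C] dphi_cut_bound[OF e, of "fst q" C] that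
      unfolding M_def by (auto simp: mem_Times_iff)
    then show ?thesis by (simp only: abs_le_square_iff)
  qed
  have Dl: "D l = 0"
  proof (rule ccontr)
    assume "D l \<noteq> 0"
    then obtain c where c: "0 < c" "c < D l" using dense[of 0 "D l"] by (auto simp: zero_less_iff_neq_zero)
    then have cfin: "c < \<infinity>" by (metis infinity_ennreal_def less_top top.not_eq_extremum top_greatest order_less_le_trans)
    obtain c' where c': "c = ennreal c'" "c' > 0" using c(1) cfin by (cases c) auto
    from c l obtain U where U: "open U" "l \<in> U" "\<forall>q\<in>U \<inter> quadrant. c < D q"
      using lsc_onD_open[OF D_lsc, of l c] by auto
    obtain N :: nat where N: "real N * c' > (2 * M)\<^sup>2"
      using reals_Archimedean3[OF c'(2)] by blast
    have "eventually (\<lambda>n. (p \<circ> r) n \<in> U) sequentially" by (rule topological_tendstoD[OF lim U(1,2)])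
    then have "eventually (\<lambda>n. (p \<circ> r) n \<in> U \<and> n \<ge> N) sequentially"
      using eventually_ge_at_top by (rule eventually_conj)
    from eventually_happens'[OF sequentially_bot this]
    obtain n where n: "p (r n) \<in> U" "n \<ge> N" by auto
    have "p (r n) \<in> quadrant" using pB[of "r n"] by (auto simp: mem_Times_iff)
    then have "c \<le> D (p (r n))" using n U by (auto intro: less_imp_le)
    have "r n \<ge> N" using n seq_suble[OF r, of n] by simp
    have "ennreal (real N * c') \<le> ennreal (real (r n)) * D (p (r n))"
      using c' \<open>c \<le> _\<close> \<open>r n \<ge> N\<close> by (simp add: ennreal_mult) (intro mult_mono ennreal_leI, auto)
    also have "\<dots> \<le> ennreal (?G (p (r n)))" using pG[of "r n"] by simp
    also have "\<dots> \<le> ennreal ((2 * M)\<^sup>2)" by (intro ennreal_leI GM pB)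
    finally show False using N by (simp add: ennreal_le_iff2)
  qed
  obtain a where a: "l = (a, a)" "0 \<le> a" "a \<le> C"
    using Dl l D_eq_0_iff[of "fst l" "snd l"] by (cases l) auto
  show False
  proof (cases "a < \<epsilon>")
    case True
    have "eventually (\<lambda>n. (p \<circ> r) n \<in> {..<\<epsilon>} \<times> {..<\<epsilon>}) sequentially"
      using True a by (intro topological_tendstoD[OF lim] open_Times) auto
    from eventually_happens'[OF sequentially_bot this]
    obtain n where "(p \<circ> r) n \<in> {..<\<epsilon>} \<times> {..<\<epsilon>}" by (elim exE)
    then have n: "p (r n) \<in> {..<\<epsilon>} \<times> {..<\<epsilon>}" by simp
    then have "?G (p (r n)) = 0" by (auto simp: dphi_cut_def max_def mem_Times_iff)
    with pG[of "r n"] show False by simp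
  next
    case False
    have apos: "\<alpha> (a, a) > 0" using False e by (intro alpha_pos) auto
    define A where "A = \<alpha> (a, a) / 2"
    have A: "A > 0" "A < \<alpha> (a, a)" using apos by (auto simp: A_def)
    \<comment> \<open>\<open>m\<close> bounds the derivative of \<open>\<phi>\<close> between
      \<open>\<epsilon> / 2\<close> and \<open>C\<close>, so \<open>2 * m\<close> bounds the
      arguments of \<open>\<psi>s\<close> that occur near \<open>(a, a)\<close>.\<close>
    define m where "m = \<bar>deriv \<phi> (\<epsilon> / 2)\<bar> + \<bar>deriv \<phi> C\<bar>"
    obtain k where k: "k > 0" "\<And>\<xi>. \<bar>\<xi>\<bar> \<le> 2 * m \<Longrightarrow> k * \<xi>\<^sup>2 \<le> \<psi>s \<xi>"
      using psi_star_quadratic[of "2 * m"] by blast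
    obtain N :: nat where N: "real N * (k * A) > 1"
      using reals_Archimedean3[of "k * A"] k A by auto
    have 1: "eventually (\<lambda>n. (p \<circ> r) n \<in> {\<epsilon>/2<..} \<times> {\<epsilon>/2<..}) sequentially"
      using False a e by (intro topological_tendstoD[OF lim] open_Times) auto
    have "(\<lambda>n. \<alpha> ((p \<circ> r) n)) \<longlonglongrightarrow> \<alpha> l"
      using pB l by (intro continuous_on_tendsto_compose[OF alpha_cont lim]) (auto simp: mem_Times_iff)
    then have 2: "eventually (\<lambda>n. A < \<alpha> ((p \<circ> r) n)) sequentially"
      using A a by (intro order_tendstoD) auto
    have "eventually (\<lambda>n. (p \<circ> r) n \<in> {\<epsilon>/2<..} \<times> {\<epsilon>/2<..} \<and> A < \<alpha> ((p \<circ> r) n) \<and> n \<ge> N) sequentially"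
      by (intro eventually_conj 1 2 eventually_ge_at_top)
    from eventually_happens'[OF sequentially_bot this]
    obtain n where "(p \<circ> r) n \<in> {\<epsilon>/2<..} \<times> {\<epsilon>/2<..} \<and> A < \<alpha> ((p \<circ> r) n) \<and> n \<ge> N"
      by (elim exE)
    then have n: "p (r n) \<in> {\<epsilon>/2<..} \<times> {\<epsilon>/2<..}" "A < \<alpha> (p (r n))" "n \<ge> N" by simp_all
    obtain u v where uv: "p (r n) = (u, v)" by (cases "p (r n)")
    have b: "\<epsilon>/2 < u" "u \<le> C" "\<epsilon>/2 < v" "v \<le> C" "A < \<alpha> (u, v)" using n uv pB[of "r n"] by auto
    let ?\<xi> = "deriv \<phi> v - deriv \<phi> u"
    have "\<bar>deriv \<phi> u\<bar> \<le> m" "\<bar>deriv \<phi> v\<bar> \<le> m"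
      using deriv_phi_mono[of "\<epsilon>/2" u] deriv_phi_mono[of u C] deriv_phi_mono[of "\<epsilon>/2" v] deriv_phi_mono[of v C] b e
      unfolding m_def by auto
    then have "k * ?\<xi>\<^sup>2 \<le> \<psi>s ?\<xi>" by (intro k(2)) auto
    moreover have "?G (u, v) \<le> ?\<xi>\<^sup>2"
    proof -
      have "\<bar>dphi_cut \<epsilon> v - dphi_cut \<epsilon> u\<bar> \<le> \<bar>?\<xi>\<bar>"
        using dphi_cut_grad_le[OF e, of u v] b e by (simp add: Lambda_pos)
      then show ?thesis by (simp add: abs_le_square_iff)
    qed
    ultimately have "k * ?G (u, v) \<le> \<psi>s ?\<xi>" using k(1) by (meson dual_order.trans less_imp_le mult_left_mono)
    then have "k * ?G (u, v) * A \<le> \<psi>s ?\<xi> * \<alpha> (u, v)"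
      using b A by (intro mult_mono) (auto simp: psi_star_nonneg)
    then have "ennreal (k * A * ?G (u, v)) \<le> D (u, v)"
      using b e A by (simp add: D_eq Lambda_pos psi_star_ext_def psi_star_nonneg ennreal_mult[symmetric] mult_ac ennreal_leI)
    then have "ennreal (real (r n)) * ennreal (k * A * ?G (u, v)) \<le> ennreal (real (r n)) * D (u, v)"
      by (rule mult_left_mono) simp
    also have "\<dots> < ennreal (?G (u, v))" using pG[of "r n"] uv by simp
    finally have lt: "real (r n) * (k * A * ?G (u, v)) < ?G (u, v)"
      using k A by (simp add: ennreal_mult'[symmetric] ennreal_less_iff)
    have "r n \<ge> N" using n seq_suble[OF r, of n] by simp
    then have "real N * (k * A) * ?G (u, v) \<le> real (r n) * (k * A) * ?G (u, v)"
      using k A by (intro mult_right_mono) auto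
    moreover have "1 * ?G (u, v) \<le> real N * (k * A) * ?G (u, v)"
      using N by (intro mult_right_mono) auto
    ultimately show False using lt by (simp add: mult_ac)
  qed
qed

lemma D_max_measurable: "(\<lambda>(u, v). D (max 0 u, max 0 v)) \<in> borel_measurable borel"
proof -
  have "closed (quadrant :: (real \<times> real) set)" by (intro closed_Times) auto
  then have m: "(\<lambda>p. if p \<in> quadrant then D p else 0) \<in> borel_measurable borel"
    by (intro lsc_on_measurable D_lsc) auto
  have "(\<lambda>(u, v). (max 0 u, max 0 v)) \<in> borel_measurable (borel :: (real \<times> real) measure)"
    by (intro borel_measurable_continuous_onI) (auto simp: case_prod_beta intro!: continuous_intros)
  from measurable_compose[OF this m] show ?thesis by (simp add: case_prod_beta)
qed

end

section \<open>Chain rule for lower semicontinuous functions of time\<close>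

lemma integral_shrinking_tendsto_0:
  fixes k :: "real \<Rightarrow> real"
  assumes "integrable lborel k"
  shows "(\<lambda>n. \<integral>r. indicator {x<..<x + 1 / real (Suc n)} r * k r \<partial>lborel) \<longlonglongrightarrow> 0"
proof -
  have "(\<lambda>n. \<integral>r. indicator {x<..<x + 1 / real (Suc n)} r * k r \<partial>lborel) \<longlonglongrightarrow> (\<integral>r. 0 \<partial>(lborel :: real measure))"
  proof (rule integral_dominated_convergence[where w = "\<lambda>r. \<bar>k r\<bar>"])
    show "AE r in lborel. (\<lambda>n. indicator {x<..<x + 1 / real (Suc n)} r * k r) \<longlonglongrightarrow> 0"
    proof (rule AE_I2)
      fix r :: real
      have "eventually (\<lambda>n. \<not> (x < r \<and> r < x + 1 / real (Suc n))) sequentially"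
      proof (cases "x < r")
        case True
        have "(\<lambda>n. 1 / real (Suc n)) \<longlonglongrightarrow> 0" using LIMSEQ_inverse_real_of_nat by (simp add: inverse_eq_divide)
        then have "eventually (\<lambda>n. 1 / real (Suc n) < r - x) sequentially" using True by (intro order_tendstoD) auto
        then show ?thesis by eventually_elim auto
      qed simp
      then have "eventually (\<lambda>n. indicator {x<..<x + 1 / real (Suc n)} r * k r = 0) sequentially"
        by eventually_elim (auto simp: indicator_def)
      then show "(\<lambda>n. indicator {x<..<x + 1 / real (Suc n)} r * k r) \<longlonglongrightarrow> 0" by (rule tendsto_eventually)
    qed
  qed (use assms in \<open>auto simp: indicator_def\<close>)
  then show ?thesis by simp
qed

text \<open>The average of \<open>E\<close> over the interval of length \<open>1 / Suc n\<close> to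
  the right of \<open>x\<close> tends to \<open>E x\<close>. The chain rule is read off from such
  averages, and lower semicontinuity alone does not recover the value at an endpoint from
  them.\<close>

definition right_average_conv :: "(real \<Rightarrow> real) \<Rightarrow> real \<Rightarrow> bool" where
  "right_average_conv E x \<longleftrightarrow>
    (\<lambda>n. real (Suc n) * (\<integral>r. indicator {x<..<x + 1 / real (Suc n)} r * E r \<partial>lborel)) \<longlonglongrightarrow> E x"

text \<open>Here \<open>f\<close> stands for the gradient of the test function, \<open>g\<close> for
  the density of the flux, and \<open>A\<close>, \<open>B\<close> for the two terms of Young's
  inequality. The factors in \<open>fg_bound\<close> stand at different times because the gradient
  at \<open>t\<close> is tested against the flux at nearby times.\<close>

locale time_pairing = sigma_finite_measure \<eta> for \<eta> :: "'z measure" +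
  fixes f g A B :: "real \<times> 'z \<Rightarrow> real" and M :: real
  assumes f_meas[measurable]: "f \<in> borel_measurable (lborel \<Otimes>\<^sub>M \<eta>)"
    and g_meas[measurable]: "g \<in> borel_measurable (lborel \<Otimes>\<^sub>M \<eta>)"
    and f_bound: "\<And>p. \<bar>f p\<bar> \<le> M"
    and A_int: "integrable (lborel \<Otimes>\<^sub>M \<eta>) A" and B_int: "integrable (lborel \<Otimes>\<^sub>M \<eta>) B"
    and A_nonneg: "\<And>p. A p \<ge> 0" and B_nonneg: "\<And>p. B p \<ge> 0"
    and fg_bound: "\<And>t r z. \<bar>f (t, z) * g (r, z)\<bar> \<le> A (t, z) + B (r, z)"
    and g_int: "AE z in \<eta>. integrable lborel (\<lambda>t. g (t, z))"
begin

sublocale P: pair_sigma_finite lborel \<eta> ..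

lemma A_meas[measurable]: "A \<in> borel_measurable (lborel \<Otimes>\<^sub>M \<eta>)"
  and B_meas[measurable]: "B \<in> borel_measurable (lborel \<Otimes>\<^sub>M \<eta>)"
  using A_int B_int by auto

definition pairing :: "real \<Rightarrow> real \<Rightarrow> real" where
  "pairing t r = (\<integral>z. f (t, z) * g (r, z) \<partial>\<eta>)"

lemma pairing_meas[measurable]: "case_prod pairing \<in> borel_measurable (lborel \<Otimes>\<^sub>M lborel)"
  unfolding pairing_def by measurable

definition Abar :: "real \<Rightarrow> real" where "Abar t = (\<integral>z. A (t, z) \<partial>\<eta>)"
definition Bbar :: "real \<Rightarrow> real" where "Bbar t = (\<integral>z. B (t, z) \<partial>\<eta>)"

lemma Abar_int: "integrable lborel Abar" and Bbar_int: "integrable lborel Bbar"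
  unfolding Abar_def Bbar_def by (intro P.integrable_fst' A_int B_int)+

lemma Abar_nonneg: "Abar t \<ge> 0" and Bbar_nonneg: "Bbar t \<ge> 0"
  unfolding Abar_def Bbar_def by (auto simp: A_nonneg B_nonneg)

lemma pairing_bound:
  assumes "integrable \<eta> (\<lambda>z. A (t, z))" "integrable \<eta> (\<lambda>z. B (r, z))"
  shows "\<bar>pairing t r\<bar> \<le> Abar t + Bbar r"
proof -
  have "\<bar>pairing t r\<bar> \<le> (\<integral>z. \<bar>f (t, z) * g (r, z)\<bar> \<partial>\<eta>)"
    unfolding pairing_def by (rule integral_abs_bound)
  also have "\<dots> \<le> (\<integral>z. A (t, z) + B (r, z) \<partial>\<eta>)"
    using assms fg_bound A_nonneg B_nonneg by (intro integral_mono') (auto intro!: add_nonneg_nonneg)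
  also have "\<dots> = Abar t + Bbar r" using assms by (simp add: Abar_def Bbar_def)
  finally show ?thesis .
qed

lemma B_shift: "integrable (lborel \<Otimes>\<^sub>M \<eta>) (\<lambda>(t, z). B (t + s, z))"
  "(\<integral>(t, z). B (t + s, z) \<partial>(lborel \<Otimes>\<^sub>M \<eta>)) = integral\<^sup>L (lborel \<Otimes>\<^sub>M \<eta>) B"
proof -
  have m: "(\<lambda>(t, z). B (t + s, z)) \<in> borel_measurable (lborel \<Otimes>\<^sub>M \<eta>)"
    by measurable
  have *: "(\<integral>\<^sup>+p. ennreal (case p of (t, z) \<Rightarrow> B (t + s, z)) \<partial>(lborel \<Otimes>\<^sub>M \<eta>)) = (\<integral>\<^sup>+p. ennreal (B p) \<partial>(lborel \<Otimes>\<^sub>M \<eta>))"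
  proof -
    have "(\<integral>\<^sup>+p. ennreal (case p of (t, z) \<Rightarrow> B (t + s, z)) \<partial>(lborel \<Otimes>\<^sub>M \<eta>)) = (\<integral>\<^sup>+z. (\<integral>\<^sup>+t. ennreal (B (s + 1 * t, z)) \<partial>lborel) \<partial>\<eta>)"
      by (subst P.nn_integral_snd[symmetric]) (auto simp: add.commute)
    also have "\<dots> = (\<integral>\<^sup>+z. (\<integral>\<^sup>+t. ennreal (B (t, z)) \<partial>lborel) \<partial>\<eta>)"
    proof (rule nn_integral_cong)
      fix z assume z: "z \<in> space \<eta>"
      have "(\<lambda>t. B (t, z)) \<in> borel_measurable lborel" using measurable_Pair1[OF B_meas z] .
      then show "(\<integral>\<^sup>+t. ennreal (B (s + 1 * t, z)) \<partial>lborel) = (\<integral>\<^sup>+t. ennreal (B (t, z)) \<partial>lborel)"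
        by (subst nn_integral_real_affine[of "\<lambda>t. ennreal (B (t, z))" 1 s]) auto
    qed
    also have "\<dots> = (\<integral>\<^sup>+p. ennreal (B p) \<partial>(lborel \<Otimes>\<^sub>M \<eta>))"
      by (subst P.nn_integral_snd[symmetric]) auto
    finally show ?thesis .
  qed
  show i: "integrable (lborel \<Otimes>\<^sub>M \<eta>) (\<lambda>(t, z). B (t + s, z))"
    using * B_int B_nonneg by (intro integrableI_nonneg m) (auto simp: integrable_iff_bounded)
  have "ennreal (\<integral>(t, z). B (t + s, z) \<partial>(lborel \<Otimes>\<^sub>M \<eta>)) = ennreal (integral\<^sup>L (lborel \<Otimes>\<^sub>M \<eta>) B)"
  proof -
    have "(\<integral>\<^sup>+p. ennreal (case p of (t, z) \<Rightarrow> B (t + s, z)) \<partial>(lborel \<Otimes>\<^sub>M \<eta>)) = ennreal (\<integral>(t, z). B (t + s, z) \<partial>(lborel \<Otimes>\<^sub>M \<eta>))"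
      by (rule nn_integral_eq_integral[OF i]) (auto simp: B_nonneg)
    with nn_integral_eq_integral[OF B_int] * show ?thesis by (simp add: B_nonneg)
  qed
  then show "(\<integral>(t, z). B (t + s, z) \<partial>(lborel \<Otimes>\<^sub>M \<eta>)) = integral\<^sup>L (lborel \<Otimes>\<^sub>M \<eta>) B"
    using B_nonneg by (subst (asm) ennreal_inj) (auto intro!: integral_nonneg_AE)
qed

text \<open>Bounds the \<open>L\<^sup>1\<close> norm of \<open>Fs s\<close> for every shift
  \<open>s\<close>, because translation in time preserves the integral of \<open>B\<close>.\<close>

definition W :: real where "W = integral\<^sup>L (lborel \<Otimes>\<^sub>M \<eta>) A + integral\<^sup>L (lborel \<Otimes>\<^sub>M \<eta>) B"

definition Fs :: "real \<Rightarrow> real \<times> 'z \<Rightarrow> real" where "Fs s = (\<lambda>(t, z). f (t, z) * g (t + s, z))"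

lemma Fs_meas[measurable]: "Fs s \<in> borel_measurable (lborel \<Otimes>\<^sub>M \<eta>)"
  unfolding Fs_def by measurable

lemma Fs_int: "integrable (lborel \<Otimes>\<^sub>M \<eta>) (Fs s)"
  and Fs_norm: "(\<integral>p. \<bar>Fs s p\<bar> \<partial>(lborel \<Otimes>\<^sub>M \<eta>)) \<le> W"
proof -
  have i: "integrable (lborel \<Otimes>\<^sub>M \<eta>) (\<lambda>p. A p + (case p of (t, z) \<Rightarrow> B (t + s, z)))"
    by (intro Bochner_Integration.integrable_add A_int B_shift)
  have le: "\<bar>Fs s p\<bar> \<le> A p + (case p of (t, z) \<Rightarrow> B (t + s, z))" for p
    using fg_bound by (cases p) (simp add: Fs_def)
  show F: "integrable (lborel \<Otimes>\<^sub>M \<eta>) (Fs s)"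
    using le A_nonneg B_nonneg by (intro Bochner_Integration.integrable_bound[OF i]) (auto intro!: AE_I2 order_trans[OF le abs_ge_self])
  have "(\<integral>p. \<bar>Fs s p\<bar> \<partial>(lborel \<Otimes>\<^sub>M \<eta>)) \<le> (\<integral>p. A p + (case p of (t, z) \<Rightarrow> B (t + s, z)) \<partial>(lborel \<Otimes>\<^sub>M \<eta>))"
    using le F by (intro integral_mono i) auto
  also have "\<dots> = W" using B_shift[of s] A_int by (simp add: W_def)
  finally show "(\<integral>p. \<bar>Fs s p\<bar> \<partial>(lborel \<Otimes>\<^sub>M \<eta>)) \<le> W" .
qed

definition \<Phi> :: "real \<Rightarrow> real" where "\<Phi> s = integral\<^sup>L (lborel \<Otimes>\<^sub>M \<eta>) (Fs s)"

lemma Phi_pairing: "\<Phi> s = (\<integral>t. pairing t (t + s) \<partial>lborel)"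
  and pairing_shift_int: "integrable lborel (\<lambda>t. pairing t (t + s))"
  and pairing_shift_norm: "(\<integral>t. \<bar>pairing t (t + s)\<bar> \<partial>lborel) \<le> W"
proof -
  have *: "pairing t (t + s) = (\<integral>z. Fs s (t, z) \<partial>\<eta>)" for t by (simp add: pairing_def Fs_def)
  show "\<Phi> s = (\<integral>t. pairing t (t + s) \<partial>lborel)"
    unfolding \<Phi>_def * by (rule P.integral_fst'[OF Fs_int, symmetric])
  show i: "integrable lborel (\<lambda>t. pairing t (t + s))"
    unfolding * by (rule P.integrable_fst'[OF Fs_int])
  have j: "integrable (lborel \<Otimes>\<^sub>M \<eta>) (\<lambda>p. \<bar>Fs s p\<bar>)" using Fs_int by (rule integrable_abs)
  have "(\<integral>t. \<bar>pairing t (t + s)\<bar> \<partial>lborel) \<le> (\<integral>t. (\<integral>z. \<bar>Fs s (t, z)\<bar> \<partial>\<eta>) \<partial>lborel)"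
    using i P.integrable_fst'[OF j] unfolding * by (intro integral_mono integrable_abs integral_abs_bound)
  also have "\<dots> = (\<integral>p. \<bar>Fs s p\<bar> \<partial>(lborel \<Otimes>\<^sub>M \<eta>))"
    by (rule P.integral_fst'[OF j])
  also have "\<dots> \<le> W" by (rule Fs_norm)
  finally show "(\<integral>t. \<bar>pairing t (t + s)\<bar> \<partial>lborel) \<le> W" .
qed

text \<open>Translation continuity is only needed for fixed \<open>z\<close>, where it is that of \<open>L\<^sup>1(\<real>)\<close>; the bound
  \<open>A + B\<close> has a \<open>t\<close>-integral that does not depend on the shift.\<close>

lemma Phi_tendsto:
  assumes "x \<longlonglongrightarrow> 0"
  shows "(\<lambda>n. \<Phi> (x n)) \<longlonglongrightarrow> \<Phi> 0"
proof -
  define q where "q s z = (\<integral>t. f (t, z) * g (t + s, z) \<partial>lborel)" for s z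
  have qeq: "q s z = (\<integral>t. Fs s (t, z) \<partial>lborel)" for s z by (simp add: q_def Fs_def)
  have Phi: "\<Phi> s = (\<integral>z. q s z \<partial>\<eta>)" for s
    using P.integral_snd[of "\<lambda>t z. Fs s (t, z)"] Fs_int[of s] by (simp add: \<Phi>_def qeq)
  define w where "w z = (\<integral>t. A (t, z) \<partial>lborel) + (\<integral>t. B (t, z) \<partial>lborel)" for z
  have wi: "integrable \<eta> w"
    unfolding w_def using P.integrable_snd[of "\<lambda>t z. A (t, z)"] P.integrable_snd[of "\<lambda>t z. B (t, z)"] A_int B_int by auto
  have AEA: "AE z in \<eta>. integrable lborel (\<lambda>t. A (t, z))" "AE z in \<eta>. integrable lborel (\<lambda>t. B (t, z))"
    using P.AE_integrable_snd[of "\<lambda>t z. A (t, z)"] P.AE_integrable_snd[of "\<lambda>t z. B (t, z)"] A_int B_int by auto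
  show ?thesis unfolding Phi
  proof (rule integral_dominated_convergence[where w = w])
    show "q 0 \<in> borel_measurable \<eta>" "\<And>n. q (x n) \<in> borel_measurable \<eta>"
      unfolding q_def by measurable
    show "integrable \<eta> w" by (rule wi)
    show "AE z in \<eta>. (\<lambda>n. q (x n) z) \<longlonglongrightarrow> q 0 z"
      using g_int AE_space
    proof eventually_elim
      case (elim z)
      have fm[measurable]: "(\<lambda>t. f (t, z)) \<in> borel_measurable lborel" using measurable_Pair1[OF f_meas] elim by auto
      have gs: "integrable lborel (\<lambda>t. g (t + s, z))" for s
        using lborel_integrable_real_affine[OF elim(1), of 1 s] by (simp add: add.commute)
      have fgs: "integrable lborel (\<lambda>t. f (t, z) * g (t + s, z))" for s
      proof (rule Bochner_Integration.integrable_bound[of _ "\<lambda>t. M * g (t + s, z)"])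
        show "integrable lborel (\<lambda>t. M * g (t + s, z))" using gs by auto
        show "AE t in lborel. norm (f (t, z) * g (t + s, z)) \<le> norm (M * g (t + s, z))"
          using order_trans[OF f_bound abs_ge_self] by (intro AE_I2) (simp add: abs_mult mult_right_mono)
      qed (use gs[of s] in measurable)
      have le: "\<bar>q s z - q 0 z\<bar> \<le> M * (\<integral>t. \<bar>g (t + s, z) - g (t, z)\<bar> \<partial>lborel)" for s
      proof -
        have "q s z - q 0 z = (\<integral>t. f (t, z) * (g (t + s, z) - g (t, z)) \<partial>lborel)"
          using fgs[of s] fgs[of 0] by (simp add: q_def right_diff_distrib)
        also have "\<bar>\<dots>\<bar> \<le> (\<integral>t. \<bar>f (t, z) * (g (t + s, z) - g (t, z))\<bar> \<partial>lborel)"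
          by (rule integral_abs_bound)
        also have "\<dots> \<le> (\<integral>t. M * \<bar>g (t + s, z) - g (t, z)\<bar> \<partial>lborel)"
          using gs[of s] elim(1) f_bound by (intro integral_mono') (auto simp: abs_mult intro!: mult_right_mono mult_nonneg_nonneg order_trans[OF abs_ge_zero f_bound])
        finally show ?thesis by simp
      qed
      have t0: "((\<lambda>s. \<integral>t. \<bar>g (t + s, z) - g (t, z)\<bar> \<partial>lborel) \<longlongrightarrow> 0) (at 0)"
        using L1_translation_continuous[OF elim(1)] .
      have "isCont (\<lambda>s. \<integral>t. \<bar>g (t + s, z) - g (t, z)\<bar> \<partial>lborel) 0"
        using t0 by (simp add: isCont_def)
      from isCont_tendsto_compose[OF this assms]
      have "(\<lambda>n. \<integral>t. \<bar>g (t + x n, z) - g (t, z)\<bar> \<partial>lborel) \<longlonglongrightarrow> 0" by simp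
      from tendsto_mult_left[OF this, of M]
      have "(\<lambda>n. M * (\<integral>t. \<bar>g (t + x n, z) - g (t, z)\<bar> \<partial>lborel)) \<longlonglongrightarrow> 0" by simp
      then have "(\<lambda>n. q (x n) z - q 0 z) \<longlonglongrightarrow> 0"
        by (rule Lim_null_comparison[rotated]) (auto intro!: always_eventually le)
      then show ?case by (simp add: LIM_zero_iff)
    qed
    show "AE z in \<eta>. norm (q (x n) z) \<le> w z" for n
      using AEA
    proof eventually_elim
      case (elim z)
      have Bs: "integrable lborel (\<lambda>t. B (t + s, z))" "(\<integral>t. B (t + s, z) \<partial>lborel) = (\<integral>t. B (t, z) \<partial>lborel)" for s
        using lborel_integrable_real_affine[OF elim(2), of 1 s] lborel_integral_real_affine[of 1 "\<lambda>t. B (t, z)" s]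
        by (simp_all add: add.commute)
      have "\<bar>q (x n) z\<bar> \<le> (\<integral>t. \<bar>f (t, z) * g (t + x n, z)\<bar> \<partial>lborel)"
        unfolding q_def by (rule integral_abs_bound)
      also have "\<dots> \<le> (\<integral>t. A (t, z) + B (t + x n, z) \<partial>lborel)"
        using elim(1) Bs fg_bound A_nonneg B_nonneg by (intro integral_mono') (auto intro!: add_nonneg_nonneg)
      also have "\<dots> = w z" using elim(1) Bs by (simp add: w_def)
      finally show ?case by simp
    qed
  qed
qed

lemma Phi_meas[measurable]: "\<Phi> \<in> borel_measurable borel"
proof -
  have "(\<lambda>s. \<integral>t. pairing t (t + s) \<partial>lborel) \<in> borel_measurable lborel" by measurable
  then show ?thesis by (simp add: Phi_pairing[abs_def])
qed

lemma Phi_bound: "\<bar>\<Phi> s\<bar> \<le> W"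
  unfolding \<Phi>_def using integral_abs_bound[of "lborel \<Otimes>\<^sub>M \<eta>" "Fs s"] Fs_norm[of s] by (rule order_trans)

text \<open>Rescaling maps all the intervals to the unit interval, where dominated convergence
  applies with the bound \<open>W\<close>.\<close>

lemma Phi_average:
  "(\<lambda>n. real (Suc n) * (\<integral>s. indicator {0<..<1 / real (Suc n)} s * \<Phi> s \<partial>lborel)) \<longlonglongrightarrow> \<Phi> 0"
proof -
  have eq: "real (Suc n) * (\<integral>s. indicator {0<..<1 / real (Suc n)} s * \<Phi> s \<partial>lborel)
      = (\<integral>s. indicator {0<..<1} s * \<Phi> (s / real (Suc n)) \<partial>lborel)" for n
  proof -
    have "(\<integral>s. indicator {0<..<1 / real (Suc n)} s * \<Phi> s \<partial>lborel)
       = (1 / real (Suc n)) * (\<integral>s. indicator {0<..<1 / real (Suc n)} (0 + 1 / real (Suc n) * s) * \<Phi> (0 + 1 / real (Suc n) * s) \<partial>lborel)"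
      by (subst lborel_integral_real_affine[of "1 / real (Suc n)" _ 0]) auto
    also have "(\<lambda>s. indicator {0<..<1 / real (Suc n)} (0 + 1 / real (Suc n) * s) * \<Phi> (0 + 1 / real (Suc n) * s))
       = (\<lambda>s. indicator {0<..<1} s * \<Phi> (s / real (Suc n)))"
      by (auto simp: fun_eq_iff indicator_def divide_less_cancel zero_less_divide_iff simp del: of_nat_Suc)
    finally show ?thesis by simp
  qed
  have "(\<lambda>n. \<integral>s. indicator {0<..<1} s * \<Phi> (s / real (Suc n)) \<partial>lborel) \<longlonglongrightarrow> (\<integral>s. indicator {0<..<1::real} s * \<Phi> 0 \<partial>lborel)"
  proof (rule integral_dominated_convergence[where w = "\<lambda>s::real. indicator {0<..<1} s * W"])
    show "AE s in lborel. (\<lambda>n. indicator {0<..<1} s * \<Phi> (s / real (Suc n))) \<longlonglongrightarrow> indicator {0<..<1} s * \<Phi> 0"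
    proof (intro AE_I2 tendsto_mult_left Phi_tendsto)
      fix s :: real
      show "(\<lambda>n. s / real (Suc n)) \<longlonglongrightarrow> 0"
        using tendsto_mult_left[OF LIMSEQ_inverse_real_of_nat, of s] by (simp add: divide_inverse)
    qed
    show "AE s in lborel. norm (indicator {0<..<1} s * \<Phi> (s / real (Suc n))) \<le> indicator {0<..<1} s * W" for n
      using Phi_bound by (intro AE_I2) (auto simp: indicator_def)
  qed auto
  then show ?thesis unfolding eq by simp
qed

text \<open>Lower semicontinuity gives the lower bound on the averages. For the upper bound the test
  function is taken at a generic later time \<open>r\<close>, since at \<open>x\<close> itself it
  need not be admissible; averaging over \<open>r\<close> makes the pairing small because
  \<open>A\<close> and \<open>B\<close> are integrable in time.\<close>

lemma right_average_convI:
  fixes E :: "real \<Rightarrow> real"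
  assumes E[measurable]: "E \<in> borel_measurable borel" and bd: "\<And>t. \<bar>E t\<bar> \<le> C" and "d > 0"
    and lsc: "\<And>e. e > 0 \<Longrightarrow> \<exists>\<delta>>0. \<forall>r. \<bar>r - x\<bar> < \<delta> \<longrightarrow> E r \<ge> E x - e"
    and up: "AE r in lborel. x < r \<longrightarrow> r < x + d \<longrightarrow>
       E r - E x \<le> (\<integral>q. indicator {x<..<r} q * pairing r q \<partial>lborel)"
  shows "right_average_conv E x"
proof -
  let ?h = "\<lambda>n. 1 / real (Suc n)"
  let ?I = "\<lambda>n r. indicator {x<..<x + ?h n} r :: real"
  have h0: "?h \<longlonglongrightarrow> 0" using LIMSEQ_inverse_real_of_nat by (simp add: inverse_eq_divide)
  define avg where "avg n = real (Suc n) * (\<integral>r. ?I n r * E r \<partial>lborel)" for n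
  have iE: "integrable lborel (\<lambda>r. ?I n r * E r)" for n
  proof (rule Bochner_Integration.integrable_bound[of _ "\<lambda>r. ?I n r * C"])
    show "AE r in lborel. norm (?I n r * E r) \<le> norm (?I n r * C)"
      using bd by (intro AE_I2) (auto simp: indicator_def intro: order_trans[OF _ abs_ge_self])
  qed auto
  have avg0: "avg n - E x = real (Suc n) * (\<integral>r. ?I n r * (E r - E x) \<partial>lborel)" for n
  proof -
    have "(\<integral>r. ?I n r * (E r - E x) \<partial>lborel) = (\<integral>r. ?I n r * E r \<partial>lborel) - ?h n * E x"
      using iE[of n] by (simp add: right_diff_distrib)
    then show ?thesis by (simp add: avg_def right_diff_distrib)
  qed
  have iEx: "integrable lborel (\<lambda>r. ?I n r * (E r - E x))" for n
    using iE[of n] by (simp add: right_diff_distrib)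
  have lower: "eventually (\<lambda>n. avg n - E x > - e) sequentially" if "e > 0" for e
  proof -
    obtain \<delta> where \<delta>: "\<delta> > 0" "\<And>r. \<bar>r - x\<bar> < \<delta> \<Longrightarrow> E r \<ge> E x - e / 2"
      using lsc[of "e / 2"] \<open>e > 0\<close> by auto
    have "eventually (\<lambda>n. ?h n < \<delta>) sequentially" using h0 \<delta> by (intro order_tendstoD) auto
    then show ?thesis
    proof eventually_elim
      case (elim n)
      have "(\<integral>r. ?I n r * (- e / 2) \<partial>lborel) \<le> (\<integral>r. ?I n r * (E r - E x) \<partial>lborel)"
      proof (rule integral_mono[OF _ iEx])
        fix r show "?I n r * (- e / 2) \<le> ?I n r * (E r - E x)"
          using \<delta>(2)[of r] elim by (auto simp: indicator_def)
      qed simp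
      then have "real (Suc n) * (?h n * (- e / 2)) \<le> avg n - E x"
        unfolding avg0 by (intro mult_left_mono) auto
      moreover have "real (Suc n) * (?h n * (- e / 2)) = - e / 2" by (simp del: of_nat_Suc)
      ultimately have "- e / 2 \<le> avg n - E x" by (simp only:)
      then show ?case using \<open>e > 0\<close> by linarith
    qed
  qed
  \<comment> \<open>For \<open>r\<close> in the window of length \<open>h = 1 / Suc n\<close>, the
    pairing integrated over \<open>q\<close> is at most \<open>h * Abar r\<close> plus the integral
    of \<open>Bbar\<close> over the window. The average of this bound over \<open>r\<close> is
    exactly \<open>\<beta> n\<close>.\<close>
  define \<beta> where "\<beta> n = (\<integral>r. ?I n r * Abar r \<partial>lborel) + (\<integral>r. ?I n r * Bbar r \<partial>lborel)" for n
  have \<beta>0: "\<beta> \<longlonglongrightarrow> 0"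
    unfolding \<beta>_def using tendsto_add[OF integral_shrinking_tendsto_0[OF Abar_int] integral_shrinking_tendsto_0[OF Bbar_int]] by simp
  have iA: "integrable lborel (\<lambda>r. ?I n r * Abar r)" "integrable lborel (\<lambda>r. ?I n r * Bbar r)" for n
    using integrable_real_mult_indicator[of "{x<..<x + ?h n}" lborel Abar] Abar_int
      integrable_real_mult_indicator[of "{x<..<x + ?h n}" lborel Bbar] Bbar_int by (auto simp: mult.commute)
  have AEA: "AE r in lborel. integrable \<eta> (\<lambda>z. A (r, z))" and AEB: "AE r in lborel. integrable \<eta> (\<lambda>z. B (r, z))"
    using P.AE_integrable_fst'[OF A_int] P.AE_integrable_fst'[OF B_int] by auto
  have upper: "avg n - E x \<le> \<beta> n" if n: "?h n < d" for n
  proof -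
    let ?b = "\<integral>r. ?I n r * Bbar r \<partial>lborel"
    have "(\<integral>r. ?I n r * (E r - E x) \<partial>lborel) \<le> (\<integral>r. ?h n * (?I n r * Abar r) + ?I n r * ?b \<partial>lborel)"
    proof (rule integral_mono_AE[OF iEx])
      show "integrable lborel (\<lambda>r. ?h n * (?I n r * Abar r) + ?I n r * ?b)"
        using iA(1)[of n] by (intro Bochner_Integration.integrable_add integrable_mult_right) auto
      show "AE r in lborel. ?I n r * (E r - E x) \<le> ?h n * (?I n r * Abar r) + ?I n r * ?b"
        using up AEA
      proof eventually_elim
        case (elim r)
        show ?case
        proof (cases "x < r \<and> r < x + ?h n")
          case True
          have "E r - E x \<le> (\<integral>q. indicator {x<..<r} q * pairing r q \<partial>lborel)" using elim(1) True n by simp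
          also have "\<dots> \<le> (\<integral>q. ?I n q * Abar r + ?I n q * Bbar q \<partial>lborel)"
          proof (rule integral_mono_AE')
            show "integrable lborel (\<lambda>q. ?I n q * Abar r + ?I n q * Bbar q)" using iA(2)[of n] by auto
            show "AE q in lborel. indicator {x<..<r} q * pairing r q \<le> ?I n q * Abar r + ?I n q * Bbar q"
              using AEB
            proof eventually_elim
              case (elim q)
              have "pairing r q \<le> Abar r + Bbar q"
                using pairing_bound[OF \<open>integrable \<eta> (\<lambda>z. A (r, z))\<close> elim] by simp
              then show ?case using True Abar_nonneg[of r] Bbar_nonneg[of q] by (auto simp: indicator_def)
            qed
          qed (auto simp: Abar_nonneg Bbar_nonneg)
          also have "\<dots> = ?h n * Abar r + ?b"
            using iA(2)[of n] by simp
          finally show ?thesis using True by simp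
        qed auto
      qed
    qed
    also have "\<dots> = ?h n * (\<integral>r. ?I n r * Abar r \<partial>lborel) + ?h n * ?b"
      using iA(1)[of n] by (subst Bochner_Integration.integral_add) auto
    also have "\<dots> = ?h n * \<beta> n" by (simp add: \<beta>_def distrib_left)
    finally have "real (Suc n) * (\<integral>r. ?I n r * (E r - E x) \<partial>lborel) \<le> real (Suc n) * (?h n * \<beta> n)"
      by (intro mult_left_mono) auto
    then show ?thesis unfolding avg0 by simp
  qed
  have "(\<lambda>n. avg n - E x) \<longlonglongrightarrow> 0"
  proof (rule order_tendstoI)
    fix a :: real assume "a < 0"
    then show "eventually (\<lambda>n. a < avg n - E x) sequentially" using lower[of "- a"] by simp
  next
    fix a :: real assume "0 < a"
    have "eventually (\<lambda>n. ?h n < d) sequentially" using h0 \<open>d > 0\<close> by (intro order_tendstoD) auto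
    moreover have "eventually (\<lambda>n. \<beta> n < a) sequentially" using \<beta>0 \<open>0 < a\<close> by (intro order_tendstoD) auto
    ultimately show "eventually (\<lambda>n. avg n - E x < a) sequentially"
      by eventually_elim (use upper in force)
  qed
  then show ?thesis unfolding right_average_conv_def avg_def by (simp add: LIM_zero_iff)
qed

text \<open>The inequality \<open>low\<close> is integrated over \<open>t\<close> in
  \<open>{a..b}\<close> with \<open>h = 1 / Suc n\<close>. On one side the increments telescope to
  the integral of \<open>E\<close> just after \<open>b\<close> minus that just after
  \<open>a\<close>; on the other, Fubini gives the integral of \<open>\<Phi>\<close> over
  \<open>{0<..<h}\<close>. Dividing by \<open>h\<close> and letting \<open>n\<close> grow yields the
  claim.\<close>

lemma increment_ge_pairing:
  fixes E :: "real \<Rightarrow> real"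
  assumes "a \<le> b" and E[measurable]: "E \<in> borel_measurable borel" and bd: "\<And>t. \<bar>E t\<bar> \<le> C"
    and supp: "\<And>t z. t \<notin> {a..b} \<Longrightarrow> f (t, z) = 0"
    and low: "AE t in lborel. t \<in> {a..b} \<longrightarrow>
       (\<forall>h>0. E (t + h) - E t \<ge> (\<integral>q. indicator {t<..<t + h} q * pairing t q \<partial>lborel))"
    and avg: "right_average_conv E a" "right_average_conv E b"
  shows "E b - E a \<ge> (\<integral>t. pairing t t \<partial>lborel)"
proof -
  let ?h = "\<lambda>n. 1 / real (Suc n)"
  let ?I = "\<lambda>x n r. indicator {x<..<x + ?h n} r :: real"
  have bi: "integrable lborel (\<lambda>r. indicator S r * E r)" if [measurable]: "S \<in> sets borel" and "emeasure lborel S < \<infinity>" for S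
  proof (rule Bochner_Integration.integrable_bound[of _ "\<lambda>r. indicator S r * C"])
    show "AE r in lborel. norm (indicator S r * E r) \<le> norm (indicator S r * C)"
      using bd by (intro AE_I2) (auto simp: indicator_def intro: order_trans[OF _ abs_ge_self])
  qed (use that in auto)
  have main: "(\<integral>r. ?I b n r * E r \<partial>lborel) - (\<integral>r. ?I a n r * E r \<partial>lborel) \<ge> (\<integral>s. indicator {0<..<?h n} s * \<Phi> s \<partial>lborel)" for n
  proof -
    have h: "?h n > 0" by simp
    define h where "h = ?h n"
    have h: "h > 0" by (simp add: h_def)
    have shift: "integrable lborel (\<lambda>t. indicator {a..b} t * E (t + h))"
      "(\<integral>t. indicator {a..b} t * E (t + h) \<partial>lborel) = (\<integral>r. indicator {a + h..b + h} r * E r \<partial>lborel)"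
    proof -
      have i: "integrable lborel (\<lambda>r. indicator {a + h..b + h} r * E r)" using \<open>a \<le> b\<close> by (intro bi) auto
      have e: "(\<lambda>t. indicator {a + h..b + h} (h + 1 * t) * E (h + 1 * t)) = (\<lambda>t. indicator {a..b} t * E (t + h))"
        by (auto simp: fun_eq_iff indicator_def add.commute)
      show "integrable lborel (\<lambda>t. indicator {a..b} t * E (t + h))"
        using lborel_integrable_real_affine[OF i, of 1 h] unfolding e by simp
      show "(\<integral>t. indicator {a..b} t * E (t + h) \<partial>lborel) = (\<integral>r. indicator {a + h..b + h} r * E r \<partial>lborel)"
        using lborel_integral_real_affine[of 1 "\<lambda>r. indicator {a + h..b + h} r * E r" h] unfolding e by simp
    qed
    have iab: "integrable lborel (\<lambda>t. indicator {a..b} t * E t)" using \<open>a \<le> b\<close> by (intro bi) auto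
    have "(\<integral>t. indicator {a..b} t * (E (t + h) - E t) \<partial>lborel) = (\<integral>r. indicator {a + h..b + h} r * E r \<partial>lborel) - (\<integral>r. indicator {a..b} r * E r \<partial>lborel)"
      using shift iab by (simp add: right_diff_distrib)
    also have "\<dots> = (\<integral>r. indicator {a + h..b + h} r * E r - indicator {a..b} r * E r \<partial>lborel)"
      using \<open>a \<le> b\<close> iab by (intro Bochner_Integration.integral_diff[symmetric] bi) auto
    \<comment> \<open>The overlap of the interval with its translate cancels; the identity also
      holds when \<open>h\<close> exceeds \<open>b - a\<close>.\<close>
    also have "\<dots> = (\<integral>r. indicator {b<..<b + h} r * E r - indicator {a<..<a + h} r * E r \<partial>lborel)"
    proof (rule integral_cong_AE)
      have "AE r in lborel. r \<noteq> a \<and> r \<noteq> b + h"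
        using AE_lborel_singleton[of a] AE_lborel_singleton[of "b + h"] by eventually_elim auto
      then show "AE r in lborel. indicator {a + h..b + h} r * E r - indicator {a..b} r * E r
          = indicator {b<..<b + h} r * E r - indicator {a<..<a + h} r * E r"
        by eventually_elim (use h \<open>a \<le> b\<close> in \<open>auto simp: indicator_def\<close>)
    qed auto
    also have "\<dots> = (\<integral>r. indicator {b<..<b + h} r * E r \<partial>lborel) - (\<integral>r. indicator {a<..<a + h} r * E r \<partial>lborel)"
      using h by (intro Bochner_Integration.integral_diff bi) auto
    finally have lhs: "(\<integral>t. indicator {a..b} t * (E (t + h) - E t) \<partial>lborel) = \<dots>" .
    define k where "k = (\<lambda>(s, t). indicator {0<..<h} s * pairing t (t + s))"
    have k[measurable]: "k \<in> borel_measurable (lborel \<Otimes>\<^sub>M lborel)" unfolding k_def by measurable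
    have ik: "integrable (lborel \<Otimes>\<^sub>M lborel) k"
    proof (rule lborel_pair.Fubini_integrable[OF k])
      show "AE s in lborel. integrable lborel (\<lambda>t. k (s, t))"
        using pairing_shift_int by (simp add: k_def)
      have "integrable lborel (\<lambda>s. indicator {0<..<h} s * W)" using h by simp
      then show "integrable lborel (\<lambda>s. \<integral>t. norm (k (s, t)) \<partial>lborel)"
      proof (rule Bochner_Integration.integrable_bound)
        show "AE s in lborel. norm (\<integral>t. norm (k (s, t)) \<partial>lborel) \<le> norm (indicator {0<..<h} s * W)"
          using pairing_shift_norm by (intro AE_I2) (auto simp: k_def indicator_def abs_mult intro: order_trans[OF _ abs_ge_self])
      qed measurable
    qed
    have "(\<integral>s. indicator {0<..<h} s * \<Phi> s \<partial>lborel) = (\<integral>s. (\<integral>t. k (s, t) \<partial>lborel) \<partial>lborel)"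
      by (simp add: k_def Phi_pairing)
    also have "\<dots> = (\<integral>t. (\<integral>s. k (s, t) \<partial>lborel) \<partial>lborel)"
      using lborel_pair.Fubini_integral[of "\<lambda>s t. k (s, t)"] ik by simp
    also have "\<dots> \<le> (\<integral>t. indicator {a..b} t * (E (t + h) - E t) \<partial>lborel)"
    proof (rule integral_mono_AE)
      show "integrable lborel (\<lambda>t. \<integral>s. k (s, t) \<partial>lborel)"
        using lborel_pair.integrable_snd[of "\<lambda>s t. k (s, t)"] ik by simp
      show "integrable lborel (\<lambda>t. indicator {a..b} t * (E (t + h) - E t))"
        using shift iab by (simp add: right_diff_distrib)
      show "AE t in lborel. (\<integral>s. k (s, t) \<partial>lborel) \<le> indicator {a..b} t * (E (t + h) - E t)"
        using low
      proof eventually_elim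
        case (elim t)
        show ?case
        proof (cases "t \<in> {a..b}")
          case True
          have "(\<integral>q. indicator {t<..<t + h} q * pairing t q \<partial>lborel) = (\<integral>s. indicator {t<..<t + h} (t + 1 * s) * pairing t (t + 1 * s) \<partial>lborel)"
            by (subst lborel_integral_real_affine[of 1 _ t]) auto
          also have "\<dots> = (\<integral>s. k (s, t) \<partial>lborel)"
            by (intro Bochner_Integration.integral_cong) (auto simp: k_def indicator_def)
          finally show ?thesis using elim True h by auto
        next
          case False
          then have "pairing t q = 0" for q by (simp add: pairing_def supp)
          with False show ?thesis by (simp add: k_def)
        qed
      qed
    qed
    finally have "(\<integral>s. indicator {0<..<h} s * \<Phi> s \<partial>lborel) \<le> (\<integral>t. indicator {a..b} t * (E (t + h) - E t) \<partial>lborel)" .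
    then show ?thesis unfolding lhs unfolding h_def .
  qed
  have "(\<lambda>n. real (Suc n) * (\<integral>r. ?I b n r * E r \<partial>lborel) - real (Suc n) * (\<integral>r. ?I a n r * E r \<partial>lborel)) \<longlonglongrightarrow> E b - E a"
    using avg unfolding right_average_conv_def by (intro tendsto_diff)
  from LIMSEQ_le[OF Phi_average this] main
  have "\<Phi> 0 \<le> E b - E a"
    by (auto simp: right_diff_distrib[symmetric] simp del: of_nat_Suc intro!: exI[of _ 0] mult_left_mono)
  then show ?thesis by (simp add: Phi_pairing)
qed

end

section \<open>Time reversal and the two-sided increment formula\<close>

lemma AE_lborel_reflect:
  fixes c :: real
  assumes "AE t in lborel. P t"
  shows "AE t in lborel. P (c - t)"
proof -
  obtain N where N: "{t \<in> space lborel. \<not> P t} \<subseteq> N" "emeasure lborel N = 0" "N \<in> sets lborel"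
    using assms by (rule AE_E)
  have [measurable]: "N \<in> sets borel" using N by simp
  have "AE t in lborel. t \<notin> N" using N by (intro AE_not_in) (auto simp: null_sets_def)
  then have "AE t in lborel. c + (-1) * t \<notin> N"
    by (intro AE_borel_affine) auto
  then show ?thesis using N by (auto elim!: eventually_mono)
qed

lemma (in sigma_finite_measure) integrable_time_reflect:
  fixes k :: "real \<times> 'a \<Rightarrow> real"
  assumes k: "integrable (lborel \<Otimes>\<^sub>M M) k"
  shows "integrable (lborel \<Otimes>\<^sub>M M) (\<lambda>(t, z). k (c - t, z))"
proof -
  interpret P: pair_sigma_finite lborel M ..
  have [measurable]: "k \<in> borel_measurable (lborel \<Otimes>\<^sub>M M)" using k by auto
  have "(\<integral>\<^sup>+p. ennreal (norm (case p of (t, z) \<Rightarrow> k (c - t, z))) \<partial>(lborel \<Otimes>\<^sub>M M))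
      = (\<integral>\<^sup>+z. (\<integral>\<^sup>+t. ennreal (norm (k (c + (-1) * t, z))) \<partial>lborel) \<partial>M)"
    by (subst P.nn_integral_snd[symmetric]) auto
  also have "\<dots> = (\<integral>\<^sup>+z. (\<integral>\<^sup>+t. ennreal (norm (k (t, z))) \<partial>lborel) \<partial>M)"
  proof (rule nn_integral_cong)
    fix z assume z: "z \<in> space M"
    have "(\<lambda>t. k (t, z)) \<in> borel_measurable lborel"
      using measurable_Pair1[OF \<open>k \<in> borel_measurable (lborel \<Otimes>\<^sub>M M)\<close> z] .
    then show "(\<integral>\<^sup>+t. ennreal (norm (k (c + (-1) * t, z))) \<partial>lborel) = (\<integral>\<^sup>+t. ennreal (norm (k (t, z))) \<partial>lborel)"
      by (subst nn_integral_real_affine[of "\<lambda>t. ennreal (norm (k (t, z)))" "-1" c]) auto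
  qed
  also have "\<dots> = (\<integral>\<^sup>+p. ennreal (norm (k p)) \<partial>(lborel \<Otimes>\<^sub>M M))"
    by (subst P.nn_integral_snd[symmetric]) auto
  also have "\<dots> < \<infinity>" using k by (simp add: integrable_iff_bounded)
  finally show ?thesis by (intro integrableI_bounded) measurable
qed

context time_pairing
begin

text \<open>Multiplying \<open>f\<close> by the indicator of \<open>{a..b}\<close> localises the
  pairing to a subinterval. As \<open>E\<close> is constant beyond \<open>T\<close> and
  \<open>g\<close> vanishes there, increments that leave the time interval contribute
  nothing.\<close>

lemma increment_ge:
  fixes E :: "real \<Rightarrow> real"
  assumes ab: "0 \<le> a" "a \<le> b" "b \<le> T" and E[measurable]: "E \<in> borel_measurable borel"
    and bd: "\<And>t. \<bar>E t\<bar> \<le> C" and E_right: "\<And>t. t > T \<Longrightarrow> E t = E T"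
    and lsc: "\<And>x e. 0 \<le> x \<Longrightarrow> x \<le> T \<Longrightarrow> e > 0 \<Longrightarrow> \<exists>\<delta>>0. \<forall>r. \<bar>r - x\<bar> < \<delta> \<longrightarrow> E r \<ge> E x - e"
    and f0: "\<And>t z. t \<notin> {0..T} \<Longrightarrow> f (t, z) = 0" and g0: "\<And>t z. t \<notin> {0<..<T} \<Longrightarrow> g (t, z) = 0"
    and low: "AE t in lborel. t \<in> {0..T} \<longrightarrow> (\<forall>r\<in>{t..T}. E r - E t \<ge> (\<integral>q. indicator {t<..<r} q * pairing t q \<partial>lborel))"
    and up: "AE t in lborel. t \<in> {0..T} \<longrightarrow> (\<forall>r\<in>{0..t}. E t - E r \<le> (\<integral>q. indicator {r<..<t} q * pairing t q \<partial>lborel))"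
  shows "E b - E a \<ge> (\<integral>t. indicator {a..b} t * pairing t t \<partial>lborel)"
proof -
  interpret I: time_pairing \<eta> "\<lambda>p. indicator {a..b} (fst p) * f p" g A B M
  proof
    show "\<bar>indicator {a..b} (fst p) * f p\<bar> \<le> M" for p
      using f_bound[of p] by (auto simp: indicator_def)
    show "\<bar>indicator {a..b} (fst (t, z)) * f (t, z) * g (r, z)\<bar> \<le> A (t, z) + B (r, z)" for t r z
      using fg_bound[of t z r] A_nonneg[of "(t, z)"] B_nonneg[of "(r, z)"] by (auto simp: indicator_def)
  qed (use A_int B_int A_nonneg B_nonneg g_int in auto)
  have Ip: "I.pairing t r = indicator {a..b} t * pairing t r" for t r
    unfolding I.pairing_def pairing_def by (simp add: mult.assoc)
  have p0: "pairing t q = 0" if "q \<ge> T" for t q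
    using g0[of q] that by (simp add: pairing_def)
  have avg: "right_average_conv E x" if x: "0 \<le> x" "x \<le> T" for x
  proof (cases "x < T")
    case True
    show ?thesis
    proof (rule right_average_convI[OF E bd _ lsc[OF x]])
      show "0 < T - x" using True by simp
      show "AE r in lborel. x < r \<longrightarrow> r < x + (T - x) \<longrightarrow> E r - E x \<le> (\<integral>q. indicator {x<..<r} q * pairing r q \<partial>lborel)"
        using up by eventually_elim (use x in auto)
    qed
  next
    case False
    then have [simp]: "x = T" using x by simp
    show ?thesis
    proof (rule right_average_convI[OF E bd zero_less_one lsc[OF x]])
      show "AE r in lborel. x < r \<longrightarrow> r < x + 1 \<longrightarrow> E r - E x \<le> (\<integral>q. indicator {x<..<r} q * pairing r q \<partial>lborel)"
      proof (intro AE_I2 impI)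
        fix r assume "x < r"
        then have "pairing r q = 0" for q using f0[of r] by (simp add: pairing_def)
        then show "E r - E x \<le> (\<integral>q. indicator {x<..<r} q * pairing r q \<partial>lborel)"
          using E_right[of r] \<open>x < r\<close> by simp
      qed
    qed
  qed
  have "E b - E a \<ge> (\<integral>t. I.pairing t t \<partial>lborel)"
  proof (rule I.increment_ge_pairing[OF ab(2) E bd])
    show "indicator {a..b} (fst (t, z)) * f (t, z) = 0" if "t \<notin> {a..b}" for t z using that by simp
    show "right_average_conv E a" "right_average_conv E b" using ab by (auto intro!: avg)
    show "AE t in lborel. t \<in> {a..b} \<longrightarrow> (\<forall>h>0. E (t + h) - E t \<ge> (\<integral>q. indicator {t<..<t + h} q * I.pairing t q \<partial>lborel))"
      using low
    proof eventually_elim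
      case (elim t)
      show ?case
      proof (intro impI allI)
        fix h :: real assume t: "t \<in> {a..b}" and h: "h > 0"
        define r where "r = min T (t + h)"
        have r: "r \<in> {t..T}" using t h ab by (auto simp: r_def)
        have "(\<integral>q. indicator {t<..<t + h} q * I.pairing t q \<partial>lborel) = (\<integral>q. indicator {t<..<r} q * pairing t q \<partial>lborel)"
          unfolding Ip using t p0[of _ t] by (intro Bochner_Integration.integral_cong) (auto simp: indicator_def r_def)
        also have "\<dots> \<le> E r - E t" using elim r t ab by auto
        also have "E r = E (t + h)" using E_right[of "t + h"] by (cases "t + h = T") (auto simp: r_def min_def)
        finally show "(\<integral>q. indicator {t<..<t + h} q * I.pairing t q \<partial>lborel) \<le> E (t + h) - E t" .
      qed
    qed
  qed
  then show ?thesis by (simp add: Ip)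
qed

text \<open>The missing inequality is \<open>increment_ge\<close> for the reversed family
  \<open>t \<mapsto> T - t\<close>: \<open>g\<close> changes sign, and the hypotheses
  \<open>low\<close> and \<open>up\<close> exchange their roles.\<close>

theorem increment_eq:
  fixes E :: "real \<Rightarrow> real"
  assumes ab: "0 \<le> a" "a \<le> b" "b \<le> T" and E[measurable]: "E \<in> borel_measurable borel"
    and bd: "\<And>t. \<bar>E t\<bar> \<le> C" and E_right: "\<And>t. t > T \<Longrightarrow> E t = E T" and E_left: "\<And>t. t < 0 \<Longrightarrow> E t = E 0"
    and lsc: "\<And>x e. 0 \<le> x \<Longrightarrow> x \<le> T \<Longrightarrow> e > 0 \<Longrightarrow> \<exists>\<delta>>0. \<forall>r. \<bar>r - x\<bar> < \<delta> \<longrightarrow> E r \<ge> E x - e"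
    and f0: "\<And>t z. t \<notin> {0..T} \<Longrightarrow> f (t, z) = 0" and g0: "\<And>t z. t \<notin> {0<..<T} \<Longrightarrow> g (t, z) = 0"
    and low: "AE t in lborel. t \<in> {0..T} \<longrightarrow> (\<forall>r\<in>{t..T}. E r - E t \<ge> (\<integral>q. indicator {t<..<r} q * pairing t q \<partial>lborel))"
    and up: "AE t in lborel. t \<in> {0..T} \<longrightarrow> (\<forall>r\<in>{0..t}. E t - E r \<le> (\<integral>q. indicator {r<..<t} q * pairing t q \<partial>lborel))"
  shows "E b - E a = (\<integral>t. indicator {a..b} t * pairing t t \<partial>lborel)"
proof (rule antisym)
  interpret R: time_pairing \<eta> "\<lambda>(t, z). f (T - t, z)" "\<lambda>(t, z). - g (T - t, z)" "\<lambda>(t, z). A (T - t, z)" "\<lambda>(t, z). B (T - t, z)" M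
  proof
    show "integrable (lborel \<Otimes>\<^sub>M \<eta>) (\<lambda>(t, z). A (T - t, z))" "integrable (lborel \<Otimes>\<^sub>M \<eta>) (\<lambda>(t, z). B (T - t, z))"
      using integrable_time_reflect[OF A_int, of T] integrable_time_reflect[OF B_int, of T] by auto
    show "\<bar>case p of (t, z) \<Rightarrow> f (T - t, z)\<bar> \<le> M" for p
      using f_bound by (auto split: prod.split)
    show "0 \<le> (case p of (t, z) \<Rightarrow> A (T - t, z))" "0 \<le> (case p of (t, z) \<Rightarrow> B (T - t, z))" for p
      using A_nonneg B_nonneg by (auto split: prod.split)
    show "AE z in \<eta>. integrable lborel (\<lambda>t. case (t, z) of (t, z) \<Rightarrow> - g (T - t, z))"
      using g_int
    proof eventually_elim
      case (elim z)
      show ?case using lborel_integrable_real_affine[OF elim, of "-1" T] by simp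
    qed
    show "\<bar>(case (t, z) of (t, z) \<Rightarrow> f (T - t, z)) * (case (r, z) of (t, z) \<Rightarrow> - g (T - t, z))\<bar>
      \<le> (case (t, z) of (t, z) \<Rightarrow> A (T - t, z)) + (case (r, z) of (t, z) \<Rightarrow> B (T - t, z))" for t r z
      using fg_bound[of "T - t" z "T - r"] by simp
  qed measurable
  have Rp: "R.pairing t r = - pairing (T - t) (T - r)" for t r
    unfolding R.pairing_def pairing_def by simp
  have refl: "(\<integral>q. k (T - q) \<partial>lborel) = (\<integral>q. k q \<partial>lborel)" for k :: "real \<Rightarrow> real"
    using lborel_integral_real_affine[of "-1" k T] by simp
  let ?E = "\<lambda>t. E (T - t)"
  have "?E (T - a) - ?E (T - b) \<ge> (\<integral>t. indicator {T - b..T - a} t * R.pairing t t \<partial>lborel)"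
  proof (rule R.increment_ge)
    show "\<exists>\<delta>>0. \<forall>r. \<bar>r - x\<bar> < \<delta> \<longrightarrow> E (T - x) - e \<le> E (T - r)" if "0 \<le> x" "x \<le> T" "0 < e" for x e
    proof -
      have "\<exists>\<delta>>0. \<forall>r. \<bar>r - (T - x)\<bar> < \<delta> \<longrightarrow> E r \<ge> E (T - x) - e"
        using that by (intro lsc) auto
      then obtain \<delta> where "\<delta> > 0" "\<And>r. \<bar>r - (T - x)\<bar> < \<delta> \<Longrightarrow> E r \<ge> E (T - x) - e"
        by blast
      then show ?thesis by (intro exI[of _ \<delta>]) (auto simp: abs_minus_commute)
    qed
    show "AE t in lborel. t \<in> {0..T} \<longrightarrow> (\<forall>r\<in>{t..T}. ?E r - ?E t \<ge> (\<integral>q. indicator {t<..<r} q * R.pairing t q \<partial>lborel))"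
      using AE_lborel_reflect[OF up, of T]
    proof eventually_elim
      case (elim t)
      show ?case
      proof (intro impI ballI)
        fix r assume t: "t \<in> {0..T}" and r: "r \<in> {t..T}"
        have "E (T - t) - E (T - r) \<le> (\<integral>q. indicator {T - r<..<T - t} q * pairing (T - t) q \<partial>lborel)"
          using elim t r by auto
        also have "\<dots> = (\<integral>q. indicator {T - r<..<T - t} (T - q) * pairing (T - t) (T - q) \<partial>lborel)"
          by (rule refl[symmetric])
        also have "\<dots> = (\<integral>q. - (indicator {t<..<r} q * R.pairing t q) \<partial>lborel)"
          by (intro Bochner_Integration.integral_cong) (auto simp: Rp indicator_def)
        finally show "?E r - ?E t \<ge> (\<integral>q. indicator {t<..<r} q * R.pairing t q \<partial>lborel)" by simp
      qed
    qed
    show "AE t in lborel. t \<in> {0..T} \<longrightarrow> (\<forall>r\<in>{0..t}. ?E t - ?E r \<le> (\<integral>q. indicator {r<..<t} q * R.pairing t q \<partial>lborel))"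
      using AE_lborel_reflect[OF low, of T]
    proof eventually_elim
      case (elim t)
      show ?case
      proof (intro impI ballI)
        fix r assume t: "t \<in> {0..T}" and r: "r \<in> {0..t}"
        have "(\<integral>q. - (indicator {r<..<t} q * R.pairing t q) \<partial>lborel) = (\<integral>q. indicator {T - t<..<T - r} (T - q) * pairing (T - t) (T - q) \<partial>lborel)"
          by (intro Bochner_Integration.integral_cong) (auto simp: Rp indicator_def)
        also have "\<dots> = (\<integral>q. indicator {T - t<..<T - r} q * pairing (T - t) q \<partial>lborel)"
          by (rule refl)
        also have "\<dots> \<le> E (T - r) - E (T - t)" using elim t r by auto
        finally show "?E t - ?E r \<le> (\<integral>q. indicator {r<..<t} q * R.pairing t q \<partial>lborel)" by simp
      qed
    qed
  qed (use ab bd E_left f0 g0 in auto)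
  moreover have "(\<integral>t. indicator {T - b..T - a} t * R.pairing t t \<partial>lborel) = - (\<integral>t. indicator {a..b} t * pairing t t \<partial>lborel)"
  proof -
    have "(\<integral>t. indicator {T - b..T - a} t * R.pairing t t \<partial>lborel) = (\<integral>t. - (indicator {a..b} (T - t) * pairing (T - t) (T - t)) \<partial>lborel)"
      by (intro Bochner_Integration.integral_cong) (auto simp: Rp indicator_def)
    also have "\<dots> = (\<integral>t. - (indicator {a..b} t * pairing t t) \<partial>lborel)" by (rule refl)
    finally show ?thesis by simp
  qed
  ultimately show "E b - E a \<le> (\<integral>t. indicator {a..b} t * pairing t t \<partial>lborel)" by simp
qed (rule increment_ge[OF assms(1-6) lsc f0 g0 low up])

end

section \<open>Reflecting pairs\<close>

text \<open>The Bochner integral is 0 by convention when the integrand is not integrable, so the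
  kernel integral is assembled from nonnegative integrals on the measurable set of those
  \<open>x\<close> where it is.\<close>

lemma integral_kernel_measurable:
  fixes f :: "'b \<Rightarrow> real"
  assumes sets: "\<And>x. x \<in> space M \<Longrightarrow> sets (K x) = sets N"
    and meas: "\<And>B. B \<in> sets N \<Longrightarrow> (\<lambda>x. emeasure (K x) B) \<in> borel_measurable M"
    and f[measurable]: "f \<in> borel_measurable N"
  shows "(\<lambda>x. \<integral>y. f y \<partial>K x) \<in> borel_measurable M"
proof -
  have m: "(\<lambda>x. \<integral>\<^sup>+y. h y \<partial>K x) \<in> borel_measurable M" if "h \<in> borel_measurable N" for h
    using nn_integral_kernel_measurable[of M K N h] sets meas that by blast
  have [measurable]: "(\<lambda>x. \<integral>\<^sup>+y. ennreal (f y) \<partial>K x) \<in> borel_measurable M"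
    by (rule m) measurable
  have [measurable]: "(\<lambda>x. \<integral>\<^sup>+y. ennreal (- f y) \<partial>K x) \<in> borel_measurable M"
    by (rule m) measurable
  have [measurable]: "(\<lambda>x. \<integral>\<^sup>+y. ennreal (norm (f y)) \<partial>K x) \<in> borel_measurable M"
    by (rule m) measurable
  have "(\<integral>y. f y \<partial>K x) = (if (\<integral>\<^sup>+y. ennreal (norm (f y)) \<partial>K x) < \<infinity>
      then enn2real (\<integral>\<^sup>+y. ennreal (f y) \<partial>K x) - enn2real (\<integral>\<^sup>+y. ennreal (- f y) \<partial>K x) else 0)"
    if x: "x \<in> space M" for x
  proof -
    have fm: "f \<in> borel_measurable (K x)" using sets[OF x] f by (simp cong: measurable_cong_sets)
    show ?thesis
    proof (cases "integrable (K x) f")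
      case True
      then show ?thesis using real_lebesgue_integral_def[OF True] by (simp add: integrable_iff_bounded)
    next
      case False
      then show ?thesis using fm not_integrable_integral_eq[OF False] by (auto simp: integrable_iff_bounded)
    qed
  qed
  then show ?thesis by (subst measurable_cong) (assumption, measurable)
qed

locale reflecting_pair = convex_fisher \<phi> \<psi>s \<alpha> for \<phi> \<psi>s \<alpha> +
  fixes \<pi> :: "'v::{metric_space,second_countable_topology} measure"
    and \<kappa> :: "'v \<Rightarrow> 'v measure" and T :: real
    and \<rho> :: "real \<Rightarrow> 'v measure" and j :: "real \<Rightarrow> ('v \<times> 'v) smeasure"
  assumes T_pos: "T > 0" and \<pi>: "finite_borel_measure \<pi>" and \<kappa>: "jump_kernel \<kappa>"
    and balance: "detailed_balance \<pi> \<kappa>" and RCE: "(\<rho>, j) \<in> RCE \<pi> \<kappa> \<phi> \<psi>s \<alpha> T"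
begin

abbreviation \<theta> :: "('v \<times> 'v) measure" where "\<theta> \<equiv> edge_measure \<pi> \<kappa>"

lemma sets_pi [measurable_cong, simp]: "sets \<pi> = sets borel"
  using \<pi> by (simp add: finite_borel_measure_def)

lemma space_pi [simp]: "space \<pi> = UNIV"
  using sets_eq_imp_space_eq[OF sets_pi] by simp

lemma sets_theta [measurable_cong, simp]: "sets \<theta> = sets borel"
  using sets_edge_measure[OF \<pi> \<kappa>] .

lemma space_theta [simp]: "space \<theta> = UNIV"
  using sets_eq_imp_space_eq[OF sets_theta] by simp

sublocale pi: finite_measure \<pi>
  using \<pi> by (simp add: finite_borel_measure_def)

sublocale theta: sigma_finite_measure \<theta>
  by (rule sigma_finite_edge_measure[OF \<pi> \<kappa>])

lemma ACE: "(\<rho>, j) \<in> ACE \<pi> \<kappa> \<phi> \<psi>s \<alpha> T" and CE: "(\<rho>, j) \<in> CE T"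
  using RCE unfolding RCE_def ACE_def by auto

lemma rho_finite: "t \<in> {0..T} \<Longrightarrow> finite_measure (\<rho> t)"
  and sets_rho [simp]: "t \<in> {0..T} \<Longrightarrow> sets (\<rho> t) = sets borel"
  using CE unfolding CE_def finite_borel_measure_def by auto

lemma space_rho [simp]: "t \<in> {0..T} \<Longrightarrow> space (\<rho> t) = UNIV"
  using sets_eq_imp_space_eq[OF sets_rho] by simp

lemma energy_finite:
  assumes "t \<in> {0..T}"
  shows "energy \<pi> \<phi> (\<rho> t) < \<infinity>"
proof -
  have "energy \<pi> \<phi> (\<rho> t) \<le> (SUP t\<in>{0..T}. energy \<pi> \<phi> (\<rho> t))"
    using assms by (rule SUP_upper)
  also have "\<dots> < \<infinity>" using ACE unfolding ACE_def by auto
  finally show ?thesis .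
qed

lemma rho_ac: "t \<in> {0..T} \<Longrightarrow> absolutely_continuous \<pi> (\<rho> t)"
  using energy_finite[of t] unfolding energy_def by (auto split: if_splits)

lemma dens_nonneg: "dens \<pi> \<mu> x \<ge> 0"
  by (simp add: dens_def)

lemma dens_measurable [measurable]: "dens \<pi> \<mu> \<in> borel_measurable borel"
  unfolding dens_def[abs_def] using borel_measurable_RN_deriv[of \<pi> \<mu>] by simp

lemma rho_density:
  assumes t: "t \<in> {0..T}"
  shows "\<rho> t = density \<pi> (\<lambda>x. ennreal (dens \<pi> (\<rho> t) x))"
proof -
  have s: "sets (\<rho> t) = sets \<pi>" using t by simp
  have "AE x in \<pi>. RN_deriv \<pi> (\<rho> t) x \<noteq> \<infinity>"
    using rho_finite[OF t] rho_ac[OF t] s by (intro pi.RN_deriv_finite finite_measure.axioms(1))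
  then have "AE x in \<pi>. RN_deriv \<pi> (\<rho> t) x = ennreal (dens \<pi> (\<rho> t) x)"
    by eventually_elim (simp add: dens_def less_top)
  then have "density \<pi> (RN_deriv \<pi> (\<rho> t)) = density \<pi> (\<lambda>x. ennreal (dens \<pi> (\<rho> t) x))"
    by (intro density_cong) auto
  then show ?thesis using pi.density_RN_deriv[OF rho_ac[OF t] s] by simp
qed

lemma j_meas:
  assumes B: "B \<in> sets borel"
  shows "(\<lambda>t. emeasure (if t \<in> {0..T} then fst (j t) else null_measure borel) B) \<in> borel_measurable lborel"
    "(\<lambda>t. emeasure (if t \<in> {0..T} then snd (j t) else null_measure borel) B) \<in> borel_measurable lborel"
proof -
  have m: "measurable_family T j" using CE unfolding CE_def by auto
  have e: "emeasure (if b then Y else null_measure borel) B = (if b then emeasure Y B else 0)"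
    for b and Y :: "('v \<times> 'v) measure" by simp
  have ext: "(\<lambda>t. if t \<in> {0..T} then h t else 0) \<in> borel_measurable lborel"
    if "h \<in> borel_measurable (restrict_space borel {0..T})" for h :: "real \<Rightarrow> ennreal"
    using that by (subst (asm) measurable_restrict_space_iff[where c = 0]) auto
  note mB = m[unfolded measurable_family_def, THEN bspec[OF _ B]]
  show "(\<lambda>t. emeasure (if t \<in> {0..T} then fst (j t) else null_measure borel) B) \<in> borel_measurable lborel"
    unfolding e by (rule ext[OF conjunct1[OF mB]])
  show "(\<lambda>t. emeasure (if t \<in> {0..T} then snd (j t) else null_measure borel) B) \<in> borel_measurable lborel"
    unfolding e by (rule ext[OF conjunct2[OF mB]])
qed

text \<open>The family \<open>j\<close> is measurable in time only on \<open>{0..T}\<close>; with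
  the null measure outside, both components become measurable on the whole line.\<close>

definition jp :: "real \<Rightarrow> ('v \<times> 'v) measure" where
  "jp t = (if t \<in> {0..T} then fst (j t) else null_measure borel)"
definition jm :: "real \<Rightarrow> ('v \<times> 'v) measure" where
  "jm t = (if t \<in> {0..T} then snd (j t) else null_measure borel)"

lemma j_signed: "t \<in> {0..T} \<Longrightarrow> signed_sigma_finite (j t)"
  using CE unfolding CE_def by auto

lemma sets_jpm [simp]: "sets (jp t) = sets borel" "sets (jm t) = sets borel"
  using j_signed unfolding signed_sigma_finite_def jp_def jm_def by auto

lemma space_jpm [simp]: "space (jp t) = UNIV" "space (jm t) = UNIV"
  using sets_eq_imp_space_eq[OF sets_jpm(1)] sets_eq_imp_space_eq[OF sets_jpm(2)] by auto

lemma jpm_eq: "t \<in> {0..T} \<Longrightarrow> jp t = fst (j t)" "t \<in> {0..T} \<Longrightarrow> jm t = snd (j t)"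
  by (simp_all add: jp_def jm_def)

lemma jpm_meas: "B \<in> sets borel \<Longrightarrow> (\<lambda>t. emeasure (jp t) B) \<in> borel_measurable lborel"
  "B \<in> sets borel \<Longrightarrow> (\<lambda>t. emeasure (jm t) B) \<in> borel_measurable lborel"
  unfolding jp_def jm_def by (rule j_meas; assumption)+

lemma offdiag_borel [measurable]: "offdiag \<in> sets (borel :: ('v \<times> 'v) measure)"
proof -
  have "open (offdiag :: ('v \<times> 'v) set)"
  proof -
    have e: "offdiag = {z :: 'v \<times> 'v. fst z \<noteq> snd z}" by (auto simp: offdiag_def)
    show ?thesis unfolding e by (intro open_Collect_neq continuous_intros)
  qed
  then show ?thesis by simp
qed

lemma AE_jpm_offdiag: "AE z in jp t. z \<in> offdiag" "AE z in jm t. z \<in> offdiag"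
proof -
  have "AE z in jp t. z \<notin> - offdiag \<and> True" "AE z in jm t. z \<notin> - offdiag"
  proof -
    have *: "emeasure (jp t) (- offdiag) = 0 \<and> emeasure (jm t) (- offdiag) = 0"
    proof (cases "t \<in> {0..T}")
      case True
      then have "emeasure (variation (j t)) (- offdiag) = 0" using CE unfolding CE_def by auto
      then show ?thesis using True emeasure_variation[of "j t" "- offdiag"] sets_jpm[of t]
        by (simp add: jpm_eq)
    next
      case False
      then have "jp t = null_measure borel" "jm t = null_measure borel"
        by (simp_all only: jp_def jm_def if_False)
      then show ?thesis by simp
    qed
    then show "AE z in jp t. z \<notin> - offdiag \<and> True" "AE z in jm t. z \<notin> - offdiag"
      using AE_not_in[of "- offdiag" "jp t"] AE_not_in[of "- offdiag" "jm t"] by (auto simp: null_sets_def)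
  qed
  then show "AE z in jp t. z \<in> offdiag" "AE z in jm t. z \<in> offdiag" by auto
qed

text \<open>The weight of the flux in \<open>CE\<close>: positive off the diagonal, where the flux
  lives, and dominating the gradients of bounded Lipschitz functions up to a constant.\<close>

abbreviation wt :: "'v \<times> 'v \<Rightarrow> real" where "wt z \<equiv> min 1 (dist (fst z) (snd z))"

lemma wt_meas [measurable]: "wt \<in> borel_measurable borel"
  by (intro borel_measurable_continuous_onI continuous_intros)

lemma wt_pos: "z \<in> offdiag \<Longrightarrow> wt z > 0"
  by (auto simp: offdiag_def)

lemma nn_integral_jpm_le_variation:
  assumes t: "t \<in> {0..T}" and f[measurable]: "f \<in> borel_measurable borel"
  shows "(\<integral>\<^sup>+z. f z \<partial>jp t) + (\<integral>\<^sup>+z. f z \<partial>jm t) = (\<integral>\<^sup>+z. f z \<partial>variation (j t))"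
proof -
  have s: "sets (fst (j t)) = sets borel" "sets (snd (j t)) = sets borel"
    using j_signed[OF t] by (simp_all add: signed_sigma_finite_def)
  note [measurable_cong] = sets_jpm sets_variation
  show ?thesis using f
  proof (induction rule: borel_measurable_induct)
    case (cong f g)
    then show ?case by simp
  next
    case (set A)
    then show ?case using emeasure_variation[OF s, of A] t by (simp add: jpm_eq[symmetric])
  next
    case (mult u c)
    then have [measurable]: "u \<in> borel_measurable borel" by simp
    show ?case using mult.IH by (simp add: nn_integral_cmult distrib_left[symmetric])
  next
    case (add u v)
    then have [measurable]: "u \<in> borel_measurable borel" "v \<in> borel_measurable borel" by auto
    have "(\<integral>\<^sup>+z. v z + u z \<partial>M) = (\<integral>\<^sup>+z. v z \<partial>M) + (\<integral>\<^sup>+z. u z \<partial>M)" if "sets M = sets borel" for M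
      using that by (intro nn_integral_add) (simp_all cong: measurable_cong_sets)
    then show ?case unfolding sets_jpm sets_variation by (simp only: sets_jpm sets_variation add.IH[symmetric] ac_simps)
  next
    case (seq U)
    then have [measurable]: "\<And>i. U i \<in> borel_measurable borel" by auto
    have inc: "incseq (\<lambda>i. \<integral>\<^sup>+z. U i z \<partial>jp t)" "incseq (\<lambda>i. \<integral>\<^sup>+z. U i z \<partial>jm t)"
      using seq(3) by (auto simp: incseq_def le_fun_def intro!: nn_integral_mono)
    have e: "(\<integral>\<^sup>+z. (SUP i. U i) z \<partial>M) = (SUP i. \<integral>\<^sup>+z. U i z \<partial>M)" if "sets M = sets borel" for M
      unfolding SUP_apply using seq(3) that
      by (intro nn_integral_monotone_convergence_SUP) (auto cong: measurable_cong_sets)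
    show ?case
      unfolding e[OF sets_jpm(1)[of t]] e[OF sets_jpm(2)[of t]] e[OF sets_variation[of "j t"]] seq.IH[symmetric]
      by (rule ennreal_SUP_add[OF inc, symmetric])
  qed
qed

lemma jpm_weight_finite:
  "(\<integral>\<^sup>+t. (\<integral>\<^sup>+z. ennreal (wt z) \<partial>jp t) \<partial>lborel) < \<infinity>"
  "(\<integral>\<^sup>+t. (\<integral>\<^sup>+z. ennreal (wt z) \<partial>jm t) \<partial>lborel) < \<infinity>"
proof -
  let ?V = "\<integral>\<^sup>+t\<in>{0..T}. (\<integral>\<^sup>+(x, y). ennreal (min 1 (dist x y)) \<partial>variation (j t)) \<partial>lborel"
  have V: "?V < \<infinity>" using CE unfolding CE_def by auto
  have le: "(\<integral>\<^sup>+z. ennreal (wt z) \<partial>jp t) \<le> (\<integral>\<^sup>+(x, y). ennreal (min 1 (dist x y)) \<partial>variation (j t)) * indicator {0..T} t"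
    "(\<integral>\<^sup>+z. ennreal (wt z) \<partial>jm t) \<le> (\<integral>\<^sup>+(x, y). ennreal (min 1 (dist x y)) \<partial>variation (j t)) * indicator {0..T} t" for t
  proof -
    let ?p = "\<integral>\<^sup>+z. ennreal (wt z) \<partial>jp t" and ?m = "\<integral>\<^sup>+z. ennreal (wt z) \<partial>jm t"
    let ?v = "(\<integral>\<^sup>+(x, y). ennreal (min 1 (dist x y)) \<partial>variation (j t)) * indicator {0..T} t"
    have "?p \<le> ?v \<and> ?m \<le> ?v"
    proof (cases "t \<in> {0..T}")
      case True
      have "?p + ?m = (\<integral>\<^sup>+z. ennreal (wt z) \<partial>variation (j t))"
        by (rule nn_integral_jpm_le_variation[OF True]) measurable
      also have "\<dots> = ?v"
        unfolding indicator_eq_1_iff[THEN iffD2, OF True] mult_1_right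
        by (intro nn_integral_cong) (auto split: prod.split)
      finally have "?v = ?p + ?m" by simp
      then show ?thesis by (simp only:) simp
    next
      case False
      then have "jp t = null_measure borel" "jm t = null_measure borel"
        by (simp_all only: jp_def jm_def if_False)
      then show ?thesis by (simp add: nn_integral_null_measure)
    qed
    then show "?p \<le> ?v" "?m \<le> ?v" by blast+
  qed
  show "(\<integral>\<^sup>+t. (\<integral>\<^sup>+z. ennreal (wt z) \<partial>jp t) \<partial>lborel) < \<infinity>"
    "(\<integral>\<^sup>+t. (\<integral>\<^sup>+z. ennreal (wt z) \<partial>jm t) \<partial>lborel) < \<infinity>"
    using le by (intro le_less_trans[OF nn_integral_mono V]; simp)+
qed

lemma sm_integral_jpm:
  "t \<in> {0..T} \<Longrightarrow> sm_integral (j t) offdiag f = (\<integral>z. indicator offdiag z * f z \<partial>jp t) - (\<integral>z. indicator offdiag z * f z \<partial>jm t)"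
  by (simp add: sm_integral_def set_lebesgue_integral_def jpm_eq)

lemma compose_fst_measurable: "h \<in> measurable borel N \<Longrightarrow> (\<lambda>z :: 'v \<times> 'v. h (fst z)) \<in> measurable borel N"
  and compose_snd_measurable: "h \<in> measurable borel N \<Longrightarrow> (\<lambda>z :: 'v \<times> 'v. h (snd z)) \<in> measurable borel N"
  by (rule measurable_compose[rotated], assumption,
      intro borel_measurable_continuous_onI continuous_intros)+

lemma grad_measurable:
  assumes "h \<in> borel_measurable borel"
  shows "(grad h :: 'v \<times> 'v \<Rightarrow> real) \<in> borel_measurable borel"
  unfolding grad_def case_prod_beta
  by (intro borel_measurable_diff compose_fst_measurable compose_snd_measurable assms)

text \<open>By the continuity equation this is an indefinite integral in time, and its integrand is
  integrable because Lipschitz gradients are dominated by \<open>wt\<close>.\<close>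

lemma Lip_b_rho_continuous:
  assumes f: "f \<in> Lip_b"
  shows "continuous_on {0..T} (\<lambda>t. \<integral>x. f x \<partial>\<rho> t)"
proof -
  have [measurable]: "f \<in> borel_measurable borel" by (rule Lip_b_measurable[OF f])
  obtain L where L: "L-lipschitz_on UNIV f" using f unfolding Lip_b_def by auto
  obtain B where B: "\<And>x. \<bar>f x\<bar> \<le> B" using Lip_b_bounded[OF f] by blast
  have B0: "B \<ge> 0" using order_trans[OF abs_ge_zero B] .
  define F where "F z = indicator offdiag z * grad f z" for z
  have "grad f \<in> borel_measurable borel" by (rule grad_measurable) measurable
  then have Fm[measurable]: "F \<in> borel_measurable borel" unfolding F_def by measurable
  \<comment> \<open>\<open>L\<close> serves for distances below 1 and \<open>2 * B\<close> for the
    others.\<close>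
  define c where "c = max L (2 * B)"
  have Fle: "\<bar>F z\<bar> \<le> c * wt z" for z
  proof -
    have "\<bar>grad f z\<bar> \<le> L * dist (fst z) (snd z)"
      using lipschitz_onD[OF L, of "snd z" "fst z"] by (simp add: grad_def case_prod_beta dist_real_def dist_commute)
    moreover have "\<bar>grad f z\<bar> \<le> 2 * B"
      using B[of "fst z"] B[of "snd z"] by (simp add: grad_def case_prod_beta)
    moreover have "L * dist (fst z) (snd z) \<le> c * dist (fst z) (snd z)" by (intro mult_right_mono) (auto simp: c_def)
    moreover have "2 * B \<le> c" by (simp add: c_def)
    ultimately have "\<bar>grad f z\<bar> \<le> c * wt z" by (auto simp: min_def)
    moreover have "\<bar>F z\<bar> \<le> \<bar>grad f z\<bar>" by (auto simp: F_def indicator_def)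
    ultimately show ?thesis by linarith
  qed
  define kp where "kp t = (\<integral>z. F z \<partial>jp t)" for t
  define km where "km t = (\<integral>z. F z \<partial>jm t)" for t
  have int: "integrable lborel (\<lambda>t. \<integral>z. F z \<partial>K t)"
    if sK: "\<And>t. sets (K t) = sets borel" and mK: "\<And>B. B \<in> sets borel \<Longrightarrow> (\<lambda>t. emeasure (K t) B) \<in> borel_measurable lborel"
      and fK: "(\<integral>\<^sup>+t. (\<integral>\<^sup>+z. ennreal (wt z) \<partial>K t) \<partial>lborel) < \<infinity>" for K
  proof (rule integrableI_bounded)
    note [measurable_cong] = sK
    show "(\<lambda>t. \<integral>z. F z \<partial>K t) \<in> borel_measurable lborel"
      by (rule integral_kernel_measurable[where N = borel, OF sK]) (rule mK, assumption, rule Fm)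
    have wm: "(\<lambda>t. \<integral>\<^sup>+z. ennreal (wt z) \<partial>K t) \<in> borel_measurable lborel"
      by (rule nn_integral_kernel_measurable[where N = borel, OF sK]) (rule mK, assumption, measurable)
    have "ennreal (norm (\<integral>z. F z \<partial>K t)) \<le> ennreal c * (\<integral>\<^sup>+z. ennreal (wt z) \<partial>K t)" for t
    proof -
      have "ennreal (norm (\<integral>z. F z \<partial>K t)) \<le> (\<integral>\<^sup>+z. ennreal (norm (F z)) \<partial>K t)"
      proof (cases "integrable (K t) F")
        case True
        then show ?thesis by (rule integral_norm_bound_ennreal)
      qed (simp add: not_integrable_integral_eq)
      also have "\<dots> \<le> (\<integral>\<^sup>+z. ennreal c * ennreal (wt z) \<partial>K t)"
        using Fle B0 by (intro nn_integral_mono) (simp add: ennreal_mult'[symmetric] ennreal_leI c_def del: min_def)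
      also have "\<dots> = ennreal c * (\<integral>\<^sup>+z. ennreal (wt z) \<partial>K t)"
        by (intro nn_integral_cmult) measurable
      finally show ?thesis .
    qed
    then have "(\<integral>\<^sup>+t. ennreal (norm (\<integral>z. F z \<partial>K t)) \<partial>lborel) \<le> (\<integral>\<^sup>+t. ennreal c * (\<integral>\<^sup>+z. ennreal (wt z) \<partial>K t) \<partial>lborel)"
      by (intro nn_integral_mono)
    also have "\<dots> = ennreal c * (\<integral>\<^sup>+t. (\<integral>\<^sup>+z. ennreal (wt z) \<partial>K t) \<partial>lborel)"
      by (rule nn_integral_cmult[OF wm])
    also have "\<dots> < \<infinity>" using fK by (simp add: ennreal_mult_less_top)
    finally show "(\<integral>\<^sup>+t. ennreal (norm (\<integral>z. F z \<partial>K t)) \<partial>lborel) < \<infinity>" .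
  qed
  have ik: "integrable lborel (\<lambda>t. kp t - km t)"
    unfolding kp_def km_def
    by (intro Bochner_Integration.integrable_diff int jpm_meas jpm_weight_finite sets_jpm)
  have si: "set_integrable lborel S (\<lambda>t. kp t - km t)" if "S \<in> sets borel" for S
    using integrable_mult_indicator[OF _ ik, of S] that by (simp add: set_integrable_def)
  have eq: "(\<integral>x. f x \<partial>\<rho> t) = (\<integral>x. f x \<partial>\<rho> 0) + integral {0..t} (\<lambda>t. kp t - km t)" if t: "t \<in> {0..T}" for t
  proof -
    have "ce_identity T \<rho> j f" using CE f unfolding CE_def by auto
    then have "(\<integral>x. f x \<partial>\<rho> t) - (\<integral>x. f x \<partial>\<rho> 0) = (\<integral>r\<in>{0..t}. sm_integral (j r) offdiag (grad f) \<partial>lborel)"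
      unfolding ce_identity_def using t by auto
    also have "\<dots> = (\<integral>r\<in>{0..t}. kp r - km r \<partial>lborel)"
      using t by (intro set_lebesgue_integral_cong) (auto simp: sm_integral_jpm kp_def km_def F_def)
    also have "\<dots> = integral {0..t} (\<lambda>t. kp t - km t)"
      by (rule set_borel_integral_eq_integral(2)[OF si]) simp
    finally show ?thesis by simp
  qed
  have "continuous_on {0..T} (\<lambda>t. integral {0..t} (\<lambda>t. kp t - km t))"
    by (rule indefinite_integral_continuous_1) (rule set_borel_integral_eq_integral(1)[OF si], simp)
  then have "continuous_on {0..T} (\<lambda>t. (\<integral>x. f x \<partial>\<rho> 0) + integral {0..t} (\<lambda>t. kp t - km t))"
    by (intro continuous_intros)
  then show ?thesis by (subst continuous_on_cong[OF refl eq])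
qed

end

section \<open>Extension of the density bound to every time\<close>

lemma AE_lborel_ex_between:
  fixes a b :: real
  assumes "AE s in lborel. P s" "a < b"
  shows "\<exists>s. a < s \<and> s < b \<and> P s"
proof (rule ccontr)
  assume "\<not> ?thesis"
  then have n: "\<not> P s" if "a < s" "s < b" for s using that by blast
  have "AE s in lborel. s \<notin> {a<..<b}"
    using assms(1) by eventually_elim (use n in auto)
  then have "{a<..<b} \<in> null_sets lborel"
    by (subst AE_iff_null_sets) auto
  then show False using assms(2) by (simp add: null_sets_def)
qed

context reflecting_pair
begin

definition Cb :: real where
  "Cb = (SOME C. 0 \<le> C \<and> (AE t in lborel. t \<in> {0<..<T} \<longrightarrow> (AE x in \<pi>. dens \<pi> (\<rho> t) x \<le> C)))"

lemma Cb_nonneg: "Cb \<ge> 0"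
  and dens_le_Cb_AE: "AE t in lborel. t \<in> {0<..<T} \<longrightarrow> (AE x in \<pi>. dens \<pi> (\<rho> t) x \<le> Cb)"
proof -
  obtain C where C: "AE t in lborel. t \<in> {0<..<T} \<longrightarrow> (AE x in \<pi>. \<bar>dens \<pi> (\<rho> t) x\<bar> \<le> C)"
    using RCE unfolding RCE_def by auto
  have "AE t in lborel. t \<in> {0<..<T} \<longrightarrow> (AE x in \<pi>. dens \<pi> (\<rho> t) x \<le> max C 0)"
    using C by eventually_elim (auto elim!: eventually_mono)
  then have "\<exists>C. 0 \<le> C \<and> (AE t in lborel. t \<in> {0<..<T} \<longrightarrow> (AE x in \<pi>. dens \<pi> (\<rho> t) x \<le> C))"
    by (intro exI[of _ "max C 0"]) auto
  from someI_ex[OF this] show "Cb \<ge> 0"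
    "AE t in lborel. t \<in> {0<..<T} \<longrightarrow> (AE x in \<pi>. dens \<pi> (\<rho> t) x \<le> Cb)"
    unfolding Cb_def by blast+
qed

lemma dens_integrable: "t \<in> {0..T} \<Longrightarrow> integrable \<pi> (dens \<pi> (\<rho> t))"
proof -
  assume t: "t \<in> {0..T}"
  interpret r: finite_measure "\<rho> t" by (rule rho_finite[OF t])
  have "emeasure (\<rho> t) UNIV = (\<integral>\<^sup>+x. ennreal (dens \<pi> (\<rho> t) x) \<partial>\<pi>)"
    by (subst rho_density[OF t]) (simp add: emeasure_density)
  moreover have "emeasure (\<rho> t) UNIV < \<infinity>" using r.emeasure_finite[of UNIV] by (simp add: less_top[symmetric])
  ultimately show ?thesis
    by (intro integrableI_nonneg) (auto simp: dens_nonneg)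
qed

lemma integral_rho:
  assumes "t \<in> {0..T}" and [measurable]: "G \<in> borel_measurable borel"
  shows "(\<integral>x. G x \<partial>\<rho> t) = (\<integral>x. dens \<pi> (\<rho> t) x * G x \<partial>\<pi>)"
  by (subst rho_density[OF assms(1)]) (simp add: integral_density dens_nonneg)

text \<open>The left side is continuous in time, so a violation would persist on a time interval of
  positive length, while the bound on the densities holds at almost every time.\<close>

lemma Lip_b_rho_le:
  assumes t: "t \<in> {0..T}" and f: "f \<in> Lip_b" and f0: "\<And>x. f x \<ge> 0"
  shows "(\<integral>x. f x \<partial>\<rho> t) \<le> Cb * (\<integral>x. f x \<partial>\<pi>)"
proof (rule ccontr)
  assume n: "\<not> ?thesis"
  have [measurable]: "f \<in> borel_measurable borel" by (rule Lip_b_measurable[OF f])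
  have good: "(\<integral>x. f x \<partial>\<rho> s) \<le> Cb * (\<integral>x. f x \<partial>\<pi>)"
    if s: "s \<in> {0..T}" and ae: "AE x in \<pi>. dens \<pi> (\<rho> s) x \<le> Cb" for s
  proof -
    have "(\<integral>x. dens \<pi> (\<rho> s) x * f x \<partial>\<pi>) \<le> (\<integral>x. Cb * f x \<partial>\<pi>)"
    proof (rule integral_mono_AE')
      show "integrable \<pi> (\<lambda>x. Cb * f x)"
        by (intro integrable_mult_right Lip_b_integrable[OF _ _ f]) (auto simp: pi.finite_measure_axioms)
      show "AE x in \<pi>. dens \<pi> (\<rho> s) x * f x \<le> Cb * f x"
        using ae by eventually_elim (auto intro: mult_right_mono f0)
    qed (auto simp: dens_nonneg f0 Cb_nonneg)
    then show ?thesis by (simp add: integral_rho[OF s])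
  qed
  have "((\<lambda>s. \<integral>x. f x \<partial>\<rho> s) \<longlongrightarrow> (\<integral>x. f x \<partial>\<rho> t)) (at t within {0..T})"
    using Lip_b_rho_continuous[OF f] t by (auto simp: continuous_on_def)
  then have "eventually (\<lambda>s. (\<integral>x. f x \<partial>\<rho> s) > Cb * (\<integral>x. f x \<partial>\<pi>)) (at t within {0..T})"
    using n by (intro order_tendstoD) auto
  then obtain d where d: "d > 0" "\<And>s. s \<in> {0..T} \<Longrightarrow> s \<noteq> t \<Longrightarrow> dist s t < d \<Longrightarrow> (\<integral>x. f x \<partial>\<rho> s) > Cb * (\<integral>x. f x \<partial>\<pi>)"
    unfolding eventually_at by blast
  have "max 0 (t - d) < min T (t + d)" using t d T_pos by auto
  from AE_lborel_ex_between[OF dens_le_Cb_AE this] obtain s where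
    s: "max 0 (t - d) < s" "s < min T (t + d)" "s \<in> {0<..<T} \<longrightarrow> (AE x in \<pi>. dens \<pi> (\<rho> s) x \<le> Cb)" by blast
  then have sT: "s \<in> {0..T}" "s \<in> {0<..<T}" by auto
  have "(\<integral>x. f x \<partial>\<rho> s) \<le> Cb * (\<integral>x. f x \<partial>\<pi>)" using s sT by (intro good) auto
  moreover have "(\<integral>x. f x \<partial>\<rho> s) > Cb * (\<integral>x. f x \<partial>\<pi>)"
  proof (cases "s = t")
    case False
    then show ?thesis using s by (intro d(2)[OF sT(1)]) (auto simp: dist_real_def)
  qed (use n in auto)
  ultimately show False by simp
qed

text \<open>\<open>RCE\<close> bounds the density at almost every time only, but the energy is
  needed at every time. Nonnegative Lipschitz approximations of the indicator of the set
  \<open>B\<close> where the bound fails show that \<open>\<rho> t\<close> gives \<open>B\<close> at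
  most \<open>Cb\<close> times its \<open>\<pi>\<close>-mass, which is impossible unless
  \<open>B\<close> is null.\<close>

lemma dens_le_Cb:
  assumes t: "t \<in> {0..T}"
  shows "AE x in \<pi>. dens \<pi> (\<rho> t) x \<le> Cb"
proof -
  let ?d = "dens \<pi> (\<rho> t)"
  define B where "B = {x. ?d x > Cb}"
  have B[measurable]: "B \<in> sets borel" unfolding B_def by measurable
  note id = dens_integrable[OF t]
  have ind: "integrable \<pi> (indicator B :: 'v \<Rightarrow> real)" by (simp add: less_top[symmetric])
  have idB: "integrable \<pi> (\<lambda>x. ?d x * indicator B x)"
    using integrable_real_mult_indicator[OF _ id, of B] by simp
  \<comment> \<open>Approximation in \<open>L\<^sup>1\<close> of this measure controls the errors
    under \<open>\<pi>\<close> and under \<open>\<rho> t\<close> at once.\<close>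
  define \<mu> where "\<mu> = density \<pi> (\<lambda>x. ennreal (1 + ?d x))"
  have s\<mu>: "sets \<mu> = sets borel" by (simp add: \<mu>_def)
  have "integrable \<pi> (\<lambda>x. 1 + ?d x)" using id by auto
  then have "(\<integral>\<^sup>+x. ennreal (1 + ?d x) \<partial>\<pi>) < \<infinity>"
    by (simp add: integrable_iff_bounded dens_nonneg abs_of_nonneg)
  then have fin: "finite_measure \<mu>"
    by (intro finite_measureI) (simp add: \<mu>_def emeasure_density)
  have "(\<integral>x. ?d x * indicator B x \<partial>\<pi>) \<le> Cb * measure \<pi> B"
  proof (rule field_le_epsilon)
    fix e' :: real assume "e' > 0"
    \<comment> \<open>The final estimate carries the error \<open>Cb * e + e\<close>.\<close>
    define e where "e = e' / (Cb + 1)"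
    have e: "e > 0" using \<open>e' > 0\<close> Cb_nonneg by (simp add: e_def)
    obtain f where f: "f \<in> Lip_b" "(\<integral>x. \<bar>indicator B x - f x\<bar> \<partial>\<mu>) < e"
      using Lip_b_dense_indicator[OF fin s\<mu> B] e by blast
    define h where "h x = max 0 (f x)" for x
    have h: "h \<in> Lip_b" "\<And>x. h x \<ge> 0" using Lip_b_max_0[OF f(1)] by (simp_all add: h_def[abs_def])
    have [measurable]: "f \<in> borel_measurable borel" "h \<in> borel_measurable borel"
      using Lip_b_measurable f h by auto
    define q where "q x = \<bar>indicator B x - h x\<bar>" for x
    have [measurable]: "q \<in> borel_measurable borel" unfolding q_def by measurable
    have q0: "q x \<ge> 0" for x by (simp add: q_def)
    have ih: "integrable \<pi> h" by (intro Lip_b_integrable[OF _ _ h(1)]) (auto simp: pi.finite_measure_axioms)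
    have ih\<mu>: "integrable \<mu> h" "integrable \<mu> f" using Lip_b_integrable[OF fin s\<mu>] h f by auto
    have iB\<mu>: "integrable \<mu> (indicator B :: 'v \<Rightarrow> real)"
      using finite_measure.emeasure_finite[OF fin, of B] by (simp add: s\<mu> less_top[symmetric])
    have iq\<mu>: "integrable \<mu> q" unfolding q_def using ih\<mu> iB\<mu> by (intro integrable_abs Bochner_Integration.integrable_diff)
    then have iq': "integrable \<pi> (\<lambda>x. (1 + ?d x) * q x)"
      unfolding \<mu>_def by (subst (asm) integrable_density) (auto simp: dens_nonneg)
    have "(\<integral>x. (1 + ?d x) * q x \<partial>\<pi>) = (\<integral>x. q x \<partial>\<mu>)"
      unfolding \<mu>_def by (subst integral_density) (auto simp: dens_nonneg)
    also have "\<dots> \<le> (\<integral>x. \<bar>indicator B x - f x\<bar> \<partial>\<mu>)"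
    proof (rule integral_mono[OF iq\<mu>])
      show "integrable \<mu> (\<lambda>x. \<bar>indicator B x - f x\<bar>)"
        by (intro integrable_abs Bochner_Integration.integrable_diff iB\<mu> ih\<mu>)
    qed (auto simp: q_def h_def indicator_def max_def)
    finally have qe: "(\<integral>x. (1 + ?d x) * q x \<partial>\<pi>) < e" using f(2) by linarith
    have iq1: "integrable \<pi> q"
      by (rule Bochner_Integration.integrable_bound[OF iq']) (auto intro!: AE_I2 simp: abs_mult q0 dens_nonneg algebra_simps)
    have iq2: "integrable \<pi> (\<lambda>x. ?d x * q x)"
      by (rule Bochner_Integration.integrable_bound[OF iq']) (auto intro!: AE_I2 simp: abs_mult q0 dens_nonneg algebra_simps)
    have sum: "(\<integral>x. q x \<partial>\<pi>) + (\<integral>x. ?d x * q x \<partial>\<pi>) < e"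
      using qe iq1 iq2 by (simp add: distrib_right)
    have q1: "(\<integral>x. q x \<partial>\<pi>) \<le> e" "(\<integral>x. ?d x * q x \<partial>\<pi>) \<le> e" 
    proof -
      have "(\<integral>x. q x \<partial>\<pi>) \<ge> 0" "(\<integral>x. ?d x * q x \<partial>\<pi>) \<ge> 0"
        by (auto intro!: integral_nonneg_AE simp: q0 dens_nonneg)
      with sum show "(\<integral>x. q x \<partial>\<pi>) \<le> e" "(\<integral>x. ?d x * q x \<partial>\<pi>) \<le> e" by linarith+
    qed
    have idh: "integrable \<pi> (\<lambda>x. ?d x * h x)"
    proof (rule Bochner_Integration.integrable_bound[OF Bochner_Integration.integrable_add[OF iq2 id]])
      show "AE x in \<pi>. norm (?d x * h x) \<le> norm (?d x * q x + ?d x)"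
      proof (rule AE_I2)
        fix x
        have "h x \<le> q x + 1" by (auto simp: q_def indicator_def)
        then have "?d x * h x \<le> ?d x * (q x + 1)" by (intro mult_left_mono dens_nonneg)
        then show "norm (?d x * h x) \<le> norm (?d x * q x + ?d x)"
          by (simp add: abs_mult h(2) dens_nonneg q0 distrib_left)
      qed
    qed measurable
    have "(\<integral>x. ?d x * indicator B x \<partial>\<pi>) \<le> (\<integral>x. ?d x * h x + ?d x * q x \<partial>\<pi>)"
    proof (rule integral_mono[OF idB])
      show "integrable \<pi> (\<lambda>x. ?d x * h x + ?d x * q x)" using idh iq2 by auto
      fix x
      have "?d x * indicator B x \<le> ?d x * (h x + q x)"
        by (intro mult_left_mono dens_nonneg) (auto simp: q_def)
      then show "?d x * indicator B x \<le> ?d x * h x + ?d x * q x" by (simp add: distrib_left)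
    qed
    also have "\<dots> = (\<integral>x. h x \<partial>\<rho> t) + (\<integral>x. ?d x * q x \<partial>\<pi>)"
      using idh iq2 by (simp add: integral_rho[OF t])
    also have "\<dots> \<le> Cb * (\<integral>x. h x \<partial>\<pi>) + e"
      using Lip_b_rho_le[OF t h] q1 by simp
    also have "(\<integral>x. h x \<partial>\<pi>) \<le> (\<integral>x. indicator B x + q x \<partial>\<pi>)"
      using ih ind iq1 by (intro integral_mono Bochner_Integration.integrable_add) (auto simp: q_def)
    also have "\<dots> = measure \<pi> B + (\<integral>x. q x \<partial>\<pi>)" using ind iq1 by simp
    also have "\<dots> \<le> measure \<pi> B + e" using q1 by simp
    finally have "(\<integral>x. ?d x * indicator B x \<partial>\<pi>) \<le> Cb * (measure \<pi> B + e) + e"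
      using Cb_nonneg by (auto simp: mult_left_mono)
    also have "\<dots> = Cb * measure \<pi> B + e'"
    proof -
      have "(Cb + 1) * e = e'" using Cb_nonneg by (simp add: e_def)
      then show ?thesis by (simp add: algebra_simps)
    qed
    finally show "(\<integral>x. ?d x * indicator B x \<partial>\<pi>) \<le> Cb * measure \<pi> B + e'" .
  qed
  then have "(\<integral>x. (?d x - Cb) * indicator B x \<partial>\<pi>) \<le> 0"
    using idB ind by (simp add: left_diff_distrib)
  moreover have nn: "AE x in \<pi>. 0 \<le> (?d x - Cb) * indicator B x" by (auto simp: B_def indicator_def)
  ultimately have "(\<integral>x. (?d x - Cb) * indicator B x \<partial>\<pi>) = 0"
    using integral_nonneg_AE[OF nn] by linarith
  moreover have "integrable \<pi> (\<lambda>x. (?d x - Cb) * indicator B x)"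
    using idB ind by (simp add: left_diff_distrib)
  ultimately have "AE x in \<pi>. (?d x - Cb) * indicator B x = 0"
    using integral_nonneg_eq_0_iff_AE nn by blast
  then show ?thesis by eventually_elim (auto simp: B_def indicator_def)
qed

text \<open>Bounded at every point and not only almost everywhere; by \<open>dens_le_Cb\<close> it
  is a version of the density at every time in \<open>{0..T}\<close>.\<close>

definition v :: "real \<Rightarrow> 'v \<Rightarrow> real" where "v t x = min Cb (dens \<pi> (\<rho> t) x)"

lemma v_measurable [measurable]: "v t \<in> borel_measurable borel"
  unfolding v_def[abs_def] by measurable

lemma v_bounds: "0 \<le> v t x" "v t x \<le> Cb"
  using Cb_nonneg dens_nonneg by (auto simp: v_def)

lemma v_eq_dens: "t \<in> {0..T} \<Longrightarrow> AE x in \<pi>. v t x = dens \<pi> (\<rho> t) x"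
  using dens_le_Cb[of t] by (auto simp: v_def elim!: eventually_mono)

section \<open>Continuity in time and the truncated energy\<close>

lemma integrable_bounded_pi:
  fixes G :: "'v \<Rightarrow> real"
  assumes [measurable]: "G \<in> borel_measurable borel" and "\<And>x. \<bar>G x\<bar> \<le> M"
  shows "integrable \<pi> G"
  using assms by (intro pi.integrable_const_bound[of _ M]) auto

lemma integral_rho_v:
  assumes "t \<in> {0..T}" and [measurable]: "G \<in> borel_measurable borel"
  shows "(\<integral>x. G x \<partial>\<rho> t) = (\<integral>x. v t x * G x \<partial>\<pi>)"
  unfolding integral_rho[OF assms]
  using v_eq_dens[OF assms(1)] by (intro integral_cong_AE) (auto elim!: eventually_mono)

text \<open>All measures \<open>\<rho> r\<close> are dominated by \<open>Cb * \<pi>\<close>, so a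
  Lipschitz approximation of \<open>G\<close> in \<open>L\<^sup>1(\<pi>)\<close> is good uniformly
  in time, and continuity passes from Lipschitz to bounded Borel functions.\<close>

lemma integral_rho_continuous:
  fixes G :: "'v \<Rightarrow> real"
  assumes t: "t \<in> {0..T}" and G[measurable]: "G \<in> borel_measurable borel" and GM: "\<And>x. \<bar>G x\<bar> \<le> M" and e: "e > 0"
  shows "\<exists>\<delta>>0. \<forall>r\<in>{0..T}. \<bar>r - t\<bar> < \<delta> \<longrightarrow> \<bar>(\<integral>x. G x \<partial>\<rho> r) - (\<integral>x. G x \<partial>\<rho> t)\<bar> < e"
proof -
  have iG: "integrable \<pi> G" by (rule integrable_bounded_pi[OF G GM])
  define e1 where "e1 = e / (3 * (Cb + 1))"
  have e1: "e1 > 0" using e Cb_nonneg by (simp add: e1_def)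
  obtain f where f: "f \<in> Lip_b" "(\<integral>x. \<bar>G x - f x\<bar> \<partial>\<pi>) < e1"
    using Lip_b_dense[OF pi.finite_measure_axioms sets_pi iG] e1 by blast
  have [measurable]: "f \<in> borel_measurable borel" by (rule Lip_b_measurable[OF f(1)])
  obtain B where B: "\<And>x. \<bar>f x\<bar> \<le> B" using Lip_b_bounded[OF f(1)] by blast
  have near: "\<bar>(\<integral>x. G x \<partial>\<rho> r) - (\<integral>x. f x \<partial>\<rho> r)\<bar> \<le> e / 3" if r: "r \<in> {0..T}" for r
  proof -
    have iv: "integrable \<pi> (\<lambda>x. v r x * G x)" "integrable \<pi> (\<lambda>x. v r x * f x)"
    proof -
      show "integrable \<pi> (\<lambda>x. v r x * G x)"
        by (rule integrable_bounded_pi[of _ "Cb * M"]) (measurable, simp add: abs_mult v_bounds mult_mono GM Cb_nonneg)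
      show "integrable \<pi> (\<lambda>x. v r x * f x)"
        by (rule integrable_bounded_pi[of _ "Cb * B"]) (measurable, simp add: abs_mult v_bounds mult_mono B Cb_nonneg)
    qed
    have iGf: "integrable \<pi> (\<lambda>x. \<bar>G x - f x\<bar>)"
      by (intro integrable_abs Bochner_Integration.integrable_diff iG integrable_bounded_pi[OF _ B]) measurable
    have "(\<integral>x. G x \<partial>\<rho> r) - (\<integral>x. f x \<partial>\<rho> r) = (\<integral>x. v r x * (G x - f x) \<partial>\<pi>)"
      using iv by (simp add: integral_rho_v[OF r] right_diff_distrib)
    also have "\<bar>\<dots>\<bar> \<le> (\<integral>x. \<bar>v r x * (G x - f x)\<bar> \<partial>\<pi>)" by (rule integral_abs_bound)
    also have "\<dots> \<le> (\<integral>x. Cb * \<bar>G x - f x\<bar> \<partial>\<pi>)"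
      using iGf by (intro integral_mono') (auto simp: abs_mult v_bounds Cb_nonneg intro!: mult_right_mono)
    also have "\<dots> \<le> Cb * e1" using f(2) Cb_nonneg by (simp add: mult_left_mono)
    also have "\<dots> \<le> e / 3"
    proof -
      have "x * (e / (3 * x)) = e / 3" if "x > 0" for x :: real using that by simp
      from this[of "Cb + 1"] have "(Cb + 1) * e1 = e / 3" using Cb_nonneg by (simp add: e1_def)
      then show ?thesis using e1 by (simp add: algebra_simps)
    qed
    finally show ?thesis .
  qed
  have "((\<lambda>s. \<integral>x. f x \<partial>\<rho> s) \<longlongrightarrow> (\<integral>x. f x \<partial>\<rho> t)) (at t within {0..T})"
    using Lip_b_rho_continuous[OF f(1)] t by (auto simp: continuous_on_def)
  then have "eventually (\<lambda>s. dist (\<integral>x. f x \<partial>\<rho> s) (\<integral>x. f x \<partial>\<rho> t) < e / 3) (at t within {0..T})"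
    using e by (intro tendstoD) auto
  then obtain d where d: "d > 0" "\<And>s. s \<in> {0..T} \<Longrightarrow> s \<noteq> t \<Longrightarrow> dist s t < d \<Longrightarrow> dist (\<integral>x. f x \<partial>\<rho> s) (\<integral>x. f x \<partial>\<rho> t) < e / 3"
    unfolding eventually_at by blast
  show ?thesis
  proof (intro exI[of _ d] conjI ballI impI)
    fix r assume r: "r \<in> {0..T}" "\<bar>r - t\<bar> < d"
    have "\<bar>(\<integral>x. f x \<partial>\<rho> r) - (\<integral>x. f x \<partial>\<rho> t)\<bar> < e / 3"
      using d(2)[of r] r e by (cases "r = t") (auto simp: dist_real_def)
    with near[OF r(1)] near[OF t] show "\<bar>(\<integral>x. G x \<partial>\<rho> r) - (\<integral>x. G x \<partial>\<rho> t)\<bar> < e" by linarith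
  qed (rule d)
qed

text \<open>Extends functions of time constantly beyond the endpoints, as the increment formula on
  the line requires.\<close>

definition clampT :: "real \<Rightarrow> real" where "clampT t = max 0 (min T t)"

lemma clampT_in [simp]: "clampT t \<in> {0..T}" using T_pos by (auto simp: clampT_def)
lemma clampT_id: "t \<in> {0..T} \<Longrightarrow> clampT t = t" by (auto simp: clampT_def)
lemma clampT_lip: "\<bar>clampT r - clampT t\<bar> \<le> \<bar>r - t\<bar>" by (auto simp: clampT_def)

definition Ecut :: "real \<Rightarrow> real \<Rightarrow> real" where
  "Ecut \<epsilon> t = (\<integral>x. phi_cut \<epsilon> (v (clampT t) x) \<partial>\<pi>)"

lemma phi_bounded: "\<exists>B\<ge>0. \<forall>u. 0 \<le> u \<and> u \<le> Cb \<longrightarrow> \<phi> u \<le> B"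
proof -
  have "compact {0..Cb}" "continuous_on {0..Cb} \<phi>" using phi_cont by (auto intro: continuous_on_subset)
  then have "bounded (\<phi> ` {0..Cb})" using compact_continuous_image compact_imp_bounded by blast
  then obtain B where "\<forall>u\<in>{0..Cb}. \<bar>\<phi> u\<bar> \<le> B" by (auto simp: bounded_iff)
  then show ?thesis by (intro exI[of _ "max B 0"]) force
qed

text \<open>The upper bound of \<open>\<phi>\<close> on \<open>{0..Cb}\<close> together with the
  lower bound from \<open>phi_cut_ge\<close>; it does not depend on
  \<open>\<epsilon>\<close>.\<close>

definition phiB :: real where "phiB = (SOME B. B \<ge> 0 \<and> (\<forall>u. 0 \<le> u \<and> u \<le> Cb \<longrightarrow> \<phi> u \<le> B)) + \<bar>deriv \<phi> 1\<bar>"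

lemma phi_cut_bounded:
  assumes "0 < \<epsilon>" "\<epsilon> \<le> 1" "0 \<le> u" "u \<le> Cb"
  shows "\<bar>phi_cut \<epsilon> u\<bar> \<le> phiB"
proof -
  have "(SOME B. B \<ge> 0 \<and> (\<forall>u. 0 \<le> u \<and> u \<le> Cb \<longrightarrow> \<phi> u \<le> B)) \<ge> 0" 
    "\<phi> u \<le> (SOME B. B \<ge> 0 \<and> (\<forall>u. 0 \<le> u \<and> u \<le> Cb \<longrightarrow> \<phi> u \<le> B))"
    using someI_ex[OF phi_bounded] assms by blast+
  then show ?thesis
    using phi_cut_le[OF assms(1,3)] phi_cut_ge[OF assms(1-3)] unfolding phiB_def by linarith
qed

lemma phi_cut_v_int:
  assumes e: "0 < \<epsilon>" "\<epsilon> \<le> 1"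
  shows "integrable \<pi> (\<lambda>x. phi_cut \<epsilon> (v t x))"
  by (intro integrable_bounded_pi[of _ phiB] measurable_compose[OF v_measurable phi_cut_measurable[OF e(1)]]
      phi_cut_bounded[OF e] v_bounds)

lemma Ecut_bound:
  assumes e: "0 < \<epsilon>" "\<epsilon> \<le> 1"
  shows "\<bar>Ecut \<epsilon> t\<bar> \<le> phiB * measure \<pi> UNIV"
proof -
  have "\<bar>Ecut \<epsilon> t\<bar> \<le> (\<integral>x. \<bar>phi_cut \<epsilon> (v (clampT t) x)\<bar> \<partial>\<pi>)" unfolding Ecut_def by (rule integral_abs_bound)
  also have "\<dots> \<le> (\<integral>x. phiB \<partial>\<pi>)"
    using phi_cut_v_int[OF e] phi_cut_bounded[OF e] v_bounds by (intro integral_mono integrable_abs) auto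
  finally show ?thesis by (simp add: mult.commute)
qed

definition G :: "real \<Rightarrow> real \<Rightarrow> 'v \<Rightarrow> real" where "G \<epsilon> t x = dphi_cut \<epsilon> (v t x)"

lemma G_measurable: "\<epsilon> > 0 \<Longrightarrow> G \<epsilon> t \<in> borel_measurable borel"
  unfolding G_def[abs_def] by (intro measurable_compose[OF v_measurable] dphi_cut_measurable)

definition GM :: "real \<Rightarrow> real" where "GM \<epsilon> = \<bar>dphi_cut \<epsilon> 0\<bar> + \<bar>dphi_cut \<epsilon> Cb\<bar>"

lemma G_bound: "\<epsilon> > 0 \<Longrightarrow> \<bar>G \<epsilon> t x\<bar> \<le> GM \<epsilon>"
  unfolding G_def GM_def by (intro dphi_cut_bound v_bounds)

text \<open>The tangent inequality for \<open>phi_cut\<close> at \<open>v t x\<close>, integrated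
  against \<open>\<pi>\<close>.\<close>

lemma Ecut_incr:
  assumes e: "0 < \<epsilon>" "\<epsilon> \<le> 1" and r: "r \<in> {0..T}" and t: "t \<in> {0..T}"
  shows "Ecut \<epsilon> r - Ecut \<epsilon> t \<ge> (\<integral>x. G \<epsilon> t x \<partial>\<rho> r) - (\<integral>x. G \<epsilon> t x \<partial>\<rho> t)"
proof -
  note [measurable] = G_measurable[OF e(1)]
  have ivG: "integrable \<pi> (\<lambda>x. v s x * G \<epsilon> t x)" for s
    by (rule integrable_bounded_pi[of _ "Cb * GM \<epsilon>"]) (measurable, simp add: abs_mult v_bounds mult_mono G_bound e Cb_nonneg)
  have "(\<integral>x. G \<epsilon> t x \<partial>\<rho> r) - (\<integral>x. G \<epsilon> t x \<partial>\<rho> t) = (\<integral>x. v r x * G \<epsilon> t x - v t x * G \<epsilon> t x \<partial>\<pi>)"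
    using ivG by (simp add: integral_rho_v[OF r] integral_rho_v[OF t])
  also have "\<dots> \<le> (\<integral>x. phi_cut \<epsilon> (v r x) - phi_cut \<epsilon> (v t x) \<partial>\<pi>)"
  proof (rule integral_mono)
    show "v r x * G \<epsilon> t x - v t x * G \<epsilon> t x \<le> phi_cut \<epsilon> (v r x) - phi_cut \<epsilon> (v t x)" for x
      using phi_cut_tangent[OF e(1) v_bounds(1)[of t x] v_bounds(1)[of r x]] by (simp add: G_def algebra_simps)
  qed (use ivG phi_cut_v_int[OF e] in auto)
  also have "\<dots> = Ecut \<epsilon> r - Ecut \<epsilon> t"
    using phi_cut_v_int[OF e] r t by (simp add: Ecut_def clampT_id)
  finally show ?thesis by simp
qed

text \<open>\<open>Ecut_incr\<close> bounds the energy at \<open>r\<close> from below by a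
  functional that is affine in \<open>\<rho> r\<close>; this functional is continuous in
  \<open>r\<close> because its test function is bounded.\<close>

lemma Ecut_lsc:
  assumes e: "0 < \<epsilon>" "\<epsilon> \<le> 1" and "e > 0"
  shows "\<exists>\<delta>>0. \<forall>r. \<bar>r - x\<bar> < \<delta> \<longrightarrow> Ecut \<epsilon> r \<ge> Ecut \<epsilon> x - e"
proof -
  obtain \<delta> where \<delta>: "\<delta> > 0" "\<And>r. r \<in> {0..T} \<Longrightarrow> \<bar>r - clampT x\<bar> < \<delta> \<Longrightarrow>
      \<bar>(\<integral>y. G \<epsilon> (clampT x) y \<partial>\<rho> r) - (\<integral>y. G \<epsilon> (clampT x) y \<partial>\<rho> (clampT x))\<bar> < e"
    using integral_rho_continuous[OF clampT_in G_measurable[OF e(1)] G_bound[OF e(1)] \<open>e > 0\<close>] by blast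
  have cl: "Ecut \<epsilon> (clampT s) = Ecut \<epsilon> s" for s by (simp only: Ecut_def clampT_id[OF clampT_in])
  show ?thesis
  proof (intro exI[of _ \<delta>] conjI allI impI)
    fix r assume "\<bar>r - x\<bar> < \<delta>"
    then have "\<bar>clampT r - clampT x\<bar> < \<delta>" using clampT_lip[of r x] by linarith
    from \<delta>(2)[OF clampT_in this] Ecut_incr[OF e clampT_in[of r] clampT_in[of x]]
    show "Ecut \<epsilon> r \<ge> Ecut \<epsilon> x - e" unfolding cl by linarith
  qed (rule \<delta>)
qed

lemma Ecut_measurable:
  assumes e: "0 < \<epsilon>" "\<epsilon> \<le> 1"
  shows "Ecut \<epsilon> \<in> borel_measurable borel"
proof (rule borel_measurableI_greater)
  fix c
  have "open {t. c < Ecut \<epsilon> t}"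
    unfolding open_dist
  proof
    fix t assume "t \<in> {t. c < Ecut \<epsilon> t}"
    then have "c < Ecut \<epsilon> t" by simp
    then have "(Ecut \<epsilon> t - c) / 2 > 0" by simp
    from Ecut_lsc[OF e this, of t] obtain d where d: "d > 0" "\<And>r. \<bar>r - t\<bar> < d \<Longrightarrow> Ecut \<epsilon> r \<ge> Ecut \<epsilon> t - (Ecut \<epsilon> t - c) / 2"
      by blast
    have "c < Ecut \<epsilon> r" if "dist r t < d" for r
      using d(2)[of r] that \<open>c < Ecut \<epsilon> t\<close> by (auto simp: dist_real_def field_simps)
    then show "\<exists>e>0. \<forall>y. dist y t < e \<longrightarrow> y \<in> {t. c < Ecut \<epsilon> t}" using d(1) by blast
  qed
  then show "{t \<in> space borel. c < Ecut \<epsilon> t} \<in> sets borel" by simp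
qed

section \<open>Jointly measurable densities and flux\<close>

lemma rho_density_v:
  assumes t: "t \<in> {0..T}"
  shows "\<rho> t = density \<pi> (\<lambda>x. ennreal (v t x))"
  using v_eq_dens[OF t]
  by (subst rho_density[OF t]) (intro density_cong, auto elim!: eventually_mono)

lemma emeasure_rho:
  assumes t: "t \<in> {0..T}" and [measurable]: "B \<in> sets borel"
  shows "emeasure (\<rho> t) B = ennreal (\<integral>x. indicator B x \<partial>\<rho> t)"
proof -
  interpret r: finite_measure "\<rho> t" by (rule rho_finite[OF t])
  show ?thesis using t by (simp add: r.emeasure_eq_measure)
qed

text \<open>Densities chosen separately for each \<open>t\<close> need not be measurable in
  \<open>(t, x)\<close>. A jointly measurable version comes from disintegrating the measures
  \<open>\<rho> t\<close> in time, with weight and reference density 1.\<close>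

lemma joint_density_ex:
  "\<exists>u. u \<in> borel_measurable (borel \<Otimes>\<^sub>M borel) \<and> (\<forall>p. 0 \<le> u p \<and> u p \<le> Cb) \<and>
     (AE t in lborel. t \<in> {0..T} \<longrightarrow> (AE x in \<pi>. u (t, x) = v t x))"
proof -
  define \<mu> where "\<mu> t = (if t \<in> {0..T} then \<rho> t else null_measure borel)" for t
  have s\<mu>: "sets (\<mu> t) = sets borel" for t by (simp add: \<mu>_def)
  have sp\<mu>: "space (\<mu> t) = UNIV" for t using sets_eq_imp_space_eq[OF s\<mu>] by simp
  have em: "emeasure (\<mu> t) B = (if t \<in> {0..T} then ennreal (\<integral>x. indicator B x \<partial>\<rho> t) else 0)"
    if "B \<in> sets borel" for B t
    using emeasure_rho[OF _ that, of t] by (simp add: \<mu>_def)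
  have meas: "(\<lambda>t. emeasure (\<mu> t) B) \<in> borel_measurable lborel" if B[measurable]: "B \<in> sets borel" for B
  proof -
    have "continuous_on {0..T} (\<lambda>t. \<integral>x. indicator B x \<partial>\<rho> t :: real)"
    proof (unfold continuous_on_iff, intro ballI allI impI)
      fix t e :: real assume "t \<in> {0..T}" "e > 0"
      from integral_rho_continuous[OF this(1) _ _ this(2), of "indicator B" 1]
      show "\<exists>d>0. \<forall>x'\<in>{0..T}. dist x' t < d \<longrightarrow> dist (\<integral>x. indicator B x \<partial>\<rho> x' :: real) (\<integral>x. indicator B x \<partial>\<rho> t) < e"
        by (auto simp: dist_real_def indicator_def)
    qed
    then have [measurable]: "(\<lambda>t. if t \<in> {0..T} then (\<integral>x. indicator B x \<partial>\<rho> t :: real) else 0) \<in> borel_measurable borel"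
      by (intro borel_measurable_continuous_on_if) auto
    have eq: "emeasure (\<mu> t) B = ennreal (if t \<in> {0..T} then (\<integral>x. indicator B x \<partial>\<rho> t :: real) else 0)" for t
      unfolding em[OF B] by simp
    show ?thesis unfolding eq by measurable
  qed
  have fin: "(\<integral>\<^sup>+t. (\<integral>\<^sup>+x. ennreal ((\<lambda>_. 1) x) \<partial>\<mu> t) \<partial>lborel) < \<infinity>"
  proof -
    have "(\<integral>\<^sup>+x. ennreal ((\<lambda>_. 1) x) \<partial>\<mu> t) \<le> ennreal (Cb * measure \<pi> UNIV) * indicator {0..T} t" for t
    proof (cases "t \<in> {0..T}")
      case True
      have "(\<integral>x. indicator UNIV x \<partial>\<rho> t :: real) = (\<integral>x. v t x * indicator UNIV x \<partial>\<pi>)"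
        by (rule integral_rho_v[OF True]) simp
      also have "\<dots> \<le> (\<integral>x. Cb \<partial>\<pi>)"
        using v_bounds Cb_nonneg by (intro integral_mono integrable_bounded_pi[of _ Cb]) auto
      finally have "(\<integral>x. indicator UNIV x \<partial>\<rho> t :: real) \<le> Cb * measure \<pi> UNIV" by (simp add: mult.commute)
      then show ?thesis using True em[of UNIV t] sp\<mu>[of t] by (simp add: ennreal_leI)
    next
      case False
      then have "\<mu> t = null_measure borel" by (simp only: \<mu>_def if_False)
      then show ?thesis by simp
    qed
    then have "(\<integral>\<^sup>+t. (\<integral>\<^sup>+x. ennreal ((\<lambda>_. 1) x) \<partial>\<mu> t) \<partial>lborel) \<le> (\<integral>\<^sup>+t. ennreal (Cb * measure \<pi> UNIV) * indicator {0..T} t \<partial>lborel)"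
      by (rule nn_integral_mono)
    also have "\<dots> < \<infinity>" using T_pos by (simp add: nn_integral_cmult ennreal_mult_less_top)
    finally show ?thesis .
  qed
  obtain k Bad where k[measurable]: "k \<in> borel_measurable (borel \<Otimes>\<^sub>M borel)" and
    Bad: "AE t in lborel. t \<in> Bad \<longleftrightarrow> \<not> absolutely_continuous (density \<pi> (\<lambda>z. ennreal 1)) (\<mu> t)"
      "AE t in lborel. t \<notin> Bad \<longrightarrow> \<mu> t = density (density \<pi> (\<lambda>z. ennreal 1)) (\<lambda>z. k (t, z))"
    by (rule disintegration[OF pi.sigma_finite_measure_axioms sets_pi s\<mu> meas _ _ fin, where a = "\<lambda>_. 1"]) auto
  define u where "u p = min Cb (enn2real (k p))" for p
  show ?thesis
  proof (intro exI[of _ u] conjI allI)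
    show "u \<in> borel_measurable (borel \<Otimes>\<^sub>M borel)" unfolding u_def by measurable
    show "0 \<le> u p" "u p \<le> Cb" for p using Cb_nonneg by (auto simp: u_def)
    have d1: "density \<pi> (\<lambda>z. ennreal 1) = \<pi>" by (simp add: density_1)
    show "AE t in lborel. t \<in> {0..T} \<longrightarrow> (AE x in \<pi>. u (t, x) = v t x)"
      using Bad
    proof eventually_elim
      case (elim t)
      show ?case
      proof
        assume t: "t \<in> {0..T}"
        then have "\<mu> t = \<rho> t" by (simp add: \<mu>_def)
        with elim[unfolded d1] rho_ac[OF t] have "\<rho> t = density \<pi> (\<lambda>x. k (t, x))" by simp
        then have "density \<pi> (\<lambda>x. k (t, x)) = density \<pi> (\<lambda>x. ennreal (v t x))"
          using rho_density_v[OF t] by simp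
        moreover have "(\<lambda>x. k (t, x)) \<in> borel_measurable \<pi>"
          unfolding measurable_cong_sets[OF sets_pi refl]
          by (rule measurable_compose[OF measurable_Pair1' k]) simp
        ultimately have "AE x in \<pi>. k (t, x) = ennreal (v t x)"
          by (intro pi.density_unique) simp_all
        then show "AE x in \<pi>. u (t, x) = v t x"
          by eventually_elim (simp add: u_def v_bounds)
      qed
    qed
  qed
qed

definition uh :: "real \<times> 'v \<Rightarrow> real" where
  "uh = (SOME u. u \<in> borel_measurable (borel \<Otimes>\<^sub>M borel) \<and> (\<forall>p. 0 \<le> u p \<and> u p \<le> Cb) \<and>
     (AE t in lborel. t \<in> {0..T} \<longrightarrow> (AE x in \<pi>. u (t, x) = v t x)))"

lemma uh_measurable [measurable]: "uh \<in> borel_measurable (borel \<Otimes>\<^sub>M borel)"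
  and uh_bounds: "0 \<le> uh p" "uh p \<le> Cb"
  and uh_eq_v: "AE t in lborel. t \<in> {0..T} \<longrightarrow> (AE x in \<pi>. uh (t, x) = v t x)"
proof -
  note u = someI_ex[OF joint_density_ex, folded uh_def]
  show "uh \<in> borel_measurable (borel \<Otimes>\<^sub>M borel)" by (rule u[THEN conjunct1])
  show "0 \<le> uh p" "uh p \<le> Cb" using u[THEN conjunct2, THEN conjunct1, THEN spec, of p] by simp_all
  show "AE t in lborel. t \<in> {0..T} \<longrightarrow> (AE x in \<pi>. uh (t, x) = v t x)"
    by (rule u[THEN conjunct2, THEN conjunct2])
qed

definition ux :: "real \<times> ('v \<times> 'v) \<Rightarrow> real" where "ux p = uh (fst p, fst (snd p))"
definition uy :: "real \<times> ('v \<times> 'v) \<Rightarrow> real" where "uy p = uh (fst p, snd (snd p))"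

lemma ux_uy_measurable [measurable]:
  "ux \<in> borel_measurable (borel \<Otimes>\<^sub>M borel)" "uy \<in> borel_measurable (borel \<Otimes>\<^sub>M borel)"
proof -
  have f: "fst \<in> measurable (borel :: ('v \<times> 'v) measure) borel" "snd \<in> measurable (borel :: ('v \<times> 'v) measure) borel"
    by (intro borel_measurable_continuous_onI continuous_intros)+
  show "ux \<in> borel_measurable (borel \<Otimes>\<^sub>M borel)"
    unfolding ux_def[abs_def]
    by (rule measurable_compose[OF measurable_Pair[OF measurable_fst measurable_compose[OF measurable_snd f(1)]] uh_measurable])
  show "uy \<in> borel_measurable (borel \<Otimes>\<^sub>M borel)"
    unfolding uy_def[abs_def]
    by (rule measurable_compose[OF measurable_Pair[OF measurable_fst measurable_compose[OF measurable_snd f(2)]] uh_measurable])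
qed

lemma uxy_bounds: "0 \<le> ux p" "ux p \<le> Cb" "0 \<le> uy p" "uy p \<le> Cb"
  using uh_bounds by (auto simp: ux_def uy_def)

definition ah :: "real \<times> ('v \<times> 'v) \<Rightarrow> real" where "ah p = \<alpha> (ux p, uy p)"
definition Dh :: "real \<times> ('v \<times> 'v) \<Rightarrow> ennreal" where "Dh p = D (ux p, uy p)"

lemma uxy_measurable: "(\<lambda>p. (ux p, uy p)) \<in> measurable (borel \<Otimes>\<^sub>M borel) borel"
  by (subst borel_prod[symmetric]) measurable

lemma ah_measurable [measurable]: "ah \<in> borel_measurable (borel \<Otimes>\<^sub>M borel)"
  using measurable_compose[OF uxy_measurable alpha_max_measurable] uxy_bounds
  by (simp add: ah_def[abs_def] max_absorb2)

lemma Dh_measurable [measurable]: "Dh \<in> borel_measurable (borel \<Otimes>\<^sub>M borel)"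
  using measurable_compose[OF uxy_measurable D_max_measurable] uxy_bounds
  by (simp add: Dh_def[abs_def] max_absorb2)

lemma ah_nonneg: "ah p \<ge> 0"
  using alpha_nonneg uxy_bounds by (simp add: ah_def)

definition nuh :: "real \<Rightarrow> ('v \<times> 'v) measure" where "nuh t = density \<theta> (\<lambda>z. ennreal (ah (t, z)))"

lemma sets_nuh [measurable_cong, simp]: "sets (nuh t) = sets borel"
  by (simp add: nuh_def)

lemma sigma_finite_nuh: "sigma_finite_measure (nuh t)"
  unfolding nuh_def by (subst theta.sigma_finite_iff_density_finite) auto

lemma uxy_eq_dens:
  "AE t in lborel. t \<in> {0..T} \<longrightarrow> (AE z in \<theta>. ux (t, z) = dens \<pi> (\<rho> t) (fst z) \<and> uy (t, z) = dens \<pi> (\<rho> t) (snd z))"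
  using uh_eq_v
proof eventually_elim
  case (elim t)
  show ?case
  proof
    assume t: "t \<in> {0..T}"
    with elim have "AE x in \<pi>. uh (t, x) = v t x" by blast
    with v_eq_dens[OF t] have "AE x in \<pi>. uh (t, x) = dens \<pi> (\<rho> t) x" by eventually_elim simp
    from AE_edge_measure_fst[OF \<pi> \<kappa> this] AE_edge_measure_snd[OF \<pi> \<kappa> balance this]
    show "AE z in \<theta>. ux (t, z) = dens \<pi> (\<rho> t) (fst z) \<and> uy (t, z) = dens \<pi> (\<rho> t) (snd z)"
      by eventually_elim (simp add: ux_def uy_def)
  qed
qed

lemma alpha_dens_measurable:
  "(\<lambda>z. \<alpha> (dens \<pi> \<mu> (fst z), dens \<pi> \<mu> (snd z))) \<in> borel_measurable borel"
proof -
  have "(\<lambda>z. (dens \<pi> \<mu> (fst z), dens \<pi> \<mu> (snd z))) \<in> measurable borel (borel \<Otimes>\<^sub>M borel)"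
    by (intro measurable_Pair compose_fst_measurable compose_snd_measurable dens_measurable)
  then have m: "(\<lambda>z. (dens \<pi> \<mu> (fst z), dens \<pi> \<mu> (snd z))) \<in> measurable borel borel" by (simp only: borel_prod)
  show ?thesis using measurable_compose[OF m alpha_max_measurable] dens_nonneg by (simp add: max_absorb2)
qed

text \<open>\<open>dissipation\<close> refers to \<open>nu\<close> through absolute continuity and
  Radon-Nikodym derivatives, so the measures themselves have to be identified, not only integrals
  against them.\<close>

lemma nu_eq_nuh: "AE t in lborel. t \<in> {0..T} \<longrightarrow> nu \<pi> \<kappa> \<alpha> (\<rho> t) = nuh t"
  using uxy_eq_dens
proof eventually_elim
  case (elim t)
  show ?case
  proof
    assume "t \<in> {0..T}"
    with elim have ae: "AE z in \<theta>. ux (t, z) = dens \<pi> (\<rho> t) (fst z) \<and> uy (t, z) = dens \<pi> (\<rho> t) (snd z)" by blast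
    show "nu \<pi> \<kappa> \<alpha> (\<rho> t) = nuh t"
      unfolding nu_def nuh_def
    proof (rule density_cong)
      show "(\<lambda>(x, y). ennreal (\<alpha> (dens \<pi> (\<rho> t) x, dens \<pi> (\<rho> t) y))) \<in> borel_measurable \<theta>"
        using alpha_dens_measurable[of "\<rho> t"] by (simp add: case_prod_beta)
      show "AE z in \<theta>. (case z of (x, y) \<Rightarrow> ennreal (\<alpha> (dens \<pi> (\<rho> t) x, dens \<pi> (\<rho> t) y))) = ennreal (ah (t, z))"
        using ae by eventually_elim (simp add: ah_def case_prod_beta)
    qed measurable
  qed
qed

text \<open>Both components are disintegrated against the same reference \<open>nuh\<close>; the
  weight \<open>wt\<close> provides the finite mass, and the bad times of the two components are
  united.\<close>

lemma jpm_disintegration: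
  "\<exists>kp km Bad. kp \<in> borel_measurable (borel \<Otimes>\<^sub>M borel) \<and> km \<in> borel_measurable (borel \<Otimes>\<^sub>M borel) \<and> Bad \<in> sets borel \<and>
    (AE t in lborel. t \<in> Bad \<longleftrightarrow> \<not> (absolutely_continuous (nuh t) (jp t) \<and> absolutely_continuous (nuh t) (jm t))) \<and>
    (AE t in lborel. t \<notin> Bad \<longrightarrow> jp t = density (nuh t) (\<lambda>z. kp (t, z)) \<and> jm t = density (nuh t) (\<lambda>z. km (t, z)))"
proof -
  have pos: "AE z in jp t. 0 < wt z" "AE z in jm t. 0 < wt z" for t
    using AE_jpm_offdiag[of t] by (auto elim!: eventually_mono dest: wt_pos)
  obtain kp Bp where p: "kp \<in> borel_measurable (borel \<Otimes>\<^sub>M borel)" "Bp \<in> sets borel"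
    "AE t in lborel. t \<in> Bp \<longleftrightarrow> \<not> absolutely_continuous (nuh t) (jp t)"
    "AE t in lborel. t \<notin> Bp \<longrightarrow> jp t = density (nuh t) (\<lambda>z. kp (t, z))"
    using disintegration[OF theta.sigma_finite_measure_axioms sets_theta sets_jpm(1) jpm_meas(1) wt_meas pos(1) jpm_weight_finite(1) ah_measurable]
    unfolding nuh_def by blast
  obtain km Bm where m: "km \<in> borel_measurable (borel \<Otimes>\<^sub>M borel)" "Bm \<in> sets borel"
    "AE t in lborel. t \<in> Bm \<longleftrightarrow> \<not> absolutely_continuous (nuh t) (jm t)"
    "AE t in lborel. t \<notin> Bm \<longrightarrow> jm t = density (nuh t) (\<lambda>z. km (t, z))"
    using disintegration[OF theta.sigma_finite_measure_axioms sets_theta sets_jpm(2) jpm_meas(2) wt_meas pos(2) jpm_weight_finite(2) ah_measurable]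
    unfolding nuh_def by blast
  show ?thesis
  proof (rule exI[of _ kp], rule exI[of _ km], rule exI[of _ "Bp \<union> Bm"], intro conjI)
    show "AE t in lborel. (t \<in> Bp \<union> Bm) = (\<not> (absolutely_continuous (nuh t) (jp t) \<and> absolutely_continuous (nuh t) (jm t)))"
      using p(3) m(3) by eventually_elim auto
    show "AE t in lborel. t \<notin> Bp \<union> Bm \<longrightarrow> jp t = density (nuh t) (\<lambda>z. kp (t, z)) \<and> jm t = density (nuh t) (\<lambda>z. km (t, z))"
      using p(4) m(4) by eventually_elim auto
  qed (use p m in auto)
qed

definition kk where
  "kk = (SOME k. case k of (k1, k2, N) \<Rightarrow> k1 \<in> borel_measurable (borel \<Otimes>\<^sub>M borel) \<and> k2 \<in> borel_measurable (borel \<Otimes>\<^sub>M borel) \<and> N \<in> sets borel \<and>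
    (AE t in lborel. t \<in> N \<longleftrightarrow> \<not> (absolutely_continuous (nuh t) (jp t) \<and> absolutely_continuous (nuh t) (jm t))) \<and>
    (AE t in lborel. t \<notin> N \<longrightarrow> jp t = density (nuh t) (\<lambda>z. k1 (t, z)) \<and> jm t = density (nuh t) (\<lambda>z. k2 (t, z))))"

definition kp where "kp = fst kk"
definition km where "km = fst (snd kk)"
definition Bad where "Bad = snd (snd kk)"

lemma kpm_measurable [measurable]: "kp \<in> borel_measurable (borel \<Otimes>\<^sub>M borel)" "km \<in> borel_measurable (borel \<Otimes>\<^sub>M borel)"
  and Bad_measurable [measurable]: "Bad \<in> sets borel"
  and Bad_iff: "AE t in lborel. t \<in> Bad \<longleftrightarrow> \<not> (absolutely_continuous (nuh t) (jp t) \<and> absolutely_continuous (nuh t) (jm t))"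
  and jpm_density: "AE t in lborel. t \<notin> Bad \<longrightarrow> jp t = density (nuh t) (\<lambda>z. kp (t, z)) \<and> jm t = density (nuh t) (\<lambda>z. km (t, z))"
proof -
  have "\<exists>k. case k of (k1, k2, N) \<Rightarrow> k1 \<in> borel_measurable (borel \<Otimes>\<^sub>M borel) \<and> k2 \<in> borel_measurable (borel \<Otimes>\<^sub>M borel) \<and> N \<in> sets borel \<and>
    (AE t in lborel. t \<in> N \<longleftrightarrow> \<not> (absolutely_continuous (nuh t) (jp t) \<and> absolutely_continuous (nuh t) (jm t))) \<and>
    (AE t in lborel. t \<notin> N \<longrightarrow> jp t = density (nuh t) (\<lambda>z. k1 (t, z)) \<and> jm t = density (nuh t) (\<lambda>z. k2 (t, z)))"
    using jpm_disintegration by auto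
  from someI_ex[OF this, folded kk_def]
  show "kp \<in> borel_measurable (borel \<Otimes>\<^sub>M borel)" "km \<in> borel_measurable (borel \<Otimes>\<^sub>M borel)" "Bad \<in> sets borel"
    "AE t in lborel. t \<in> Bad \<longleftrightarrow> \<not> (absolutely_continuous (nuh t) (jp t) \<and> absolutely_continuous (nuh t) (jm t))"
    "AE t in lborel. t \<notin> Bad \<longrightarrow> jp t = density (nuh t) (\<lambda>z. kp (t, z)) \<and> jm t = density (nuh t) (\<lambda>z. km (t, z))"
    unfolding kp_def km_def Bad_def case_prod_beta by simp_all
qed

text \<open>Densities of the two components with respect to \<open>\<theta>\<close> instead of
  \<open>nuh\<close>.\<close>

definition pk where "pk p = ennreal (ah p) * kp p"
definition mk where "mk p = ennreal (ah p) * km p"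

lemma pmk_measurable [measurable]: "pk \<in> borel_measurable (borel \<Otimes>\<^sub>M borel)" "mk \<in> borel_measurable (borel \<Otimes>\<^sub>M borel)"
  unfolding pk_def[abs_def] mk_def[abs_def] by measurable

text \<open>At times that are not bad, the signed density of the flux with respect to
  \<open>\<theta>\<close>, while \<open>Wh\<close> is the density of twice the flux with respect to
  \<open>nuh\<close>.\<close>

definition gh :: "real \<times> ('v \<times> 'v) \<Rightarrow> real" where
  "gh p = (if fst p \<in> {0<..<T} \<and> fst p \<notin> Bad then enn2real (pk p) - enn2real (mk p) else 0)"
definition Wh :: "real \<times> ('v \<times> 'v) \<Rightarrow> real" where "Wh p = 2 * gh p / ah p"

lemma gh_measurable [measurable]: "gh \<in> borel_measurable (borel \<Otimes>\<^sub>M borel)"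
  unfolding gh_def[abs_def] by measurable

lemma Wh_measurable [measurable]: "Wh \<in> borel_measurable (borel \<Otimes>\<^sub>M borel)"
  unfolding Wh_def[abs_def] by measurable

text \<open>Where \<open>ah\<close> vanishes, so do \<open>pk\<close> and \<open>mk\<close>, because
  \<open>0 * \<infinity> = 0\<close> in \<open>ennreal\<close>, and hence \<open>gh\<close>. The
  identity therefore holds without exception.\<close>

lemma gh_eq: "gh p = Wh p * ah p / 2"
  by (cases "ah p = 0") (auto simp: Wh_def gh_def pk_def mk_def)

lemma psi_Wh_measurable [measurable]: "(\<lambda>p. \<psi> (Wh p)) \<in> borel_measurable (borel \<Otimes>\<^sub>M borel)"
  using measurable_compose[OF Wh_measurable psi_measurable] .

definition Rh :: "real \<Rightarrow> ennreal" where "Rh t = (\<integral>\<^sup>+z. ennreal (ah (t, z) * \<psi> (Wh (t, z))) \<partial>\<theta>) / 2"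
definition Fh :: "real \<Rightarrow> ennreal" where "Fh t = (\<integral>\<^sup>+z. Dh (t, z) \<partial>\<theta>) / 2"

lemma Rh_measurable [measurable]: "Rh \<in> borel_measurable borel"
  and Fh_measurable [measurable]: "Fh \<in> borel_measurable borel"
proof -
  have [measurable]: "f \<in> borel_measurable (borel \<Otimes>\<^sub>M \<theta>) \<Longrightarrow> (\<lambda>t. \<integral>\<^sup>+z. f (t, z) \<partial>\<theta>) \<in> borel_measurable borel" for f :: "real \<times> _ \<Rightarrow> ennreal"
    by (rule theta.borel_measurable_nn_integral_fst)
  have s: "sets (borel \<Otimes>\<^sub>M \<theta>) = sets (borel \<Otimes>\<^sub>M borel)" by (intro sets_pair_measure_cong) auto
  have "(\<lambda>t. \<integral>\<^sup>+z. ennreal (ah (t, z) * \<psi> (Wh (t, z))) \<partial>\<theta>) \<in> borel_measurable borel"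
    by (rule theta.borel_measurable_nn_integral_fst[of "\<lambda>p. ennreal (ah p * \<psi> (Wh p))"])
       (subst measurable_cong_sets[OF s refl], measurable)
  then show "Rh \<in> borel_measurable borel" unfolding Rh_def[abs_def] by measurable
  have "(\<lambda>t. \<integral>\<^sup>+z. Dh (t, z) \<partial>\<theta>) \<in> borel_measurable borel"
    by (rule theta.borel_measurable_nn_integral_fst[of Dh])
       (subst measurable_cong_sets[OF s refl], measurable)
  then show "Fh \<in> borel_measurable borel" unfolding Fh_def[abs_def] by measurable
qed

lemma section_measurable:
  "h \<in> measurable (borel \<Otimes>\<^sub>M borel) N \<Longrightarrow> (\<lambda>z. h (t, z)) \<in> measurable borel N"
  by (rule measurable_compose[OF measurable_Pair1']) simp_all

lemma fisher_eq_Fh: "AE t in lborel. t \<in> {0..T} \<longrightarrow> fisher \<pi> \<kappa> \<phi> \<psi>s \<alpha> (\<rho> t) = Fh t"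
  using uxy_eq_dens
proof eventually_elim
  case (elim t)
  show ?case
  proof
    assume "t \<in> {0..T}"
    with elim have "AE z in \<theta>. ux (t, z) = dens \<pi> (\<rho> t) (fst z) \<and> uy (t, z) = dens \<pi> (\<rho> t) (snd z)" by blast
    then have "AE z in \<theta>. (case z of (x, y) \<Rightarrow> D (dens \<pi> (\<rho> t) x, dens \<pi> (\<rho> t) y)) = Dh (t, z)"
      by eventually_elim (simp add: Dh_def case_prod_beta)
    then show "fisher \<pi> \<kappa> \<phi> \<psi>s \<alpha> (\<rho> t) = Fh t"
      unfolding fisher_def Fh_def
      by (intro arg_cong[where f = "\<lambda>x. x / 2"] nn_integral_cong_AE)
  qed
qed

lemma ac_variation_iff:
  assumes t: "t \<in> {0..T}" and s: "sets M = sets borel"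
  shows "absolutely_continuous M (variation (j t)) \<longleftrightarrow> absolutely_continuous M (jp t) \<and> absolutely_continuous M (jm t)"
proof -
  have e: "emeasure (variation (j t)) A = emeasure (jp t) A + emeasure (jm t) A" if "A \<in> sets borel" for A
    using emeasure_variation[of "j t" A] j_signed[OF t] t that by (simp add: jpm_eq signed_sigma_finite_def)
  show ?thesis
    unfolding absolutely_continuous_def using e s by (fastforce simp: null_sets_def)
qed

text \<open>\<open>kp\<close> and \<open>km\<close> are the Radon-Nikodym derivatives up to null
  sets of \<open>nuh t\<close>, and only points with \<open>ah > 0\<close> carry mass of
  \<open>nuh t\<close>, so the division by \<open>ah\<close> in \<open>Wh\<close> is
  legitimate.\<close>

lemma dissipation_good:
  assumes t: "t \<in> {0<..<T}" "t \<notin> Bad" and nu: "nu \<pi> \<kappa> \<alpha> (\<rho> t) = nuh t"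
    and j: "jp t = density (nuh t) (\<lambda>z. kp (t, z))" "jm t = density (nuh t) (\<lambda>z. km (t, z))"
  shows "dissipation \<pi> \<kappa> \<psi>s \<alpha> (\<rho> t) (j t) = Rh t"
proof -
  interpret nuh: sigma_finite_measure "nuh t" by (rule sigma_finite_nuh)
  have tT: "t \<in> {0..T}" using t by auto
  note sec[measurable] = section_measurable[OF kpm_measurable(1), of t] section_measurable[OF kpm_measurable(2), of t]
    section_measurable[OF ah_measurable, of t] section_measurable[OF psi_Wh_measurable, of t]
  have m: "(\<lambda>z. kp (t, z)) \<in> borel_measurable (nuh t)" "(\<lambda>z. km (t, z)) \<in> borel_measurable (nuh t)" by measurable
  have "absolutely_continuous (nuh t) (jp t)" "absolutely_continuous (nuh t) (jm t)"
    unfolding j by (intro absolutely_continuousI_density m)+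
  then have ac: "absolutely_continuous (nuh t) (variation (j t))"
    using ac_variation_iff[OF tT] by simp
  have scale: "scale_measure 2 (density (nuh t) k) = density (nuh t) (\<lambda>z. 2 * k z)" if "k \<in> borel_measurable (nuh t)" for k
    using that by (intro measure_eqI) (auto simp: emeasure_density nn_integral_cmult[symmetric] mult.assoc)
  have 1: "AE z in nuh t. 2 * kp (t, z) = RN_deriv (nuh t) (scale_measure 2 (fst (j t))) z"
    by (rule nuh.RN_deriv_unique) (use m scale[OF m(1)] j in \<open>auto simp: jpm_eq[OF tT, symmetric]\<close>)
  have 2: "AE z in nuh t. 2 * km (t, z) = RN_deriv (nuh t) (scale_measure 2 (snd (j t))) z"
    by (rule nuh.RN_deriv_unique) (use m scale[OF m(2)] j in \<open>auto simp: jpm_eq[OF tT, symmetric]\<close>)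
  have 3: "AE z in nuh t. ah (t, z) > 0"
    unfolding nuh_def by (subst AE_density) auto
  have "AE z in nuh t. sm_deriv (sm_scale 2 (j t)) (nuh t) z = Wh (t, z)"
    using 1 2 3
  proof eventually_elim
    case (elim z)
    have e: "enn2real (2 * k) = 2 * enn2real k" for k using enn2real_mult[of 2 k] by simp
    have "sm_deriv (sm_scale 2 (j t)) (nuh t) z = 2 * enn2real (kp (t, z)) - 2 * enn2real (km (t, z))"
      unfolding sm_deriv_def sm_scale_def fst_conv snd_conv elim(1,2)[symmetric] e ..
    also have "\<dots> = Wh (t, z)"
      using elim(3) t by (simp add: Wh_def gh_def pk_def mk_def enn2real_mult field_simps)
    finally show ?case .
  qed
  then have "(\<integral>\<^sup>+z. ennreal (\<psi> (sm_deriv (sm_scale 2 (j t)) (nuh t) z)) \<partial>nuh t) = (\<integral>\<^sup>+z. ennreal (\<psi> (Wh (t, z))) \<partial>nuh t)"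
    by (intro nn_integral_cong_AE) (auto elim!: eventually_mono)
  also have "\<dots> = (\<integral>\<^sup>+z. ennreal (ah (t, z)) * ennreal (\<psi> (Wh (t, z))) \<partial>\<theta>)"
    unfolding nuh_def by (intro nn_integral_density) measurable
  also have "\<dots> = (\<integral>\<^sup>+z. ennreal (ah (t, z) * \<psi> (Wh (t, z))) \<partial>\<theta>)"
    by (simp add: ennreal_mult' ah_nonneg)
  finally show ?thesis
    using ac unfolding dissipation_def nu Rh_def by simp
qed

lemma dissipation_bad:
  assumes t: "t \<in> {0..T}" and nu: "nu \<pi> \<kappa> \<alpha> (\<rho> t) = nuh t"
    and "\<not> (absolutely_continuous (nuh t) (jp t) \<and> absolutely_continuous (nuh t) (jm t))"
  shows "dissipation \<pi> \<kappa> \<psi>s \<alpha> (\<rho> t) (j t) = \<infinity>"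
proof -
  have "\<not> absolutely_continuous (nuh t) (variation (j t))"
    using assms(3) ac_variation_iff[OF t sets_nuh[of t]] by blast
  then show ?thesis unfolding dissipation_def nu by simp
qed

text \<open>The left side is not known to be measurable in \<open>t\<close>, the right side is; an
  identity at almost every time suffices to exchange them under \<open>nn_integral\<close>.\<close>

lemma action_eq:
  "AE t in lborel. t \<in> {0<..<T} \<longrightarrow>
     dissipation \<pi> \<kappa> \<psi>s \<alpha> (\<rho> t) (j t) + fisher \<pi> \<kappa> \<phi> \<psi>s \<alpha> (\<rho> t) = (if t \<in> Bad then \<infinity> else Rh t + Fh t)"
  using nu_eq_nuh fisher_eq_Fh Bad_iff jpm_density
proof eventually_elim
  case (elim t)
  show ?case
  proof
    assume t: "t \<in> {0<..<T}"
    then have t': "t \<in> {0..T}" by auto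
    show "dissipation \<pi> \<kappa> \<psi>s \<alpha> (\<rho> t) (j t) + fisher \<pi> \<kappa> \<phi> \<psi>s \<alpha> (\<rho> t) = (if t \<in> Bad then \<infinity> else Rh t + Fh t)"
    proof (cases "t \<in> Bad")
      case True
      have "dissipation \<pi> \<kappa> \<psi>s \<alpha> (\<rho> t) (j t) = \<infinity>" 
        by (rule dissipation_bad[OF t' elim(1)[rule_format, OF t'] elim(3)[THEN iffD1, OF True]])
      then show ?thesis using True by simp
    next
      case False
      have "dissipation \<pi> \<kappa> \<psi>s \<alpha> (\<rho> t) (j t) = Rh t" 
        by (rule dissipation_good[OF t False elim(1)[rule_format, OF t'] conjunct1[OF elim(4)[rule_format, OF False]]
            conjunct2[OF elim(4)[rule_format, OF False]]])
      then show ?thesis using False elim(2) t' by simp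
    qed
  qed
qed

lemma action_finite:
  "(\<integral>\<^sup>+t\<in>{0<..<T}. (if t \<in> Bad then \<infinity> else Rh t + Fh t) \<partial>lborel) < \<infinity>"
proof -
  have "(\<integral>\<^sup>+t\<in>{0<..<T}. (if t \<in> Bad then \<infinity> else Rh t + Fh t) \<partial>lborel)
    = (\<integral>\<^sup>+t\<in>{0<..<T}. (dissipation \<pi> \<kappa> \<psi>s \<alpha> (\<rho> t) (j t) + fisher \<pi> \<kappa> \<phi> \<psi>s \<alpha> (\<rho> t)) \<partial>lborel)"
    using action_eq by (intro nn_integral_cong_AE) (auto elim!: eventually_mono simp: indicator_def)
  also have "\<dots> \<le> (\<integral>\<^sup>+t\<in>{0..T}. (dissipation \<pi> \<kappa> \<psi>s \<alpha> (\<rho> t) (j t) + fisher \<pi> \<kappa> \<phi> \<psi>s \<alpha> (\<rho> t)) \<partial>lborel)"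
    by (intro nn_integral_mono) (auto simp: indicator_def)
  also have "\<dots> < \<infinity>" using ACE unfolding ACE_def by auto
  finally show ?thesis .
qed

lemma AE_not_Bad: "AE t in lborel. t \<in> {0<..<T} \<longrightarrow> t \<notin> Bad"
  and AE_Fh_finite: "AE t in lborel. t \<in> {0<..<T} \<longrightarrow> Fh t < \<infinity>"
proof -
  have "AE t in lborel. (if t \<in> Bad then \<infinity> else Rh t + Fh t) * indicator {0<..<T} t \<noteq> \<infinity>"
    using action_finite by (intro nn_integral_noteq_infinite) auto
  then show "AE t in lborel. t \<in> {0<..<T} \<longrightarrow> t \<notin> Bad" "AE t in lborel. t \<in> {0<..<T} \<longrightarrow> Fh t < \<infinity>"
    by (eventually_elim, auto simp: less_top[symmetric] split: if_splits)+
qed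

lemma action_Rh_Fh:
  assumes "0 \<le> t" "t \<le> T"
  shows "(\<integral>\<^sup>+r\<in>{0..t}. (dissipation \<pi> \<kappa> \<psi>s \<alpha> (\<rho> r) (j r) + fisher \<pi> \<kappa> \<phi> \<psi>s \<alpha> (\<rho> r)) \<partial>lborel)
    = (\<integral>\<^sup>+r\<in>{0<..<t}. (Rh r + Fh r) \<partial>lborel)"
proof (rule nn_integral_cong_AE)
  show "AE r in lborel. (dissipation \<pi> \<kappa> \<psi>s \<alpha> (\<rho> r) (j r) + fisher \<pi> \<kappa> \<phi> \<psi>s \<alpha> (\<rho> r)) * indicator {0..t} r
     = (Rh r + Fh r) * indicator {0<..<t} r"
    using action_eq AE_not_Bad AE_lborel_singleton[of 0] AE_lborel_singleton[of t]
    by eventually_elim (use assms in \<open>auto simp: indicator_def\<close>)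
qed

definition good :: "real \<Rightarrow> bool" where
  "good t \<longleftrightarrow> t \<in> {0<..<T} \<and> t \<notin> Bad \<and> Fh t < \<infinity> \<and> (AE x in \<pi>. uh (t, x) = v t x) \<and>
    (AE z in \<theta>. ux (t, z) = dens \<pi> (\<rho> t) (fst z) \<and> uy (t, z) = dens \<pi> (\<rho> t) (snd z)) \<and>
    jp t = density \<theta> (\<lambda>z. pk (t, z)) \<and> jm t = density \<theta> (\<lambda>z. mk (t, z))"

lemma AE_good: "AE t in lborel. t \<in> {0<..<T} \<longrightarrow> good t"
  using AE_not_Bad AE_Fh_finite uh_eq_v uxy_eq_dens jpm_density
proof eventually_elim
  case (elim t)
  show ?case
  proof
    assume t: "t \<in> {0<..<T}"
    note [measurable] = section_measurable[OF kpm_measurable(1), of t] section_measurable[OF kpm_measurable(2), of t]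
      section_measurable[OF ah_measurable, of t]
    have "density (nuh t) (\<lambda>z. kp (t, z)) = density \<theta> (\<lambda>z. pk (t, z))" "density (nuh t) (\<lambda>z. km (t, z)) = density \<theta> (\<lambda>z. mk (t, z))"
      unfolding nuh_def pk_def mk_def by (intro density_density_eq; measurable)+
    then show "good t" using elim t unfolding good_def by auto
  qed
qed

text \<open>Mutual singularity of the two components places their densities on disjoint sets, and
  sigma-finiteness makes them finite. Hence they are the positive and negative parts of
  \<open>gh\<close>.\<close>

lemma good_sections:
  assumes t: "good t"
  shows "AE z in \<theta>. pk (t, z) = 0 \<or> mk (t, z) = 0" "AE z in \<theta>. pk (t, z) \<noteq> \<infinity>" "AE z in \<theta>. mk (t, z) \<noteq> \<infinity>"
proof -
  have tT: "t \<in> {0..T}" using t by (auto simp: good_def)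
  note [measurable] = section_measurable[OF pmk_measurable(1), of t] section_measurable[OF pmk_measurable(2), of t]
  have jd: "jp t = density \<theta> (\<lambda>z. pk (t, z))" "jm t = density \<theta> (\<lambda>z. mk (t, z))" using t by (auto simp: good_def)
  obtain A where A: "A \<in> sets borel" "emeasure (jp t) A = 0" "emeasure (jm t) (- A) = 0"
    and sf: "sigma_finite_measure (jp t)" "sigma_finite_measure (jm t)"
    using j_signed[OF tT] by (auto simp: signed_sigma_finite_def jpm_eq[OF tT])
  have "AE z in \<theta>. pk (t, z) * indicator A z = 0" "AE z in \<theta>. mk (t, z) * indicator (- A) z = 0"
    using A unfolding jd by (auto simp: emeasure_density nn_integral_0_iff_AE)
  then show "AE z in \<theta>. pk (t, z) = 0 \<or> mk (t, z) = 0"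
    by eventually_elim (auto simp: indicator_def split: if_splits)
  show "AE z in \<theta>. pk (t, z) \<noteq> \<infinity>"
    using sf unfolding jd by (subst (asm) theta.sigma_finite_iff_density_finite) auto
  show "AE z in \<theta>. mk (t, z) \<noteq> \<infinity>"
    using sf(2) unfolding jd by (subst (asm) theta.sigma_finite_iff_density_finite) auto
qed

lemma good_gh:
  assumes t: "good t"
  shows "AE z in \<theta>. pk (t, z) = ennreal (gh (t, z)) \<and> mk (t, z) = ennreal (- gh (t, z))"
  using good_sections[OF t]
proof eventually_elim
  case (elim z)
  have "gh (t, z) = enn2real (pk (t, z)) - enn2real (mk (t, z))" using t by (simp add: gh_def good_def)
  with elim show ?case
    by (cases "pk (t, z)"; cases "mk (t, z)") (auto simp: ennreal_neg)
qed

lemma sm_integral_good: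
  assumes t: "good t" and [measurable]: "h \<in> borel_measurable borel" and int: "integrable \<theta> (\<lambda>z. h z * gh (t, z))"
  shows "sm_integral (j t) offdiag h = (\<integral>z. h z * gh (t, z) \<partial>\<theta>)"
proof -
  have tT: "t \<in> {0..T}" using t by (auto simp: good_def)
  note [measurable] = section_measurable[OF pmk_measurable(1), of t] section_measurable[OF pmk_measurable(2), of t]
    section_measurable[OF gh_measurable, of t]
  let ?p = "\<lambda>z. max 0 (gh (t, z))" and ?m = "\<lambda>z. max 0 (- gh (t, z))"
  have "density \<theta> (\<lambda>z. pk (t, z)) = density \<theta> (\<lambda>z. ennreal (?p z))" "density \<theta> (\<lambda>z. mk (t, z)) = density \<theta> (\<lambda>z. ennreal (?m z))"
  proof -
    have "AE z in \<theta>. pk (t, z) = ennreal (?p z)" "AE z in \<theta>. mk (t, z) = ennreal (?m z)"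
      using good_gh[OF t] by (eventually_elim, simp add: max_def ennreal_neg)+
    then show "density \<theta> (\<lambda>z. pk (t, z)) = density \<theta> (\<lambda>z. ennreal (?p z))" "density \<theta> (\<lambda>z. mk (t, z)) = density \<theta> (\<lambda>z. ennreal (?m z))"
      by (auto intro!: density_cong)
  qed
  then have j: "jp t = density \<theta> (\<lambda>z. ennreal (?p z))" "jm t = density \<theta> (\<lambda>z. ennreal (?m z))"
    using t by (auto simp: good_def)
  have off: "AE z in \<theta>. z \<in> offdiag" by (rule AE_edge_measure_offdiag[OF \<pi> \<kappa>])
  have "(\<integral>z. indicator offdiag z * h z \<partial>jp t) = (\<integral>z. ?p z * (indicator offdiag z * h z) \<partial>\<theta>)"
    unfolding j by (subst integral_density) auto
  also have "\<dots> = (\<integral>z. ?p z * h z \<partial>\<theta>)"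
    using off by (intro integral_cong_AE) (auto elim!: eventually_mono)
  finally have 1: "(\<integral>z. indicator offdiag z * h z \<partial>jp t) = (\<integral>z. ?p z * h z \<partial>\<theta>)" .
  have "(\<integral>z. indicator offdiag z * h z \<partial>jm t) = (\<integral>z. ?m z * (indicator offdiag z * h z) \<partial>\<theta>)"
    unfolding j by (subst integral_density) auto
  also have "\<dots> = (\<integral>z. ?m z * h z \<partial>\<theta>)"
    using off by (intro integral_cong_AE) (auto elim!: eventually_mono)
  finally have 2: "(\<integral>z. indicator offdiag z * h z \<partial>jm t) = (\<integral>z. ?m z * h z \<partial>\<theta>)" .
  have "integrable \<theta> (\<lambda>z. ?p z * h z)" "integrable \<theta> (\<lambda>z. ?m z * h z)"
  proof -
    have le: "norm (?p z * h z) \<le> norm (h z * gh (t, z))" "norm (?m z * h z) \<le> norm (h z * gh (t, z))" for z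
    proof -
      have "\<bar>?p z\<bar> * \<bar>h z\<bar> \<le> \<bar>gh (t, z)\<bar> * \<bar>h z\<bar>" "\<bar>?m z\<bar> * \<bar>h z\<bar> \<le> \<bar>gh (t, z)\<bar> * \<bar>h z\<bar>"
        by (intro mult_right_mono; simp)+
      then show "norm (?p z * h z) \<le> norm (h z * gh (t, z))" "norm (?m z * h z) \<le> norm (h z * gh (t, z))"
        by (simp_all add: abs_mult mult.commute)
    qed
    show "integrable \<theta> (\<lambda>z. ?p z * h z)"
      by (rule Bochner_Integration.integrable_bound[OF int]) (measurable, intro AE_I2 le)
    show "integrable \<theta> (\<lambda>z. ?m z * h z)"
      by (rule Bochner_Integration.integrable_bound[OF int]) (measurable, intro AE_I2 le)
  qed
  then have "(\<integral>z. ?p z * h z \<partial>\<theta>) - (\<integral>z. ?m z * h z \<partial>\<theta>) = (\<integral>z. ?p z * h z - ?m z * h z \<partial>\<theta>)" by simp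
  also have "\<dots> = (\<integral>z. h z * gh (t, z) \<partial>\<theta>)"
    by (intro Bochner_Integration.integral_cong) (auto simp: max_def)
  finally show ?thesis using sm_integral_jpm[OF tT, of h] 1 2 by simp
qed

end

section \<open>Chain rule for the truncated energy\<close>

lemma ennreal_half_finite: "(x :: ennreal) / 2 < \<infinity> \<Longrightarrow> x < \<infinity>"
  using ennreal_mult_divide_cancel[of 2 x] ennreal_mult_less_top[of 2 "x / 2"] by auto

context reflecting_pair
begin

abbreviation P :: "(real \<times> ('v \<times> 'v)) measure" where "P \<equiv> lborel \<Otimes>\<^sub>M \<theta>"

lemma sets_P [measurable_cong]: "sets P = sets (borel \<Otimes>\<^sub>M borel)"
  by (intro sets_pair_measure_cong) auto

sublocale PP: pair_sigma_finite lborel \<theta> ..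

lemma borel_P: "h \<in> measurable (borel \<Otimes>\<^sub>M borel) N \<Longrightarrow> h \<in> measurable P N"
  by (simp only: measurable_cong_sets[OF sets_P refl])

definition inT :: "real \<times> ('v \<times> 'v) \<Rightarrow> real" where "inT p = indicator {0<..<T} (fst p)"

lemma inT_measurable [measurable]: "inT \<in> borel_measurable (borel \<Otimes>\<^sub>M borel)"
  unfolding inT_def[abs_def] by measurable

text \<open>Real integrands of the Fisher information and, with \<open>Br\<close>, of the
  dissipation, without the factor one half. \<open>enn2real\<close> sends an infinite
  \<open>Dh\<close> to 0, which matters only on a null set of the time interval.\<close>

definition Dr :: "real \<times> ('v \<times> 'v) \<Rightarrow> real" where "Dr p = inT p * enn2real (Dh p)"
definition Br :: "real \<times> ('v \<times> 'v) \<Rightarrow> real" where "Br p = inT p * (ah p * \<psi> (Wh p))"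

lemma Dr_measurable [measurable]: "Dr \<in> borel_measurable (borel \<Otimes>\<^sub>M borel)"
  and Br_measurable [measurable]: "Br \<in> borel_measurable (borel \<Otimes>\<^sub>M borel)"
  unfolding Dr_def[abs_def] Br_def[abs_def] by measurable

lemma Dr_nonneg: "Dr p \<ge> 0" and Br_nonneg: "Br p \<ge> 0"
  by (auto simp: Dr_def Br_def inT_def ah_nonneg psi_nonneg)

lemma action_finite': "(\<integral>\<^sup>+r\<in>{0<..<T}. (Rh r + Fh r) \<partial>lborel) < \<infinity>"
proof -
  have "(\<integral>\<^sup>+r\<in>{0<..<T}. (Rh r + Fh r) \<partial>lborel) = (\<integral>\<^sup>+t\<in>{0<..<T}. (if t \<in> Bad then \<infinity> else Rh t + Fh t) \<partial>lborel)"
  proof (rule nn_integral_cong_AE)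
    show "AE r in lborel. (Rh r + Fh r) * indicator {0<..<T} r = (if r \<in> Bad then \<infinity> else Rh r + Fh r) * indicator {0<..<T} r"
      using AE_not_Bad by eventually_elim (auto simp: indicator_def)
  qed
  then show ?thesis using action_finite by simp
qed

lemma Fh_integral: "(\<integral>\<^sup>+p. ennreal (inT p) * Dh p \<partial>P) / 2 = (\<integral>\<^sup>+r\<in>{0<..<T}. Fh r \<partial>lborel)"
proof -
  have "(\<integral>\<^sup>+p. ennreal (inT p) * Dh p \<partial>P) = (\<integral>\<^sup>+r. (\<integral>\<^sup>+z. ennreal (inT (r, z)) * Dh (r, z) \<partial>\<theta>) \<partial>lborel)"
    by (rule theta.nn_integral_fst[symmetric]) measurable
  also have "\<dots> = (\<integral>\<^sup>+r. (\<integral>\<^sup>+z. Dh (r, z) \<partial>\<theta>) * indicator {0<..<T} r \<partial>lborel)"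
    by (intro nn_integral_cong) (auto simp: inT_def indicator_def)
  finally have e: "(\<integral>\<^sup>+p. ennreal (inT p) * Dh p \<partial>P) = \<dots>" .
  have m: "(\<lambda>r. \<integral>\<^sup>+z. Dh (r, z) \<partial>\<theta>) \<in> borel_measurable lborel"
    by (rule theta.borel_measurable_nn_integral_fst) measurable
  have "(\<integral>\<^sup>+r\<in>{0<..<T}. Fh r \<partial>lborel) = (\<integral>\<^sup>+r. ((\<integral>\<^sup>+z. Dh (r, z) \<partial>\<theta>) * indicator {0<..<T} r) / 2 \<partial>lborel)"
    by (intro nn_integral_cong) (auto simp: Fh_def indicator_def)
  also have "\<dots> = (\<integral>\<^sup>+r. (\<integral>\<^sup>+z. Dh (r, z) \<partial>\<theta>) * indicator {0<..<T} r \<partial>lborel) / 2"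
    using m by (intro nn_integral_divide) measurable
  finally show ?thesis using e by simp
qed

lemma AE_Dh_finite: "AE p in P. fst p \<in> {0<..<T} \<longrightarrow> Dh p < \<infinity>"
proof -
  have "(\<integral>\<^sup>+r\<in>{0<..<T}. Fh r \<partial>lborel) \<le> (\<integral>\<^sup>+r\<in>{0<..<T}. (Rh r + Fh r) \<partial>lborel)"
    by (intro nn_integral_mono) (auto simp: indicator_def)
  then have "(\<integral>\<^sup>+p. ennreal (inT p) * Dh p \<partial>P) / 2 < \<infinity>"
    unfolding Fh_integral using action_finite' by (rule le_less_trans)
  from ennreal_half_finite[OF this] have "(\<integral>\<^sup>+p. ennreal (inT p) * Dh p \<partial>P) \<noteq> \<infinity>"
    by (rule less_imp_neq)
  then have "AE p in P. ennreal (inT p) * Dh p \<noteq> \<infinity>"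
    by (intro nn_integral_noteq_infinite) measurable
  then show ?thesis
    by eventually_elim (auto simp: inT_def less_top[symmetric])
qed

lemma action_eq_P:
  assumes t: "0 \<le> t" "t \<le> T"
  shows "(\<integral>\<^sup>+r\<in>{0<..<t}. (Rh r + Fh r) \<partial>lborel) = (\<integral>\<^sup>+p. ennreal (indicator {0<..<t} (fst p) * (Br p / 2 + Dr p / 2)) \<partial>P)"
proof -
  have m: "(\<lambda>p. ennreal (indicator {0<..<t} (fst p) * (Br p / 2 + Dr p / 2))) \<in> borel_measurable P" by measurable
  have "(\<integral>\<^sup>+p. ennreal (indicator {0<..<t} (fst p) * (Br p / 2 + Dr p / 2)) \<partial>P)
     = (\<integral>\<^sup>+r. (\<integral>\<^sup>+z. ennreal (indicator {0<..<t} r * (Br (r, z) / 2 + Dr (r, z) / 2)) \<partial>\<theta>) \<partial>lborel)"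
    by (subst theta.nn_integral_fst[OF m, symmetric]) simp
  also have "\<dots> = (\<integral>\<^sup>+r\<in>{0<..<t}. (Rh r + Fh r) \<partial>lborel)"
  proof (rule nn_integral_cong_AE)
    have "AE r in lborel. AE z in \<theta>. fst (r, z) \<in> {0<..<T} \<longrightarrow> Dh (r, z) < \<infinity>"
      by (rule PP.AE_pair[OF AE_Dh_finite])
    then show "AE r in lborel. (\<integral>\<^sup>+z. ennreal (indicator {0<..<t} r * (Br (r, z) / 2 + Dr (r, z) / 2)) \<partial>\<theta>)
        = (Rh r + Fh r) * indicator {0<..<t} r"
    proof eventually_elim
      case (elim r)
      show ?case
      proof (cases "r \<in> {0<..<t}")
        case True
        then have r: "r \<in> {0<..<T}" using t by auto
        have b: "(\<lambda>z. ah (r, z) * \<psi> (Wh (r, z))) \<in> borel_measurable borel"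
          by (rule section_measurable[of "\<lambda>p. ah p * \<psi> (Wh p)"]) measurable
        note [measurable] = b section_measurable[OF Dh_measurable, of r]
        have "(\<integral>\<^sup>+z. ennreal (indicator {0<..<t} r * (Br (r, z) / 2 + Dr (r, z) / 2)) \<partial>\<theta>)
          = (\<integral>\<^sup>+z. ennreal (ah (r, z) * \<psi> (Wh (r, z))) / 2 + Dh (r, z) / 2 \<partial>\<theta>)"
        proof (rule nn_integral_cong_AE)
          show "AE z in \<theta>. ennreal (indicator {0<..<t} r * (Br (r, z) / 2 + Dr (r, z) / 2)) = ennreal (ah (r, z) * \<psi> (Wh (r, z))) / 2 + Dh (r, z) / 2"
            using elim
          proof eventually_elim
            case (elim z)
            then have "Dh (r, z) < \<infinity>" using r by simp
            then obtain d where d: "Dh (r, z) = ennreal d" "d \<ge> 0" by (cases "Dh (r, z)") auto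
            have half: "ennreal (x / 2) = ennreal x / 2" if "x \<ge> 0" for x
              using that by (simp add: ennreal_divide_numeral)
            have "ah (r, z) * \<psi> (Wh (r, z)) \<ge> 0" by (simp add: ah_nonneg psi_nonneg)
            then show ?case using True r d
              by (simp add: Br_def Dr_def inT_def ennreal_plus half)
          qed
        qed
        also have "\<dots> = Rh r + Fh r"
          unfolding Rh_def Fh_def
          by (subst nn_integral_add) (measurable, simp add: nn_integral_divide)
        finally show ?thesis using True by simp
      qed simp
    qed
  qed
  finally show ?thesis by simp
qed

lemma Br_Dr_integrable: "integrable P Br" "integrable P Dr"
proof -
  have "(\<integral>\<^sup>+p. ennreal (indicator {0<..<T} (fst p) * (Br p / 2 + Dr p / 2)) \<partial>P) < \<infinity>"
    using action_eq_P[of T] action_finite' T_pos by simp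
  moreover have "indicator {0<..<T} (fst p) * (Br p / 2 + Dr p / 2) = Br p / 2 + Dr p / 2" for p
    by (auto simp: Br_def Dr_def inT_def indicator_def)
  ultimately have "(\<integral>\<^sup>+p. ennreal (Br p / 2 + Dr p / 2) \<partial>P) < \<infinity>" by simp
  then have "integrable P (\<lambda>p. Br p / 2 + Dr p / 2)"
    by (intro integrableI_nonneg) (measurable, simp add: Br_nonneg Dr_nonneg)
  then have i2: "integrable P (\<lambda>p. 2 * (Br p / 2 + Dr p / 2))" by (rule integrable_mult_right)
  show "integrable P Br"
    by (rule Bochner_Integration.integrable_bound[OF i2]) (measurable, simp add: Br_nonneg Dr_nonneg)
  show "integrable P Dr"
    by (rule Bochner_Integration.integrable_bound[OF i2]) (measurable, simp add: Br_nonneg Dr_nonneg)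
qed

text \<open>Set to 0 where \<open>Dh\<close> is infinite: there \<open>Dr\<close> is 0, and the
  pointwise bound of the square of \<open>fh\<close> by \<open>Dr\<close> could otherwise
  fail.\<close>

definition fh :: "real \<Rightarrow> real \<times> ('v \<times> 'v) \<Rightarrow> real" where
  "fh \<epsilon> p = (if fst p \<in> {0<..<T} \<and> Dh p < \<infinity> then dphi_cut \<epsilon> (uy p) - dphi_cut \<epsilon> (ux p) else 0)"

lemma fh_measurable: "\<epsilon> > 0 \<Longrightarrow> fh \<epsilon> \<in> borel_measurable (borel \<Otimes>\<^sub>M borel)"
proof -
  assume "\<epsilon> > 0"
  note [measurable] = dphi_cut_measurable[OF this]
  show ?thesis unfolding fh_def[abs_def] by measurable
qed

lemma fh_bound: "\<epsilon> > 0 \<Longrightarrow> \<bar>fh \<epsilon> p\<bar> \<le> 2 * GM \<epsilon>"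
  using dphi_cut_bound[of \<epsilon> "ux p" Cb] dphi_cut_bound[of \<epsilon> "uy p" Cb] uxy_bounds[of p]
  unfolding fh_def GM_def by (auto simp: abs_le_iff)

lemma fh_sq_le:
  assumes e: "\<epsilon> > 0"
  shows "\<exists>K\<ge>0. \<forall>p. (fh \<epsilon> p)\<^sup>2 \<le> K * Dr p"
proof -
  obtain K where K: "K \<ge> 0" "\<And>u v. 0 \<le> u \<and> u \<le> Cb \<and> 0 \<le> v \<and> v \<le> Cb \<Longrightarrow> ennreal ((dphi_cut \<epsilon> v - dphi_cut \<epsilon> u)\<^sup>2) \<le> ennreal K * D (u, v)"
    using dphi_cut_grad_sq_le[OF e Cb_nonneg] by blast
  show ?thesis
  proof (intro exI[of _ K] conjI allI)
    fix p
    show "(fh \<epsilon> p)\<^sup>2 \<le> K * Dr p"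
    proof (cases "fst p \<in> {0<..<T} \<and> Dh p < \<infinity>")
      case True
      then obtain d where d: "Dh p = ennreal d" "d \<ge> 0" by (cases "Dh p") auto
      have "ennreal ((fh \<epsilon> p)\<^sup>2) \<le> ennreal K * Dh p"
        using K(2)[of "ux p" "uy p"] uxy_bounds[of p] True by (simp add: fh_def Dh_def)
      also have "\<dots> = ennreal (K * d)" using d K by (simp add: ennreal_mult)
      finally have "(fh \<epsilon> p)\<^sup>2 \<le> K * d" using d K by (simp add: ennreal_le_iff)
      then show ?thesis using True d by (simp add: Dr_def inT_def)
    next
      case False
      then have "fh \<epsilon> p = 0" by (auto simp: fh_def)
      then show ?thesis using K Dr_nonneg[of p] by simp
    qed
  qed (rule K)
qed

text \<open>Young's inequality with \<open>Wh\<close> at time \<open>r\<close> and the gradient at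
  time \<open>t\<close>. As \<open>fh\<close> is bounded, \<open>\<psi>s\<close> of it is at most
  quadratic, and its square is controlled by \<open>Dr\<close> at time \<open>t\<close>. The
  mobility at time \<open>r\<close> is at most a constant because the densities are bounded.\<close>

lemma fh_gh_bound:
  assumes e: "\<epsilon> > 0"
  shows "\<exists>K\<ge>0. \<forall>t r z. \<bar>fh \<epsilon> (t, z) * gh (r, z)\<bar> \<le> K * Dr (t, z) + Br (r, z)"
proof -
  obtain K1 where K1: "K1 \<ge> 0" "\<And>p. (fh \<epsilon> p)\<^sup>2 \<le> K1 * Dr p" using fh_sq_le[OF e] by blast
  obtain K2 where K2: "K2 > 0" "\<And>\<xi>. \<bar>\<xi>\<bar> \<le> 2 * GM \<epsilon> \<Longrightarrow> \<psi>s \<xi> \<le> K2 * \<xi>\<^sup>2"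
    using psi_star_quadratic[of "2 * GM \<epsilon>"] by blast
  obtain A where A: "A \<ge> 0" "\<And>u v. 0 \<le> u \<and> u \<le> Cb \<and> 0 \<le> v \<and> v \<le> Cb \<Longrightarrow> \<alpha> (u, v) \<le> A"
    using alpha_bounded[of Cb] by blast
  show ?thesis
  proof (intro exI[of _ "A * K2 * K1"] conjI allI)
    fix t r z
    let ?f = "fh \<epsilon> (t, z)" and ?W = "Wh (r, z)" and ?a = "ah (r, z)"
    show "\<bar>?f * gh (r, z)\<bar> \<le> A * K2 * K1 * Dr (t, z) + Br (r, z)"
    proof (cases "r \<in> {0<..<T}")
      case True
      have "\<bar>?f * ?W\<bar> \<le> \<psi> ?W + \<psi>s ?f"
        using Young[of ?W ?f] Young_neg[of ?W ?f] by (simp add: abs_le_iff mult.commute)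
      moreover have "\<psi>s ?f \<le> K2 * ?f\<^sup>2" by (rule K2(2)[OF fh_bound[OF e]])
      moreover have "K2 * ?f\<^sup>2 \<le> K2 * (K1 * Dr (t, z))" using K2(1) K1(2) by (intro mult_left_mono) auto
      ultimately have "\<bar>?f * ?W\<bar> \<le> \<psi> ?W + K2 * K1 * Dr (t, z)" by (simp add: mult.assoc)
      then have "?a * \<bar>?f * ?W\<bar> \<le> ?a * (\<psi> ?W + K2 * K1 * Dr (t, z))"
        by (intro mult_left_mono ah_nonneg)
      also have "\<dots> = Br (r, z) + ?a * (K2 * K1 * Dr (t, z))"
        using True by (simp add: Br_def inT_def distrib_left)
      also have "?a * (K2 * K1 * Dr (t, z)) \<le> A * (K2 * K1 * Dr (t, z))"
        using A(2) uxy_bounds[of "(r, z)"] K1 K2 Dr_nonneg by (intro mult_right_mono) (auto simp: ah_def)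
      finally have "?a * \<bar>?f * ?W\<bar> \<le> A * K2 * K1 * Dr (t, z) + Br (r, z)" by (simp add: mult_ac)
      moreover have "\<bar>?f * gh (r, z)\<bar> = ?a * \<bar>?f * ?W\<bar> / 2"
        using ah_nonneg[of "(r, z)"] by (simp add: gh_eq abs_mult mult_ac)
      moreover have "?a * \<bar>?f * ?W\<bar> \<ge> 0" using ah_nonneg by simp
      ultimately show ?thesis by linarith
    next
      case False
      then have "gh (r, z) = 0" by (auto simp: gh_def)
      then show ?thesis using A K1 K2 Dr_nonneg[of "(t, z)"] Br_nonneg[of "(r, z)"] by simp
    qed
  qed (use A K1 K2 in auto)
qed

definition Kf :: "real \<Rightarrow> real" where
  "Kf \<epsilon> = (SOME K. K \<ge> 0 \<and> (\<forall>t r z. \<bar>fh \<epsilon> (t, z) * gh (r, z)\<bar> \<le> K * Dr (t, z) + Br (r, z)))"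

lemma Kf: "\<epsilon> > 0 \<Longrightarrow> Kf \<epsilon> \<ge> 0"
  "\<epsilon> > 0 \<Longrightarrow> \<bar>fh \<epsilon> (t, z) * gh (r, z)\<bar> \<le> Kf \<epsilon> * Dr (t, z) + Br (r, z)"
proof -
  assume "\<epsilon> > 0"
  note k = someI_ex[OF fh_gh_bound[OF this], folded Kf_def]
  show "Kf \<epsilon> \<ge> 0" by (rule k[THEN conjunct1])
  show "\<bar>fh \<epsilon> (t, z) * gh (r, z)\<bar> \<le> Kf \<epsilon> * Dr (t, z) + Br (r, z)"
    by (rule k[THEN conjunct2, rule_format])
qed

text \<open>The flux density is integrable in space-time after weighting by \<open>wt\<close>. For
  fixed \<open>z\<close> the weight is a constant, positive off the diagonal, and can be divided
  out.\<close>

lemma gh_int: "AE z in \<theta>. integrable lborel (\<lambda>t. gh (t, z))"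
proof -
  let ?w = "\<lambda>p. wt (snd p) * gh p"
  have wm: "wt \<in> borel_measurable borel" by (rule wt_meas)
  then have [measurable]: "(\<lambda>p. wt (snd p)) \<in> borel_measurable (borel \<Otimes>\<^sub>M borel)"
    by (rule measurable_compose[OF measurable_snd])
  have [measurable]: "?w \<in> borel_measurable (borel \<Otimes>\<^sub>M borel)" by measurable
  have w0: "wt z \<ge> 0" for z :: "'v \<times> 'v" by simp
  have "(\<integral>\<^sup>+p. ennreal (norm (?w p)) \<partial>P) = (\<integral>\<^sup>+t. (\<integral>\<^sup>+z. ennreal (norm (?w (t, z))) \<partial>\<theta>) \<partial>lborel)"
    by (rule theta.nn_integral_fst[symmetric]) measurable
  also have "\<dots> \<le> (\<integral>\<^sup>+t. (\<integral>\<^sup>+z. ennreal (wt z) \<partial>jp t) + (\<integral>\<^sup>+z. ennreal (wt z) \<partial>jm t) \<partial>lborel)"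
  proof (rule nn_integral_mono_AE)
    show "AE t in lborel. (\<integral>\<^sup>+z. ennreal (norm (?w (t, z))) \<partial>\<theta>) \<le> (\<integral>\<^sup>+z. ennreal (wt z) \<partial>jp t) + (\<integral>\<^sup>+z. ennreal (wt z) \<partial>jm t)"
      using AE_good
    proof eventually_elim
      case (elim t)
      show ?case
      proof (cases "t \<in> {0<..<T}")
        case True
        then have g: "good t" using elim by simp
        note [measurable] = section_measurable[OF pmk_measurable(1), of t] section_measurable[OF pmk_measurable(2), of t] wm
        have "(\<integral>\<^sup>+z. ennreal (norm (?w (t, z))) \<partial>\<theta>) \<le> (\<integral>\<^sup>+z. pk (t, z) * ennreal (wt z) + mk (t, z) * ennreal (wt z) \<partial>\<theta>)"
        proof (rule nn_integral_mono_AE)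
          show "AE z in \<theta>. ennreal (norm (?w (t, z))) \<le> pk (t, z) * ennreal (wt z) + mk (t, z) * ennreal (wt z)"
            using good_gh[OF g]
          proof eventually_elim
            case (elim z)
            have "norm (?w (t, z)) = wt z * \<bar>gh (t, z)\<bar>" unfolding snd_conv by (simp only: real_norm_def abs_mult abs_of_nonneg[OF w0])
            also have "ennreal \<dots> = ennreal (wt z) * ennreal \<bar>gh (t, z)\<bar>" by (rule ennreal_mult) (simp_all add: w0)
            also have "ennreal \<bar>gh (t, z)\<bar> \<le> pk (t, z) + mk (t, z)"
              using elim by (cases "gh (t, z) \<ge> 0") (auto simp: abs_if ennreal_neg)
            finally show ?case by (simp only: distrib_right[symmetric] mult.commute[of "ennreal (wt z)"] mult_left_mono mult_right_mono zero_le)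
          qed
        qed
        also have "\<dots> = (\<integral>\<^sup>+z. ennreal (wt z) \<partial>jp t) + (\<integral>\<^sup>+z. ennreal (wt z) \<partial>jm t)"
        proof -
          have "jp t = density \<theta> (\<lambda>z. pk (t, z))" "jm t = density \<theta> (\<lambda>z. mk (t, z))" using g by (auto simp: good_def)
          then show ?thesis by (simp only:) (subst nn_integral_add, measurable, simp add: nn_integral_density)
        qed
        finally show ?thesis .
      next
        case False
        then have "gh (t, z) = 0" for z by (auto simp: gh_def)
        then show ?thesis by simp
      qed
    qed
  qed
  also have "\<dots> = (\<integral>\<^sup>+t. (\<integral>\<^sup>+z. ennreal (wt z) \<partial>jp t) \<partial>lborel) + (\<integral>\<^sup>+t. (\<integral>\<^sup>+z. ennreal (wt z) \<partial>jm t) \<partial>lborel)"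
  proof (rule nn_integral_add)
    show "(\<lambda>t. \<integral>\<^sup>+z. ennreal (wt z) \<partial>jp t) \<in> borel_measurable lborel"
      by (rule nn_integral_kernel_measurable[where N = borel, OF sets_jpm(1)]) (rule jpm_meas(1), assumption, use wm in measurable)
    show "(\<lambda>t. \<integral>\<^sup>+z. ennreal (wt z) \<partial>jm t) \<in> borel_measurable lborel"
      by (rule nn_integral_kernel_measurable[where N = borel, OF sets_jpm(2)]) (rule jpm_meas(2), assumption, use wm in measurable)
  qed
  also have "\<dots> < \<infinity>" using jpm_weight_finite by simp
  finally have iw: "integrable P ?w" by (intro integrableI_bounded) measurable
  define w where "w = ?w"
  have "integrable P w" unfolding w_def by (rule iw)
  then have "integrable P (\<lambda>(t, z). w (t, z))" unfolding case_prod_eta .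
  from PP.AE_integrable_snd[OF this] have "AE z in \<theta>. integrable lborel (\<lambda>t. ?w (t, z))"
    unfolding w_def .
  then show ?thesis using AE_edge_measure_offdiag[OF \<pi> \<kappa>]
  proof eventually_elim
    case (elim z)
    have "wt z \<noteq> 0" by (rule less_imp_neq[OF wt_pos[OF elim(2)], symmetric])
    have "integrable lborel (\<lambda>t. inverse (wt z) * ?w (t, z))" using elim(1) by (rule integrable_mult_right)
    also have "(\<lambda>t. inverse (wt z) * ?w (t, z)) = (\<lambda>t. gh (t, z))"
      unfolding snd_conv mult.assoc[symmetric] left_inverse[OF \<open>wt z \<noteq> 0\<close>] mult_1_left ..
    finally show ?case .
  qed
qed

lemma time_pairing_fh:
  assumes e: "\<epsilon> > 0"
  shows "time_pairing \<theta> (fh \<epsilon>) gh (\<lambda>p. Kf \<epsilon> * Dr p) Br (2 * GM \<epsilon>)"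
proof
  show "fh \<epsilon> \<in> borel_measurable P" by (rule borel_P[OF fh_measurable[OF e]])
  show "gh \<in> borel_measurable P" by (rule borel_P[OF gh_measurable])
  show "integrable P (\<lambda>p. Kf \<epsilon> * Dr p)" "integrable P Br" using Br_Dr_integrable by auto
qed (use fh_bound[OF e] Kf[OF e] Dr_nonneg Br_nonneg gh_int in auto)

text \<open>The square of the gradient is dominated by \<open>Dh\<close>, whose integral is finite
  at a good time; so the reflecting continuity equation may be tested with
  \<open>G \<epsilon> t\<close>.\<close>

lemma G_X2:
  assumes e: "\<epsilon> > 0" and t: "good t"
  shows "G \<epsilon> t \<in> X2 \<pi> \<kappa>"
    and "AE z in \<theta>. grad (G \<epsilon> t) z = fh \<epsilon> (t, z)"
proof -
  have tT: "t \<in> {0<..<T}" using t by (simp add: good_def)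
  note [measurable] = section_measurable[OF Dh_measurable, of t] section_measurable[OF fh_measurable[OF e], of t]
  have "Fh t < \<infinity>" using t unfolding good_def by (elim conjE)
  then have "(\<integral>\<^sup>+z. Dh (t, z) \<partial>\<theta>) < \<infinity>" unfolding Fh_def by (rule ennreal_half_finite)
  then have fin: "AE z in \<theta>. Dh (t, z) \<noteq> \<infinity>" by (intro nn_integral_noteq_infinite) auto
  have "AE x in \<pi>. uh (t, x) = v t x" using t unfolding good_def by (elim conjE)
  from AE_edge_measure_fst[OF \<pi> \<kappa> this] AE_edge_measure_snd[OF \<pi> \<kappa> balance this] fin
  show ae: "AE z in \<theta>. grad (G \<epsilon> t) z = fh \<epsilon> (t, z)"
    by eventually_elim (use tT in \<open>auto simp: grad_def case_prod_beta G_def fh_def ux_def uy_def less_top[symmetric]\<close>)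
  obtain K where K: "K \<ge> 0" "\<And>p. (fh \<epsilon> p)\<^sup>2 \<le> K * Dr p" using fh_sq_le[OF e] by blast
  have "(\<integral>\<^sup>+z\<in>offdiag. ennreal (\<bar>grad (G \<epsilon> t) z\<bar>\<^sup>2) \<partial>\<theta>) \<le> (\<integral>\<^sup>+z. ennreal K * Dh (t, z) \<partial>\<theta>)"
  proof (rule nn_integral_mono_AE)
    show "AE z in \<theta>. ennreal (\<bar>grad (G \<epsilon> t) z\<bar>\<^sup>2) * indicator offdiag z \<le> ennreal K * Dh (t, z)"
      using ae fin
    proof eventually_elim
      case (elim z)
      then obtain d where d: "Dh (t, z) = ennreal d" "d \<ge> 0" by (cases "Dh (t, z)") auto
      have "(fh \<epsilon> (t, z))\<^sup>2 \<le> K * d" using K(2)[of "(t, z)"] d tT by (simp add: Dr_def inT_def)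
      then have "ennreal (\<bar>grad (G \<epsilon> t) z\<bar>\<^sup>2) \<le> ennreal K * Dh (t, z)"
        using elim(1) d K by (simp add: ennreal_mult[symmetric] ennreal_leI)
      then show ?case by (auto simp: indicator_def)
    qed
  qed
  also have "\<dots> = ennreal K * (\<integral>\<^sup>+z. Dh (t, z) \<partial>\<theta>)" by (rule nn_integral_cmult) measurable
  also have "\<dots> < \<infinity>" using \<open>(\<integral>\<^sup>+z. Dh (t, z) \<partial>\<theta>) < \<infinity>\<close> by (simp add: ennreal_mult_less_top)
  finally show "G \<epsilon> t \<in> X2 \<pi> \<kappa>"
    unfolding X2_def using G_measurable[OF e] G_bound[OF e] by (auto intro!: exI[of _ "GM \<epsilon>"])
qed

text \<open>The reflecting continuity equation for a test function frozen at \<open>t\<close>,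
  rewritten with the flux density. Integrability at almost every \<open>q\<close> comes from the
  mixed-time bound with constant \<open>Kf \<epsilon>\<close>.\<close>

lemma ce_G:
  assumes e: "\<epsilon> > 0" and t: "good t" and Dt: "integrable \<theta> (\<lambda>z. Dr (t, z))" and sr: "0 \<le> s" "s \<le> r" "r \<le> T"
  shows "(\<integral>x. G \<epsilon> t x \<partial>\<rho> r) - (\<integral>x. G \<epsilon> t x \<partial>\<rho> s)
    = (\<integral>q. indicator {s<..<r} q * time_pairing.pairing \<theta> (fh \<epsilon>) gh t q \<partial>lborel)"
proof -
  interpret I: time_pairing \<theta> "fh \<epsilon>" gh "\<lambda>p. Kf \<epsilon> * Dr p" Br "2 * GM \<epsilon>" by (rule time_pairing_fh[OF e])
  note [measurable] = G_measurable[OF e, of t] section_measurable[OF fh_measurable[OF e], of t]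
  have gm[measurable]: "grad (G \<epsilon> t) \<in> borel_measurable borel" by (rule grad_measurable) measurable
  have "ce_identity T \<rho> j (G \<epsilon> t)" using RCE G_X2(1)[OF e t] unfolding RCE_def by auto
  then have "(\<integral>x. G \<epsilon> t x \<partial>\<rho> r) - (\<integral>x. G \<epsilon> t x \<partial>\<rho> s) = (\<integral>q\<in>{s..r}. sm_integral (j q) offdiag (grad (G \<epsilon> t)) \<partial>lborel)"
    unfolding ce_identity_def using sr by auto
  also have "\<dots> = (\<integral>q. indicator {s..r} q * (indicator {s..r} q * sm_integral (j q) offdiag (grad (G \<epsilon> t))) \<partial>lborel)"
    unfolding set_lebesgue_integral_def by (intro Bochner_Integration.integral_cong) (auto simp: indicator_def)
  also have "\<dots> = (\<integral>q. indicator {s<..<r} q * I.pairing t q \<partial>lborel)"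
  proof (rule integral_cong_AE)
    have hm: "(\<lambda>z. indicator offdiag z * grad (G \<epsilon> t) z) \<in> borel_measurable borel"
      by (intro borel_measurable_times borel_measurable_indicator offdiag_borel gm)
    have jm1: "(\<lambda>q. \<integral>z. indicator offdiag z * grad (G \<epsilon> t) z \<partial>jp q) \<in> borel_measurable lborel"
      by (rule integral_kernel_measurable[where N = borel]) (rule sets_jpm, erule jpm_meas, rule hm)
    have jm2: "(\<lambda>q. \<integral>z. indicator offdiag z * grad (G \<epsilon> t) z \<partial>jm q) \<in> borel_measurable lborel"
      by (rule integral_kernel_measurable[where N = borel]) (rule sets_jpm, erule jpm_meas, rule hm)
    have m: "(\<lambda>q. (\<integral>z. indicator offdiag z * grad (G \<epsilon> t) z \<partial>jp q) - (\<integral>z. indicator offdiag z * grad (G \<epsilon> t) z \<partial>jm q)) \<in> borel_measurable lborel"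
      by (intro borel_measurable_diff jm1 jm2)
    have e2: "indicator {s..r} q * (indicator {s..r} q * sm_integral (j q) offdiag (grad (G \<epsilon> t)))
       = indicator {s..r} q * ((\<integral>z. indicator offdiag z * grad (G \<epsilon> t) z \<partial>jp q) - (\<integral>z. indicator offdiag z * grad (G \<epsilon> t) z \<partial>jm q))" for q
      using sr sm_integral_jpm[of q "grad (G \<epsilon> t)"] by (auto simp: indicator_def)
    show "(\<lambda>q. indicator {s..r} q * (indicator {s..r} q * sm_integral (j q) offdiag (grad (G \<epsilon> t)))) \<in> borel_measurable lborel"
      unfolding e2 using m by measurable
    have "(\<lambda>q. I.pairing t q) \<in> borel_measurable lborel"
      using measurable_Pair2[OF I.pairing_meas, of t] by simp
    then show "(\<lambda>q. indicator {s<..<r} q * I.pairing t q) \<in> borel_measurable lborel" by measurable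
    have iB: "AE q in lborel. integrable \<theta> (\<lambda>z. Br (q, z))"
      by (rule PP.AE_integrable_fst'[OF Br_Dr_integrable(1)])
    show "AE q in lborel. indicator {s..r} q * (indicator {s..r} q * sm_integral (j q) offdiag (grad (G \<epsilon> t))) = indicator {s<..<r} q * I.pairing t q"
      using AE_good iB AE_lborel_singleton[of s] AE_lborel_singleton[of r]
    proof eventually_elim
      case (elim q)
      show ?case
      proof (cases "q \<in> {s<..<r}")
        case True
        then have q: "good q" using elim sr by auto
        note [measurable] = section_measurable[OF gh_measurable, of q]
        have m1: "(\<lambda>z. fh \<epsilon> (t, z) * gh (q, z)) \<in> borel_measurable \<theta>"
          and m2: "(\<lambda>z. grad (G \<epsilon> t) z * gh (q, z)) \<in> borel_measurable \<theta>" by measurable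
        have ae: "AE z in \<theta>. grad (G \<epsilon> t) z * gh (q, z) = fh \<epsilon> (t, z) * gh (q, z)"
          using G_X2(2)[OF e t] by eventually_elim simp
        have "integrable \<theta> (\<lambda>z. Kf \<epsilon> * Dr (t, z) + Br (q, z))" using Dt elim(2) by auto
        then have "integrable \<theta> (\<lambda>z. fh \<epsilon> (t, z) * gh (q, z))"
        proof (rule Bochner_Integration.integrable_bound[OF _ m1])
          show "AE z in \<theta>. norm (fh \<epsilon> (t, z) * gh (q, z)) \<le> norm (Kf \<epsilon> * Dr (t, z) + Br (q, z))"
            unfolding real_norm_def by (intro AE_I2 order_trans[OF Kf(2)[OF e] abs_ge_self])
        qed
        then have "integrable \<theta> (\<lambda>z. grad (G \<epsilon> t) z * gh (q, z))"
          by (rule integrable_cong_AE[OF m2 m1 ae, THEN iffD2])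
        from sm_integral_good[OF q gm this]
        have "sm_integral (j q) offdiag (grad (G \<epsilon> t)) = (\<integral>z. grad (G \<epsilon> t) z * gh (q, z) \<partial>\<theta>)" .
        also have "\<dots> = I.pairing t q"
          unfolding I.pairing_def by (rule integral_cong_AE[OF m2 m1 ae])
        finally show ?thesis using True by simp
      qed (use elim in \<open>auto simp: indicator_def\<close>)
    qed
  qed
  finally show ?thesis .
qed

text \<open>Both inequalities required by \<open>increment_eq\<close> are \<open>Ecut_incr\<close>
  with the test function frozen at the generic time \<open>t\<close>, read for \<open>r\<close>
  after and before \<open>t\<close>.\<close>

lemma Ecut_chain:
  assumes e: "0 < \<epsilon>" "\<epsilon> \<le> 1" and b: "0 \<le> b" "b \<le> T"
  shows "Ecut \<epsilon> b - Ecut \<epsilon> 0 = (\<integral>p. indicator {0<..<b} (fst p) * (fh \<epsilon> p * gh p) \<partial>P)"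
proof -
  interpret I: time_pairing \<theta> "fh \<epsilon>" gh "\<lambda>p. Kf \<epsilon> * Dr p" Br "2 * GM \<epsilon>" by (rule time_pairing_fh[OF e(1)])
  have Dt: "AE t in lborel. integrable \<theta> (\<lambda>z. Dr (t, z))"
    by (rule PP.AE_integrable_fst'[OF Br_Dr_integrable(2)])
  have "Ecut \<epsilon> b - Ecut \<epsilon> 0 = (\<integral>t. indicator {0..b} t * I.pairing t t \<partial>lborel)"
  proof (rule I.increment_eq[OF order_refl b Ecut_measurable[OF e] Ecut_bound[OF e]])
    show "t > T \<Longrightarrow> Ecut \<epsilon> t = Ecut \<epsilon> T" "t < 0 \<Longrightarrow> Ecut \<epsilon> t = Ecut \<epsilon> 0" for t
      using T_pos by (auto simp: Ecut_def clampT_def)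
    show "e > 0 \<Longrightarrow> \<exists>\<delta>>0. \<forall>r. \<bar>r - x\<bar> < \<delta> \<longrightarrow> Ecut \<epsilon> x - e \<le> Ecut \<epsilon> r" for x e
      by (rule Ecut_lsc[OF \<open>0 < \<epsilon>\<close> \<open>\<epsilon> \<le> 1\<close>])
    show "t \<notin> {0..T} \<Longrightarrow> fh \<epsilon> (t, z) = 0" "t \<notin> {0<..<T} \<Longrightarrow> gh (t, z) = 0" for t z
      by (auto simp: fh_def gh_def)
    show "AE t in lborel. t \<in> {0..T} \<longrightarrow> (\<forall>r\<in>{t..T}. Ecut \<epsilon> r - Ecut \<epsilon> t \<ge> (\<integral>q. indicator {t<..<r} q * I.pairing t q \<partial>lborel))"
      using AE_good Dt AE_lborel_singleton[of 0] AE_lborel_singleton[of T]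
    proof eventually_elim
      case (elim t)
      show ?case
      proof (intro impI ballI)
        fix r assume t: "t \<in> {0..T}" and r: "r \<in> {t..T}"
        have g: "good t" using elim t by auto
        show "Ecut \<epsilon> r - Ecut \<epsilon> t \<ge> (\<integral>q. indicator {t<..<r} q * I.pairing t q \<partial>lborel)"
          using Ecut_incr[OF e, of r t] ce_G[OF e(1) g elim(2), of t r] t r by auto
      qed
    qed
    show "AE t in lborel. t \<in> {0..T} \<longrightarrow> (\<forall>r\<in>{0..t}. Ecut \<epsilon> t - Ecut \<epsilon> r \<le> (\<integral>q. indicator {r<..<t} q * I.pairing t q \<partial>lborel))"
      using AE_good Dt AE_lborel_singleton[of 0] AE_lborel_singleton[of T]
    proof eventually_elim
      case (elim t)
      show ?case
      proof (intro impI ballI)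
        fix r assume t: "t \<in> {0..T}" and r: "r \<in> {0..t}"
        have g: "good t" using elim t by auto
        have "Ecut \<epsilon> r - Ecut \<epsilon> t \<ge> - ((\<integral>x. G \<epsilon> t x \<partial>\<rho> t) - (\<integral>x. G \<epsilon> t x \<partial>\<rho> r))"
          using Ecut_incr[OF e, of r t] t r by auto
        then show "Ecut \<epsilon> t - Ecut \<epsilon> r \<le> (\<integral>q. indicator {r<..<t} q * I.pairing t q \<partial>lborel)"
          using ce_G[OF e(1) g elim(2), of r t] t r by auto
      qed
    qed
  qed
  also have "\<dots> = (\<integral>t. indicator {0<..<b} t * I.pairing t t \<partial>lborel)"
  proof (rule integral_cong_AE)
    have "(\<lambda>t. I.pairing t t) \<in> borel_measurable lborel" using I.pairing_shift_int[of 0] by simp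
    then show "(\<lambda>t. indicator {0..b} t * I.pairing t t) \<in> borel_measurable lborel"
      "(\<lambda>t. indicator {0<..<b} t * I.pairing t t) \<in> borel_measurable lborel" by measurable
    show "AE t in lborel. indicator {0..b} t * I.pairing t t = indicator {0<..<b} t * I.pairing t t"
      using AE_lborel_singleton[of 0] AE_lborel_singleton[of b] by eventually_elim (auto simp: indicator_def)
  qed
  also have "\<dots> = (\<integral>t. (\<integral>z. indicator {0<..<b} t * (fh \<epsilon> (t, z) * gh (t, z)) \<partial>\<theta>) \<partial>lborel)"
    by (simp add: I.pairing_def)
  also have "\<dots> = (\<integral>p. indicator {0<..<b} (fst p) * (fh \<epsilon> p * gh p) \<partial>P)"
  proof -
    have "integrable P (\<lambda>p. indicator {0<..<b} (fst p) * (fh \<epsilon> p * gh p))"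
    proof (rule Bochner_Integration.integrable_bound[OF I.Fs_int[of 0]])
      show "(\<lambda>p. indicator {0<..<b} (fst p) * (fh \<epsilon> p * gh p)) \<in> borel_measurable P" by measurable
      show "AE p in P. norm (indicator {0<..<b} (fst p) * (fh \<epsilon> p * gh p)) \<le> norm (I.Fs 0 p)"
        by (intro AE_I2) (auto simp: I.Fs_def indicator_def case_prod_beta)
    qed
    from PP.integral_fst'[OF this] show ?thesis by simp
  qed
  finally show ?thesis .
qed

end

section \<open>The energy balance\<close>

text \<open>A number is determined by its positive and negative parts. An infinite \<open>y\<close>
  is excluded because one of its parts is \<open>\<infinity>\<close>, while \<open>ennreal\<close>
  of a real is finite.\<close>

lemma ennreal_e2ennreal_eq_iff:
  "(ennreal g = e2ennreal y \<and> ennreal (- g) = e2ennreal (- y)) \<longleftrightarrow> ereal g = y"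
proof (cases y)
  case (real r)
  then have "(ennreal g = e2ennreal y \<and> ennreal (- g) = e2ennreal (- y)) \<longleftrightarrow> (ennreal g = ennreal r \<and> ennreal (- g) = ennreal (- r))"
    by (simp add: e2ennreal_ereal)
  also have "\<dots> \<longleftrightarrow> g = r"
    by (cases "g \<ge> 0"; cases "r \<ge> 0") (auto simp: ennreal_neg ennreal_eq_0_iff)
  finally show ?thesis using real by simp
qed auto

context admissible_densities
begin

lemma phi'_measurable: "(\<lambda>r. phi' \<phi> (max 0 r)) \<in> borel_measurable borel"
proof (rule borel_measurable_LIMSEQ_order)
  show "(\<lambda>r. ereal (dphi_cut (1 / real (Suc n)) (max 0 r))) \<in> borel_measurable borel" for n
    using dphi_cut_measurable[of "1 / real (Suc n)"] by measurable
  show "(\<lambda>n. ereal (dphi_cut (1 / real (Suc n)) (max 0 r))) \<longlonglongrightarrow> phi' \<phi> (max 0 r)" for r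
    by (rule dphi_cut_tendsto) simp
qed

lemma psi_star'_ext_measurable: "psi_star'_ext \<psi>s \<in> borel_measurable borel"
proof -
  have eq: "psi_star'_ext \<psi>s y = (if y = \<infinity> then \<infinity> else if y = -\<infinity> then -\<infinity> else ereal (deriv \<psi>s (real_of_ereal y)))" for y
    by (cases y) (auto simp: psi_star'_ext_def)
  note [measurable] = deriv_psi_star_measurable
  show ?thesis unfolding eq[abs_def] by measurable
qed

lemma F_map_measurable:
  assumes u[measurable]: "u \<in> borel_measurable M" and v[measurable]: "v \<in> borel_measurable M"
    and nn: "\<And>x. u x \<ge> 0" "\<And>x. v x \<ge> 0"
  shows "(\<lambda>x. F_map \<phi> \<psi>s \<alpha> (u x) (v x)) \<in> borel_measurable M"
proof -
  have [measurable]: "(\<lambda>x. phi' \<phi> (u x)) \<in> borel_measurable M" "(\<lambda>x. phi' \<phi> (v x)) \<in> borel_measurable M"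
    using measurable_compose[OF u phi'_measurable] measurable_compose[OF v phi'_measurable] nn by (simp_all add: max_absorb2)
  have L: "(\<lambda>x. Lambda \<phi> (u x) (v x)) \<in> borel_measurable M"
    unfolding Lambda_def by measurable
  note [measurable] = measurable_compose[OF L psi_star'_ext_measurable]
  have "(\<lambda>x. (u x, v x)) \<in> measurable M (borel \<Otimes>\<^sub>M borel)" by measurable
  then have "(\<lambda>x. (u x, v x)) \<in> measurable M borel" by (simp only: borel_prod)
  from measurable_compose[OF this alpha_max_measurable] nn
  have [measurable]: "(\<lambda>x. \<alpha> (u x, v x)) \<in> borel_measurable M" by (simp add: max_absorb2)
  show ?thesis unfolding F_map_def by measurable
qed

end

context reflecting_pair
begin

text \<open>The driving force as a real number. Where the mobility vanishes \<open>Lambda\<close>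
  may be infinite, but \<open>gh\<close> is 0 there, so the default value does not affect the
  product with the flux.\<close>

definition \<Lambda>h :: "real \<times> ('v \<times> 'v) \<Rightarrow> real" where
  "\<Lambda>h p = (if fst p \<in> {0<..<T} \<and> Dh p < \<infinity> \<and> ah p > 0 then real_of_ereal (Lambda \<phi> (ux p) (uy p)) else 0)"

text \<open>With positive mobility, an infinite \<open>Lambda\<close> would make \<open>Dh\<close>
  infinite.\<close>

lemma Lambda_h:
  assumes "fst p \<in> {0<..<T}" "Dh p < \<infinity>" "ah p > 0"
  shows "Lambda \<phi> (ux p) (uy p) = ereal (\<Lambda>h p)" "Dr p = \<psi>s (\<Lambda>h p) * ah p"
proof -
  let ?L = "Lambda \<phi> (ux p) (uy p)"
  have D: "Dh p = psi_star_ext \<psi>s ?L * ennreal (ah p)"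
    unfolding Dh_def ah_def using assms uxy_bounds[of p] by (intro D_eq) (auto simp: ah_def)
  have "\<bar>?L\<bar> \<noteq> \<infinity>"
  proof
    assume "\<bar>?L\<bar> = \<infinity>"
    then have "psi_star_ext \<psi>s ?L = \<infinity>" by (cases ?L) (auto simp: psi_star_ext_def)
    then have "Dh p = \<infinity>" using D assms(3) by (simp add: ennreal_top_mult ennreal_eq_0_iff)
    then show False using assms(2) by simp
  qed
  then show L: "?L = ereal (\<Lambda>h p)" using assms by (simp add: \<Lambda>h_def ereal_real')
  then have "Dh p = ennreal (\<psi>s (\<Lambda>h p) * ah p)"
    using D assms(3) psi_star_nonneg by (simp add: psi_star_ext_def ennreal_mult)
  then show "Dr p = \<psi>s (\<Lambda>h p) * ah p"
    using assms psi_star_nonneg[of "\<Lambda>h p"] by (simp add: Dr_def inT_def)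
qed

lemma gh_eq_0: "\<not> (fst p \<in> {0<..<T} \<and> ah p > 0) \<Longrightarrow> gh p = 0"
  using ah_nonneg[of p] gh_eq[of p] by (cases "ah p = 0") (auto simp: gh_def)

text \<open>Unlike the bound with \<open>Kf\<close>, this one does not depend on
  \<open>\<epsilon>\<close>, which permits the limit. Both factors stand at the same time, the
  truncated gradient is at most \<open>\<bar>\<Lambda>h p\<bar>\<close>, and Young's inequality is
  applied to \<open>Wh\<close> and \<open>\<Lambda>h\<close>.\<close>

lemma fh_gh_le:
  assumes e: "\<epsilon> > 0"
  shows "\<bar>fh \<epsilon> p * gh p\<bar> \<le> Dr p / 2 + Br p / 2"
proof (cases "fst p \<in> {0<..<T} \<and> Dh p < \<infinity> \<and> ah p > 0")
  case True
  then have c: "fst p \<in> {0<..<T}" "Dh p < \<infinity>" "ah p > 0" by auto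
  have "ereal \<bar>fh \<epsilon> p\<bar> \<le> \<bar>Lambda \<phi> (ux p) (uy p)\<bar>"
    using dphi_cut_grad_le[OF e uxy_bounds(1) uxy_bounds(3), of p p] c by (simp add: fh_def)
  then have "\<bar>fh \<epsilon> p\<bar> \<le> \<bar>\<Lambda>h p\<bar>" by (simp add: Lambda_h(1)[OF c])
  then have "\<bar>fh \<epsilon> p\<bar> * \<bar>gh p\<bar> \<le> \<bar>\<Lambda>h p\<bar> * \<bar>gh p\<bar>" by (rule mult_right_mono) simp
  also have "\<dots> = ah p * \<bar>Wh p * \<Lambda>h p\<bar> / 2" using c(3) by (simp add: gh_eq abs_mult mult_ac)
  also have "\<bar>Wh p * \<Lambda>h p\<bar> \<le> \<psi> (Wh p) + \<psi>s (\<Lambda>h p)"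
    using Young[of "Wh p" "\<Lambda>h p"] Young_neg[of "Wh p" "\<Lambda>h p"] by (simp add: abs_le_iff)
  finally have "\<bar>fh \<epsilon> p\<bar> * \<bar>gh p\<bar> \<le> ah p * (\<psi> (Wh p) + \<psi>s (\<Lambda>h p)) / 2"
    using c(3) by (simp add: mult_left_mono divide_right_mono)
  also have "\<dots> = Dr p / 2 + Br p / 2"
    using c(1) Lambda_h(2)[OF c] by (simp add: Br_def inT_def algebra_simps add_divide_distrib)
  finally show ?thesis by (simp add: abs_mult)
next
  case False
  then have "fh \<epsilon> p * gh p = 0" using gh_eq_0[of p] by (auto simp: fh_def)
  then show ?thesis using Dr_nonneg[of p] Br_nonneg[of p] by (simp only: abs_zero add_nonneg_nonneg divide_nonneg_nonneg zero_le_numeral)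
qed

lemma fh_gh_tendsto: "(\<lambda>n. fh (1 / real (Suc n)) p * gh p) \<longlonglongrightarrow> \<Lambda>h p * gh p"
proof (cases "fst p \<in> {0<..<T} \<and> Dh p < \<infinity> \<and> ah p > 0")
  case True
  then have c: "fst p \<in> {0<..<T}" "Dh p < \<infinity>" "ah p > 0" by auto
  have "(\<lambda>n. dphi_cut (1 / real (Suc n)) (uy p) - dphi_cut (1 / real (Suc n)) (ux p)) \<longlonglongrightarrow> real_of_ereal (Lambda \<phi> (ux p) (uy p))"
    using Lambda_h(1)[OF c] by (intro dphi_cut_grad_tendsto uxy_bounds) simp
  then have "(\<lambda>n. fh (1 / real (Suc n)) p) \<longlonglongrightarrow> \<Lambda>h p" using c by (simp add: fh_def \<Lambda>h_def)
  then show ?thesis by (intro tendsto_mult_right)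
next
  case False
  then have "fh (1 / real (Suc n)) p * gh p = 0" for n using gh_eq_0[of p] by (auto simp: fh_def)
  moreover have "\<Lambda>h p * gh p = 0" using False by (auto simp: \<Lambda>h_def)
  ultimately show ?thesis by (simp only: tendsto_const)
qed

lemma Lgh_measurable [measurable]: "(\<lambda>p. \<Lambda>h p * gh p) \<in> borel_measurable (borel \<Otimes>\<^sub>M borel)"
proof (rule borel_measurable_LIMSEQ_real[OF fh_gh_tendsto])
  show "(\<lambda>p. fh (1 / real (Suc n)) p * gh p) \<in> borel_measurable (borel \<Otimes>\<^sub>M borel)" for n
    by (intro borel_measurable_times fh_measurable gh_measurable) simp
qed

lemma Lgh_le: "\<bar>\<Lambda>h p * gh p\<bar> \<le> Dr p / 2 + Br p / 2"
proof (rule LIMSEQ_le_const2[OF tendsto_rabs[OF fh_gh_tendsto]])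
  show "\<exists>N. \<forall>n\<ge>N. \<bar>fh (1 / real (Suc n)) p * gh p\<bar> \<le> Dr p / 2 + Br p / 2"
    by (intro exI allI impI fh_gh_le) simp
qed

lemma bound_integrable: "integrable P (\<lambda>p. Dr p / 2 + Br p / 2)"
  using Br_Dr_integrable by (intro Bochner_Integration.integrable_add) auto

section \<open>Removal of the truncation\<close>

definition Efull :: "real \<Rightarrow> real" where "Efull t = (\<integral>x. \<phi> (v t x) \<partial>\<pi>)"

lemma phi_v_measurable [measurable]: "(\<lambda>x. \<phi> (v t x)) \<in> borel_measurable borel"
proof (rule borel_measurable_LIMSEQ_real[OF phi_cut_tendsto[OF v_bounds(1)]])
  show "(\<lambda>x. phi_cut (1 / real (Suc n)) (v t x)) \<in> borel_measurable borel" for n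
    by (intro measurable_compose[OF v_measurable phi_cut_measurable]) simp
qed

lemma phi_v_bound: "\<bar>\<phi> (v t x)\<bar> \<le> phiB"
proof (rule LIMSEQ_le_const2[OF tendsto_rabs[OF phi_cut_tendsto[OF v_bounds(1)]]])
  show "\<exists>N. \<forall>n\<ge>N. \<bar>phi_cut (1 / real (Suc n)) (v t x)\<bar> \<le> phiB"
    by (intro exI allI impI phi_cut_bounded v_bounds) auto
qed

lemma Ecut_tendsto:
  assumes t: "t \<in> {0..T}"
  shows "(\<lambda>n. Ecut (1 / real (Suc n)) t) \<longlonglongrightarrow> Efull t"
  unfolding Ecut_def Efull_def clampT_id[OF t]
proof (rule integral_dominated_convergence[where w = "\<lambda>_. phiB"])
  show "(\<lambda>x. phi_cut (1 / real (Suc n)) (v t x)) \<in> borel_measurable \<pi>" for n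
    unfolding measurable_cong_sets[OF sets_pi refl]
    by (intro measurable_compose[OF v_measurable phi_cut_measurable]) simp
  show "AE x in \<pi>. norm (phi_cut (1 / real (Suc n)) (v t x)) \<le> phiB" for n
    unfolding real_norm_def by (intro AE_I2 phi_cut_bounded v_bounds) auto
  show "AE x in \<pi>. (\<lambda>n. phi_cut (1 / real (Suc n)) (v t x)) \<longlonglongrightarrow> \<phi> (v t x)"
    by (intro AE_I2 phi_cut_tendsto v_bounds)
qed auto

lemma energy_Efull:
  assumes t: "t \<in> {0..T}"
  shows "energy \<pi> \<phi> (\<rho> t) = ennreal (Efull t)"
proof -
  have "energy \<pi> \<phi> (\<rho> t) = (\<integral>\<^sup>+x. ennreal (\<phi> (dens \<pi> (\<rho> t) x)) \<partial>\<pi>)"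
    using rho_ac[OF t] by (simp add: energy_def)
  also have "\<dots> = (\<integral>\<^sup>+x. ennreal (\<phi> (v t x)) \<partial>\<pi>)"
    using v_eq_dens[OF t] by (intro nn_integral_cong_AE) (auto elim!: eventually_mono)
  also have "\<dots> = ennreal (Efull t)"
    unfolding Efull_def using v_bounds phi_nonneg
    by (intro nn_integral_eq_integral integrable_bounded_pi[OF phi_v_measurable phi_v_bound]) auto
  finally show ?thesis .
qed

lemma Efull_nonneg: "Efull t \<ge> 0"
  unfolding Efull_def using v_bounds phi_nonneg by (intro integral_nonneg_AE) auto

lemma Efull_chain:
  assumes b: "0 \<le> b" "b \<le> T"
  shows "Efull b - Efull 0 = (\<integral>p. indicator {0<..<b} (fst p) * (\<Lambda>h p * gh p) \<partial>P)"
proof (rule LIMSEQ_unique)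
  show "(\<lambda>n. Ecut (1 / real (Suc n)) b - Ecut (1 / real (Suc n)) 0) \<longlonglongrightarrow> Efull b - Efull 0"
    using b by (intro tendsto_diff Ecut_tendsto) auto
  have eq: "Ecut (1 / real (Suc n)) b - Ecut (1 / real (Suc n)) 0 = (\<integral>p. indicator {0<..<b} (fst p) * (fh (1 / real (Suc n)) p * gh p) \<partial>P)" for n
    by (rule Ecut_chain[OF _ _ b]) auto
  show "(\<lambda>n. Ecut (1 / real (Suc n)) b - Ecut (1 / real (Suc n)) 0) \<longlonglongrightarrow> (\<integral>p. indicator {0<..<b} (fst p) * (\<Lambda>h p * gh p) \<partial>P)"
    unfolding eq
  proof (rule integral_dominated_convergence[where w = "\<lambda>p. Dr p / 2 + Br p / 2"])
    show "(\<lambda>p. indicator {0<..<b} (fst p) * (\<Lambda>h p * gh p)) \<in> borel_measurable P" by measurable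
    show "(\<lambda>p. indicator {0<..<b} (fst p) * (fh (1 / real (Suc n)) p * gh p)) \<in> borel_measurable P" for n
    proof -
      have [measurable]: "fh (1 / real (Suc n)) \<in> borel_measurable (borel \<Otimes>\<^sub>M borel)" by (rule fh_measurable) simp
      show ?thesis by measurable
    qed
    show "AE p in P. (\<lambda>n. indicator {0<..<b} (fst p) * (fh (1 / real (Suc n)) p * gh p)) \<longlonglongrightarrow> indicator {0<..<b} (fst p) * (\<Lambda>h p * gh p)"
      by (intro AE_I2 tendsto_mult_left fh_gh_tendsto)
    show "AE p in P. norm (indicator {0<..<b} (fst p) * (fh (1 / real (Suc n)) p * gh p)) \<le> Dr p / 2 + Br p / 2" for n
    proof (rule AE_I2)
      fix p
      have "norm (indicator {0<..<b} (fst p) * (fh (1 / real (Suc n)) p * gh p)) \<le> \<bar>fh (1 / real (Suc n)) p * gh p\<bar>"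
        by (auto simp: indicator_def)
      also have "\<dots> \<le> Dr p / 2 + Br p / 2" by (rule fh_gh_le) simp
      finally show "norm (indicator {0<..<b} (fst p) * (fh (1 / real (Suc n)) p * gh p)) \<le> Dr p / 2 + Br p / 2" .
    qed
  qed (rule bound_integrable)
qed

section \<open>The balance as a space-time integral\<close>

definition hh :: "real \<times> ('v \<times> 'v) \<Rightarrow> real" where "hh p = Br p / 2 + Dr p / 2 + \<Lambda>h p * gh p"

lemma hh_measurable [measurable]: "hh \<in> borel_measurable (borel \<Otimes>\<^sub>M borel)"
  unfolding hh_def[abs_def] by measurable

lemma hh_nonneg: "hh p \<ge> 0"
  using Lgh_le[of p] unfolding hh_def by linarith

lemma hh_integrable: "integrable P hh"
proof (rule Bochner_Integration.integrable_bound[OF integrable_mult_right[OF bound_integrable, of 2]])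
  show "hh \<in> borel_measurable P" by (rule borel_P[OF hh_measurable])
  show "AE p in P. norm (hh p) \<le> norm (2 * (Dr p / 2 + Br p / 2))"
  proof (rule AE_I2)
    fix p
    show "norm (hh p) \<le> norm (2 * (Dr p / 2 + Br p / 2))"
      using Lgh_le[of p] hh_nonneg[of p] Dr_nonneg[of p] Br_nonneg[of p] by (simp add: hh_def)
  qed
qed

lemma hh_outside: "fst p \<notin> {0<..<T} \<Longrightarrow> hh p = 0"
  using gh_eq_0[of p] by (auto simp: hh_def Br_def Dr_def inT_def)

lemma EDF_eq:
  assumes b: "0 \<le> b" "b \<le> T"
  shows "EDF \<pi> \<kappa> \<phi> \<psi>s \<alpha> \<rho> j b = ereal (\<integral>p. indicator {0<..<b} (fst p) * hh p \<partial>P)"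
proof -
  have iP: "integrable P (\<lambda>p. indicator {0<..<b} (fst p) * k p)" if k: "integrable P k" for k :: "real \<times> ('v \<times> 'v) \<Rightarrow> real"
  proof (rule Bochner_Integration.integrable_bound[OF k])
    show "(\<lambda>p. indicator {0<..<b} (fst p) * k p) \<in> borel_measurable P"
      using borel_measurable_integrable[OF k] by measurable
  qed (auto simp: indicator_def)
  have i1: "integrable P (\<lambda>p. indicator {0<..<b} (fst p) * (Br p / 2 + Dr p / 2))"
    using iP[OF bound_integrable] by (simp add: add.commute)
  have "integrable P (\<lambda>p. \<Lambda>h p * gh p)"
  proof (rule Bochner_Integration.integrable_bound[OF bound_integrable])
    show "(\<lambda>p. \<Lambda>h p * gh p) \<in> borel_measurable P" by (rule borel_P[OF Lgh_measurable])
    show "AE p in P. norm (\<Lambda>h p * gh p) \<le> norm (Dr p / 2 + Br p / 2)"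
      unfolding real_norm_def by (intro AE_I2 order_trans[OF Lgh_le abs_ge_self])
  qed
  from iP[OF this] have i2: "integrable P (\<lambda>p. indicator {0<..<b} (fst p) * (\<Lambda>h p * gh p))" .
  let ?I = "\<integral>p. indicator {0<..<b} (fst p) * (Br p / 2 + Dr p / 2) \<partial>P"
  have I0: "?I \<ge> 0" using Br_nonneg Dr_nonneg by (intro integral_nonneg_AE) auto
  have "(\<integral>\<^sup>+r\<in>{0..b}. (dissipation \<pi> \<kappa> \<psi>s \<alpha> (\<rho> r) (j r) + fisher \<pi> \<kappa> \<phi> \<psi>s \<alpha> (\<rho> r)) \<partial>lborel) = ennreal ?I"
    unfolding action_Rh_Fh[OF b] action_eq_P[OF b]
    using Br_nonneg Dr_nonneg by (intro nn_integral_eq_integral[OF i1]) auto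
  then have "EDF \<pi> \<kappa> \<phi> \<psi>s \<alpha> \<rho> j b = ereal (Efull b - Efull 0 + ?I)"
    using b T_pos I0 Efull_nonneg by (simp add: EDF_def energy_Efull enn2ereal_ennreal)
  also have "Efull b - Efull 0 + ?I = (\<integral>p. indicator {0<..<b} (fst p) * (\<Lambda>h p * gh p) + indicator {0<..<b} (fst p) * (Br p / 2 + Dr p / 2) \<partial>P)"
    using i1 i2 by (simp add: Efull_chain[OF b])
  also have "\<dots> = (\<integral>p. indicator {0<..<b} (fst p) * hh p \<partial>P)"
    by (intro Bochner_Integration.integral_cong) (auto simp: hh_def algebra_simps)
  finally show ?thesis .
qed

lemma EDF_nonneg: "b \<in> {0..T} \<Longrightarrow> EDF \<pi> \<kappa> \<phi> \<psi>s \<alpha> \<rho> j b \<ge> 0"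
  by (subst EDF_eq) (auto intro!: integral_nonneg_AE simp: hh_nonneg zero_ereal_def)

text \<open>The value at the final time determines all others: the integrand is nonnegative, so a
  zero integral over \<open>{0<..<T}\<close> makes it vanish almost everywhere, and then every
  partial integral is 0.\<close>

lemma EDF_zero_iff:
  "(\<forall>t\<in>{0..T}. EDF \<pi> \<kappa> \<phi> \<psi>s \<alpha> \<rho> j t = 0) \<longleftrightarrow> (AE t in lborel. AE z in \<theta>. hh (t, z) = 0)"
proof -
  have "(AE t in lborel. AE z in \<theta>. hh (t, z) = 0) \<longleftrightarrow> (AE p in P. hh (fst p, snd p) = 0)"
  proof (rule PP.AE_pair_iff)
    have "hh \<in> borel_measurable P" by (rule borel_P[OF hh_measurable])
    then show "{x \<in> space P. hh (fst x, snd x) = 0} \<in> sets P" by measurable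
  qed
  moreover have "(\<forall>t\<in>{0..T}. EDF \<pi> \<kappa> \<phi> \<psi>s \<alpha> \<rho> j t = 0) \<longleftrightarrow> (AE p in P. hh p = 0)"
  proof
    assume "\<forall>t\<in>{0..T}. EDF \<pi> \<kappa> \<phi> \<psi>s \<alpha> \<rho> j t = 0"
    then have "EDF \<pi> \<kappa> \<phi> \<psi>s \<alpha> \<rho> j T = 0" using T_pos by simp
    then have "(\<integral>p. indicator {0<..<T} (fst p) * hh p \<partial>P) = 0"
      using EDF_eq[of T] T_pos by (simp add: zero_ereal_def)
    moreover have "(\<lambda>p. indicator {0<..<T} (fst p) * hh p) = hh"
    proof
      show "indicator {0<..<T} (fst p) * hh p = hh p" for p
        using hh_outside[of p] by (cases "fst p \<in> {0<..<T}") (auto simp del: greaterThanLessThan_iff)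
    qed
    ultimately have "integral\<^sup>L P hh = 0" by (simp only:)
    then show "AE p in P. hh p = 0"
      using integral_nonneg_eq_0_iff_AE[OF hh_integrable] hh_nonneg by simp
  next
    assume ae: "AE p in P. hh p = 0"
    have "(\<integral>p. indicator {0<..<b} (fst p) * hh p \<partial>P) = 0" for b
      using ae by (intro integral_eq_zero_AE) (auto elim!: eventually_mono)
    then show "\<forall>t\<in>{0..T}. EDF \<pi> \<kappa> \<phi> \<psi>s \<alpha> \<rho> j t = 0"
      by (auto simp: EDF_eq zero_ereal_def)
  qed
  ultimately show ?thesis by simp
qed

text \<open>With positive mobility this is the equality case of Young's inequality, multiplied by
  the mobility. With zero mobility both sides of the flux identity are 0, and the condition is
  carried by \<open>F_defined\<close>: \<open>Dh p = 0\<close> means \<open>ux p = uy p\<close>, and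
  on the diagonal \<open>\<alpha>\<close> vanishes at most at the origin.\<close>

lemma hh_eq_0_iff:
  assumes t: "fst p \<in> {0<..<T}" and D: "Dh p < \<infinity>"
  shows "hh p = 0 \<longleftrightarrow> F_defined \<alpha> (ux p) (uy p) \<and> ereal (2 * gh p) = - F_map \<phi> \<psi>s \<alpha> (ux p) (uy p)"
proof (cases "ah p > 0")
  case True
  note L = Lambda_h[OF t D True]
  have "hh p = ah p / 2 * (\<psi> (Wh p) + \<psi>s (\<Lambda>h p) + Wh p * \<Lambda>h p)"
    using t L(2) by (simp add: hh_def Br_def inT_def gh_eq algebra_simps add_divide_distrib)
  then have "hh p = 0 \<longleftrightarrow> Wh p = - deriv \<psi>s (\<Lambda>h p)"
    using True Young_neg_eq_iff[of "Wh p" "\<Lambda>h p"] by (simp only: mult_eq_0_iff) simp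
  also have "\<dots> \<longleftrightarrow> Wh p * ah p = - (deriv \<psi>s (\<Lambda>h p) * ah p)"
    unfolding minus_mult_left mult_cancel_right using True by simp
  also have "\<dots> \<longleftrightarrow> ereal (2 * gh p) = - F_map \<phi> \<psi>s \<alpha> (ux p) (uy p)"
    using True L(1) by (simp add: F_map_def ah_def[symmetric] psi_star'_ext_def gh_eq)
  finally show ?thesis using True by (simp add: F_defined_def ah_def)
next
  case False
  then have g: "gh p = 0" by (intro gh_eq_0) simp
  have a: "ah p = 0" using False ah_nonneg[of p] by simp
  have "hh p = Dr p / 2" using a g by (simp add: hh_def Br_def)
  also have "Dr p = enn2real (Dh p)" using t by (simp add: Dr_def inT_def)
  finally have "hh p = 0 \<longleftrightarrow> enn2real (Dh p) = 0" by linarith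
  also have "\<dots> \<longleftrightarrow> Dh p = 0" using D by (auto simp: enn2real_eq_0_iff)
  also have "\<dots> \<longleftrightarrow> ux p = uy p" unfolding Dh_def by (rule D_eq_0_iff) (rule uxy_bounds)+
  also have "\<dots> \<longleftrightarrow> F_defined \<alpha> (ux p) (uy p)"
  proof -
    have "ux p = 0" if "ux p = uy p"
    proof (rule ccontr)
      assume "ux p \<noteq> 0"
      then have "ux p > 0" using uxy_bounds(1)[of p] by simp
      then have "\<alpha> (ux p, uy p) > 0" using that alpha_pos[of "ux p" "uy p"] by simp
      then show False using a by (simp add: ah_def)
    qed
    then show ?thesis using False by (auto simp: F_defined_def ah_def)
  qed
  finally show ?thesis using False g by (simp add: F_map_def ah_def[symmetric])
qed

text \<open>All components have densities with respect to the sigma-finite \<open>\<theta>\<close>,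
  so the pairs agree exactly when positive and negative parts agree almost everywhere. As the left
  side has finite density, this also excludes infinite values of \<open>F_map\<close> almost
  everywhere.\<close>

lemma flux_eq_iff:
  assumes t: "good t"
  shows "sm_scale 2 (j t) = sm_density \<theta> (\<lambda>(x, y). - F_map \<phi> \<psi>s \<alpha> (dens \<pi> (\<rho> t) x) (dens \<pi> (\<rho> t) y)) \<longleftrightarrow>
    (AE z in \<theta>. ereal (2 * gh (t, z)) = - F_map \<phi> \<psi>s \<alpha> (dens \<pi> (\<rho> t) (fst z)) (dens \<pi> (\<rho> t) (snd z)))"
proof -
  have tT: "t \<in> {0..T}" using t by (auto simp: good_def)
  define y where "y z = - F_map \<phi> \<psi>s \<alpha> (dens \<pi> (\<rho> t) (fst z)) (dens \<pi> (\<rho> t) (snd z))" for z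
  have "(\<lambda>z. F_map \<phi> \<psi>s \<alpha> (dens \<pi> (\<rho> t) (fst z)) (dens \<pi> (\<rho> t) (snd z))) \<in> borel_measurable borel"
    by (intro F_map_measurable compose_fst_measurable compose_snd_measurable dens_measurable dens_nonneg)
  then have ym: "y \<in> borel_measurable borel" unfolding y_def by measurable
  note gm = section_measurable[OF gh_measurable, of t]
  have scale: "scale_measure 2 (density \<theta> k) = density \<theta> (\<lambda>z. 2 * k z)" if "k \<in> borel_measurable \<theta>" for k
    using that by (intro measure_eqI) (auto simp: emeasure_density nn_integral_cmult[symmetric] mult.assoc)
  have jp: "jp t = density \<theta> (\<lambda>z. pk (t, z))" using t unfolding good_def by (elim conjE)
  have jm: "jm t = density \<theta> (\<lambda>z. mk (t, z))" using t unfolding good_def by (elim conjE)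
  note pm = section_measurable[OF pmk_measurable(1), of t] section_measurable[OF pmk_measurable(2), of t]
  have twice: "2 * ennreal x = ennreal (2 * x)" for x
    by (cases "x \<ge> 0") (auto simp: ennreal_mult ennreal_neg)
  have "scale_measure 2 (jp t) = density \<theta> (\<lambda>z. 2 * pk (t, z))" "scale_measure 2 (jm t) = density \<theta> (\<lambda>z. 2 * mk (t, z))"
    unfolding jp jm using pm by (auto intro!: scale)
  moreover have "density \<theta> (\<lambda>z. 2 * pk (t, z)) = density \<theta> (\<lambda>z. ennreal (2 * gh (t, z)))"
  proof (rule density_cong)
    show "AE z in \<theta>. 2 * pk (t, z) = ennreal (2 * gh (t, z))"
      using good_gh[OF t] by eventually_elim (simp add: twice)
  qed (use pm gm in measurable)
  moreover have "density \<theta> (\<lambda>z. 2 * mk (t, z)) = density \<theta> (\<lambda>z. ennreal (- (2 * gh (t, z))))"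
  proof (rule density_cong)
    show "AE z in \<theta>. 2 * mk (t, z) = ennreal (- (2 * gh (t, z)))"
      using good_gh[OF t] by eventually_elim (simp add: twice)
  qed (use pm gm in measurable)
  ultimately have lhs: "sm_scale 2 (j t) = (density \<theta> (\<lambda>z. ennreal (2 * gh (t, z))), density \<theta> (\<lambda>z. ennreal (- (2 * gh (t, z)))))"
    unfolding sm_scale_def jpm_eq[OF tT, symmetric] by simp
  have rhs: "sm_density \<theta> (\<lambda>(x, y). - F_map \<phi> \<psi>s \<alpha> (dens \<pi> (\<rho> t) x) (dens \<pi> (\<rho> t) y)) = (density \<theta> (\<lambda>z. e2ennreal (y z)), density \<theta> (\<lambda>z. e2ennreal (- y z)))"
    unfolding sm_density_def y_def case_prod_beta ..
  have m: "(\<lambda>z. ennreal (2 * gh (t, z))) \<in> borel_measurable \<theta>" "(\<lambda>z. ennreal (- (2 * gh (t, z)))) \<in> borel_measurable \<theta>"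
    "(\<lambda>z. e2ennreal (y z)) \<in> borel_measurable \<theta>" "(\<lambda>z. e2ennreal (- y z)) \<in> borel_measurable \<theta>"
    using gm ym by measurable
  have "sm_scale 2 (j t) = sm_density \<theta> (\<lambda>(x, y). - F_map \<phi> \<psi>s \<alpha> (dens \<pi> (\<rho> t) x) (dens \<pi> (\<rho> t) y)) \<longleftrightarrow>
    (AE z in \<theta>. ennreal (2 * gh (t, z)) = e2ennreal (y z)) \<and> (AE z in \<theta>. ennreal (- (2 * gh (t, z))) = e2ennreal (- y z))"
    unfolding lhs rhs prod.inject theta.density_unique_iff[OF m(1) m(3)] theta.density_unique_iff[OF m(2) m(4)] ..
  also have "\<dots> \<longleftrightarrow> (AE z in \<theta>. ennreal (2 * gh (t, z)) = e2ennreal (y z) \<and> ennreal (- (2 * gh (t, z))) = e2ennreal (- y z))"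
    by (rule AE_conj_iff[symmetric])
  also have "\<dots> \<longleftrightarrow> (AE z in \<theta>. ereal (2 * gh (t, z)) = y z)"
    unfolding ennreal_e2ennreal_eq_iff ..
  finally show ?thesis unfolding y_def .
qed

lemma good_iff:
  assumes t: "good t"
  shows "(AE z in \<theta>. hh (t, z) = 0) \<longleftrightarrow>
    (AE (x, y) in \<theta>. F_defined \<alpha> (dens \<pi> (\<rho> t) x) (dens \<pi> (\<rho> t) y)) \<and>
    sm_scale 2 (j t) = sm_density \<theta> (\<lambda>(x, y). - F_map \<phi> \<psi>s \<alpha> (dens \<pi> (\<rho> t) x) (dens \<pi> (\<rho> t) y))"
proof -
  have tT: "t \<in> {0<..<T}" using t unfolding good_def by (elim conjE)
  have "Fh t < \<infinity>" using t unfolding good_def by (elim conjE)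
  then have "(\<integral>\<^sup>+z. Dh (t, z) \<partial>\<theta>) < \<infinity>" unfolding Fh_def by (rule ennreal_half_finite)
  then have fin: "AE z in \<theta>. Dh (t, z) \<noteq> \<infinity>"
    using section_measurable[OF Dh_measurable, of t] by (intro nn_integral_noteq_infinite) auto
  have ud: "AE z in \<theta>. ux (t, z) = dens \<pi> (\<rho> t) (fst z) \<and> uy (t, z) = dens \<pi> (\<rho> t) (snd z)"
    using t unfolding good_def by (elim conjE)
  let ?F = "\<lambda>z. F_defined \<alpha> (dens \<pi> (\<rho> t) (fst z)) (dens \<pi> (\<rho> t) (snd z))"
  let ?E = "\<lambda>z. ereal (2 * gh (t, z)) = - F_map \<phi> \<psi>s \<alpha> (dens \<pi> (\<rho> t) (fst z)) (dens \<pi> (\<rho> t) (snd z))"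
  have pt: "AE z in \<theta>. hh (t, z) = 0 \<longleftrightarrow> ?F z \<and> ?E z"
    using fin ud
  proof eventually_elim
    case (elim z)
    then show ?case using hh_eq_0_iff[of "(t, z)"] tT by (simp add: less_top[symmetric])
  qed
  have "(AE z in \<theta>. hh (t, z) = 0) \<longleftrightarrow> (AE z in \<theta>. ?F z \<and> ?E z)"
  proof
    assume "AE z in \<theta>. hh (t, z) = 0"
    with pt show "AE z in \<theta>. ?F z \<and> ?E z" by eventually_elim simp
  next
    assume "AE z in \<theta>. ?F z \<and> ?E z"
    with pt show "AE z in \<theta>. hh (t, z) = 0" by eventually_elim simp
  qed
  also have "\<dots> \<longleftrightarrow> (AE z in \<theta>. ?F z) \<and> (AE z in \<theta>. ?E z)" by (rule AE_conj_iff)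
  finally show ?thesis unfolding flux_eq_iff[OF t] case_prod_beta .
qed

lemma main_equivalence:
  "((\<forall>t\<in>{0..T}. EDF \<pi> \<kappa> \<phi> \<psi>s \<alpha> \<rho> j t \<le> 0) \<longleftrightarrow> (\<forall>t\<in>{0..T}. EDF \<pi> \<kappa> \<phi> \<psi>s \<alpha> \<rho> j t = 0)) \<and>
   ((\<forall>t\<in>{0..T}. EDF \<pi> \<kappa> \<phi> \<psi>s \<alpha> \<rho> j t = 0) \<longleftrightarrow>
    (AE t in lborel. t \<in> {0<..<T} \<longrightarrow>
      (AE (x, y) in \<theta>. F_defined \<alpha> (dens \<pi> (\<rho> t) x) (dens \<pi> (\<rho> t) y)) \<and>
      sm_scale 2 (j t) = sm_density \<theta> (\<lambda>(x, y). - F_map \<phi> \<psi>s \<alpha> (dens \<pi> (\<rho> t) x) (dens \<pi> (\<rho> t) y))))"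
proof (intro conjI)
  show "(\<forall>t\<in>{0..T}. EDF \<pi> \<kappa> \<phi> \<psi>s \<alpha> \<rho> j t \<le> 0) \<longleftrightarrow> (\<forall>t\<in>{0..T}. EDF \<pi> \<kappa> \<phi> \<psi>s \<alpha> \<rho> j t = 0)"
    using EDF_nonneg by (auto intro: antisym)
  let ?C = "\<lambda>t. (AE (x, y) in \<theta>. F_defined \<alpha> (dens \<pi> (\<rho> t) x) (dens \<pi> (\<rho> t) y)) \<and>
      sm_scale 2 (j t) = sm_density \<theta> (\<lambda>(x, y). - F_map \<phi> \<psi>s \<alpha> (dens \<pi> (\<rho> t) x) (dens \<pi> (\<rho> t) y))"
  have "(AE t in lborel. AE z in \<theta>. hh (t, z) = 0) \<longleftrightarrow> (AE t in lborel. t \<in> {0<..<T} \<longrightarrow> ?C t)"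
  proof
    assume "AE t in lborel. AE z in \<theta>. hh (t, z) = 0"
    with AE_good show "AE t in lborel. t \<in> {0<..<T} \<longrightarrow> ?C t"
    proof eventually_elim
      case (elim t)
      show ?case
      proof
        assume "t \<in> {0<..<T}"
        with elim(1) have "good t" by blast
        from good_iff[OF this, THEN iffD1, OF elim(2)] show "?C t" .
      qed
    qed
  next
    assume "AE t in lborel. t \<in> {0<..<T} \<longrightarrow> ?C t"
    with AE_good show "AE t in lborel. AE z in \<theta>. hh (t, z) = 0"
    proof eventually_elim
      case (elim t)
      show ?case
      proof (cases "t \<in> {0<..<T}")
        case True
        with elim(1) have "good t" by blast
        from good_iff[OF this, THEN iffD2] elim(2) True show ?thesis by blast
      next
        case False
        then have "hh (t, z) = 0" for z using hh_outside[of "(t, z)"] by simp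
        then show ?thesis by simp
      qed
    qed
  qed
  then show "(\<forall>t\<in>{0..T}. EDF \<pi> \<kappa> \<phi> \<psi>s \<alpha> \<rho> j t = 0) \<longleftrightarrow> (AE t in lborel. t \<in> {0<..<T} \<longrightarrow> ?C t)"
    unfolding EDF_zero_iff .
qed

end

theorem theorem2:
  fixes \<pi> :: "'v::{metric_space,second_countable_topology} measure"
    and \<kappa> :: "'v \<Rightarrow> 'v measure"
    and \<phi> \<psi>s :: "real \<Rightarrow> real"
    and \<alpha> :: "real \<times> real \<Rightarrow> real"
    and T :: real
    and \<rho> :: "real \<Rightarrow> 'v measure"
    and j :: "real \<Rightarrow> ('v \<times> 'v) smeasure"
  assumes "T > 0"
    and "finite_borel_measure \<pi>"
    and "jump_kernel \<kappa>"
    and "detailed_balance \<pi> \<kappa>"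
    and "admissible_phi \<phi>"
    and "admissible_psi_star \<psi>s"
    and "admissible_alpha \<alpha>"
    and "strictly_convex_on {0..} \<phi>"
    and "convex_on_ennreal quadrant (D_phi \<phi> \<psi>s \<alpha>)"
    and "(\<rho>, j) \<in> RCE \<pi> \<kappa> \<phi> \<psi>s \<alpha> T"
  shows "((\<forall>t\<in>{0..T}. EDF \<pi> \<kappa> \<phi> \<psi>s \<alpha> \<rho> j t \<le> 0) \<longleftrightarrow>
          (\<forall>t\<in>{0..T}. EDF \<pi> \<kappa> \<phi> \<psi>s \<alpha> \<rho> j t = 0)) \<and>
         ((\<forall>t\<in>{0..T}. EDF \<pi> \<kappa> \<phi> \<psi>s \<alpha> \<rho> j t = 0) \<longleftrightarrow>
          (AE t in lborel. t \<in> {0<..<T} \<longrightarrow>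
             (AE (x, y) in edge_measure \<pi> \<kappa>. F_defined \<alpha> (dens \<pi> (\<rho> t) x) (dens \<pi> (\<rho> t) y)) \<and>
             sm_scale 2 (j t) =
               sm_density (edge_measure \<pi> \<kappa>)
                 (\<lambda>(x, y). - F_map \<phi> \<psi>s \<alpha> (dens \<pi> (\<rho> t) x) (dens \<pi> (\<rho> t) y))))"
proof -
  interpret reflecting_pair \<phi> \<psi>s \<alpha> \<pi> \<kappa> T \<rho> j
    by unfold_locales (use assms in auto)
  show ?thesis by (rule main_equivalence)
qed

end
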